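(* Let $n\ge 1$, $Q=2n+2$, and $1<p<\frac{Q+2}{Q-2}$. Then the problem $$\begin{cases}\Delta_{H^n}u-u+u^p=0 & \text{in } H^n,\\ u>0 & \text{in } H^n,\\ u(z)\to 0 & \text{as } \rho(z)\to\infty\end{cases}$$ has a solution $u\in E$.
   Context: $H^n$ is the Heisenberg group, with real coordinates $z=(x_1,\dots,x_n,y_1,\dots,y_n,t)\in\mathbb{R}^{2n+1}$ and homogeneous dimension $Q=2n+2$. For $i=1,\dots,n$ set $X_i=\frac{\partial}{\partial x_i}+2y_i\frac{\partial}{\partial t}$ and $Y_i=\frac{\partial}{\partial y_i}-2x_i\frac{\partial}{\partial t}$. The subelliptic Laplacian is $\Delta_{H^n}=\sum_{i=1}^n(X_i^2+Y_i^2)$ and the horizontal gradient is $\nabla_H u=(X_1u,\dots,X_nu,Y_1u,\dots,Y_nu)$. The distance function to the origin is $\rho(z)=\big(\sum_{i=1}^n(x_i^2+y_i^2)^2+t^2\big)^{1/4}$. The Folland-Stein-Sobolev space $E$ is the (real) Hilbert space obtained as the completion of $C_0^\infty(H^n)$ (smooth compactly supported functions) under the norm given by $\|u\|^2=\int_{H^n}\big(|\nabla_H u|^2+u^2\big)$, where integration is with respect to Lebesgue measure $dx\,dy\,dt$. *)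

theory Defs
  imports "HOL-Analysis.Analysis"
begin

text \<open>A point of \<open>H\<^sup>n\<close> is \<open>z = (x, y, t)\<close> with \<open>n = CARD('n)\<close>.\<close>

type_synonym 'n heis = "(real ^ 'n) \<times> (real ^ 'n) \<times> real"

definition rho :: "'n::finite heis \<Rightarrow> real" where
  "rho = (\<lambda>(x, y, t). root 4 ((\<Sum>i\<in>UNIV. ((x $ i)\<^sup>2 + (y $ i)\<^sup>2)\<^sup>2) + t\<^sup>2))"

text \<open>\<open>d_dx i u z\<close>, \<open>d_dy i u z\<close>, \<open>d_dt u z\<close> are the coordinate partial derivatives of \<open>u\<close> at \<open>z\<close>.
  They are meaningful only where \<open>u\<close> is differentiable; below they are applied only to
  functions for which this is guaranteed by \<open>C_k\<close>.\<close>

definition d_dx :: "'n \<Rightarrow> ('n::finite heis \<Rightarrow> real) \<Rightarrow> 'n heis \<Rightarrow> real" where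
  "d_dx i u z = frechet_derivative u (at z) (axis i 1, 0, 0)"

definition d_dy :: "'n \<Rightarrow> ('n::finite heis \<Rightarrow> real) \<Rightarrow> 'n heis \<Rightarrow> real" where
  "d_dy i u z = frechet_derivative u (at z) (0, axis i 1, 0)"

definition d_dt :: "('n::finite heis \<Rightarrow> real) \<Rightarrow> 'n heis \<Rightarrow> real" where
  "d_dt u z = frechet_derivative u (at z) (0, 0, 1)"

definition X_field :: "'n \<Rightarrow> ('n::finite heis \<Rightarrow> real) \<Rightarrow> 'n heis \<Rightarrow> real" where
  "X_field i u = (\<lambda>(x, y, t). d_dx i u (x, y, t) + 2 * y $ i * d_dt u (x, y, t))"

definition Y_field :: "'n \<Rightarrow> ('n::finite heis \<Rightarrow> real) \<Rightarrow> 'n heis \<Rightarrow> real" where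
  "Y_field i u = (\<lambda>(x, y, t). d_dy i u (x, y, t) - 2 * x $ i * d_dt u (x, y, t))"

definition sub_laplacian :: "('n::finite heis \<Rightarrow> real) \<Rightarrow> 'n heis \<Rightarrow> real" where
  "sub_laplacian u z =
     (\<Sum>i\<in>UNIV. X_field i (X_field i u) z + Y_field i (Y_field i u) z)"

definition horizontal_gradient ::
    "('n::finite heis \<Rightarrow> real) \<Rightarrow> 'n heis \<Rightarrow> (real ^ 'n) \<times> (real ^ 'n)" where
  "horizontal_gradient u z = (\<chi> i. X_field i u z, \<chi> i. Y_field i u z)"

fun C_k :: "nat \<Rightarrow> ('a::euclidean_space \<Rightarrow> real) \<Rightarrow> bool" where
  "C_k 0 f \<longleftrightarrow> continuous_on UNIV f"
| "C_k (Suc k) f \<longleftrightarrow>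
     f differentiable_on UNIV \<and> (\<forall>b\<in>Basis. C_k k (\<lambda>z. frechet_derivative f (at z) b))"

definition test_functions :: "('a::euclidean_space \<Rightarrow> real) set" where
  "test_functions = {\<phi>. (\<forall>k. C_k k \<phi>) \<and> compact (closure {z. \<phi> z \<noteq> 0})}"

text \<open>The norm is used only on test functions, for which the integrand is integrable.\<close>

definition FS_norm :: "('n::finite heis \<Rightarrow> real) \<Rightarrow> real" where
  "FS_norm u = sqrt (\<integral>z. (norm (horizontal_gradient u z))\<^sup>2 + (u z)\<^sup>2 \<partial>lebesgue)"

text \<open>The completion of the test functions, realised as a space of functions: since \<open>FS_norm\<close>
  dominates the \<open>L\<^sup>2\<close> norm and the horizontal gradient is closable in \<open>L\<^sup>2\<close>, an element
  of the completion is the same as the \<open>L\<^sup>2\<close> limit of an \<open>FS_norm\<close>-Cauchy sequence of test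
  functions. The set contains all representatives of each almost-everywhere class. The
  nonnegative integral is used for the \<open>L\<^sup>2\<close> distance because it is infinite, rather than
  zero, when the integrand is not integrable.\<close>

definition FS_space :: "('n::finite heis \<Rightarrow> real) set" where
  "FS_space = {u. u \<in> borel_measurable lebesgue \<and>
     (\<exists>\<phi>. (\<forall>k::nat. \<phi> k \<in> test_functions) \<and>
       (\<forall>e>0. \<exists>N. \<forall>j\<ge>N. \<forall>k\<ge>N. FS_norm (\<lambda>z. \<phi> j z - \<phi> k z) < e) \<and>
       (\<lambda>k. \<integral>\<^sup>+z. ennreal ((\<phi> k z - u z)\<^sup>2) \<partial>lebesgue) \<longlonglongrightarrow> 0)}"

end

theory Submission
 imports Defs "HOL-Complex_Analysis.Complex_Analysis" "HOL-Real_Asymp.Real_Asymp"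
begin

text \<open>A solution of \<open>u - \<Delta>u = u\<^sup>p\<close> is a fixed point of \<open>u \<mapsto> (1 - \<Delta>)\<^sup>-\<^sup>1 u\<^sup>p\<close>. The resolvent is the Laplace
 transform of the heat semigroup, whose kernel is the explicit Fourier integral of Gaveau and Hulanicki;
 the parabolic maximum principle shows that this kernel is nonnegative.

 By duality a solution is obtained by maximising the norm of \<open>(1 - \<Delta>)\<^sup>-\<^sup>1 f\<close> in \<open>L\<^sup>q\<close>, with \<open>q = p + 1\<close>, over
 \<open>f \<ge> 0\<close> of norm at most one in the dual space. Iterating the map which sends \<open>f\<close> to its optimal
 dual partner makes maximising sequences uniformly bounded (this uses that \<open>p\<close> is subcritical), and left
 translations keep them away from zero at the origin. The potentials are then equicontinuous, so
 pointwise limits exist, and equality in Young's inequality in the limit yields a pair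
 \<open>u = (1 - \<Delta>)\<^sup>-\<^sup>1 v\<^sup>p\<close>, \<open>v = (1 - \<Delta>)\<^sup>-\<^sup>1 u\<^sup>p\<close> up to a constant. The elliptic maximum principle gives \<open>u = v\<close>.

 Horizontal derivatives of a potential fall on the kernel, while derivatives in the central direction
 commute with the resolvent; this gives \<open>C\<^sup>2\<close> regularity. The horizontal gradient is square integrable by
 Young's convolution inequality, and cutting off and mollifying show that \<open>u\<close> is in the
 Folland-Stein space.\<close>

text \<open>The group is not compact, so mass of a maximising sequence can escape along left
  translations. Translating rules out vanishing; splitting of mass is never excluded. Instead the
  deficit in Young's inequality is pointwise nonnegative with integral tending to 0, so Fatou's
  lemma makes it vanish for whatever pointwise limit remains. Equality links an iterate only to the
  one two steps later, which is why three iterates are followed and a pair appears first.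
  Subcriticality enters twice as integrability of a power of the scale at 0: for finiteness of the
  supremum and for a contracting exponent of the iteration. Time is replaced by the scale
  \<open>e\<close>, so that the heat flow becomes an average over dilates of one fixed kernel. Only
  quadratic decay in the central variable is established for this kernel, by two integrations by
  parts; this suffices for its first moment. The weight of second horizontal and of central
  derivatives behaves like 1/e at 0, hence these are controlled only by combining Hoelder continuity
  with kernels of mean zero.\<close>

abbreviation nn_lborel :: "('a::euclidean_space => ennreal) => ennreal" (binder "NNI " 10) where
 "nn_lborel f == nn_integral lborel f"

abbreviation borel_fun :: "('a::topological_space => 'b::topological_space) => bool" where
 "borel_fun f == f \<in> borel_measurable borel"

abbreviation cont_UNIV :: "('a::topological_space => 'b::topological_space) => bool" where
 "cont_UNIV == continuous_on UNIV"

lemmas bintegrable_add = Bochner_Integration.integrable_add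
 and bintegrable_bound = Bochner_Integration.integrable_bound
 and bintegrable_diff = Bochner_Integration.integrable_diff
 and bintegral_add = Bochner_Integration.integral_add
 and bintegral_sum = Bochner_Integration.integral_sum
 and borel_continuous = borel_measurable_continuous_onI

section \<open>The heat kernel in Fourier variables\<close>

definition inv_sinhc :: "real => real" where
 "inv_sinhc x = (if x = 0 then 1 else x / sinh x)"

text \<open>The Langevin function coth x - 1/x, continued by 0. Up to sign it is the logarithmic
  derivative of \<open>inv_sinhc\<close>.\<close>

definition langevin :: "real => real" where
 "langevin x = (if x = 0 then 0 else (x * cosh x / sinh x - 1) / x)"

definition langevin_deriv :: "real => real" where
 "langevin_deriv x = (if x = 0 then 1 / 3 else (1 - (x / sinh x)\<^sup>2) / x\<^sup>2)"

text \<open>This is x coth x, continued by 1; writing it through \<open>langevin\<close> avoids a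
  further case distinction at 0.\<close>

definition xcoth :: "real => real" where
 "xcoth x = 1 + x * langevin x"

lemma langevin_limits:
 "((\<lambda>x::real. (x / sinh x - 1) / x) \<longlongrightarrow> 0) (at 0)"
 "((\<lambda>x::real. ((x * cosh x / sinh x - 1) / x) / x) \<longlongrightarrow> 1/3) (at 0)"
 "((\<lambda>x::real. (1 - (x / sinh x)\<^sup>2) / x\<^sup>2) \<longlongrightarrow> 1/3) (at 0)"
 unfolding sinh_field_def cosh_field_def
 by real_asymp+

text \<open>The identity cosh^2 - sinh^2 = 1 multiplied by (x / sinh x)^2.\<close>

lemma inv_sinhc_sq: "(inv_sinhc x)\<^sup>2 = (xcoth x)\<^sup>2 - x\<^sup>2"
proof (cases "x = 0")
 case False
 then have s: "sinh x ~= 0" by simp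
 have "(cosh x)\<^sup>2 = (sinh x)\<^sup>2 + 1" using cosh_square_eq by blast
 then show ?thesis using False s
  by (simp add: inv_sinhc_def xcoth_def langevin_def field_simps power2_eq_square)
qed (simp add: inv_sinhc_def xcoth_def)

text \<open>Expresses the derivative of \<open>xcoth\<close> without dividing by x, so that later
  derivatives remain polynomial in \<open>xcoth\<close>, \<open>langevin\<close> and
  \<open>langevin_deriv\<close>.\<close>

lemma x_langevin_deriv_eq: "x * langevin_deriv x = x - langevin x - xcoth x * langevin x"
proof (cases "x = 0")
 case False
 have "x\<^sup>2 * langevin_deriv x = 1 - (inv_sinhc x)\<^sup>2"
  using False by (simp add: langevin_deriv_def inv_sinhc_def)
 also have "\<dots> = 1 - (xcoth x)\<^sup>2 + x\<^sup>2" by (simp add: inv_sinhc_sq)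
 also have "\<dots> = x * (x - langevin x - xcoth x * langevin x)"
  by (simp add: xcoth_def field_simps power2_eq_square)
 finally show ?thesis using False by (simp add: power2_eq_square)
qed (simp add: langevin_def)

lemma inv_sinhc_deriv: "(inv_sinhc has_real_derivative - inv_sinhc x * langevin x) (at x)"
proof (cases "x = 0")
 case True
 have "((\<lambda>h. (inv_sinhc (0 + h) - inv_sinhc 0) / h) \<longlongrightarrow> 0) (at 0)"
  by (rule Lim_transform_eventually[OF langevin_limits(1)])
   (auto simp: eventually_at_filter inv_sinhc_def)
 then show ?thesis using True by (simp add: DERIV_def langevin_def)
next
 case False
 then have s: "sinh x ~= 0" by simp
 have "((\<lambda>x. x / sinh x) has_real_derivative - inv_sinhc x * langevin x) (at x)"
  using False s by (auto intro!: derivative_eq_intros simp: inv_sinhc_def langevin_def field_simps)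
 then show ?thesis
  by (rule has_field_derivative_transform_within_open[where S="- {0}"])
   (use False in \<open>auto simp: inv_sinhc_def\<close>)
qed

lemma langevin_has_deriv: "(langevin has_real_derivative langevin_deriv x) (at x)"
proof (cases "x = 0")
 case True
 have "((\<lambda>h. (langevin (0 + h) - langevin 0) / h) \<longlongrightarrow> 1/3) (at 0)"
  by (rule Lim_transform_eventually[OF langevin_limits(2)])
   (auto simp: eventually_at_filter langevin_def)
 then show ?thesis using True by (simp add: DERIV_def langevin_deriv_def)
next
 case False
 then have s: "sinh x ~= 0" by simp
 have c: "(cosh x)\<^sup>2 = (sinh x)\<^sup>2 + 1" using cosh_square_eq by blast
 have "((\<lambda>x. (x * cosh x / sinh x - 1) / x) has_real_derivative
  (((cosh x + x * sinh x) * sinh x - x * cosh x * cosh x) / (sinh x)\<^sup>2 * x - (x * cosh x / sinh x - 1)) / x\<^sup>2) (at x)"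
  using False s by (auto intro!: derivative_eq_intros simp: power2_eq_square)
 also have "(((cosh x + x * sinh x) * sinh x - x * cosh x * cosh x) / (sinh x)\<^sup>2 * x - (x * cosh x / sinh x - 1)) / x\<^sup>2
  = langevin_deriv x"
 proof -
  have "x * cosh x * cosh x = x * (sinh x)\<^sup>2 + x" using c by (simp add: power2_eq_square algebra_simps)
  then show ?thesis using False s
   by (simp add: langevin_deriv_def field_simps power2_eq_square)
 qed
 finally show ?thesis
  by (rule has_field_derivative_transform_within_open[where S="- {0}"])
   (use False in \<open>auto simp: langevin_def\<close>)
qed

lemma xcoth_deriv: "(xcoth has_real_derivative x - xcoth x * langevin x) (at x)"
proof -
 have "(xcoth has_real_derivative langevin x + x * langevin_deriv x) (at x)"
  unfolding xcoth_def[abs_def]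
  by (auto intro!: derivative_eq_intros langevin_has_deriv)
 then show ?thesis by (simp add: x_langevin_deriv_eq)
qed

lemma isCont_langevin_deriv: "isCont langevin_deriv x"
proof (cases "x = 0")
 case True
 have "(langevin_deriv \<longlongrightarrow> 1/3) (at 0)"
  by (rule Lim_transform_eventually[OF langevin_limits(3)])
   (auto simp: eventually_at_filter langevin_deriv_def)
 then show ?thesis using True by (simp add: isCont_def langevin_deriv_def)
next
 case False
 have "isCont (\<lambda>x. (1 - (x / sinh x)\<^sup>2) / x\<^sup>2) x" using False by (intro continuous_intros) auto
 moreover have "eventually (\<lambda>y. y \<in> -{0::real}) (nhds x)"
  using False by (intro eventually_nhds_in_open) auto
 then have "eventually (\<lambda>y. langevin_deriv y = (1 - (y / sinh y)\<^sup>2) / y\<^sup>2) (nhds x)"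
  by eventually_elim (simp add: langevin_deriv_def)
 ultimately show ?thesis by (simp add: isCont_cong)
qed

lemma sinh_ge_self: "x <= sinh x" if "0 <= (x::real)"
proof -
 have "sinh 0 - 0 <= sinh x - x"
 proof (rule DERIV_nonneg_imp_nondecreasing[of 0 x "\<lambda>x. sinh x - x"])
  fix y :: real
  have "((\<lambda>x. sinh x - x) has_real_derivative cosh y - 1) (at y)"
   by (auto intro!: derivative_eq_intros)
  then show "\<exists>d. ((\<lambda>x. sinh x - x) has_real_derivative d) (at y) \<and> 0 <= d"
   using cosh_real_ge_1[of y] by force
 qed (use that in simp)
 then show ?thesis by simp
qed

lemma cosh_eq_sinh_exp: "cosh x = sinh x + exp (- x)" for x :: real
 by (simp add: sinh_field_def cosh_field_def field_simps)

lemma langevin_minus: "langevin (- x) = - langevin x"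
 by (simp add: langevin_def)

text \<open>For the lower bound, x cosh x - sinh x has derivative x sinh x. For the upper one, cosh
  x = sinh x + exp (-x) reduces it to x exp (-x) <= sinh x.\<close>

lemma langevin_bounds_pos:
 assumes "0 < x" shows "0 <= langevin x" "langevin x <= 1"
proof -
 have s: "0 < sinh x" using assms by simp
 have "0 * cosh 0 - sinh 0 <= x * cosh x - sinh x"
 proof (rule DERIV_nonneg_imp_nondecreasing[of 0 x "\<lambda>x. x * cosh x - sinh x"])
  fix y :: real assume "0 <= y"
  moreover have "((\<lambda>x. x * cosh x - sinh x) has_real_derivative y * sinh y) (at y)"
   by (auto intro!: derivative_eq_intros)
  ultimately show "\<exists>d. ((\<lambda>x. x * cosh x - sinh x) has_real_derivative d) (at y) \<and> 0 <= d"
   by force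
 qed (use assms in simp)
 then show "0 <= langevin x" using assms s by (auto simp: langevin_def field_simps)
 have "x * exp (- x) <= x" using assms by simp
 also have "\<dots> <= sinh x" using sinh_ge_self assms by simp
 finally have "x * cosh x <= x * sinh x + sinh x" by (simp add: cosh_eq_sinh_exp algebra_simps)
 then show "langevin x <= 1" using assms s by (simp add: langevin_def field_simps)
qed

lemma x_langevin_bounds: "0 <= x * langevin x" "x * langevin x <= \<bar>x\<bar>" and abs_langevin: "\<bar>langevin x\<bar> <= 1"
proof -
 consider "x = 0" | "0 < x" | "0 < - x" by linarith
 then have "0 <= x * langevin x \<and> x * langevin x <= \<bar>x\<bar> \<and> \<bar>langevin x\<bar> <= 1"
 proof cases
  case 2 then show ?thesis using langevin_bounds_pos[of x] by (simp add: mult_left_le)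
 next
  case 3
  then have "- 1 <= langevin x" "langevin x <= 0"
   using langevin_bounds_pos[of "-x"] langevin_minus[of x] by auto
  moreover from this 3 have "(- x) * (- langevin x) <= (- x) * 1" by (intro mult_left_mono) auto
  ultimately show ?thesis using 3 by (simp add: mult_nonpos_nonpos)
 qed (simp add: langevin_def)
 then show "0 <= x * langevin x" "x * langevin x <= \<bar>x\<bar>" "\<bar>langevin x\<bar> <= 1" by auto
qed

lemma xcoth_bounds: "1 <= xcoth x" "xcoth x <= 1 + \<bar>x\<bar>"
 using x_langevin_bounds[of x] by (auto simp: xcoth_def)

lemma inv_sinhc_pos: "0 < inv_sinhc x"
 by (auto simp: inv_sinhc_def zero_less_divide_iff sinh_real_pos_iff sinh_real_neg_iff)

text \<open>For large x the quotient behaves like 2 x exp (-x); the extra 1 makes the bound valid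
  down to 0. After clearing denominators it is the inequality 1 + 2 x <= exp (2 x).\<close>

lemma inv_sinhc_le: "inv_sinhc x <= (1 + 2 * \<bar>x\<bar>) * exp (- \<bar>x\<bar>)"
proof -
 have *: "inv_sinhc x <= (1 + 2 * x) * exp (- x)" if "0 < x" for x
 proof -
  have "1 + 2 * x <= exp (2 * x)" by (rule exp_ge_add_one_self)
  then have "exp (- 2 * x) * (1 + 2 * x) <= exp (- 2 * x) * exp (2 * x)" by (intro mult_left_mono) auto
  also have "\<dots> = 1" by (simp flip: exp_add)
  finally have a: "2 * x <= (1 + 2 * x) * (1 - exp (-2*x))" by (simp add: algebra_simps)
  have "(1 + 2 * x) * exp (- x) * sinh x = (1 + 2 * x) * (1 - exp (-2*x)) / 2"
  proof -
   have "exp (- x) * sinh x = (1 - exp (-2*x)) / 2"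
    by (simp add: sinh_field_def right_diff_distrib flip: exp_add)
   then show ?thesis by (simp add: mult.assoc)
  qed
  then have "x <= (1 + 2 * x) * exp (- x) * sinh x" using a by linarith
  then show ?thesis using that by (simp add: inv_sinhc_def pos_divide_le_eq)
 qed
 have e: "inv_sinhc (-x) = inv_sinhc x" by (simp add: inv_sinhc_def)
 consider "x = 0" | "0 < x" | "0 < - x" by linarith
 then show ?thesis
 proof cases
  case 3 then show ?thesis using *[of "-x"] e by simp
 qed (use *[of x] in \<open>simp_all add: inv_sinhc_def\<close>)
qed

lemma inv_sinhc_le_1: "inv_sinhc x <= 1"
proof -
 have "(inv_sinhc x)\<^sup>2 <= 1\<^sup>2"
 proof (cases "x = 0")
  case False
  have "\<bar>x\<bar> <= \<bar>sinh x\<bar>" using sinh_ge_self[of "\<bar>x\<bar>"] by simp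
  then have "x\<^sup>2 <= (sinh x)\<^sup>2" by (simp only: abs_le_square_iff)
  then show ?thesis using False by (simp add: inv_sinhc_def power_divide)
 qed (simp add: inv_sinhc_def)
 then show ?thesis by (rule power2_le_imp_le) simp
qed

text \<open>By \<open>inv_sinhc_sq\<close> the numerator 1 - (x / sinh x)^2 equals x^2 + 1 - (x coth
  x)^2, which is at most x^2 because x coth x is at least 1.\<close>

lemma abs_langevin_deriv: "\<bar>langevin_deriv x\<bar> <= 1"
proof (cases "x = 0")
 case False
 have "0 <= 1 - (inv_sinhc x)\<^sup>2" using inv_sinhc_le_1 inv_sinhc_pos[of x]
  by (simp add: power_le_one less_imp_le)
 moreover have "1 - (inv_sinhc x)\<^sup>2 <= x\<^sup>2"
  using xcoth_bounds[of x] one_le_power[of "xcoth x" 2] by (simp add: inv_sinhc_sq)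
 moreover have "langevin_deriv x = (1 - (inv_sinhc x)\<^sup>2) / x\<^sup>2"
  using False by (simp add: langevin_deriv_def inv_sinhc_def)
 ultimately show ?thesis using False by (simp add: divide_le_eq)
qed (simp add: langevin_deriv_def)

section \<open>Integration on the line and differentiation under the integral\<close>

text \<open>The form in which integration by parts is used below: an oscillatory integrand is
  exhibited as a total derivative whose primitive vanishes at both ends.\<close>

lemma integral_derivative_line_zero:
 fixes F f :: "real => real"
 assumes "!!x. (F has_real_derivative f x) (at x)" and "!!x. isCont f x"
  and "integrable lborel f" and "(F \<longlongrightarrow> 0) at_top" and "(F \<longlongrightarrow> 0) at_bot"
 shows "(LBINT x. f x) = 0"
proof -
 have "(LBINT x=-\<infinity>..\<infinity>. f x) = 0 - 0"
  using assms
  by (intro interval_integral_FTC_integrable[where F=F])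
   (auto simp: has_real_derivative_iff_has_vector_derivative ereal_tendsto_simps set_integrable_def einterval_def)
 then show ?thesis by (simp add: interval_lebesgue_integral_def set_lebesgue_integral_def einterval_def)
qed

lemma integrable_abs_arg:
 fixes f :: "real => real"
 assumes f: "borel_fun f" and nn: "!!x. 0 <= x ==> 0 <= f x"
  and F: "!!x. 0 <= x ==> (F has_real_derivative f x) (at x)" and lim: "(F \<longlongrightarrow> T) at_top"
 shows "integrable lborel (\<lambda>x. f \<bar>x\<bar>)"
proof -
 have I: "(NNI x. ennreal (f x) * indicator {0..} x) < \<infinity>"
  using nn_integral_FTC_atLeast[OF f F nn lim] by simp
 have [measurable]: "borel_fun f" by (fact f)
 have "(NNI x. ennreal (f \<bar>x\<bar>)) <=
   (NNI x. ennreal (f x) * indicator {0..} x + ennreal (f (0 + (-1) * x)) * indicator {0..} (0 + (-1) * x))"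
  by (intro nn_integral_mono) (auto split: split_indicator simp: abs_if)
 also have "\<dots> = (NNI x. ennreal (f x) * indicator {0..} x)
   + (NNI x. ennreal (f (0 + (-1) * x)) * indicator {0..} (0 + (-1) * x))"
  by (intro nn_integral_add) auto
 also have "(NNI x. ennreal (f (0 + (-1) * x)) * indicator {0..} (0 + (-1) * x))
  = (NNI x. ennreal (f x) * indicator {0..} x)"
  by (subst nn_integral_real_affine[of "\<lambda>x. ennreal (f x) * indicator {0..} x" "-1" 0]) auto
 also have "\<dots> + \<dots> < \<infinity>" using I by (simp add: less_top)
 finally show ?thesis
  by (intro integrableI_nonneg) (auto simp: nn)
qed

lemma integrable_exp_abs:
 assumes "0 < c" shows "integrable lborel (\<lambda>x::real. exp (- c * \<bar>x\<bar>))"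
proof (rule integrable_abs_arg[where F="\<lambda>x. - exp (- c * x) / c" and T=0])
 show "((\<lambda>x. - exp (- c * x) / c) \<longlongrightarrow> 0) at_top" using assms by real_asymp
qed (use assms in \<open>auto intro!: derivative_eq_intros\<close>)

lemma integrable_inverse_three_halves: "integrable lborel (\<lambda>x::real. (1 + \<bar>x\<bar>) powr (-3/2))"
proof (rule integrable_abs_arg[where F="\<lambda>x. - 2 * (1 + x) powr (-1/2)" and T=0])
 show "((\<lambda>x::real. - 2 * (1 + x) powr (-1/2)) \<longlongrightarrow> 0) at_top" by real_asymp
qed (auto intro!: derivative_eq_intros)

lemma poly_le_exp:
 fixes N :: nat and c :: real
 assumes "0 < c"
 obtains C :: real where "0 < C" "!!x. 0 <= x ==> (1 + x) ^ N <= C * exp (c * x)"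
proof -
 \<comment> \<open>The scale \<open>d\<close> gives N / d <= c, and it is at least 1, so that 1 + x
   <= d (1 + x / d) <= d exp (x / d).\<close>
 define d where "d = max 1 (real N / c)"
 have d: "1 <= d" "real N / c <= d" by (auto simp: d_def)
 have "(1 + x) ^ N <= d ^ N * exp (c * x)" if "0 <= x" for x
 proof -
  have "1 + x <= d * (1 + x / d)" using d by (simp add: field_simps)
  also have "\<dots> <= d * exp (x / d)" using d by (intro mult_left_mono exp_ge_add_one_self) auto
  finally have "(1 + x) ^ N <= (d * exp (x / d)) ^ N" using that by (intro power_mono) auto
  also have "\<dots> = d ^ N * exp (real N * (x / d))"
   by (simp only: power_mult_distrib exp_of_nat_mult)
  also have "real N * (x / d) <= c * x"
  proof -
   have "real N <= c * d" using d assms by (simp add: field_simps)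
   then have "real N * x <= c * d * x" using that by (intro mult_right_mono)
   then show ?thesis using d by (simp add: field_simps)
  qed
  then have "d ^ N * exp (real N * (x / d)) <= d ^ N * exp (c * x)" using d by simp
  finally show ?thesis .
 qed
 moreover have "0 < d ^ N" using d by simp
 ultimately show ?thesis using that by blast
qed

text \<open>On the convex set \<open>S\<close> the mean value inequality bounds the remainder
  quotient by twice the majorant, so dominated convergence along sequences applies. A Frechet
  derivative is wanted because the heat integral depends jointly on \<rho> and t.\<close>

lemma has_derivative_integral_dominated:
 fixes F :: "'a::euclidean_space => 'b => real"
 assumes S: "open S" "convex S" "x0 \<in> S"
  and D: "!!x w. x \<in> S ==> w \<in> space M ==> ((\<lambda>x. F x w) has_derivative F' x w) (at x)"
  and I: "!!x. x \<in> S ==> integrable M (F x)"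
  and m: "!!h. (\<lambda>w. F' x0 w h) \<in> borel_measurable M"
  and b: "!!x w h. x \<in> S ==> w \<in> space M ==> \<bar>F' x w h\<bar> <= g w * norm h"
  and g: "integrable M g"
 shows "((\<lambda>x. \<integral>w. F x w \<partial>M) has_derivative (\<lambda>h. \<integral>w. F' x0 w h \<partial>M)) (at x0)"
  and "!!h. integrable M (\<lambda>w. F' x0 w h)"
proof -
 show I': "integrable M (\<lambda>w. F' x0 w h)" for h
  by (rule bintegrable_bound[of _ "\<lambda>w. g w * norm h"])
   (use m S g in \<open>auto intro!: AE_I2 order_trans[OF b] mult_right_mono simp: abs_mult\<close>)
 have lin: "bounded_linear (F' x0 w)" if "w \<in> space M" for w
  using D[OF S(3) that] by (rule has_derivative_bounded_linear)
 have g0: "0 <= g w" if w: "w \<in> space M" for w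
 proof -
  obtain b :: 'a where "b \<in> Basis" using nonempty_Basis by blast
  then show ?thesis using b[OF S(3) w, of b] by (smt (verit) norm_Basis mult_cancel_left2)
 qed
 have bl: "bounded_linear (\<lambda>h. \<integral>w. F' x0 w h \<partial>M)"
 proof (rule bounded_linear_intro)
  fix h h' :: 'a and r :: real
  have "(\<integral>w. F' x0 w (h + h') \<partial>M) = (\<integral>w. F' x0 w h + F' x0 w h' \<partial>M)"
   using lin by (intro Bochner_Integration.integral_cong) (auto simp: linear_simps)
  then show "(\<integral>w. F' x0 w (h + h') \<partial>M) = (\<integral>w. F' x0 w h \<partial>M) + (\<integral>w. F' x0 w h' \<partial>M)"
   using I' by simp
  have "(\<integral>w. F' x0 w (r *\<^sub>R h) \<partial>M) = (\<integral>w. r * F' x0 w h \<partial>M)"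
   using lin by (intro Bochner_Integration.integral_cong) (auto simp: linear_simps)
  then show "(\<integral>w. F' x0 w (r *\<^sub>R h) \<partial>M) = r *\<^sub>R (\<integral>w. F' x0 w h \<partial>M)" using I' by simp
  have "norm (\<integral>w. F' x0 w h \<partial>M) <= (\<integral>w. norm (F' x0 w h) \<partial>M)"
   by (rule integral_norm_bound)
  also have "\<dots> <= (\<integral>w. g w * norm h \<partial>M)"
   using I' g b[OF S(3)] by (intro integral_mono) auto
  finally show "norm (\<integral>w. F' x0 w h \<partial>M) <= norm h * (\<integral>w. g w \<partial>M)"
   by (simp add: mult.commute)
 qed
 \<comment> \<open>At \<open>x = x0\<close> the quotient is 0 by the convention for division, so no
   point of \<open>S\<close> has to be excluded in the bounds.\<close>
 define R where "R x w = ((F x w - F x0 w) - F' x0 w (x - x0)) / norm (x - x0)" for x w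
 have mR: "R x \<in> borel_measurable M" if "x \<in> S" for x
  unfolding R_def using that S(3) I m by (intro borel_measurable_divide borel_measurable_diff) auto
 have bR: "\<bar>R x w\<bar> <= 2 * g w" if "x \<in> S" "w \<in> space M" for x w
 proof (cases "x = x0")
  case False
  have "norm (F x w - F x0 w) <= g w * norm (x - x0)"
  proof (rule differentiable_bound[where S=S and f'="\<lambda>x. F' x w"])
   fix y assume y: "y \<in> S"
   show "((\<lambda>x. F x w) has_derivative F' y w) (at y within S)"
    using D[OF y that(2)] has_derivative_at_withinI by blast
   show "onorm (F' y w) <= g w"
    using b[OF y that(2)] by (intro onorm_bound g0 that) auto
  qed (use that S in auto)
  moreover have "\<bar>F' x0 w (x - x0)\<bar> <= g w * norm (x - x0)" using b[OF S(3) that(2)] .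
  ultimately have "\<bar>F x w - F x0 w - F' x0 w (x - x0)\<bar> <= 2 * g w * norm (x - x0)" by simp
  then show ?thesis using False by (simp add: R_def field_simps)
 qed (use g0 that in \<open>auto simp: R_def\<close>)
 have lim: "((\<lambda>x. \<integral>w. R x w \<partial>M) \<longlongrightarrow> 0) (at x0 within S)"
  unfolding tendsto_at_iff_sequentially
 proof (intro allI impI)
  fix X :: "nat => 'a" assume X: "\<forall>i. X i \<in> S - {x0}" "X \<longlonglongrightarrow> x0"
  have "(\<lambda>i. \<integral>w. R (X i) w \<partial>M) \<longlonglongrightarrow> (\<integral>w. 0 \<partial>M)"
  proof (rule integral_dominated_convergence[where w="\<lambda>w. 2 * g w"])
   show "AE w in M. (\<lambda>i. R (X i) w) \<longlonglongrightarrow> 0"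
   proof (rule AE_I2)
    fix w assume "w \<in> space M"
    from D[OF S(3) this] have "((\<lambda>y. norm ((F y w - F x0 w) - F' x0 w (y - x0)) / norm (y - x0)) \<longlongrightarrow> 0) (at x0)"
     by (simp add: has_derivative_iff_norm)
    then have "((\<lambda>y. R y w) \<longlongrightarrow> 0) (at x0)"
     unfolding R_def by (subst tendsto_norm_zero_iff[symmetric]) simp
    then have "((\<lambda>y. R y w) \<longlongrightarrow> 0) (at x0 within S)" by (rule tendsto_within_subset) simp
    then show "(\<lambda>i. R (X i) w) \<longlonglongrightarrow> 0"
     using X unfolding tendsto_at_iff_sequentially comp_def by blast
   qed
   show "AE w in M. norm (R (X i) w) <= 2 * g w" for i
    using X bR by (intro AE_I2) auto
  qed (use X g mR in auto)
  then show "((\<lambda>x. \<integral>w. R x w \<partial>M) \<circ> X) \<longlonglongrightarrow> 0" by (simp add: comp_def)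
 qed
 have RI: "(\<integral>w. R x w \<partial>M) = ((\<integral>w. F x w \<partial>M) - (\<integral>w. F x0 w \<partial>M) - (\<integral>w. F' x0 w (x - x0) \<partial>M)) / norm (x - x0)"
  if "x \<in> S" for x
  unfolding R_def using I I' S(3) that by simp
 have "((\<lambda>x. \<integral>w. F x w \<partial>M) has_derivative (\<lambda>h. \<integral>w. F' x0 w h \<partial>M)) (at x0 within S)"
  unfolding has_derivative_iff_norm
 proof (intro conjI bl)
  have "((\<lambda>x. norm (\<integral>w. R x w \<partial>M)) \<longlongrightarrow> 0) (at x0 within S)"
   using tendsto_norm[OF lim] by simp
  then show "((\<lambda>y. norm ((\<integral>w. F y w \<partial>M) - (\<integral>w. F x0 w \<partial>M) - (\<integral>w. F' x0 w (y - x0) \<partial>M)) / norm (y - x0)) \<longlongrightarrow> 0) (at x0 within S)"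
  proof (rule Lim_transform_eventually)
   show "\<forall>\<^sub>F x in at x0 within S. norm (\<integral>w. R x w \<partial>M) = norm ((\<integral>w. F x w \<partial>M) - (\<integral>w. F x0 w \<partial>M) - (\<integral>w. F' x0 w (x - x0) \<partial>M)) / norm (x - x0)"
    unfolding eventually_at_filter
    by (rule always_eventually) (auto simp: RI)
  qed
 qed
 then show "((\<lambda>x. \<integral>w. F x w \<partial>M) has_derivative (\<lambda>h. \<integral>w. F' x0 w h \<partial>M)) (at x0)"
  using at_within_open[OF S(3,1)] by simp
qed

text \<open>The Gaveau-Hulanicki formula at time \<open>1/4\<close>, as a Fourier integral over the dual variable \<open>l\<close>
 of \<open>t\<close>, with \<open>\<rho> = \<bar>x\<bar>\<^sup>2 + \<bar>y\<bar>\<^sup>2\<close>. The indices \<open>j\<close> and \<open>m\<close> count derivatives with respect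
 to \<open>\<rho>\<close> and \<open>t\<close>; the phase \<open>m * pi / 2\<close> turns the cosine into its \<open>m\<close>-th derivative.\<close>

definition heat_amp :: "nat => nat => nat => real => real => real" where
 "heat_amp n j m \<rho> l = l ^ m * (- xcoth l) ^ j * inv_sinhc l ^ n * exp (- \<rho> * xcoth l)"

definition heat_ker :: "nat => nat => nat => real => real => real" where
 "heat_ker n j m \<rho> t = (LBINT l. cos (l * t + real m * pi / 2) * heat_amp n j m \<rho> l)"

lemma isCont_amp_functions: "isCont inv_sinhc x" "isCont xcoth x" "isCont langevin x"
 using inv_sinhc_deriv xcoth_deriv langevin_has_deriv DERIV_isCont by blast+

lemma continuous_amp_functions [continuous_intros]:
 "continuous_on A inv_sinhc" "continuous_on A xcoth" "continuous_on A langevin" "continuous_on A langevin_deriv"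
 by (auto intro!: continuous_at_imp_continuous_on isCont_amp_functions isCont_langevin_deriv)

lemma measurable_amp_functions [measurable]:
 "borel_fun inv_sinhc" "borel_fun xcoth"
 by (auto intro!: borel_continuous continuous_intros)

lemma heat_amp_measurable [measurable]: "borel_fun (heat_amp n j m \<rho>)"
 unfolding heat_amp_def[abs_def] by measurable

lemma inv_sinhc_power_le:
 assumes "1 <= n" shows "inv_sinhc x ^ n <= 2 * (1 + \<bar>x\<bar>) * exp (- \<bar>x\<bar>)"
proof -
 have "inv_sinhc x ^ n <= inv_sinhc x ^ 1"
  using assms inv_sinhc_le_1[of x] inv_sinhc_pos[of x] by (intro power_decreasing) auto
 also have "\<dots> <= (1 + 2 * \<bar>x\<bar>) * exp (- \<bar>x\<bar>)" using inv_sinhc_le by simp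
 also have "\<dots> <= 2 * (1 + \<bar>x\<bar>) * exp (- \<bar>x\<bar>)" by (intro mult_right_mono) auto
 finally show ?thesis .
qed

text \<open>The decay exp (-|l|) of \<open>inv_sinhc\<close> leaves room for slightly negative
  \<rho>, where exp (- \<rho> * xcoth l) grows at most like exp (|l| / 2). Thus \<rho> = 0, the
  value on the centre of the group, is an interior point and the kernel is differentiable
  there.\<close>

lemma heat_amp_bound:
 assumes n: "1 <= n"
 obtains C where "0 < C" "!!\<rho> l. - 1 / 2 <= \<rho> ==> \<bar>heat_amp n j m \<rho> l\<bar> <= C * exp (- (1/4) * \<bar>l\<bar>)"
proof -
 \<comment> \<open>The degree counts \<open>m\<close> powers of l, \<open>j\<close> powers of
   \<open>xcoth\<close> and one power from \<open>inv_sinhc_power_le\<close>. After exp (|l| / 2) is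
   spent on negative \<rho>, half of the remaining rate 1/2 pays for the polynomial.\<close>
 obtain C :: real where C: "0 < C" "!!x. 0 <= x ==> (1 + x) ^ (m + j + 1) <= C * exp (1/4 * x)"
  by (rule poly_le_exp[of "1/4" "m + j + 1"]) simp_all
 have "\<bar>heat_amp n j m \<rho> l\<bar> <= 2 * C * exp 1 * exp (- (1/4) * \<bar>l\<bar>)" if \<rho>: "- 1 / 2 <= \<rho>" for \<rho> l
 proof -
  have 1: "\<bar>l\<bar> ^ m <= (1 + \<bar>l\<bar>) ^ m" by (intro power_mono) auto
  have 2: "\<bar>xcoth l\<bar> ^ j <= (1 + \<bar>l\<bar>) ^ j" using xcoth_bounds[of l] by (intro power_mono) auto
  have "- \<rho> * xcoth l <= 1/2 * xcoth l" using \<rho> xcoth_bounds[of l] by (intro mult_right_mono) auto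
  also have "\<dots> <= 1 + 1/2 * \<bar>l\<bar>" using xcoth_bounds[of l] by (simp add: field_simps)
  finally have 3: "exp (- \<rho> * xcoth l) <= exp 1 * exp (1/2 * \<bar>l\<bar>)" by (simp flip: exp_add)
  have "\<bar>heat_amp n j m \<rho> l\<bar> = \<bar>l\<bar> ^ m * \<bar>xcoth l\<bar> ^ j * inv_sinhc l ^ n * exp (- \<rho> * xcoth l)"
   using inv_sinhc_pos[of l] by (simp add: heat_amp_def abs_mult power_abs)
  also have "\<dots> <= (1 + \<bar>l\<bar>) ^ m * (1 + \<bar>l\<bar>) ^ j * (2 * (1 + \<bar>l\<bar>) * exp (- \<bar>l\<bar>)) * (exp 1 * exp (1/2 * \<bar>l\<bar>))"
   using inv_sinhc_pos[of l] inv_sinhc_power_le[OF n, of l] 1 2 3 by (intro mult_mono) auto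
  also have "\<dots> = 2 * exp 1 * (1 + \<bar>l\<bar>) ^ (m + j + 1) * (exp (- \<bar>l\<bar>) * exp (1/2 * \<bar>l\<bar>))"
   by (simp add: power_add)
  also have "exp (- \<bar>l\<bar>) * exp (1/2 * \<bar>l\<bar>) = exp (- (1/2) * \<bar>l\<bar>)" by (simp flip: exp_add)
  also have "2 * exp 1 * (1 + \<bar>l\<bar>) ^ (m + j + 1) * exp (- (1/2) * \<bar>l\<bar>) <= 2 * exp 1 * (C * exp (1/4 * \<bar>l\<bar>)) * exp (- (1/2) * \<bar>l\<bar>)"
   by (intro mult_right_mono mult_left_mono C) auto
  also have "\<dots> = 2 * C * exp 1 * (exp (1/4 * \<bar>l\<bar>) * exp (- (1/2) * \<bar>l\<bar>))" by simp
  also have "exp (1/4 * \<bar>l\<bar>) * exp (- (1/2) * \<bar>l\<bar>) = exp (- (1/4) * \<bar>l\<bar>)" by (simp flip: exp_add)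
  finally show ?thesis .
 qed
 then show ?thesis using C(1) that[of "2 * C * exp 1"] by simp
qed

lemma heat_amp_integrable:
 assumes "1 <= n" "- 1 / 2 <= \<rho>"
 shows "integrable lborel (\<lambda>l. cos (l * t + c) * heat_amp n j m \<rho> l)"
proof -
 obtain C where C: "0 < C" "!!\<rho> l. - 1 / 2 <= \<rho> ==> \<bar>heat_amp n j m \<rho> l\<bar> <= C * exp (- (1/4) * \<bar>l\<bar>)"
  using heat_amp_bound[OF assms(1)] by blast
 show ?thesis
 proof (rule bintegrable_bound)
  show "integrable lborel (\<lambda>l::real. C * exp (- (1/4) * \<bar>l\<bar>))"
   by (intro integrable_mult_right integrable_exp_abs) simp
  show "AE l in lborel. norm (cos (l * t + c) * heat_amp n j m \<rho> l) <= norm (C * exp (- (1/4) * \<bar>l\<bar>))"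
   using C assms(2) by (intro AE_I2) (auto simp: abs_mult intro: order_trans[OF mult_left_le_one_le])
 qed simp
qed

text \<open>A \<rho>-derivative multiplies the amplitude by \<open>- xcoth l\<close>, raising
  \<open>j\<close>; a t-derivative multiplies it by l and advances the phase by pi / 2, raising
  \<open>m\<close>. The family is therefore closed under differentiation.\<close>

lemma heat_ker_has_derivative:
 assumes n: "1 <= n" and "- 1 / 2 < \<rho>"
 shows "((\<lambda>p. heat_ker n j m (fst p) (snd p)) has_derivative
  (\<lambda>h. fst h * heat_ker n (Suc j) m \<rho> t + snd h * heat_ker n j (Suc m) \<rho> t)) (at (\<rho>, t))"
proof -
 obtain C1 where C1: "0 < C1" "!!\<rho> l. - 1 / 2 <= \<rho> ==> \<bar>heat_amp n (Suc j) m \<rho> l\<bar> <= C1 * exp (- (1/4) * \<bar>l\<bar>)"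
  using heat_amp_bound[OF n] by blast
 obtain C2 where C2: "0 < C2" "!!\<rho> l. - 1 / 2 <= \<rho> ==> \<bar>heat_amp n j (Suc m) \<rho> l\<bar> <= C2 * exp (- (1/4) * \<bar>l\<bar>)"
  using heat_amp_bound[OF n] by blast
 let ?S = "{- 1 / 2 :: real <..} \<times> (UNIV :: real set)"
 let ?F = "\<lambda>(p::real \<times> real) l. cos (l * snd p + real m * pi / 2) * heat_amp n j m (fst p) l"
 let ?F' = "\<lambda>(p::real \<times> real) l h. fst h * (cos (l * snd p + real m * pi / 2) * heat_amp n (Suc j) m (fst p) l)
  + snd h * (cos (l * snd p + real (Suc m) * pi / 2) * heat_amp n j (Suc m) (fst p) l)"
 have "((\<lambda>p. LBINT l. ?F p l) has_derivative (\<lambda>h. LBINT l. ?F' (\<rho>, t) l h)) (at (\<rho>, t))"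
 proof (rule has_derivative_integral_dominated(1)[where S="?S" and g="\<lambda>l. (C1 + C2) * exp (- (1/4) * \<bar>l\<bar>)"])
  show "open ?S" by (intro open_Times) auto
  show "convex ?S" by (intro convex_Times) auto
  show "(\<rho>, t) \<in> ?S" using assms by simp
  show "((\<lambda>p. ?F p l) has_derivative ?F' p l) (at p)" for p l
  proof -
   have c: "cos (x + real (Suc m) * pi / 2) = - sin (x + real m * pi / 2)" for x
   proof -
    have "x + real (Suc m) * pi / 2 = (x + real m * pi / 2) + pi / 2" by (simp add: field_simps)
    then show ?thesis by (simp only: cos_add) simp
   qed
   show ?thesis
    unfolding c heat_amp_def
    by (auto intro!: derivative_eq_intros simp: fun_eq_iff algebra_simps)
  qed
  show "integrable lborel (?F p)" if "p \<in> ?S" for p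
   using heat_amp_integrable[OF n, of "fst p" "snd p" "real m * pi / 2"] that by auto
  show "\<bar>?F' p l h\<bar> <= (C1 + C2) * exp (- (1/4) * \<bar>l\<bar>) * norm h" if p: "p \<in> ?S" for p l h
  proof -
   have f: "\<bar>fst h\<bar> <= norm h" "\<bar>snd h\<bar> <= norm h"
    using norm_fst_le[of "fst h" "snd h"] norm_snd_le[of "snd h" "fst h"] by auto
   have *: "\<bar>y * (cos x * a)\<bar> <= norm h * B" if "\<bar>y\<bar> <= norm h" "\<bar>a\<bar> <= B" for y x a B :: real
    unfolding abs_mult using that by (intro mult_mono order_trans[OF mult_left_le_one_le]) auto
   have "\<bar>?F' p l h\<bar> <= norm h * (C1 * exp (- (1/4) * \<bar>l\<bar>)) + norm h * (C2 * exp (- (1/4) * \<bar>l\<bar>))"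
    using p by (intro order_trans[OF abs_triangle_ineq] add_mono * C1 C2 f) auto
   then show ?thesis by (simp add: algebra_simps)
  qed
  show "integrable lborel (\<lambda>l::real. (C1 + C2) * exp (- (1/4) * \<bar>l\<bar>))"
   by (intro integrable_mult_right integrable_exp_abs) simp
 qed measurable
 also have "(\<lambda>h. LBINT l. ?F' (\<rho>, t) l h) = (\<lambda>h. fst h * heat_ker n (Suc j) m \<rho> t + snd h * heat_ker n j (Suc m) \<rho> t)"
  using heat_amp_integrable[OF n, of \<rho>] assms(2) by (simp add: heat_ker_def)
 finally show ?thesis by (simp add: heat_ker_def)
qed

section \<open>Decay of the heat kernel by two integrations by parts\<close>

text \<open>The prefactors admissible for two integrations by parts against
  \<open>heat_weight\<close>. The derivatives are explicit arguments, so that products are handled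
  by the Leibniz rule.\<close>

definition polyC2 :: "(real => real) => (real => real) => (real => real) => bool" where
 "polyC2 P P1 P2 \<longleftrightarrow> (\<forall>x. (P has_real_derivative P1 x) (at x)) \<and> (\<forall>x. (P1 has_real_derivative P2 x) (at x)) \<and>
  cont_UNIV P2 \<and>
  (\<exists>C N. \<forall>x. \<bar>P x\<bar> <= C * (1 + \<bar>x\<bar>) ^ N \<and> \<bar>P1 x\<bar> <= C * (1 + \<bar>x\<bar>) ^ N \<and> \<bar>P2 x\<bar> <= C * (1 + \<bar>x\<bar>) ^ N)"

lemma polyC2_const: "polyC2 (\<lambda>x. c) (\<lambda>x. 0) (\<lambda>x. 0)"
 unfolding polyC2_def
 by (intro conjI allI exI[of _ "\<bar>c\<bar>"] exI[of _ "0::nat"]) (auto intro!: derivative_eq_intros)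

lemma polyC2_ident: "polyC2 (\<lambda>x. x) (\<lambda>x. 1) (\<lambda>x. 0)"
 unfolding polyC2_def by (auto intro!: exI[of _ "1"] exI[of _ 1])

lemma polyC2_xcoth:
 "polyC2 (\<lambda>x. - xcoth x) (\<lambda>x. - (x - xcoth x * langevin x))
  (\<lambda>x. - (1 - ((x - xcoth x * langevin x) * langevin x + xcoth x * langevin_deriv x)))"
 unfolding polyC2_def
proof (intro conjI allI exI)
 fix x :: real
 show "((\<lambda>x. - xcoth x) has_real_derivative - (x - xcoth x * langevin x)) (at x)"
  by (auto intro!: derivative_eq_intros xcoth_deriv)
 show "((\<lambda>x. - (x - xcoth x * langevin x)) has_real_derivative
  - (1 - ((x - xcoth x * langevin x) * langevin x + xcoth x * langevin_deriv x))) (at x)"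
  by (auto intro!: derivative_eq_intros xcoth_deriv langevin_has_deriv simp: algebra_simps)
 have b: "\<bar>xcoth x\<bar> <= 1 + \<bar>x\<bar>" using xcoth_bounds[of x] by auto
 then show "\<bar>- xcoth x\<bar> <= 4 * (1 + \<bar>x\<bar>) ^ 1" by simp
 have "\<bar>xcoth x * langevin x\<bar> <= (1 + \<bar>x\<bar>) * 1"
  unfolding abs_mult by (intro mult_mono b abs_langevin) auto
 then have u: "\<bar>x - xcoth x * langevin x\<bar> <= 2 * (1 + \<bar>x\<bar>)" by simp
 then show "\<bar>- (x - xcoth x * langevin x)\<bar> <= 4 * (1 + \<bar>x\<bar>) ^ 1" by simp
 have "\<bar>(x - xcoth x * langevin x) * langevin x\<bar> <= (2 * (1 + \<bar>x\<bar>)) * 1"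
  unfolding abs_mult[of "x - xcoth x * langevin x"] by (intro mult_mono u abs_langevin) auto
 moreover have "\<bar>xcoth x * langevin_deriv x\<bar> <= (1 + \<bar>x\<bar>) * 1"
  unfolding abs_mult by (intro mult_mono b abs_langevin_deriv) auto
 ultimately show "\<bar>- (1 - ((x - xcoth x * langevin x) * langevin x + xcoth x * langevin_deriv x))\<bar> <= 4 * (1 + \<bar>x\<bar>) ^ 1"
  by simp
qed (intro continuous_intros)

lemma polyC2_mult:
 assumes "polyC2 P P1 P2" "polyC2 Q Q1 Q2"
 shows "polyC2 (\<lambda>x. P x * Q x) (\<lambda>x. P1 x * Q x + P x * Q1 x) (\<lambda>x. P2 x * Q x + 2 * (P1 x * Q1 x) + P x * Q2 x)"
proof -
 have D: "!!x. (P has_real_derivative P1 x) (at x)" "!!x. (P1 has_real_derivative P2 x) (at x)"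
  "!!x. (Q has_real_derivative Q1 x) (at x)" "!!x. (Q1 has_real_derivative Q2 x) (at x)"
  and c: "cont_UNIV P2" "cont_UNIV Q2"
  using assms by (auto simp: polyC2_def)
 have c': "cont_UNIV P" "cont_UNIV P1" "cont_UNIV Q" "cont_UNIV Q1"
  using D by (auto intro!: DERIV_isCont continuous_at_imp_continuous_on)
 obtain C N where C: "!!x. \<bar>P x\<bar> <= C * (1 + \<bar>x\<bar>) ^ N" "!!x. \<bar>P1 x\<bar> <= C * (1 + \<bar>x\<bar>) ^ N" "!!x. \<bar>P2 x\<bar> <= C * (1 + \<bar>x\<bar>) ^ N"
  using assms unfolding polyC2_def by blast
 obtain C' N' where C': "!!x. \<bar>Q x\<bar> <= C' * (1 + \<bar>x\<bar>) ^ N'" "!!x. \<bar>Q1 x\<bar> <= C' * (1 + \<bar>x\<bar>) ^ N'" "!!x. \<bar>Q2 x\<bar> <= C' * (1 + \<bar>x\<bar>) ^ N'"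
  using assms unfolding polyC2_def by blast
 have 0: "0 <= C * C'" using order_trans[OF abs_ge_zero C(1)[of 0]] order_trans[OF abs_ge_zero C'(1)[of 0]] by simp
 have *: "\<bar>u * v\<bar> <= C * C' * (1 + \<bar>x\<bar>) ^ (N + N')" if "\<bar>u\<bar> <= C * (1 + \<bar>x\<bar>) ^ N" "\<bar>v\<bar> <= C' * (1 + \<bar>x\<bar>) ^ N'" for u v x
 proof -
  have "\<bar>u * v\<bar> <= (C * (1 + \<bar>x\<bar>) ^ N) * (C' * (1 + \<bar>x\<bar>) ^ N')"
   unfolding abs_mult by (intro mult_mono that) (use that in linarith)+
  then show ?thesis by (simp add: power_add mult_ac)
 qed
 have p: "0 <= C * C' * (1 + \<bar>x\<bar>) ^ (N + N')" for x using 0 by simp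
 show ?thesis unfolding polyC2_def
 proof (intro conjI allI exI)
  fix x
  show "((\<lambda>x. P x * Q x) has_real_derivative P1 x * Q x + P x * Q1 x) (at x)"
   by (auto intro!: derivative_eq_intros D)
  show "((\<lambda>x. P1 x * Q x + P x * Q1 x) has_real_derivative P2 x * Q x + 2 * (P1 x * Q1 x) + P x * Q2 x) (at x)"
   by (auto intro!: derivative_eq_intros D)
  show "\<bar>P x * Q x\<bar> <= 4 * (C * C') * (1 + \<bar>x\<bar>) ^ (N + N')"
   using *[OF C(1) C'(1), of x] p[of x] by simp
  show "\<bar>P1 x * Q x + P x * Q1 x\<bar> <= 4 * (C * C') * (1 + \<bar>x\<bar>) ^ (N + N')"
   using *[OF C(1) C'(2), of x] *[OF C(2) C'(1), of x] p[of x] by linarith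
  show "\<bar>P2 x * Q x + 2 * (P1 x * Q1 x) + P x * Q2 x\<bar> <= 4 * (C * C') * (1 + \<bar>x\<bar>) ^ (N + N')"
   using *[OF C(3) C'(1), of x] *[OF C(2) C'(2), of x] *[OF C(1) C'(3), of x] by linarith
 qed (use c c' in \<open>intro continuous_intros\<close>)
qed

lemma polyC2_power:
 assumes "polyC2 P P1 P2" shows "\<exists>Q1 Q2. polyC2 (\<lambda>x. P x ^ k) Q1 Q2"
proof (induction k)
 case 0 then show ?case using polyC2_const[of 1] by auto
next
 case (Suc k)
 then obtain Q1 Q2 where "polyC2 (\<lambda>x. P x ^ k) Q1 Q2" by blast
 from polyC2_mult[OF assms this] show ?case by auto
qed

lemma polyC2_monomial: "\<exists>P1 P2. polyC2 (\<lambda>l. l ^ m * (- xcoth l) ^ j) P1 P2"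
 using polyC2_power[OF polyC2_ident, of m] polyC2_power[OF polyC2_xcoth, of j] polyC2_mult by blast

definition heat_weight :: "nat => real => real => real" where
 "heat_weight n \<rho> l = inv_sinhc l ^ n * exp (- \<rho> * xcoth l)"

text \<open>Minus the logarithmic derivative of \<open>heat_weight\<close> in l, with
  \<open>heat_logdd\<close> as its own derivative. Every derivative of the weight is then a factor
  of polynomial growth times the weight itself.\<close>

definition heat_logd :: "nat => real => real => real" where
 "heat_logd n \<rho> l = real n * langevin l + \<rho> * (l - xcoth l * langevin l)"

definition heat_logdd :: "nat => real => real => real" where
 "heat_logdd n \<rho> l = real n * langevin_deriv l
  + \<rho> * (1 - ((l - xcoth l * langevin l) * langevin l + xcoth l * langevin_deriv l))"

lemma heat_weight_deriv:
 "(heat_weight n \<rho> has_real_derivative - heat_logd n \<rho> l * heat_weight n \<rho> l) (at l)"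
proof -
 have p: "((\<lambda>x. inv_sinhc x ^ n) has_real_derivative - real n * langevin l * inv_sinhc l ^ n) (at l)"
  using DERIV_power[OF inv_sinhc_deriv[of l], of n] by (cases n) (simp_all add: algebra_simps)
 have e: "((\<lambda>x. exp (- \<rho> * xcoth x)) has_real_derivative - \<rho> * (l - xcoth l * langevin l) * exp (- \<rho> * xcoth l)) (at l)"
  by (auto intro!: derivative_eq_intros xcoth_deriv)
 show ?thesis unfolding heat_weight_def[abs_def] heat_logd_def
  using DERIV_mult[OF p e] by (simp add: algebra_simps)
qed

lemma heat_logd_deriv: "(heat_logd n \<rho> has_real_derivative heat_logdd n \<rho> l) (at l)"
 unfolding heat_logd_def[abs_def] heat_logdd_def
 by (auto intro!: derivative_eq_intros xcoth_deriv langevin_has_deriv simp: algebra_simps)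

lemma heat_weight_pos: "0 < heat_weight n \<rho> l"
 by (simp add: heat_weight_def inv_sinhc_pos)

lemma continuous_on_heat_weight: "continuous_on A (heat_weight n \<rho>)" "continuous_on A (heat_logd n \<rho>)"
 "continuous_on A (heat_logdd n \<rho>)"
 unfolding heat_weight_def[abs_def] heat_logd_def[abs_def] heat_logdd_def[abs_def]
 by (intro continuous_intros)+

lemma heat_logd_bounds:
 assumes "0 <= \<rho>"
 shows "\<bar>heat_logd n \<rho> l\<bar> <= 4 * (real n + 1) * (1 + \<rho>) * (1 + \<bar>l\<bar>)"
  and "\<bar>heat_logdd n \<rho> l\<bar> <= 4 * (real n + 1) * (1 + \<rho>) * (1 + \<bar>l\<bar>)"
proof -
 have b: "\<bar>xcoth l\<bar> <= 1 + \<bar>l\<bar>" using xcoth_bounds[of l] by auto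
 have "\<bar>xcoth l * langevin l\<bar> <= (1 + \<bar>l\<bar>) * 1"
  unfolding abs_mult by (intro mult_mono b abs_langevin) auto
 then have u: "\<bar>l - xcoth l * langevin l\<bar> <= 2 * (1 + \<bar>l\<bar>)" by simp
 have "\<bar>(l - xcoth l * langevin l) * langevin l\<bar> <= (2 * (1 + \<bar>l\<bar>)) * 1"
  unfolding abs_mult[of "l - xcoth l * langevin l"] by (intro mult_mono u abs_langevin) auto
 moreover have "\<bar>xcoth l * langevin_deriv l\<bar> <= (1 + \<bar>l\<bar>) * 1"
  unfolding abs_mult by (intro mult_mono b abs_langevin_deriv) auto
 ultimately have v: "\<bar>1 - ((l - xcoth l * langevin l) * langevin l + xcoth l * langevin_deriv l)\<bar> <= 4 * (1 + \<bar>l\<bar>)"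
  by simp
 have key: "\<bar>real n * x + \<rho> * y\<bar> <= 4 * (real n + 1) * (1 + \<rho>) * (1 + \<bar>l\<bar>)"
  if "\<bar>x\<bar> <= 1" "\<bar>y\<bar> <= 4 * (1 + \<bar>l\<bar>)" for x y
 proof -
  have "\<bar>real n * x + \<rho> * y\<bar> <= real n * \<bar>x\<bar> + \<rho> * \<bar>y\<bar>"
   using assms by (intro order_trans[OF abs_triangle_ineq]) (simp add: abs_mult)
  also have "\<dots> <= real n * (4 * (1 + \<bar>l\<bar>)) + \<rho> * (4 * (1 + \<bar>l\<bar>))"
   using that assms by (intro add_mono mult_left_mono) auto
  also have "\<dots> = 4 * (real n + \<rho>) * (1 + \<bar>l\<bar>)" by (simp add: algebra_simps)
  also have "\<dots> <= 4 * ((real n + 1) * (1 + \<rho>)) * (1 + \<bar>l\<bar>)"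
   using assms by (intro mult_right_mono mult_left_mono) (auto simp: algebra_simps)
  finally show ?thesis by (simp add: mult_ac)
 qed
 show "\<bar>heat_logd n \<rho> l\<bar> <= 4 * (real n + 1) * (1 + \<rho>) * (1 + \<bar>l\<bar>)"
  unfolding heat_logd_def using u by (intro key abs_langevin) auto
 show "\<bar>heat_logdd n \<rho> l\<bar> <= 4 * (real n + 1) * (1 + \<rho>) * (1 + \<bar>l\<bar>)"
  unfolding heat_logdd_def using v by (intro key abs_langevin_deriv) auto
qed

lemma heat_weight_bound:
 assumes "1 <= n" "0 <= \<rho>"
 shows "heat_weight n \<rho> l <= 2 * (1 + \<bar>l\<bar>) * exp (- \<bar>l\<bar>) * exp (- \<rho>)"
proof -
 have "- \<rho> * xcoth l <= - \<rho>" using mult_left_mono[OF xcoth_bounds(1)[of l] assms(2)] by simp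
 then show ?thesis unfolding heat_weight_def
  using inv_sinhc_power_le[OF assms(1)] by (intro mult_mono) auto
qed

text \<open>The three expressions are P w, its first and its second derivative, where w is the heat
  weight. A differentiation costs at most a factor (1 + \<rho>) (1 + |l|) up to constants, and half
  of each exponential rate absorbs all these factors.\<close>

lemma heat_weight_derivs_bound:
 assumes n: "1 <= n" and P: "polyC2 P P1 P2"
 obtains C where "0 < C"
  "!!\<rho> l. 0 <= \<rho> ==> \<bar>P l * heat_weight n \<rho> l\<bar> <= C * exp (- \<rho> / 2) * exp (- (1/2) * \<bar>l\<bar>)"
  "!!\<rho> l. 0 <= \<rho> ==> \<bar>(P1 l - P l * heat_logd n \<rho> l) * heat_weight n \<rho> l\<bar> <= C * exp (- \<rho> / 2) * exp (- (1/2) * \<bar>l\<bar>)"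
  "!!\<rho> l. 0 <= \<rho> ==> \<bar>(P2 l - 2 * P1 l * heat_logd n \<rho> l - P l * heat_logdd n \<rho> l + P l * (heat_logd n \<rho> l)\<^sup>2) * heat_weight n \<rho> l\<bar>
   <= C * exp (- \<rho> / 2) * exp (- (1/2) * \<bar>l\<bar>)"
proof -
 obtain C N where C: "!!x. \<bar>P x\<bar> <= C * (1 + \<bar>x\<bar>) ^ N" "!!x. \<bar>P1 x\<bar> <= C * (1 + \<bar>x\<bar>) ^ N" "!!x. \<bar>P2 x\<bar> <= C * (1 + \<bar>x\<bar>) ^ N"
  using P unfolding polyC2_def by blast
 have C0: "0 <= C" using order_trans[OF abs_ge_zero C(1)[of 0]] by simp
 \<comment> \<open>\<open>N\<close> powers come from the prefactor, two from the square of
   \<open>heat_logd\<close> and one from \<open>heat_weight_bound\<close>.\<close>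
 obtain A :: real where A: "0 < A" "!!x. 0 <= x ==> (1 + x) ^ (N + 3) <= A * exp (1/2 * x)"
  by (rule poly_le_exp[of "1/2" "N + 3"]) simp_all
 obtain B :: real where B: "0 < B" "!!x. 0 <= x ==> (1 + x) ^ 2 <= B * exp (1/2 * x)"
  by (rule poly_le_exp[of "1/2" "2"]) simp_all
 define K where "K = 4 * (real n + 1)"
 have K: "1 <= K" by (simp add: K_def)
 define D where "D = 5 * C * K\<^sup>2 * 2 * A * B + 1"
 have D: "5 * C * K\<^sup>2 * 2 * A * B <= D" "0 < D" using C0 A(1) B(1) by (auto simp: D_def intro!: add_nonneg_pos)
 \<comment> \<open>The constant 5 counts the terms of the second derivative with multiplicity: 1 + 2
   + 1 + 1.\<close>
 have main: "\<bar>g * heat_weight n \<rho> l\<bar> <= D * exp (- \<rho> / 2) * exp (- (1/2) * \<bar>l\<bar>)"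
  if g: "\<bar>g\<bar> <= 5 * (C * (1 + \<bar>l\<bar>) ^ N * (K * (1 + \<rho>) * (1 + \<bar>l\<bar>))\<^sup>2)" and \<rho>: "0 <= \<rho>" for g \<rho> l
 proof -
  have "\<bar>g * heat_weight n \<rho> l\<bar> <= (5 * (C * (1 + \<bar>l\<bar>) ^ N * (K * (1 + \<rho>) * (1 + \<bar>l\<bar>))\<^sup>2)) * (2 * (1 + \<bar>l\<bar>) * exp (- \<bar>l\<bar>) * exp (- \<rho>))"
   unfolding abs_mult using heat_weight_bound[OF n \<rho>, of l] heat_weight_pos[of n \<rho> l] g
   by (intro mult_mono) auto
  also have "\<dots> = 5 * C * K\<^sup>2 * 2 * (1 + \<bar>l\<bar>) ^ (N + 3) * exp (- \<bar>l\<bar>) * ((1 + \<rho>)^2 * exp (- \<rho>))"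
   by (simp add: power_add power2_eq_square power3_eq_cube)
  also have "\<dots> <= 5 * C * K\<^sup>2 * 2 * (A * exp (1/2 * \<bar>l\<bar>)) * exp (- \<bar>l\<bar>) * ((B * exp (1/2 * \<rho>)) * exp (- \<rho>))"
   using C0 A B(1) \<rho> B(2)[OF \<rho>] A(2)[of "\<bar>l\<bar>"]
   by (intro mult_mono mult_right_mono mult_left_mono) auto
  also have "\<dots> = 5 * C * K\<^sup>2 * 2 * A * B * (exp (1/2 * \<rho>) * exp (- \<rho>)) * (exp (1/2 * \<bar>l\<bar>) * exp (- \<bar>l\<bar>))"
   by (simp add: mult_ac)
  also have "\<dots> <= D * (exp (1/2 * \<rho>) * exp (- \<rho>)) * (exp (1/2 * \<bar>l\<bar>) * exp (- \<bar>l\<bar>))"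
   by (intro mult_right_mono D) auto
  also have "\<dots> = D * exp (- \<rho> / 2) * exp (- (1/2) * \<bar>l\<bar>)" by (simp flip: exp_add)
  finally show ?thesis .
 qed
 have "\<bar>P l\<bar> <= 5 * (C * (1 + \<bar>l\<bar>) ^ N * (K * (1 + \<rho>) * (1 + \<bar>l\<bar>))\<^sup>2)"
  "\<bar>P1 l - P l * heat_logd n \<rho> l\<bar> <= 5 * (C * (1 + \<bar>l\<bar>) ^ N * (K * (1 + \<rho>) * (1 + \<bar>l\<bar>))\<^sup>2)"
  "\<bar>P2 l - 2 * P1 l * heat_logd n \<rho> l - P l * heat_logdd n \<rho> l + P l * (heat_logd n \<rho> l)\<^sup>2\<bar>
  <= 5 * (C * (1 + \<bar>l\<bar>) ^ N * (K * (1 + \<rho>) * (1 + \<bar>l\<bar>))\<^sup>2)" if \<rho>: "0 <= \<rho>" for \<rho> l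
 proof -
  define W where "W = K * (1 + \<rho>) * (1 + \<bar>l\<bar>)"
  define V where "V = C * (1 + \<bar>l\<bar>) ^ N"
  have V: "0 <= V" "\<bar>P l\<bar> <= V" "\<bar>P1 l\<bar> <= V" "\<bar>P2 l\<bar> <= V" using C C0 by (auto simp: V_def)
  have "1 * 1 * 1 <= W" unfolding W_def using K \<rho> by (intro mult_mono) auto
  then have W: "1 <= W" "W <= W\<^sup>2" by (auto simp: power2_eq_square)
  have u: "\<bar>heat_logd n \<rho> l\<bar> <= W" "\<bar>heat_logdd n \<rho> l\<bar> <= W"
   using heat_logd_bounds[OF \<rho>] by (auto simp: W_def K_def)
  have VW: "V <= V * W\<^sup>2" "V * W <= V * W\<^sup>2" using V W mult_left_mono[of 1 "W\<^sup>2" V] mult_left_mono[of W "W\<^sup>2" V] by auto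
  have p: "\<bar>x * y\<bar> <= V * Z" if "\<bar>x\<bar> <= V" "\<bar>y\<bar> <= Z" for x y Z
   unfolding abs_mult using that V by (intro mult_mono) auto
  have u2: "\<bar>(heat_logd n \<rho> l)\<^sup>2\<bar> <= W\<^sup>2" using power_mono[OF u(1), of 2] by simp
  show "\<bar>P l\<bar> <= 5 * (C * (1 + \<bar>l\<bar>) ^ N * (K * (1 + \<rho>) * (1 + \<bar>l\<bar>))\<^sup>2)"
   unfolding W_def[symmetric] V_def[symmetric] using V VW by linarith
  show "\<bar>P1 l - P l * heat_logd n \<rho> l\<bar> <= 5 * (C * (1 + \<bar>l\<bar>) ^ N * (K * (1 + \<rho>) * (1 + \<bar>l\<bar>))\<^sup>2)"
   unfolding W_def[symmetric] V_def[symmetric] using V VW p[OF V(2) u(1)] by linarith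
  show "\<bar>P2 l - 2 * P1 l * heat_logd n \<rho> l - P l * heat_logdd n \<rho> l + P l * (heat_logd n \<rho> l)\<^sup>2\<bar>
  <= 5 * (C * (1 + \<bar>l\<bar>) ^ N * (K * (1 + \<rho>) * (1 + \<bar>l\<bar>))\<^sup>2)"
   unfolding W_def[symmetric] V_def[symmetric]
   using V VW p[OF V(3) u(1)] p[OF V(2) u(2)] p[OF V(2) u2] unfolding mult.assoc[of 2] by linarith
 qed
 note bounds = this
 show ?thesis
  by (rule that[OF D(2)]) (rule main, erule bounds, assumption)+
qed

lemma exp_abs_mult_integrable:
 assumes "borel_fun f" "!!l. \<bar>f l\<bar> <= C * exp (- (1/2) * \<bar>l\<bar>)"
 shows "integrable lborel (\<lambda>l. f l :: real)" and "\<bar>(LBINT l. f l)\<bar> <= C * (\<integral>l. exp (- (1/2) * \<bar>l\<bar>) \<partial>(lborel::real measure))"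
proof -
 have i: "integrable lborel (\<lambda>l::real. C * exp (- (1/2) * \<bar>l\<bar>))"
  by (intro integrable_mult_right integrable_exp_abs) simp
 show f: "integrable lborel f"
  by (rule bintegrable_bound[OF i]) (use assms in \<open>auto intro!: AE_I2 intro: order_trans[OF _ abs_ge_self]\<close>)
 have "\<bar>(LBINT l. f l)\<bar> <= (LBINT l. norm (f l))"
  using integral_norm_bound[of lborel f] by simp
 also have "\<dots> <= (LBINT l. C * exp (- (1/2) * \<bar>l\<bar>))"
  by (rule integral_mono[OF integrable_norm[OF f] i]) (use assms(2) in simp)
 finally have "\<bar>(LBINT l. f l)\<bar> <= (LBINT l. C * exp (- (1/2) * \<bar>l\<bar>))" .
 then show "\<bar>(LBINT l. f l)\<bar> <= C * (\<integral>l. exp (- (1/2) * \<bar>l\<bar>) \<partial>(lborel::real measure))" by simp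
qed

lemma tendsto_zero_exp_abs:
 fixes F :: "real => real"
 assumes "!!l. \<bar>F l\<bar> <= C * exp (- (1/2) * \<bar>l\<bar>)"
 shows "(F \<longlongrightarrow> 0) at_top" "(F \<longlongrightarrow> 0) at_bot"
proof -
 have 1: "((\<lambda>l::real. C * exp (- (1/2) * \<bar>l\<bar>)) \<longlongrightarrow> 0) at_top"
  by real_asymp
 have 2: "((\<lambda>l::real. C * exp (- (1/2) * \<bar>l\<bar>)) \<longlongrightarrow> 0) at_bot"
  by real_asymp
 have ev: "\<forall>\<^sub>F l in G. norm (F l) <= C * exp (- (1/2) * \<bar>l\<bar>)" for G
  by (rule always_eventually) (simp only: real_norm_def assms simp_thms)
 show "(F \<longlongrightarrow> 0) at_top" "(F \<longlongrightarrow> 0) at_bot"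
  by (rule Lim_null_comparison[OF ev 1], rule Lim_null_comparison[OF ev 2])
qed

text \<open>Two integrations by parts give t^2 Z0 = - Z2; adding the trivial bound for Z0 produces
  the factor 1 / (1 + t^2). The phase \<open>c\<close> is arbitrary so that one statement serves all
  t-derivatives.\<close>

lemma heat_weight_fourier_decay:
 assumes n: "1 <= n" and P: "polyC2 P P1 P2"
 obtains C where "0 < C"
  "!!\<rho> t c. 0 <= \<rho> ==> \<bar>(LBINT l. cos (l * t + c) * (P l * heat_weight n \<rho> l))\<bar> <= C * exp (- \<rho> / 2) / (1 + t\<^sup>2)"
proof -
 obtain C where C: "0 < C"
  "!!\<rho> l. 0 <= \<rho> ==> \<bar>P l * heat_weight n \<rho> l\<bar> <= C * exp (- \<rho> / 2) * exp (- (1/2) * \<bar>l\<bar>)"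
  "!!\<rho> l. 0 <= \<rho> ==> \<bar>(P1 l - P l * heat_logd n \<rho> l) * heat_weight n \<rho> l\<bar> <= C * exp (- \<rho> / 2) * exp (- (1/2) * \<bar>l\<bar>)"
  "!!\<rho> l. 0 <= \<rho> ==> \<bar>(P2 l - 2 * P1 l * heat_logd n \<rho> l - P l * heat_logdd n \<rho> l + P l * (heat_logd n \<rho> l)\<^sup>2) * heat_weight n \<rho> l\<bar>
   <= C * exp (- \<rho> / 2) * exp (- (1/2) * \<bar>l\<bar>)"
  by (rule heat_weight_derivs_bound[OF n P]) (rule that)
 have DP: "!!x. (P has_real_derivative P1 x) (at x)" "!!x. (P1 has_real_derivative P2 x) (at x)" "cont_UNIV P2"
  using P by (auto simp: polyC2_def)
 have cP: "cont_UNIV P" "cont_UNIV P1"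
  using DP by (auto intro!: DERIV_isCont continuous_at_imp_continuous_on)
 define I where "I = (\<integral>l. exp (- (1/2) * \<bar>l\<bar>) \<partial>(lborel::real measure))"
 have I0: "0 <= I" unfolding I_def by (intro integral_nonneg_AE) auto
 have "\<bar>(LBINT l. cos (l * t + c) * (P l * heat_weight n \<rho> l))\<bar> <= (2 * C * I + 1) * exp (- \<rho> / 2) / (1 + t\<^sup>2)"
  if \<rho>: "0 <= \<rho>" for \<rho> t c
 proof -
  let ?g = "\<lambda>l. P l * heat_weight n \<rho> l"
  let ?g1 = "\<lambda>l. (P1 l - P l * heat_logd n \<rho> l) * heat_weight n \<rho> l"
  let ?g2 = "\<lambda>l. (P2 l - 2 * P1 l * heat_logd n \<rho> l - P l * heat_logdd n \<rho> l + P l * (heat_logd n \<rho> l)\<^sup>2) * heat_weight n \<rho> l"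
  let ?E = "C * exp (- \<rho> / 2)"
  have E: "0 <= ?E" using C by simp
  have d1: "(?g has_real_derivative ?g1 l) (at l)" for l
   by (auto intro!: derivative_eq_intros DP heat_weight_deriv simp: algebra_simps)
  have d2: "(?g1 has_real_derivative ?g2 l) (at l)" for l
   by (auto intro!: derivative_eq_intros DP heat_weight_deriv heat_logd_deriv simp: algebra_simps power2_eq_square)
  have cont: "cont_UNIV ?g" "cont_UNIV ?g1" "cont_UNIV ?g2"
   by (intro continuous_intros cP DP continuous_on_heat_weight)+
  then have [measurable]: "borel_fun ?g" "borel_fun ?g1" "borel_fun ?g2"
   by (auto intro: borel_continuous)
  have cb: "\<bar>cos x * y\<bar> <= B" "\<bar>sin x * y\<bar> <= B" if "\<bar>y\<bar> <= B" for x y B :: real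
   unfolding abs_mult using that by (auto intro: order_trans[OF mult_left_le_one_le])
  have i0: "integrable lborel (\<lambda>l. cos (l * t + c) * ?g l)" "\<bar>(LBINT l. cos (l * t + c) * ?g l)\<bar> <= ?E * I"
   unfolding I_def by (rule exp_abs_mult_integrable[where C="?E"]; measurable?; intro cb C(2) \<rho>)+
  have i2: "integrable lborel (\<lambda>l. cos (l * t + c) * ?g2 l)" "\<bar>(LBINT l. cos (l * t + c) * ?g2 l)\<bar> <= ?E * I"
   unfolding I_def by (rule exp_abs_mult_integrable[where C="?E"]; measurable?; intro cb C(4) \<rho>)+
  \<comment> \<open>Both integrations by parts at once: in the derivative of this function the sine
    terms cancel, leaving the cosine against \<open>?g2\<close> plus t^2 times the cosine against
    \<open>?g\<close>.\<close>
  let ?F = "\<lambda>l. cos (l * t + c) * ?g1 l + t * (sin (l * t + c) * ?g l)"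
  have "\<bar>?F l\<bar> <= (1 + \<bar>t\<bar>) * ?E * exp (- (1/2) * \<bar>l\<bar>)" for l
  proof -
   have "\<bar>?F l\<bar> <= \<bar>cos (l * t + c) * ?g1 l\<bar> + \<bar>t\<bar> * \<bar>sin (l * t + c) * ?g l\<bar>"
    by (rule order_trans[OF abs_triangle_ineq]) (simp add: abs_mult)
   also have "\<dots> <= ?E * exp (- (1/2) * \<bar>l\<bar>) + \<bar>t\<bar> * (?E * exp (- (1/2) * \<bar>l\<bar>))"
    by (intro add_mono mult_left_mono cb C \<rho>) auto
   finally show ?thesis by (simp add: algebra_simps)
  qed
  note lim = tendsto_zero_exp_abs[OF this]
  have "(LBINT l. cos (l * t + c) * ?g2 l + t\<^sup>2 * (cos (l * t + c) * ?g l)) = 0"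
  proof (rule integral_derivative_line_zero[OF _ _ _ lim])
   show "(?F has_real_derivative cos (l * t + c) * ?g2 l + t\<^sup>2 * (cos (l * t + c) * ?g l)) (at l)" for l
    by (rule derivative_eq_intros d1 d2 refl)+ (simp add: algebra_simps power2_eq_square)
   show "isCont (\<lambda>l. cos (l * t + c) * ?g2 l + t\<^sup>2 * (cos (l * t + c) * ?g l)) l" for l
    by (rule continuous_on_interior[of UNIV], intro continuous_on_add continuous_on_mult continuous_on_cos continuous_on_const continuous_on_id cont) simp
   show "integrable lborel (\<lambda>l. cos (l * t + c) * ?g2 l + t\<^sup>2 * (cos (l * t + c) * ?g l))"
    by (intro bintegrable_add integrable_mult_right i0 i2)
  qed
  then have "(LBINT l. cos (l * t + c) * ?g2 l) + t\<^sup>2 * (LBINT l. cos (l * t + c) * ?g l) = 0"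
   by (simp only: bintegral_add[OF i2(1) integrable_mult_right[OF i0(1)]] integral_mult_right_zero)
  moreover define Z0 Z2 where "Z0 = (LBINT l. cos (l * t + c) * ?g l)" and "Z2 = (LBINT l. cos (l * t + c) * ?g2 l)"
  ultimately have eq: "t\<^sup>2 * Z0 = - Z2" and Z: "\<bar>Z0\<bar> <= ?E * I" "\<bar>Z2\<bar> <= ?E * I"
   using i0(2) i2(2) by simp_all
  have "t\<^sup>2 * \<bar>Z0\<bar> = \<bar>t\<^sup>2 * Z0\<bar>" by (simp add: abs_mult)
  then have "(1 + t\<^sup>2) * \<bar>Z0\<bar> <= 2 * C * I * exp (- \<rho> / 2)"
   using Z eq by (simp add: algebra_simps)
  also have "\<dots> <= (2 * C * I + 1) * exp (- \<rho> / 2)" by (intro mult_right_mono) auto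
  finally have "(1 + t\<^sup>2) * \<bar>Z0\<bar> <= (2 * C * I + 1) * exp (- \<rho> / 2)" .
  moreover have "0 < 1 + t\<^sup>2" by (simp add: add_pos_nonneg)
  ultimately show ?thesis unfolding Z0_def[symmetric] by (simp add: pos_le_divide_eq mult.commute)
 qed
 note bound = this
 have "0 < 2 * C * I + 1" using C(1) I0 by (intro add_nonneg_pos) auto
 from that[OF this bound] show ?thesis .
qed

lemma heat_amp_eq: "heat_amp n j m \<rho> l = l ^ m * (- xcoth l) ^ j * heat_weight n \<rho> l"
 by (simp add: heat_amp_def heat_weight_def)

lemma heat_ker_decay:
 assumes "1 <= n"
 obtains C where "0 < C" "!!\<rho> t. 0 <= \<rho> ==> \<bar>heat_ker n j m \<rho> t\<bar> <= C * exp (- \<rho> / 2) / (1 + t\<^sup>2)"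
proof -
 obtain P1 P2 where P: "polyC2 (\<lambda>l. l ^ m * (- xcoth l) ^ j) P1 P2" using polyC2_monomial by blast
 obtain C where C: "0 < C"
  "!!\<rho> t c. 0 <= \<rho> ==> \<bar>(LBINT l. cos (l * t + c) * (l ^ m * (- xcoth l) ^ j * heat_weight n \<rho> l))\<bar> <= C * exp (- \<rho> / 2) / (1 + t\<^sup>2)"
  by (rule heat_weight_fourier_decay[OF assms P]) (rule that)
 show ?thesis
  by (rule that[OF C(1)], unfold heat_ker_def heat_amp_eq, rule C(2))
qed

text \<open>The heat equation at one fixed time. The left side is a quarter of the sub-Laplacian of
  the kernel; by self-similarity the time derivative is a multiple of the dilation generator on the
  right. It comes from integrating the l-derivative of
  \<open>cos (l * t) * (l * heat_weight n \<rho> l)\<close> over the line.\<close>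

lemma heat_ker_pde:
 assumes n: "1 <= n" and \<rho>: "0 <= \<rho>"
 shows "real n * heat_ker n 1 0 \<rho> t + \<rho> * (heat_ker n 2 0 \<rho> t + heat_ker n 0 2 \<rho> t)
  = - ((real n + 1) * heat_ker n 0 0 \<rho> t + \<rho> * heat_ker n 1 0 \<rho> t + t * heat_ker n 0 1 \<rho> t)"
proof -
 obtain C where C: "0 < C"
  "!!\<rho> l. 0 <= \<rho> ==> \<bar>l * heat_weight n \<rho> l\<bar> <= C * exp (- \<rho> / 2) * exp (- (1/2) * \<bar>l\<bar>)"
  "!!\<rho> l. 0 <= \<rho> ==> \<bar>(1 - l * heat_logd n \<rho> l) * heat_weight n \<rho> l\<bar> <= C * exp (- \<rho> / 2) * exp (- (1/2) * \<bar>l\<bar>)"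
  by (rule heat_weight_derivs_bound[OF n polyC2_ident]) (rule that)
 let ?w = "heat_weight n \<rho>"
 have int: "integrable lborel (\<lambda>l. cos (l * t) * heat_amp n j m \<rho> l)" for j m
  using heat_amp_integrable[OF n, of \<rho> t 0] \<rho> by simp
 have ints: "integrable lborel (\<lambda>l. sin (l * t) * heat_amp n 0 1 \<rho> l)"
  using heat_amp_integrable[OF n, of \<rho> t "- pi / 2" 0 1] \<rho> by (simp add: cos_diff)
 have c: "cos (x + pi / 2) = - sin x" for x by (simp add: cos_add)
 have k00: "heat_ker n 0 0 \<rho> t = (LBINT l. cos (l * t) * heat_amp n 0 0 \<rho> l)"
  and k10: "heat_ker n 1 0 \<rho> t = (LBINT l. cos (l * t) * heat_amp n 1 0 \<rho> l)"
  and k20: "heat_ker n 2 0 \<rho> t = (LBINT l. cos (l * t) * heat_amp n 2 0 \<rho> l)"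
  and k02: "heat_ker n 0 2 \<rho> t = - (LBINT l. cos (l * t) * heat_amp n 0 2 \<rho> l)"
  and k01: "heat_ker n 0 1 \<rho> t = - (LBINT l. sin (l * t) * heat_amp n 0 1 \<rho> l)"
  by (simp_all add: heat_ker_def c)
 have bnd: "\<bar>cos (l * t) * (l * ?w l)\<bar> <= C * exp (- \<rho> / 2) * exp (- (1/2) * \<bar>l\<bar>)" for l
  unfolding abs_mult[of "cos _"] by (rule order_trans[OF mult_left_le_one_le C(2)[OF \<rho>]]) auto
 note lim = tendsto_zero_exp_abs[OF bnd]
 \<comment> \<open>Replacing \<open>l * langevin l\<close> by \<open>xcoth l - 1\<close> turns the
   derivative into a linear combination of the amplitudes \<open>heat_amp\<close>.\<close>
 have logd: "l * heat_logd n \<rho> l = real n * (xcoth l - 1) + \<rho> * (xcoth l - ((xcoth l)\<^sup>2 - l\<^sup>2))" for l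
 proof -
  have "l * heat_logd n \<rho> l = real n * (l * langevin l) + \<rho> * (l\<^sup>2 - xcoth l * (l * langevin l))"
   by (simp add: heat_logd_def algebra_simps power2_eq_square)
  also have "l * langevin l = xcoth l - 1" by (simp add: xcoth_def)
  finally show ?thesis by (simp add: algebra_simps power2_eq_square)
 qed
 let ?D = "\<lambda>l. (1 - l * heat_logd n \<rho> l) * ?w l"
 have D: "?D l = (1 + real n) * heat_amp n 0 0 \<rho> l + (real n + \<rho>) * heat_amp n 1 0 \<rho> l + \<rho> * heat_amp n 2 0 \<rho> l - \<rho> * heat_amp n 0 2 \<rho> l" for l
  unfolding logd heat_amp_eq by (simp add: algebra_simps power2_eq_square)
 have Deq: "(\<lambda>l. cos (l * t) * ?D l - t * (sin (l * t) * heat_amp n 0 1 \<rho> l)) =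
  (\<lambda>l. (1 + real n) * (cos (l * t) * heat_amp n 0 0 \<rho> l) + (real n + \<rho>) * (cos (l * t) * heat_amp n 1 0 \<rho> l)
   + \<rho> * (cos (l * t) * heat_amp n 2 0 \<rho> l) - \<rho> * (cos (l * t) * heat_amp n 0 2 \<rho> l) - t * (sin (l * t) * heat_amp n 0 1 \<rho> l))"
  unfolding D by (simp add: fun_eq_iff algebra_simps)
 have "(LBINT l. cos (l * t) * ?D l - t * (sin (l * t) * heat_amp n 0 1 \<rho> l)) = 0"
 proof (rule integral_derivative_line_zero[OF _ _ _ lim])
  show "((\<lambda>l. cos (l * t) * (l * ?w l)) has_real_derivative cos (l * t) * ?D l - t * (sin (l * t) * heat_amp n 0 1 \<rho> l)) (at l)" for l
   unfolding heat_amp_eq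
   by (rule derivative_eq_intros heat_weight_deriv refl)+ (simp add: algebra_simps power2_eq_square)
  show "isCont (\<lambda>l. cos (l * t) * ?D l - t * (sin (l * t) * heat_amp n 0 1 \<rho> l)) l" for l
   unfolding heat_amp_eq
   by (rule continuous_on_interior[of UNIV], intro continuous_on_diff continuous_on_mult continuous_on_cos continuous_on_sin
     continuous_on_power continuous_on_minus continuous_on_const continuous_on_id continuous_on_heat_weight continuous_amp_functions) simp
  show "integrable lborel (\<lambda>l. cos (l * t) * ?D l - t * (sin (l * t) * heat_amp n 0 1 \<rho> l))"
   unfolding Deq by (intro bintegrable_diff bintegrable_add integrable_mult_right int ints)
 qed
 then have "(1 + real n) * (LBINT l. cos (l * t) * heat_amp n 0 0 \<rho> l) + (real n + \<rho>) * (LBINT l. cos (l * t) * heat_amp n 1 0 \<rho> l)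
   + \<rho> * (LBINT l. cos (l * t) * heat_amp n 2 0 \<rho> l) - \<rho> * (LBINT l. cos (l * t) * heat_amp n 0 2 \<rho> l) - t * (LBINT l. sin (l * t) * heat_amp n 0 1 \<rho> l) = 0"
  unfolding Deq by (simp only: Bochner_Integration.integral_diff bintegral_add integral_mult_right_zero
   bintegrable_diff bintegrable_add integrable_mult_right int ints)
 then show ?thesis unfolding k00 k10 k20 k01 k02 by (simp add: algebra_simps)
qed

text \<open>At t = 0 the cosine is 1 and the integrand is positive. For other t oscillation hides
  the sign, so this single value later fixes the sign of the whole kernel.\<close>

lemma heat_ker_origin_pos:
 assumes "1 <= n" shows "0 < heat_ker n 0 0 0 0"
proof -
 have i: "integrable lborel (\<lambda>l. heat_amp n 0 0 0 l)"
  using heat_amp_integrable[OF assms, of 0 0 0 0 0] by simp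
 have "0 <= heat_ker n 0 0 0 0"
  unfolding heat_ker_def by (intro integral_nonneg_AE) (auto simp: heat_amp_eq heat_weight_pos less_imp_le)
 moreover have "heat_ker n 0 0 0 0 ~= 0"
 proof
  assume "heat_ker n 0 0 0 0 = 0"
  then have "AE l in lborel. heat_amp n 0 0 0 l = 0"
   using i by (subst (asm) heat_ker_def) (simp add: integral_nonneg_eq_0_iff_AE heat_amp_eq heat_weight_pos less_imp_le)
  then have "AE l in (lborel::real measure). False" by eventually_elim (simp add: heat_amp_eq heat_weight_pos less_imp_neq[symmetric])
  then show False using emeasure_lborel_UNIV by (simp add: AE_iff_measurable[OF _ refl] )
 qed
 ultimately show ?thesis by simp
qed

section \<open>The Heisenberg group\<close>

text \<open>The group law for which the fields \<open>X_field\<close> and \<open>Y_field\<close> are left invariant. The inverse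
 of \<open>z\<close> is \<open>- z\<close>.\<close>

definition hmul :: "'n::finite heis => 'n heis => 'n heis" (infixl "\<star>" 70) where
 "z \<star> w = (fst z + fst w, fst (snd z) + fst (snd w),
  snd (snd z) + snd (snd w) + 2 * (fst (snd z) \<bullet> fst w - fst z \<bullet> fst (snd w)))"

text \<open>Group automorphisms of Jacobian e^(2n+2). Admitting e = 0, where everything collapses to
  the identity element, puts the initial time of the heat flow on the same footing as positive
  times.\<close>

definition dil :: "real => 'n::finite heis => 'n heis" where
 "dil e z = (e *\<^sub>R fst z, e *\<^sub>R fst (snd z), e\<^sup>2 * snd (snd z))"

lemma heis_eq_iff: "z = w \<longleftrightarrow> fst z = fst w \<and> fst (snd z) = fst (snd w) \<and> snd (snd z) = snd (snd w)"
 by (auto simp: prod_eq_iff)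

lemma hmul_assoc: "z \<star> w \<star> v = z \<star> (w \<star> v)"
 by (simp add: heis_eq_iff hmul_def inner_add_left inner_add_right algebra_simps)

lemma hmul_0 [simp]: "z \<star> 0 = z" "0 \<star> z = z"
 by (simp_all add: heis_eq_iff hmul_def)

lemma hmul_minus [simp]: "z \<star> (- z) = 0" "(- z) \<star> z = 0"
 by (simp_all add: heis_eq_iff hmul_def inner_commute)

lemma hmul_cancel [simp]: "- z \<star> (z \<star> w) = w" "z \<star> (- z \<star> w) = w" "w \<star> z \<star> (- z) = w" "w \<star> (- z) \<star> z = w"
 by (simp_all add: hmul_assoc flip: hmul_assoc[of _ _ w])

lemma dil_hmul: "dil e (z \<star> w) = dil e z \<star> dil e w"
 by (simp add: heis_eq_iff hmul_def dil_def algebra_simps power2_eq_square)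

lemma dil_minus [simp]: "dil e (- z) = - dil e z"
 by (simp add: heis_eq_iff dil_def)

lemma dil_0 [simp]: "dil e 0 = 0" "dil 0 z = 0"
 by (simp_all add: heis_eq_iff dil_def)

lemma dil_dil: "dil e (dil d z) = dil (e * d) z"
 by (simp add: heis_eq_iff dil_def power_mult_distrib)

lemma dil_1 [simp]: "dil 1 z = z"
 by (simp add: heis_eq_iff dil_def)

lemma continuous_on_hmul [continuous_intros]:
 assumes "continuous_on A f" "continuous_on A g" shows "continuous_on A (\<lambda>x. f x \<star> g x)"
 unfolding hmul_def using assms by (intro continuous_intros)

lemma continuous_on_dil [continuous_intros]:
 assumes "continuous_on A e" "continuous_on A g" shows "continuous_on A (\<lambda>x. dil (e x) (g x))"
 unfolding dil_def using assms by (intro continuous_intros)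

lemma measurable_borel_Pair [measurable (raw)]:
 fixes f :: "'a => 'b::second_countable_topology" and g :: "'a => 'c::second_countable_topology"
 assumes "f \<in> borel_measurable M" "g \<in> borel_measurable M"
 shows "(\<lambda>x. (f x, g x)) \<in> borel_measurable M"
 using measurable_Pair[OF assms] by (simp add: borel_prod)

lemma measurable_borel_fst_snd [measurable (raw)]:
 fixes f :: "'a => 'b::second_countable_topology \<times> 'c::second_countable_topology"
 assumes "f \<in> borel_measurable M"
 shows "(\<lambda>x. fst (f x)) \<in> borel_measurable M" "(\<lambda>x. snd (f x)) \<in> borel_measurable M"
 using assms measurable_fst'[of f M borel borel] measurable_snd'[of f M borel borel] by (simp_all add: borel_prod)

lemma measurable_hmul [measurable (raw)]:
 assumes "f \<in> borel_measurable M" "g \<in> borel_measurable M"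
 shows "(\<lambda>x. f x \<star> g x) \<in> borel_measurable M"
 by (rule borel_measurable_continuous_Pair[OF assms]) (intro continuous_intros)

lemma measurable_dil [measurable (raw)]:
 assumes "f \<in> borel_measurable M" "g \<in> borel_measurable M"
 shows "(\<lambda>x. dil (f x) (g x)) \<in> borel_measurable M"
 by (rule borel_measurable_continuous_Pair[OF assms]) (intro continuous_intros)

section \<open>Invariance and scaling of Lebesgue measure\<close>

lemma nn_integral_heis:
 fixes f :: "'n::finite heis => ennreal"
 assumes [measurable]: "borel_fun f"
 shows "(NNI z. f z) = (NNI x. NNI y. NNI t. f (x, y, t))"
proof -
 have "(NNI z. f z) = (\<integral>\<^sup>+z. f z \<partial>(lborel \<Otimes>\<^sub>M lborel))" by (simp add: lborel_prod)
 also have "\<dots> = (NNI x. NNI w. f (x, w))"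
  by (subst lborel.nn_integral_fst[symmetric]) (simp_all add: lborel_prod)
 also have "\<dots> = (NNI x. \<integral>\<^sup>+w. f (x, w) \<partial>(lborel \<Otimes>\<^sub>M lborel))" by (simp add: lborel_prod)
 also have "\<dots> = (NNI x. NNI y. NNI t. f (x, y, t))"
  by (intro nn_integral_cong, subst lborel.nn_integral_fst[symmetric]) (simp_all add: lborel_prod)
 finally show ?thesis .
qed

lemma nn_integral_shift:
 fixes f :: "'a::euclidean_space => ennreal"
 assumes [measurable]: "borel_fun f"
 shows "(NNI x. f (c + x)) = (NNI x. f x)"
 by (subst (2) lborel_distr_plus[of c, symmetric]) (simp add: nn_integral_distr)

lemma nn_integral_scale:
 fixes f :: "'a::euclidean_space => ennreal"
 assumes [measurable]: "borel_fun f" and "c ~= 0"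
 shows "ennreal (\<bar>c\<bar> ^ DIM('a)) * (NNI x. f (c *\<^sub>R x)) = (NNI x. f x)"
 by (subst (2) lborel_affine[OF assms(2), of 0]) (simp add: nn_integral_density nn_integral_distr nn_integral_cmult)

text \<open>Left and right translations both shift the horizontal coordinates by constants and t by
  a function of the horizontal ones. Integrating in t first shows that either preserves Lebesgue
  measure, so the group is unimodular.\<close>

lemma nn_integral_shear:
 fixes f :: "'n::finite heis => ennreal"
 assumes [measurable]: "borel_fun f" "borel_fun c"
 shows "(NNI z. f (a + fst z, b + fst (snd z), c (fst z, fst (snd z)) + snd (snd z))) = (NNI z. f z)"
proof -
 have "(NNI z. f (a + fst z, b + fst (snd z), c (fst z, fst (snd z)) + snd (snd z)))
  = (NNI x. NNI y. NNI t. f (a + x, b + y, c (x, y) + t))"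
  by (subst nn_integral_heis) simp_all
 also have "\<dots> = (NNI x. NNI y. NNI t. f (a + x, b + y, t))"
  by (intro nn_integral_cong nn_integral_shift) simp
 also have "\<dots> = (NNI x. NNI y. NNI t. f (a + x, y, t))"
 proof (rule nn_integral_cong)
  show "(NNI y. NNI t. f (a + x, b + y, t)) = (NNI y. NNI t. f (a + x, y, t))" for x
   by (rule nn_integral_shift[of "\<lambda>y. (NNI t. f (a + x, y, t))"]) simp
 qed
 also have "\<dots> = (NNI x. NNI y. NNI t. f (x, y, t))"
  by (rule nn_integral_shift[of "\<lambda>x. (NNI y. NNI t. f (x, y, t))"]) simp
 also have "\<dots> = (NNI z. f z)" by (rule nn_integral_heis[symmetric]) simp
 finally show ?thesis .
qed

lemma nn_integral_hmul_left:
 fixes f :: "'n::finite heis => ennreal"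
 assumes [measurable]: "borel_fun f"
 shows "(NNI w. f (z \<star> w)) = (NNI w. f w)"
 using nn_integral_shear[of f "\<lambda>p. snd (snd z) + 2 * (fst (snd z) \<bullet> fst p - fst z \<bullet> snd p)" "fst z" "fst (snd z)"]
 by (simp add: hmul_def algebra_simps)

lemma nn_integral_hmul_right:
 fixes f :: "'n::finite heis => ennreal"
 assumes [measurable]: "borel_fun f"
 shows "(NNI z. f (z \<star> w)) = (NNI w. f w)"
 using nn_integral_shear[of f "\<lambda>p. snd (snd w) + 2 * (snd p \<bullet> fst w - fst p \<bullet> fst (snd w))" "fst w" "fst (snd w)"]
 by (simp add: hmul_def algebra_simps)

lemma nn_integral_uminus:
 fixes f :: "'a::euclidean_space => ennreal"
 assumes [measurable]: "borel_fun f"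
 shows "(NNI x. f (- x)) = (NNI x. f x)"
 using nn_integral_scale[of f "-1"] by simp

lemma nn_integral_dil:
 fixes f :: "'n::finite heis => ennreal"
 assumes [measurable]: "borel_fun f" and e: "0 < e"
 shows "ennreal (e ^ (2 * CARD('n) + 2)) * (NNI w. f (dil e w)) = (NNI w. f w)"
proof -
 let ?N = "CARD('n)"
 have "(NNI w. f w) = (NNI x. NNI y. NNI t. f (x, y, t))"
  by (rule nn_integral_heis) simp
 also have "\<dots> = (NNI x. NNI y. ennreal (e\<^sup>2) * (NNI t. f (x, y, e\<^sup>2 * t)))"
  using nn_integral_scale[of "\<lambda>t. f (_, _, t)" "e\<^sup>2"] e by (intro nn_integral_cong) simp
 also have "\<dots> = (NNI x. ennreal (e ^ ?N) * (NNI y. ennreal (e\<^sup>2) * (NNI t. f (x, e *\<^sub>R y, e\<^sup>2 * t))))"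
  using nn_integral_scale[of "\<lambda>y. ennreal (e\<^sup>2) * (NNI t. f (_, y, e\<^sup>2 * t))" e] e
  by (intro nn_integral_cong) (simp add: DIM_cart)
 also have "\<dots> = ennreal (e ^ ?N) * (NNI x. ennreal (e ^ ?N) * (NNI y. ennreal (e\<^sup>2) * (NNI t. f (e *\<^sub>R x, e *\<^sub>R y, e\<^sup>2 * t))))"
  using nn_integral_scale[of "\<lambda>x. ennreal (e ^ ?N) * (NNI y. ennreal (e\<^sup>2) * (NNI t. f (x, e *\<^sub>R y, e\<^sup>2 * t)))" e] e
  by (simp add: DIM_cart)
 also have "\<dots> = ennreal (e ^ ?N) * (ennreal (e ^ ?N) * (ennreal (e\<^sup>2) * (NNI x. NNI y. NNI t. f (e *\<^sub>R x, e *\<^sub>R y, e\<^sup>2 * t))))"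
  by (simp add: nn_integral_cmult)
 also have "\<dots> = ennreal (e ^ (2 * ?N + 2)) * (NNI x. NNI y. NNI t. f (dil e (x, y, t)))"
 proof -
  have "ennreal (e ^ (2 * ?N + 2)) = ennreal (e ^ ?N) * (ennreal (e ^ ?N) * ennreal (e\<^sup>2))"
  proof -
   have "e ^ (2 * ?N + 2) = e ^ ?N * (e ^ ?N * e\<^sup>2)" by (simp only: power_add mult_2 mult.assoc)
   then show ?thesis using e by (simp add: ennreal_mult'[symmetric])
  qed
  then show ?thesis by (simp add: dil_def mult.assoc)
 qed
 also have "(NNI x. NNI y. NNI t. f (dil e (x, y, t))) = (NNI w. f (dil e w))"
  by (subst nn_integral_heis[of "\<lambda>w. f (dil e w)"]) simp_all
 finally show ?thesis by simp
qed

text \<open>Turns invariance of nonnegative integrals into invariance of the measure, from which it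
  passes to Bochner integrals.\<close>

lemma distr_eq_lborel_if_nn_integral:
 fixes T :: "'a::euclidean_space => 'a"
 assumes [measurable]: "borel_fun T"
  and "!!f. borel_fun f ==> (NNI x. f (T x)) = (NNI x. f x)"
 shows "distr lborel lborel T = lborel"
proof (rule measure_eqI)
 fix A assume "A \<in> sets (distr lborel lborel T)"
 then have [measurable]: "A \<in> sets borel" by simp
 have "(\<integral>\<^sup>+x. indicator A x \<partial>distr lborel lborel T) = (NNI x. indicator A (T x))"
  by (rule nn_integral_distr) simp_all
 then have "emeasure (distr lborel lborel T) A = (NNI x. indicator A (T x))" by simp
 then show "emeasure (distr lborel lborel T) A = emeasure lborel A"
  using assms(2)[of "indicator A"] by simp
qed simp

lemma distr_hmul_left: "distr lborel lborel ((\<star>) z) = (lborel :: 'n::finite heis measure)"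
 by (auto intro!: distr_eq_lborel_if_nn_integral nn_integral_hmul_left)

lemma
 fixes f :: "'n::finite heis => real"
 assumes [measurable]: "borel_fun f"
 shows integral_hmul_left: "(LBINT w. f (z \<star> w)) = (LBINT w. f w)"
  and integrable_hmul_left: "integrable lborel (\<lambda>w. f (z \<star> w)) \<longleftrightarrow> integrable lborel f"
proof -
 show "(LBINT w. f (z \<star> w)) = (LBINT w. f w)"
  by (subst (2) distr_hmul_left[of z, symmetric]) (simp add: integral_distr)
 show "integrable lborel (\<lambda>w. f (z \<star> w)) \<longleftrightarrow> integrable lborel f"
  by (subst (2) distr_hmul_left[of z, symmetric]) (simp add: integrable_distr_eq)
qed

section \<open>The heat kernel on the group and its right invariant derivatives\<close>

definition hsq :: "'n::finite heis => real" where
 "hsq w = fst w \<bullet> fst w + fst (snd w) \<bullet> fst (snd w)"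

text \<open>A gauge homogeneous of degree one under \<open>dil\<close>, used for all moduli of
  continuity; the square root on the central coordinate reflects that this coordinate has weight
  two.\<close>

definition hnorm :: "'n::finite heis => real" where
 "hnorm w = norm (fst w) + norm (fst (snd w)) + sqrt \<bar>snd (snd w)\<bar>"

definition hdot :: "'n::finite heis => 'n heis => real" where
 "hdot v w = fst v \<bullet> fst w + fst (snd v) \<bullet> fst (snd w)"

text \<open>The symplectic form of the group law: twice this term is what \<open>hmul\<close> adds
  to the sum of the central coordinates.\<close>

definition hsymp :: "'n::finite heis => 'n heis => real" where
 "hsymp v w = fst (snd v) \<bullet> fst w - fst v \<bullet> fst (snd w)"

definition hker :: "nat => nat => 'n::finite heis => real" where
 "hker j m w = heat_ker CARD('n) j m (hsq w) (snd (snd w))"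

text \<open>\<open>rderiv v K K1\<close>: the derivative of \<open>K\<close> along the right invariant field through \<open>v\<close> is \<open>K1\<close>.
 Kernels enter convolutions as \<open>\<integral>w. K w * f (z \<star> w)\<close>, so that left invariant derivatives
 of the convolution become right invariant derivatives of \<open>K\<close>.\<close>

definition rderiv :: "'n::finite heis => ('n heis => real) => ('n heis => real) => bool" where
 "rderiv v K K1 \<longleftrightarrow> (\<forall>w. ((\<lambda>r. K ((r *\<^sub>R v) \<star> w)) has_real_derivative K1 w) (at 0))"

text \<open>Chain rule along the right invariant field through \<open>v\<close>: the two factors are
  the derivatives of \<open>hsq\<close> and of the central coordinate at
  \<open>r = 0\<close>.\<close>

definition hker1 :: "'n::finite heis => nat => nat => 'n heis => real" where
 "hker1 v j m w = 2 * hdot v w * hker (Suc j) m w + (snd (snd v) + 2 * hsymp v w) * hker j (Suc m) w"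

text \<open>The product rule applied to \<open>hker1 v 0 0\<close> along \<open>v'\<close>; the
  first and third terms come from differentiating the coefficients.\<close>

definition hker2 :: "'n::finite heis => 'n heis => 'n heis => real" where
 "hker2 v v' w = 2 * hdot v v' * hker 1 0 w + 2 * hdot v w * hker1 v' 1 0 w
  + 2 * hsymp v v' * hker 0 1 w + (snd (snd v) + 2 * hsymp v w) * hker1 v' 0 1 w"

lemma hsq_nonneg: "0 <= hsq w"
 by (simp add: hsq_def)

lemma sqrt_le_1_plus: "sqrt a <= 1 + a" if "0 <= a" for a :: real
 using that by (intro real_le_lsqrt) (auto simp: power2_eq_square algebra_simps)

lemma scale_hmul: "(r *\<^sub>R v) \<star> (s *\<^sub>R v) = (r + s) *\<^sub>R v"
 by (simp add: heis_eq_iff hmul_def scaleR_add_left inner_commute algebra_simps)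

text \<open>The multiples of \<open>v\<close> form a one-parameter subgroup, so differentiability at
  0 for every base point gives it at every parameter.\<close>

lemma rderiv_at:
 assumes "rderiv v K K1"
 shows "((\<lambda>r. K ((r *\<^sub>R v) \<star> w)) has_real_derivative K1 ((r *\<^sub>R v) \<star> w)) (at r)"
proof -
 have "((\<lambda>s. K ((s *\<^sub>R v) \<star> ((r *\<^sub>R v) \<star> w))) has_real_derivative K1 ((r *\<^sub>R v) \<star> w)) (at 0)"
  using assms unfolding rderiv_def by blast
 then have "((\<lambda>s. K (((s + r) *\<^sub>R v) \<star> w)) has_real_derivative K1 ((r *\<^sub>R v) \<star> w)) (at 0)"
  by (simp add: hmul_assoc[symmetric] scale_hmul)
 then have "((\<lambda>s. K ((s *\<^sub>R v) \<star> w)) has_real_derivative K1 ((r *\<^sub>R v) \<star> w)) (at (0 + r))"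
  by (subst DERIV_shift)
 then show ?thesis by simp
qed

lemma rderiv_hker: "rderiv (v :: 'n::finite heis) (hker j m) (hker1 v j m)"
 unfolding rderiv_def
proof
 fix w :: "'n heis"
 let ?n = "CARD('n)"
 let ?p = "\<lambda>r::real. (hsq ((r *\<^sub>R v) \<star> w), snd (snd ((r *\<^sub>R v) \<star> w)))"
 have h: "hsq ((r *\<^sub>R v) \<star> w) = hsq w + 2 * r * hdot v w + r\<^sup>2 * hsq v" for r
  by (simp add: hsq_def hdot_def hmul_def inner_add_left inner_add_right inner_commute algebra_simps power2_eq_square)
 have t: "snd (snd ((r *\<^sub>R v) \<star> w)) = snd (snd w) + r * (snd (snd v) + 2 * hsymp v w)" for r
  by (simp add: hsymp_def hmul_def algebra_simps)
 have d1: "((\<lambda>r. hsq ((r *\<^sub>R v) \<star> w)) has_real_derivative 2 * hdot v w) (at 0)"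
  unfolding h by (auto intro!: derivative_eq_intros)
 have d2: "((\<lambda>r. snd (snd ((r *\<^sub>R v) \<star> w))) has_real_derivative (snd (snd v) + 2 * hsymp v w)) (at 0)"
  unfolding t by (auto intro!: derivative_eq_intros)
 have dp: "(?p has_derivative (\<lambda>r. (2 * hdot v w * r, (snd (snd v) + 2 * hsymp v w) * r))) (at 0)"
  using d1 d2 by (intro has_derivative_Pair) (simp_all add: has_field_derivative_def)
 have p0: "?p 0 = (hsq w, snd (snd w))" by simp
 have n: "1 <= ?n" by (simp add: Suc_leI)
 have "((\<lambda>p. heat_ker ?n j m (fst p) (snd p)) has_derivative
  (\<lambda>h. fst h * heat_ker ?n (Suc j) m (hsq w) (snd (snd w)) + snd h * heat_ker ?n j (Suc m) (hsq w) (snd (snd w)))) (at (?p 0))"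
  unfolding p0 using hsq_nonneg[of w] by (intro heat_ker_has_derivative n) simp
 from has_derivative_compose[OF dp this]
 have "((\<lambda>r. hker j m ((r *\<^sub>R v) \<star> w)) has_derivative (\<lambda>r. r * hker1 v j m w)) (at 0)"
  by (simp add: hker_def hker1_def algebra_simps)
 then show "((\<lambda>r. hker j m ((r *\<^sub>R v) \<star> w)) has_real_derivative hker1 v j m w) (at 0)"
  by (rule has_derivative_imp_has_field_derivative) simp
qed

lemma rderiv_hdot: "rderiv v' (hdot v) (\<lambda>_. hdot v v')"
proof -
 have "hdot v ((r *\<^sub>R v') \<star> w) = hdot v w + r * hdot v v'" for r w
  by (simp add: hdot_def hmul_def inner_add_right algebra_simps)
 then show ?thesis by (auto simp: rderiv_def intro!: derivative_eq_intros)
qed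

lemma rderiv_hsymp: "rderiv v' (hsymp v) (\<lambda>_. hsymp v v')"
proof -
 have "hsymp v ((r *\<^sub>R v') \<star> w) = hsymp v w + r * hsymp v v'" for r w
  by (simp add: hsymp_def hmul_def inner_add_right algebra_simps)
 then show ?thesis by (auto simp: rderiv_def intro!: derivative_eq_intros)
qed

lemma rderiv_hker1: "rderiv v' (hker1 v 0 0) (hker2 v v')"
proof -
 note d = rderiv_hdot[unfolded rderiv_def, rule_format] rderiv_hsymp[unfolded rderiv_def, rule_format]
  rderiv_hker[unfolded rderiv_def, rule_format]
 have e: "hker1 v 0 0 = (\<lambda>w. 2 * hdot v w * hker (Suc 0) 0 w + (snd (snd v) + 2 * hsymp v w) * hker 0 (Suc 0) w)"
  by (rule ext) (rule hker1_def)
 show ?thesis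
  unfolding rderiv_def e hker2_def
  by (intro allI) (rule derivative_eq_intros d refl | simp)+
qed

section \<open>Decay classes of kernels and their first moments\<close>

text \<open>Gaussian decay horizontally, quadratic decay centrally: the latter is what two
  integrations by parts provide. The rate \<open>c\<close> is tracked because the polynomial
  coefficients of derivatives are paid for with part of it.\<close>

definition good_kernel :: "real => ('n::finite heis => real) => bool" where
 "good_kernel c K \<longleftrightarrow> cont_UNIV K \<and>
  (\<exists>C. \<forall>w. \<bar>K w\<bar> <= C * (exp (- c * hsq w) / (1 + (snd (snd w))\<^sup>2)))"

lemma continuous_on_hsq [continuous_intros]: "continuous_on A hsq"
 and continuous_on_hnorm [continuous_intros]: "continuous_on A hnorm"
 and continuous_on_hdot [continuous_intros]: "continuous_on A (hdot v)"
 and continuous_on_hsymp [continuous_intros]: "continuous_on A (hsymp v)"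
 unfolding hsq_def[abs_def] hnorm_def[abs_def] hdot_def[abs_def] hsymp_def[abs_def]
 by (intro continuous_intros)+

lemma measurable_hsq [measurable]: "borel_fun hsq"
 and measurable_hnorm [measurable]: "borel_fun hnorm"
 by (intro borel_continuous continuous_intros)+

lemma good_kernel_measurable: "good_kernel c K ==> K \<in> borel_measurable borel"
 unfolding good_kernel_def by (blast intro: borel_continuous)

lemma good_kernel_hker: "good_kernel (1/2) (hker j m :: 'n::finite heis => real)"
 unfolding good_kernel_def
proof
 let ?n = "CARD('n)"
 have n: "1 <= ?n" by (simp add: Suc_leI)
 have c: "continuous_on ({-1/2<..} \<times> UNIV) (\<lambda>p. heat_ker ?n j m (fst p) (snd p))"
 proof (rule continuous_at_imp_continuous_on, rule ballI)
  fix p :: "real \<times> real" assume p: "p \<in> {-1/2<..} \<times> UNIV"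
  have "- 1 / 2 < fst p" using p by auto
  from has_derivative_continuous[OF heat_ker_has_derivative[OF n this, of j m "snd p"]]
  show "isCont (\<lambda>p. heat_ker ?n j m (fst p) (snd p)) p" by simp
 qed
 have "cont_UNIV (\<lambda>w::'n heis. (\<lambda>p. heat_ker ?n j m (fst p) (snd p)) (hsq w, snd (snd w)))"
 proof (rule continuous_on_compose2[OF c])
  show "(\<lambda>w::'n heis. (hsq w, snd (snd w))) ` UNIV \<subseteq> {-1/2<..} \<times> UNIV"
  proof -
   have "- 1 / 2 < hsq w" for w :: "'n heis" using hsq_nonneg[of w] by linarith
   then show ?thesis by blast
  qed
 qed (intro continuous_intros)
 then show "cont_UNIV (hker j m :: 'n heis => real)" by (simp add: hker_def[abs_def])
 obtain C where C: "0 < C" "!!\<rho> t. 0 <= \<rho> ==> \<bar>heat_ker ?n j m \<rho> t\<bar> <= C * exp (- \<rho> / 2) / (1 + t\<^sup>2)"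
  by (rule heat_ker_decay[OF n, of j m]) (rule that)
 show "\<exists>C. \<forall>w::'n heis. \<bar>hker j m w\<bar> <= C * (exp (- (1/2) * hsq w) / (1 + (snd (snd w))\<^sup>2))"
  using C(2)[OF hsq_nonneg] by (intro exI[of _ C] allI) (simp add: hker_def)
qed

lemma good_kernel_mono:
 assumes "good_kernel c K" "d <= c" shows "good_kernel d K"
proof -
 obtain C where C: "!!w. \<bar>K w\<bar> <= C * (exp (- c * hsq w) / (1 + (snd (snd w))\<^sup>2))"
  using assms unfolding good_kernel_def by blast
 have "\<bar>K w\<bar> <= max C 0 * (exp (- d * hsq w) / (1 + (snd (snd w))\<^sup>2))" for w
 proof -
  have "\<bar>K w\<bar> <= max C 0 * (exp (- c * hsq w) / (1 + (snd (snd w))\<^sup>2))"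
   by (rule order_trans[OF C]) (intro mult_right_mono, auto)
  also have "\<dots> <= max C 0 * (exp (- d * hsq w) / (1 + (snd (snd w))\<^sup>2))"
   using assms(2) hsq_nonneg[of w] by (intro mult_left_mono divide_right_mono) (auto intro: mult_right_mono)
  finally show ?thesis .
 qed
 then show ?thesis using assms(1) unfolding good_kernel_def by blast
qed

lemma good_kernel_add:
 assumes "good_kernel c K" "good_kernel c K'" shows "good_kernel c (\<lambda>w. K w + K' w)"
proof -
 obtain C C' where "!!w. \<bar>K w\<bar> <= C * (exp (- c * hsq w) / (1 + (snd (snd w))\<^sup>2))"
  "!!w. \<bar>K' w\<bar> <= C' * (exp (- c * hsq w) / (1 + (snd (snd w))\<^sup>2))"
  using assms unfolding good_kernel_def by blast
 then have "\<bar>K w + K' w\<bar> <= (C + C') * (exp (- c * hsq w) / (1 + (snd (snd w))\<^sup>2))" for w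
  using abs_triangle_ineq[of "K w" "K' w"] unfolding distrib_right by (meson add_mono order_trans)
 moreover have "cont_UNIV (\<lambda>w. K w + K' w)" using assms unfolding good_kernel_def by (intro continuous_intros) blast+
 ultimately show ?thesis unfolding good_kernel_def by blast
qed

text \<open>A factor of linear horizontal growth is absorbed by exp (hsq w / 8). Starting from rate
  1/2 for \<open>hker\<close>, this gives 3/8 for first and 1/4 for second derivatives.\<close>

lemma good_kernel_mult:
 assumes K: "good_kernel c K" and l: "cont_UNIV l" "!!w. \<bar>l w\<bar> <= A * (1 + sqrt (hsq w))"
 shows "good_kernel (c - 1/8) (\<lambda>w. l w * K w)"
proof -
 obtain C where C: "!!w. \<bar>K w\<bar> <= C * (exp (- c * hsq w) / (1 + (snd (snd w))\<^sup>2))"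
  using assms unfolding good_kernel_def by blast
 have A0: "0 <= A" using order_trans[OF abs_ge_zero l(2)[of 0]] by (simp add: hsq_def)
 have "\<bar>l w * K w\<bar> <= A * 16 * C * (exp (- (c - 1/8) * hsq w) / (1 + (snd (snd w))\<^sup>2))" for w
 proof -
  have "sqrt (hsq w) <= 1 + hsq w" by (rule sqrt_le_1_plus[OF hsq_nonneg])
  moreover have "1 + hsq w / 8 <= exp (hsq w / 8)" by (rule exp_ge_add_one_self)
  ultimately have s: "1 + sqrt (hsq w) <= 16 * exp (hsq w / 8)" using hsq_nonneg[of w] by linarith
  have "\<bar>l w * K w\<bar> <= (A * (1 + sqrt (hsq w))) * (C * (exp (- c * hsq w) / (1 + (snd (snd w))\<^sup>2)))"
   unfolding abs_mult using C[of w] l(2)[of w] by (intro mult_mono) auto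
  also have "\<dots> <= (A * (16 * exp (hsq w / 8))) * (C * (exp (- c * hsq w) / (1 + (snd (snd w))\<^sup>2)))"
   using s A0 order_trans[OF abs_ge_zero C[of w]] by (intro mult_right_mono mult_left_mono) auto
  also have "\<dots> = A * 16 * C * ((exp (hsq w / 8) * exp (- c * hsq w)) / (1 + (snd (snd w))\<^sup>2))" by simp
  also have "exp (hsq w / 8) * exp (- c * hsq w) = exp (- (c - 1/8) * hsq w)"
   by (simp add: algebra_simps flip: exp_add)
  finally show ?thesis .
 qed
 moreover have "cont_UNIV (\<lambda>w. l w * K w)" using K l(1) unfolding good_kernel_def by (intro continuous_intros) blast+
 ultimately show ?thesis unfolding good_kernel_def by blast
qed

lemma hdot_bound: "\<bar>hdot v w\<bar> <= (norm (fst v) + norm (fst (snd v))) * (1 + sqrt (hsq w))"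
 and hsymp_bound: "\<bar>hsymp v w\<bar> <= (norm (fst v) + norm (fst (snd v))) * (1 + sqrt (hsq w))"
proof -
 have x: "norm (fst w) <= 1 + sqrt (hsq w)" and y: "norm (fst (snd w)) <= 1 + sqrt (hsq w)"
  unfolding norm_eq_sqrt_inner hsq_def by (simp_all add: add_increasing)
 have i: "\<bar>a \<bullet> b\<bar> <= norm a * (1 + sqrt (hsq w))" if "norm b <= 1 + sqrt (hsq w)" for a b :: "real ^ 'n"
  using order_trans[OF Cauchy_Schwarz_ineq2 mult_left_mono[OF that norm_ge_zero]] .
 show "\<bar>hdot v w\<bar> <= (norm (fst v) + norm (fst (snd v))) * (1 + sqrt (hsq w))"
  unfolding hdot_def distrib_right by (intro order_trans[OF abs_triangle_ineq] add_mono i x y)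
 show "\<bar>hsymp v w\<bar> <= (norm (fst v) + norm (fst (snd v))) * (1 + sqrt (hsq w))"
  unfolding hsymp_def distrib_right add.commute[of "norm (fst v) * _"]
  by (intro order_trans[OF abs_triangle_ineq4] add_mono i x y)
qed

lemma good_kernel_cmult:
 assumes "good_kernel c K" shows "good_kernel c (\<lambda>w. a * K w)"
proof -
 obtain C where C: "!!w. \<bar>K w\<bar> <= C * (exp (- c * hsq w) / (1 + (snd (snd w))\<^sup>2))"
  using assms unfolding good_kernel_def by blast
 have "\<bar>a * K w\<bar> <= \<bar>a\<bar> * C * (exp (- c * hsq w) / (1 + (snd (snd w))\<^sup>2))" for w
  using mult_left_mono[OF C abs_ge_zero[of a]] by (simp add: abs_mult mult.assoc)
 moreover have "cont_UNIV (\<lambda>w. a * K w)" using assms unfolding good_kernel_def by (intro continuous_intros) blast+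
 ultimately show ?thesis unfolding good_kernel_def by blast
qed

lemma good_kernel_hker1: "good_kernel (3/8) (hker1 v j m)"
proof -
 have "good_kernel (1/2 - 1/8) (\<lambda>w. hdot v w * (2 * hker (Suc j) m w))"
  by (rule good_kernel_mult[OF _ continuous_on_hdot hdot_bound]) (intro good_kernel_cmult good_kernel_hker)
 moreover have "good_kernel (1/2 - 1/8) (\<lambda>w. hsymp v w * (2 * hker j (Suc m) w))"
  by (rule good_kernel_mult[OF _ continuous_on_hsymp hsymp_bound]) (intro good_kernel_cmult good_kernel_hker)
 moreover have "good_kernel (1/2 - 1/8) (\<lambda>w. snd (snd v) * hker j (Suc m) w)"
  by (rule good_kernel_mono[OF good_kernel_cmult[OF good_kernel_hker]]) simp
 ultimately have "good_kernel (1/2 - 1/8) (\<lambda>w. (hdot v w * (2 * hker (Suc j) m w) + hsymp v w * (2 * hker j (Suc m) w)) + snd (snd v) * hker j (Suc m) w)"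
  by (intro good_kernel_add)
 then show ?thesis by (simp add: hker1_def[abs_def] algebra_simps)
qed

lemma good_kernel_hker2: "good_kernel (1/4) (hker2 v v')"
proof -
 have "good_kernel (3/8 - 1/8) (\<lambda>w. hdot v w * (2 * hker1 v' 1 0 w))"
  by (rule good_kernel_mult[OF _ continuous_on_hdot hdot_bound]) (intro good_kernel_cmult good_kernel_hker1)
 moreover have "good_kernel (3/8 - 1/8) (\<lambda>w. hsymp v w * (2 * hker1 v' 0 1 w))"
  by (rule good_kernel_mult[OF _ continuous_on_hsymp hsymp_bound]) (intro good_kernel_cmult good_kernel_hker1)
 moreover have "good_kernel (3/8 - 1/8) (\<lambda>w. snd (snd v) * hker1 v' 0 1 w)"
  by (rule good_kernel_mono[OF good_kernel_cmult[OF good_kernel_hker1]]) simp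
 moreover have "good_kernel (3/8 - 1/8) (\<lambda>w. 2 * hdot v v' * hker 1 0 w)" "good_kernel (3/8 - 1/8) (\<lambda>w. 2 * hsymp v v' * hker 0 1 w)"
  by (rule good_kernel_mono[OF good_kernel_cmult[OF good_kernel_hker]], simp)+
 ultimately have "good_kernel (3/8 - 1/8) (\<lambda>w. (hdot v w * (2 * hker1 v' 1 0 w) + hsymp v w * (2 * hker1 v' 0 1 w)) + snd (snd v) * hker1 v' 0 1 w
  + (2 * hdot v v' * hker 1 0 w + 2 * hsymp v v' * hker 0 1 w))"
  by (intro good_kernel_add)
 then show ?thesis by (simp add: hker2_def[abs_def] algebra_simps)
qed

lemma nn_integral_gauss_finite:
 "(\<integral>\<^sup>+x. ennreal (exp (- (1/8) * (x \<bullet> x))) \<partial>(lborel :: 'a::euclidean_space measure)) < \<infinity>"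
proof -
 have 1: "(\<integral>\<^sup>+x. ennreal (exp (- (1/8) * x\<^sup>2)) \<partial>(lborel :: real measure)) < \<infinity>"
 proof -
  have "(\<integral>\<^sup>+x. ennreal (exp (- (1/8) * x\<^sup>2)) \<partial>(lborel :: real measure)) <= (\<integral>\<^sup>+x. ennreal (exp 2 * exp (- 1 * \<bar>x\<bar>)) \<partial>(lborel :: real measure))"
  proof (intro nn_integral_mono ennreal_leI)
   fix x :: real
   \<comment> \<open>This square yields x^2 / 8 >= |x| - 2, which compares the Gaussian with an
     exponential.\<close>
   have "0 <= (\<bar>x\<bar> - 4)\<^sup>2" by simp
   then have "- (1/8) * x\<^sup>2 <= 2 + - 1 * \<bar>x\<bar>" by (simp add: power2_diff)
   then show "exp (- (1/8) * x\<^sup>2) <= exp 2 * exp (- 1 * \<bar>x\<bar>)" unfolding exp_add[symmetric] by simp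
  qed
  also have "\<dots> < \<infinity>"
   by (subst nn_integral_eq_integral) (intro integrable_mult_right integrable_exp_abs, simp_all)
  finally show ?thesis .
 qed
 have "exp (- (1/8) * (x \<bullet> x)) = (\<Prod>b\<in>Basis. exp (- (1/8) * (x \<bullet> b)\<^sup>2))" for x :: 'a
  by (subst euclidean_inner[of x x]) (simp add: exp_sum[symmetric] sum_distrib_left power2_eq_square)
 then have "(\<integral>\<^sup>+x. ennreal (exp (- (1/8) * (x \<bullet> x))) \<partial>(lborel :: 'a measure)) =
  (\<integral>\<^sup>+x. (\<Prod>b\<in>Basis. ennreal (exp (- (1/8) * (x \<bullet> b)\<^sup>2))) \<partial>(lborel :: 'a measure))"
  by (simp add: prod_ennreal)
 also have "\<dots> = (\<Prod>b\<in>(Basis :: 'a set). \<integral>\<^sup>+x. ennreal (exp (- (1/8) * x\<^sup>2)) \<partial>(lborel :: real measure))"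
  by (rule nn_integral_lborel_prod) auto
 also have "\<dots> < \<infinity>" unfolding prod_constant power_less_top_ennreal infinity_ennreal_def using 1 by (simp only: infinity_ennreal_def simp_thms)
 finally show ?thesis .
qed

text \<open>The power -3/2 is what remains of the quadratic central decay after multiplication by
  the weight sqrt (1 + |t|); it is still integrable on the line.\<close>

lemma integrable_heis_envelope:
 "integrable lborel (\<lambda>w::'n::finite heis. exp (- (1/8) * hsq w) * (1 + \<bar>snd (snd w)\<bar>) powr (-3/2))"
proof (rule integrableI_nonneg)
 define G where "G = (\<lambda>x::real^'n. exp (- (1/8) * (x \<bullet> x)))"
 define T where "T = (\<lambda>t::real. (1 + \<bar>t\<bar>) powr (-3/2))"
 define f where "f = (\<lambda>w::'n heis. exp (- (1/8) * hsq w) * (1 + \<bar>snd (snd w)\<bar>) powr (-3/2))"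
 have [measurable]: "borel_fun T" unfolding T_def by measurable
 have [measurable]: "borel_fun G" unfolding G_def by (intro borel_continuous continuous_intros)
 have fGT: "f (x, y, t) = G x * (G y * T t)" for x y t
  by (simp only: f_def G_def T_def hsq_def fst_conv snd_conv distrib_left exp_add mult.assoc)
 have nn: "0 <= G x" "0 <= T t" for x t by (simp_all add: G_def T_def)
 have [measurable]: "borel_fun f"
  unfolding f_def by (intro borel_continuous continuous_intros) (simp add: add_pos_nonneg less_imp_neq[symmetric])
 then show "(\<lambda>w::'n heis. exp (- (1/8) * hsq w) * (1 + \<bar>snd (snd w)\<bar>) powr (-3/2)) \<in> borel_measurable lborel"
  by (simp add: f_def)
 have fT: "(NNI t. ennreal (T t)) < \<infinity>"
  unfolding T_def by (subst nn_integral_eq_integral[OF integrable_inverse_three_halves]) simp_all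
 have fG: "(NNI x. ennreal (G x)) < \<infinity>"
  unfolding G_def by (rule nn_integral_gauss_finite)
 have "(NNI w. ennreal (f w)) = (NNI x. NNI y. NNI t. ennreal (f (x, y, t)))"
  by (rule nn_integral_heis) measurable
 also have "\<dots> = (NNI x. NNI y. NNI t. ennreal (G x) * (ennreal (G y) * ennreal (T t)))"
  unfolding fGT by (simp add: ennreal_mult nn)
 also have "\<dots> = (NNI x. ennreal (G x)) * ((NNI x. ennreal (G x)) * (NNI t. ennreal (T t)))"
  by (simp add: nn_integral_cmult nn_integral_multc)
 also have "\<dots> < \<infinity>"
  using fT fG by (simp add: ennreal_mult_less_top)
 finally show "(\<integral>\<^sup>+w. ennreal (exp (- (1/8) * hsq w) * (1 + \<bar>snd (snd w)\<bar>) powr (-3/2)) \<partial>(lborel :: 'n heis measure)) < \<infinity>"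
  by (simp only: f_def)
qed simp

lemma hnorm_nonneg: "0 <= hnorm w"
 by (simp add: hnorm_def)

text \<open>Half of the Gaussian rate pays for the horizontal growth of \<open>hnorm\<close>, and
  half a power of t for its central growth. The first moment is needed to exploit Hoelder continuity
  of the averaged function.\<close>

lemma good_kernel_weighted_integrable:
 fixes K :: "'n::finite heis => real"
 assumes K: "good_kernel (1/4) K"
 shows "integrable lborel (\<lambda>w. \<bar>K w\<bar> * (1 + hnorm w))"
proof -
 obtain C where C: "!!w. \<bar>K w\<bar> <= C * (exp (- (1/4) * hsq w) / (1 + (snd (snd w))\<^sup>2))"
  using K unfolding good_kernel_def by blast
 have [measurable]: "borel_fun K" by (rule good_kernel_measurable[OF K])
 have C0: "0 <= C" using order_trans[OF abs_ge_zero C[of 0]] by (simp add: hsq_def)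
 show ?thesis
 proof (rule bintegrable_bound)
  show "integrable lborel (\<lambda>w::'n heis. (C * 160) * (exp (- (1/8) * hsq w) * (1 + \<bar>snd (snd w)\<bar>) powr (-3/2)))"
   using integrable_heis_envelope by (rule integrable_mult_right)
  have "\<bar>K w\<bar> * (1 + hnorm w) <= (C * 160) * (exp (- (1/8) * hsq w) * (1 + \<bar>snd (snd w)\<bar>) powr (-3/2))" for w
  proof -
   let ?t = "\<bar>snd (snd w)\<bar>"
   have "norm (fst w) <= 1 + hsq w" "norm (fst (snd w)) <= 1 + hsq w"
   proof -
    have "norm a <= 1 + a \<bullet> a" for a :: "real ^ 'n"
     unfolding norm_eq_sqrt_inner by (rule sqrt_le_1_plus) simp
    from this[of "fst w"] this[of "fst (snd w)"] show "norm (fst w) <= 1 + hsq w" "norm (fst (snd w)) <= 1 + hsq w"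
     unfolding hsq_def using inner_ge_zero[of "fst w"] inner_ge_zero[of "fst (snd w)"] by linarith+
   qed
   moreover have "1 + hsq w / 8 <= exp (hsq w / 8)" by (rule exp_ge_add_one_self)
   ultimately have x: "norm (fst w) + norm (fst (snd w)) + 2 <= 20 * exp (hsq w / 8)" using hsq_nonneg[of w] by linarith
   have t: "1 <= sqrt (1 + ?t)" "sqrt ?t <= sqrt (1 + ?t)" by auto
   have 1: "1 + hnorm w <= (20 * exp (hsq w / 8)) * (2 * sqrt (1 + ?t))"
   proof -
    have "1 + hnorm w <= (norm (fst w) + norm (fst (snd w)) + 2) * sqrt (1 + ?t)"
    proof -
     define P where "P = norm (fst w) + norm (fst (snd w)) + 1"
     have "P * 1 <= P * sqrt (1 + ?t)" by (rule mult_left_mono[OF t(1)]) (simp add: P_def)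
     moreover have "(norm (fst w) + norm (fst (snd w)) + 2) * sqrt (1 + ?t) = P * sqrt (1 + ?t) + sqrt (1 + ?t)"
      by (simp add: P_def algebra_simps)
     moreover have "1 + hnorm w = P + sqrt ?t" by (simp add: P_def hnorm_def)
     ultimately show ?thesis using t(2) by linarith
    qed
    also have "\<dots> <= (20 * exp (hsq w / 8)) * sqrt (1 + ?t)" using x by (intro mult_right_mono) auto
    also have "\<dots> <= (20 * exp (hsq w / 8)) * (2 * sqrt (1 + ?t))" by (intro mult_left_mono) auto
    finally show ?thesis .
   qed
   have 2: "(2 * sqrt (1 + ?t)) / (1 + (snd (snd w))\<^sup>2) <= 8 * (1 + ?t) powr (-3/2)"
   proof -
    have "0 <= (?t - 1)\<^sup>2" by simp
    then have "(1 + ?t)\<^sup>2 <= 2 * (1 + (snd (snd w))\<^sup>2)" by (simp add: power2_eq_square algebra_simps)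
    then have "(2 * sqrt (1 + ?t)) / (1 + (snd (snd w))\<^sup>2) <= (2 * sqrt (1 + ?t)) / ((1 + ?t)\<^sup>2 / 2)"
     by (intro divide_left_mono) (auto intro!: mult_pos_pos add_pos_nonneg)
    also have "\<dots> = 4 * (sqrt (1 + ?t) / (1 + ?t)\<^sup>2)" by simp
    also have "sqrt (1 + ?t) / (1 + ?t)\<^sup>2 = (1 + ?t) powr (1/2) / (1 + ?t) powr 2"
     by (simp add: powr_half_sqrt)
    also have "\<dots> = (1 + ?t) powr (1/2 - 2)" by (rule powr_diff[symmetric])
    also have "(1/2 - 2 :: real) = -3/2" by simp
    also have "4 * (1 + ?t) powr (-3/2) <= 8 * (1 + ?t) powr (-3/2)" by simp
    finally show ?thesis .
   qed
   have "\<bar>K w\<bar> * (1 + hnorm w) <= (C * (exp (- (1/4) * hsq w) / (1 + (snd (snd w))\<^sup>2))) * ((20 * exp (hsq w / 8)) * (2 * sqrt (1 + ?t)))"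
    using C[of w] 1 hnorm_nonneg[of w] order_trans[OF abs_ge_zero C[of w]] by (intro mult_mono) auto
   also have "\<dots> = C * 20 * (exp (- (1/4) * hsq w) * exp (hsq w / 8)) * ((2 * sqrt (1 + ?t)) / (1 + (snd (snd w))\<^sup>2))" by simp
   also have "\<dots> <= C * 20 * (exp (- (1/4) * hsq w) * exp (hsq w / 8)) * (8 * (1 + ?t) powr (-3/2))"
    using 2 C0 by (intro mult_left_mono) auto
   also have "exp (- (1/4) * hsq w) * exp (hsq w / 8) = exp (- (1/8) * hsq w)" by (simp flip: exp_add)
   finally show ?thesis by simp
  qed
  then show "AE w in lborel. norm (\<bar>K w\<bar> * (1 + hnorm w)) <= norm ((C * 160) * (exp (- (1/8) * hsq w) * (1 + \<bar>snd (snd w)\<bar>) powr (-3/2)))"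
   using C0 by (intro AE_I2) (simp add: abs_mult abs_of_nonneg[OF add_nonneg_nonneg[OF zero_le_one hnorm_nonneg]])
 qed simp
qed

text \<open>Points of \<open>heis\<close> are triples, but should not be split into coordinates by the simplifier.\<close>

declare split_paired_All [simp del] split_paired_Ex [simp del]

section \<open>Averages over dilated kernels\<close>

lemma continuous_integral_dominated:
 fixes F :: "'a::metric_space => 'b => real"
 assumes c: "!!w. w \<in> space M ==> continuous_on S (\<lambda>z. F z w)"
  and m: "!!z. z \<in> S ==> F z \<in> borel_measurable M"
  and b: "!!z w. z \<in> S ==> w \<in> space M ==> \<bar>F z w\<bar> <= g w"
  and g: "integrable M g"
 shows "continuous_on S (\<lambda>z. \<integral>w. F z w \<partial>M)"
 unfolding continuous_on_sequentially
proof (intro allI ballI impI, elim conjE)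
 fix X :: "nat => 'a" and a assume a: "a \<in> S" and X: "\<forall>i. X i \<in> S" "X \<longlonglongrightarrow> a"
 have "(\<lambda>i. \<integral>w. F (X i) w \<partial>M) \<longlonglongrightarrow> (\<integral>w. F a w \<partial>M)"
 proof (rule integral_dominated_convergence[where w=g])
  show "AE w in M. (\<lambda>i. F (X i) w) \<longlonglongrightarrow> F a w"
  proof (rule AE_I2)
   fix w assume "w \<in> space M"
   from c[OF this] show "(\<lambda>i. F (X i) w) \<longlonglongrightarrow> F a w"
    unfolding continuous_on_sequentially comp_def using a X by blast
  qed
  show "AE w in M. norm (F (X i) w) <= g w" for i
   using X(1) b by (intro AE_I2) auto
 qed (use a X m g in auto)
 then show "((\<lambda>z. \<integral>w. F z w \<partial>M) \<circ> X) \<longlonglongrightarrow> (\<integral>w. F a w \<partial>M)" by (simp add: comp_def)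
qed

text \<open>For e > 0 this is convolution with the L^1-normalised dilate of \<open>K\<close>.
  Placing the dilation in the argument of \<open>f\<close> keeps the mass independent of e and makes
  e = 0 meaningful.\<close>

definition avg :: "real => ('n::finite heis => real) => ('n heis => real) => 'n heis => real" where
 "avg e K f z = (LBINT w. K w * f (z \<star> dil e w))"

text \<open>A superposition of scales. The resolvent and its derivatives all have this form, with
  different weights and kernels.\<close>

definition wavg :: "(real => real) => ('n::finite heis => real) => ('n heis => real) => 'n heis => real" where
 "wavg \<omega> K f z = (LBINT e. \<omega> e * avg e K f z)"

text \<open>The integrated form of "U is the derivative of u along the left invariant field through
  v", whose integral curves are right translations by multiples of \<open>v\<close>. In this form
  derivatives pass through integrals by Fubini.\<close>

definition flow_deriv :: "'n::finite heis => ('n heis => real) => ('n heis => real) => bool" where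
 "flow_deriv v u U \<longleftrightarrow>
  (\<forall>z r. u (z \<star> (r *\<^sub>R v)) - u z = r * (LBINT s:{0..1}. U (z \<star> ((s * r) *\<^sub>R v))))"

definition kmass :: "('n::finite heis => real) => real" where
 "kmass K = (LBINT w. \<bar>K w\<bar> * (1 + hnorm w))"

lemma hnorm_dil: "hnorm (dil e w) = \<bar>e\<bar> * hnorm w"
 by (simp add: hnorm_def dil_def real_sqrt_mult abs_mult algebra_simps)

lemma hnorm_0 [simp]: "hnorm 0 = 0"
 by (simp add: hnorm_def)

lemma hnorm_powr_le: "0 <= \<alpha> ==> \<alpha> <= 1 ==> hnorm w powr \<alpha> <= 1 + hnorm w"
proof -
 assume a: "0 <= \<alpha>" "\<alpha> <= 1"
 have "hnorm w powr \<alpha> <= (1 + hnorm w) powr \<alpha>" using a hnorm_nonneg[of w] by (intro powr_mono2) auto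
 also have "\<dots> <= (1 + hnorm w) powr 1" using a hnorm_nonneg[of w] by (intro powr_mono) auto
 finally show ?thesis using hnorm_nonneg[of w] by simp
qed

lemma good_kernel_integrable:
 assumes "good_kernel (1/4) K"
 shows "integrable lborel (\<lambda>w. \<bar>K w\<bar>)" "integrable lborel K" "(LBINT w. \<bar>K w\<bar>) <= kmass K"
proof -
 note i = good_kernel_weighted_integrable[OF assms]
 have [measurable]: "borel_fun K" by (rule good_kernel_measurable[OF assms])
 have le: "\<bar>K w\<bar> <= \<bar>K w\<bar> * (1 + hnorm w)" for w
  using mult_left_mono[of 1 "1 + hnorm w" "\<bar>K w\<bar>"] hnorm_nonneg[of w] by simp
 show I: "integrable lborel (\<lambda>w. \<bar>K w\<bar>)"
  by (rule bintegrable_bound[OF i])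
   (auto intro!: AE_I2 order_trans[OF le] simp: abs_of_nonneg[OF add_nonneg_nonneg[OF zero_le_one hnorm_nonneg]] abs_mult)
 then show "integrable lborel K" by (simp add: integrable_iff_bounded)
 show "(LBINT w. \<bar>K w\<bar>) <= kmass K" unfolding kmass_def by (intro integral_mono I i le)
qed

lemma avg_integrable:
 fixes K f :: "'n::finite heis => real"
 assumes K: "integrable lborel K" and [measurable]: "borel_fun f" and b: "!!z. \<bar>f z\<bar> <= B"
 shows "integrable lborel (\<lambda>w. K w * f (z \<star> dil e w))"
proof (rule bintegrable_bound[of lborel "\<lambda>w. B * \<bar>K w\<bar>"])
 show "integrable lborel (\<lambda>w. B * \<bar>K w\<bar>)" using K by simp
 have [measurable]: "borel_fun K" using K by simp
 show "(\<lambda>w. K w * f (z \<star> dil e w)) \<in> borel_measurable lborel" by simp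
 have "0 <= B" using b[of 0] by simp
 then show "AE w in lborel. norm (K w * f (z \<star> dil e w)) <= norm (B * \<bar>K w\<bar>)"
  using b by (intro AE_I2) (simp add: abs_mult mult.commute[of B] mult_left_mono)
qed

lemma avg_measurable [measurable]:
 assumes [measurable]: "borel_fun K" "borel_fun f"
 shows "borel_fun (\<lambda>p. avg (fst p) K f (snd p))"
 unfolding avg_def by measurable

lemma avg_measurable' [measurable (raw)]:
 assumes "borel_fun K" "borel_fun f" "g \<in> borel_measurable M" "k \<in> borel_measurable M"
 shows "(\<lambda>x. avg (g x) K f (k x)) \<in> borel_measurable M"
 using measurable_compose[OF measurable_borel_Pair[OF assms(3,4)] avg_measurable[OF assms(1,2)]] by simp

lemma wavg_measurable [measurable (raw)]:
 assumes [measurable]: "borel_fun K" "borel_fun f" "borel_fun \<omega>"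
 shows "borel_fun (wavg \<omega> K f)"
 unfolding wavg_def[abs_def] by measurable

lemma avg_bound:
 assumes K: "integrable lborel K" and f: "borel_fun f" "!!z. \<bar>f z\<bar> <= B"
 shows "\<bar>avg e K f z\<bar> <= B * (LBINT w. \<bar>K w\<bar>)"
proof -
 have "\<bar>avg e K f z\<bar> <= (LBINT w. \<bar>K w * f (z \<star> dil e w)\<bar>)"
  unfolding avg_def using integral_norm_bound[of lborel "\<lambda>w. K w * f (z \<star> dil e w)"] by simp
 also have "\<dots> <= (LBINT w. B * \<bar>K w\<bar>)"
  using integrable_abs[OF avg_integrable[OF assms, of z e]] K f(2)
  by (intro integral_mono) (simp_all add: abs_mult mult.commute[of B] mult_left_mono)
 finally show ?thesis by simp
qed

lemma avg_diff_eq: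
 assumes "integrable lborel K" "(LBINT w. K w) = 0" "borel_fun f" "!!z. \<bar>f z\<bar> <= B"
 shows "avg e K f z = (LBINT w. K w * (f (z \<star> dil e w) - f z))"
  and "integrable lborel (\<lambda>w. K w * (f (z \<star> dil e w) - f z))"
 using avg_integrable[OF assms(1,3,4), of z e] assms(1,2) by (simp_all add: avg_def right_diff_distrib)

text \<open>A kernel of mean zero permits subtracting \<open>f z\<close> under the integral. The
  increment then contributes e^\<alpha>, and the first moment of the kernel bounds the rest.\<close>

lemma avg_holder_bound:
 assumes K: "good_kernel (1/4) K" "(LBINT w. K w) = 0" and f: "borel_fun f" "!!z. \<bar>f z\<bar> <= B"
  and h: "!!z w. \<bar>f (z \<star> w) - f z\<bar> <= L * hnorm w powr \<alpha>" and \<alpha>: "0 <= \<alpha>" "\<alpha> <= 1" and L: "0 <= L" and e: "0 < e"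
 shows "\<bar>avg e K f z\<bar> <= L * e powr \<alpha> * kmass K"
proof -
 note i = avg_diff_eq[OF good_kernel_integrable(2)[OF K(1)] K(2) f, where e=e and z=z]
 have "\<bar>avg e K f z\<bar> <= (LBINT w. \<bar>K w * (f (z \<star> dil e w) - f z)\<bar>)"
  unfolding i(1) using integral_norm_bound[of lborel "\<lambda>w. K w * (f (z \<star> dil e w) - f z)"] by simp
 also have "\<dots> <= (LBINT w. L * e powr \<alpha> * (\<bar>K w\<bar> * (1 + hnorm w)))"
 proof (rule integral_mono)
  show "integrable lborel (\<lambda>w. \<bar>K w * (f (z \<star> dil e w) - f z)\<bar>)" using i(2) by (rule integrable_abs)
  show "integrable lborel (\<lambda>w. L * e powr \<alpha> * (\<bar>K w\<bar> * (1 + hnorm w)))"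
   using good_kernel_weighted_integrable[OF K(1)] by (rule integrable_mult_right)
  fix w
  have "\<bar>f (z \<star> dil e w) - f z\<bar> <= L * (e powr \<alpha> * (hnorm w powr \<alpha>))"
   using h[of z "dil e w"] e hnorm_nonneg[of w] by (simp add: hnorm_dil powr_mult)
  also have "\<dots> <= L * (e powr \<alpha> * (1 + hnorm w))" by (intro mult_left_mono hnorm_powr_le \<alpha> L) simp
  finally have "\<bar>K w\<bar> * \<bar>f (z \<star> dil e w) - f z\<bar> <= \<bar>K w\<bar> * (L * (e powr \<alpha> * (1 + hnorm w)))"
   by (intro mult_left_mono) auto
  then show "\<bar>K w * (f (z \<star> dil e w) - f z)\<bar> <= L * e powr \<alpha> * (\<bar>K w\<bar> * (1 + hnorm w))"
   by (simp add: abs_mult mult_ac)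
 qed
 finally show ?thesis by (simp add: kmass_def)
qed

text \<open>Continuity is joint in scale and point and includes e = 0; this supplies initial values
  and the compactness needed for the maximum principle.\<close>

lemma continuous_on_avg:
 assumes K: "integrable lborel K" and f: "cont_UNIV f" "!!z. \<bar>f z\<bar> <= B"
 shows "cont_UNIV (\<lambda>p. avg (fst p) K f (snd p))"
 unfolding avg_def
proof (rule continuous_integral_dominated[where g="\<lambda>w. B * \<bar>K w\<bar>"])
 have fm[measurable]: "borel_fun f" using f(1) by (rule borel_continuous)
 have [measurable]: "borel_fun K" using K by simp
 show "cont_UNIV (\<lambda>p. K w * f (snd p \<star> dil (fst p) w))" for w
  by (intro continuous_intros continuous_on_compose2[OF f(1)]) auto
 show "(\<lambda>w. K w * f (snd p \<star> dil (fst p) w)) \<in> borel_measurable lborel" for p by simp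
 show "\<bar>K w * f (snd p \<star> dil (fst p) w)\<bar> <= B * \<bar>K w\<bar>" for p w
  using f(2) by (simp add: abs_mult mult.commute[of B] mult_left_mono)
qed (use K in auto)

lemma continuous_on_avg':
 assumes K: "integrable lborel K" and f: "cont_UNIV f" "!!z. \<bar>f z\<bar> <= B"
  and "continuous_on A g" "continuous_on A k"
 shows "continuous_on A (\<lambda>x. avg (g x) K f (k x))"
 using continuous_on_compose2[OF continuous_on_avg[OF K f] continuous_on_Pair[OF assms(4,5)]] by simp

section \<open>Derivatives of averages along one-parameter subgroups\<close>

lemma rderiv_scale:
 assumes "rderiv v K K1" shows "rderiv (c *\<^sub>R v) K (\<lambda>w. c * K1 w)"
 unfolding rderiv_def
proof
 fix w
 have "((\<lambda>r. K ((r *\<^sub>R v) \<star> w)) has_real_derivative K1 w) (at (c * 0))"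
  using assms unfolding rderiv_def by (simp only: mult_zero_right)
 moreover have "((\<lambda>r. c * r) has_real_derivative c) (at 0)" by (auto intro!: derivative_eq_intros)
 ultimately have "((\<lambda>r. K (((c * r) *\<^sub>R v) \<star> w)) has_real_derivative K1 w * c) (at 0)"
  by (rule DERIV_chain2)
 then show "((\<lambda>r. K ((r *\<^sub>R c *\<^sub>R v) \<star> w)) has_real_derivative c * K1 w) (at 0)"
  by (simp add: mult.commute)
qed

lemma avg_translate:
 assumes [measurable]: "borel_fun K" "borel_fun f"
 shows "avg e K f (z \<star> dil e v) = (LBINT w. K (- v \<star> w) * f (z \<star> dil e w))"
proof -
 have "(LBINT w. K (- v \<star> w) * f (z \<star> dil e w)) = (LBINT w. K (- v \<star> (v \<star> w)) * f (z \<star> dil e (v \<star> w)))"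
  by (rule integral_hmul_left[of "\<lambda>w. K (- v \<star> w) * f (z \<star> dil e w)" v, symmetric]) simp
 then show ?thesis by (simp add: avg_def dil_hmul hmul_assoc)
qed

text \<open>The increment of \<open>avg e K f\<close> along \<open>v\<close>: translate the kernel instead of \<open>f\<close>, apply the
 fundamental theorem of calculus to the kernel and exchange the integrals. No regularity of \<open>f\<close> is used.\<close>

lemma avg_increment:
 assumes K: "good_kernel (1/4) K" "good_kernel (1/4) K1" "rderiv v K K1"
  and f: "borel_fun f" "!!z. \<bar>f z\<bar> <= B"
 shows "avg e K f (z \<star> dil e v) - avg e K f z = - (LBINT s:{0..1}. avg e K1 f (z \<star> dil e (s *\<^sub>R v)))"
  and "set_integrable lborel {0..1} (\<lambda>s. avg e K1 f (z \<star> dil e (s *\<^sub>R v)))"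
proof -
 note i = good_kernel_integrable(2)[OF K(1)] good_kernel_integrable(2)[OF K(2)]
 note iabs = good_kernel_integrable(1)[OF K(2)]
 have [measurable]: "borel_fun f" by (fact f)
 have [measurable]: "borel_fun K" "borel_fun K1"
  by (rule good_kernel_measurable[OF K(1)], rule good_kernel_measurable[OF K(2)])
 have cK1: "cont_UNIV K1" using K(2) unfolding good_kernel_def by blast
 let ?g = "\<lambda>s w. indicator {0..1} s * (K1 (- (s *\<^sub>R v) \<star> w) * f (z \<star> dil e w))"
 have pw: "K (- v \<star> w) - K w = - (LBINT s:{0..1}. K1 (- (s *\<^sub>R v) \<star> w))" for w
 proof -
  have "(LBINT s=0..1. K1 (- (s *\<^sub>R v) \<star> w)) = - K (- (1 *\<^sub>R v) \<star> w) - - K (- (0 *\<^sub>R v) \<star> w)"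
  proof (rule interval_integral_FTC_finite[where F="\<lambda>s. - K (- (s *\<^sub>R v) \<star> w)" and a=0 and b=1, folded zero_ereal_def one_ereal_def])
   show "continuous_on {min 0 1..max 0 1} (\<lambda>s. K1 (- (s *\<^sub>R v) \<star> w))"
    by (intro continuous_on_compose2[OF cK1] continuous_intros) auto
   fix s :: real
   have "((\<lambda>r. K ((r *\<^sub>R v) \<star> w)) has_real_derivative K1 (((- s) *\<^sub>R v) \<star> w)) (at (- s))"
    by (rule rderiv_at[OF K(3)])
   moreover have "((\<lambda>s. - s) has_real_derivative - 1) (at s)" by (auto intro!: derivative_eq_intros)
   ultimately have "((\<lambda>s. K (((- s) *\<^sub>R v) \<star> w)) has_real_derivative K1 (((- s) *\<^sub>R v) \<star> w) * - 1) (at s)"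
    by (rule DERIV_chain2)
   then have "((\<lambda>s. - K (- (s *\<^sub>R v) \<star> w)) has_real_derivative K1 (- (s *\<^sub>R v) \<star> w)) (at s)"
    by (auto dest: DERIV_minus)
   then show "((\<lambda>s. - K (- (s *\<^sub>R v) \<star> w)) has_vector_derivative K1 (- (s *\<^sub>R v) \<star> w)) (at s within {min 0 1..max 0 1})"
    unfolding has_real_derivative_iff_has_vector_derivative by (rule has_vector_derivative_at_within)
  qed
  then show ?thesis by (simp add: interval_integral_Icc zero_ereal_def one_ereal_def)
 qed
 have in1: "(LBINT w. \<bar>?g s w\<bar>) <= indicator {0..1} s * (B * kmass K1)" for s
 proof -
  have "(LBINT w. \<bar>?g s w\<bar>) <= (LBINT w. indicator {0..1} s * (B * \<bar>K1 (- (s *\<^sub>R v) \<star> w)\<bar>))"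
  proof (rule integral_mono)
   have "integrable lborel (\<lambda>w. \<bar>K1 (- (s *\<^sub>R v) \<star> w)\<bar>)"
    using iabs by (subst integrable_hmul_left[of "\<lambda>w. \<bar>K1 w\<bar>"]) simp_all
   then show b: "integrable lborel (\<lambda>w. indicator {0..1} s * (B * \<bar>K1 (- (s *\<^sub>R v) \<star> w)\<bar>))" by simp
   show le: "\<bar>?g s w\<bar> <= indicator {0..1} s * (B * \<bar>K1 (- (s *\<^sub>R v) \<star> w)\<bar>)" for w
    using f(2) by (auto split: split_indicator simp: abs_mult mult.commute[of B] mult_left_mono)
   show "integrable lborel (\<lambda>w. \<bar>?g s w\<bar>)"
    by (rule bintegrable_bound[OF b]) (auto intro!: AE_I2 order_trans[OF le abs_ge_self])
  qed
  also have "\<dots> = indicator {0..1} s * (B * (LBINT w. \<bar>K1 w\<bar>))"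
   using integral_hmul_left[of "\<lambda>w. \<bar>K1 w\<bar>" "- (s *\<^sub>R v)"] by simp
  also have "\<dots> <= indicator {0..1} s * (B * kmass K1)"
   using good_kernel_integrable(3)[OF K(2)] f(2)[of 0] by (intro mult_left_mono) auto
  finally show ?thesis .
 qed
 have pi: "integrable (lborel \<Otimes>\<^sub>M lborel) (\<lambda>(s, w). ?g s w)"
 proof (rule lborel_pair.Fubini_integrable)
  show "(\<lambda>(s, w). ?g s w) \<in> borel_measurable (lborel \<Otimes>\<^sub>M lborel)" by measurable
  show "integrable lborel (\<lambda>s. LBINT w. norm (case (s, w) of (s, w) => ?g s w))"
  proof (rule bintegrable_bound)
   show "integrable lborel (\<lambda>s::real. indicator {0..1} s * (B * kmass K1) :: real)"
    by (intro integrable_mult_left integrable_real_indicator) auto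
   show "AE s in lborel. norm (LBINT w. norm (case (s, w) of (s, w) => ?g s w)) <= norm (indicator {0..1} s * (B * kmass K1))"
    using in1 by (intro AE_I2) (auto intro!: order_trans[OF _ abs_ge_self] simp: abs_of_nonneg integral_nonneg_AE)
  qed measurable
  show "AE s in lborel. integrable lborel (\<lambda>w. case (s, w) of (s, w) => ?g s w)"
  proof (rule AE_I2)
   fix s
   have "integrable lborel (\<lambda>w. K1 (- (s *\<^sub>R v) \<star> w))" using i(2) by (subst integrable_hmul_left) simp_all
   from avg_integrable[OF this f] show "integrable lborel (\<lambda>w. case (s, w) of (s, w) => ?g s w)" by simp
  qed
 qed
 have inner: "(LBINT w. ?g s w) = indicator {0..1} s * avg e K1 f (z \<star> dil e (s *\<^sub>R v))" for s
  by (simp add: avg_translate[of K1 f])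
 have Kv: "integrable lborel (\<lambda>w. K (- v \<star> w))" using i(1) by (subst integrable_hmul_left) simp_all
 have tr: "avg e K f (z \<star> dil e v) = (LBINT w. K (- v \<star> w) * f (z \<star> dil e w))"
  by (rule avg_translate) simp_all
 have "avg e K f (z \<star> dil e v) - avg e K f z = (LBINT w. (K (- v \<star> w) - K w) * f (z \<star> dil e w))"
  unfolding tr using avg_integrable[OF i(1) f] avg_integrable[OF Kv f]
  by (simp add: avg_def left_diff_distrib)
 also have "\<dots> = (LBINT w. - (LBINT s. ?g s w))"
  unfolding pw by (simp add: set_lebesgue_integral_def mult.assoc[symmetric])
 also have "\<dots> = - (LBINT w. (LBINT s. ?g s w))" by simp
 also have "(LBINT w. (LBINT s. ?g s w)) = (LBINT s. (LBINT w. ?g s w))"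
  by (rule lborel_pair.Fubini_integral[OF pi])
 finally show "avg e K f (z \<star> dil e v) - avg e K f z = - (LBINT s:{0..1}. avg e K1 f (z \<star> dil e (s *\<^sub>R v)))"
  by (simp only: inner set_lebesgue_integral_def) simp
 show "set_integrable lborel {0..1} (\<lambda>s. avg e K1 f (z \<star> dil e (s *\<^sub>R v)))"
  using lborel_pair.integrable_fst'[OF pi] by (simp only: inner set_integrable_def prod.case real_scaleR_def)
qed

text \<open>Averages of the constant 1 do not vary, so \<open>avg_increment\<close> for this
  function says that the derivative kernel has mean zero.\<close>

lemma rderiv_integral_zero:
 assumes K: "good_kernel (1/4) K" "good_kernel (1/4) K1" "rderiv v K K1"
 shows "(LBINT w. K1 w) = 0"
 using avg_increment(1)[OF K, of "\<lambda>_. 1" 1 1 0] by (simp add: avg_def set_lebesgue_integral_def)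

lemma integrable_pair_bound:
 fixes h :: "'a::euclidean_space => 'b::euclidean_space => real"
 assumes m: "(\<lambda>(x, y). h x y) \<in> borel_measurable (lborel \<Otimes>\<^sub>M lborel)"
  and b: "!!x y. \<bar>h x y\<bar> <= g x * k y" and g: "integrable lborel g" and k: "integrable lborel k"
 shows "integrable (lborel \<Otimes>\<^sub>M lborel) (\<lambda>(x, y). h x y)"
proof (rule lborel_pair.Fubini_integrable[OF m])
 have hm: "h x \<in> borel_measurable lborel" for x using measurable_Pair2[OF m, of x] by simp
 have gk: "integrable lborel (\<lambda>y. g x * k y)" for x using k by simp
 have hi: "integrable lborel (h x)" for x
  by (rule bintegrable_bound[OF gk[of x] hm]) (auto intro!: AE_I2 order_trans[OF b abs_ge_self])
 then show "AE x in lborel. integrable lborel (\<lambda>y. case (x, y) of (x, y) => h x y)" by simp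
 show "integrable lborel (\<lambda>x. LBINT y. norm (case (x, y) of (x, y) => h x y))"
 proof (rule bintegrable_bound)
  show "integrable lborel (\<lambda>x. g x * (LBINT y. k y))" using g by simp
  show "(\<lambda>x. LBINT y. norm (case (x, y) of (x, y) => h x y)) \<in> borel_measurable lborel"
   using m by measurable
  have "(LBINT y. \<bar>h x y\<bar>) <= (LBINT y. g x * k y)" for x
   by (rule integral_mono[OF integrable_abs[OF hi] gk b])
  then show "AE x in lborel. norm (LBINT y. norm (case (x, y) of (x, y) => h x y)) <= norm (g x * (LBINT y. k y))"
   by (intro AE_I2) (auto intro!: order_trans[OF _ abs_ge_self] simp: integral_nonneg_AE)
 qed
qed

text \<open>An integrable majorant of the derivatives is all that Fubini needs to exchange the
  parameter integral with the integral along the flow.\<close>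

lemma flow_deriv_integral:
 fixes A A' :: "'b::euclidean_space => 'n::finite heis => real"
 assumes fl: "!!w. flow_deriv v (A w) (A' w)" and i: "!!z. integrable lborel (\<lambda>w. A w z)"
  and m: "borel_fun (\<lambda>p. A' (fst p) (snd p))"
  and b: "!!w z. \<bar>A' w z\<bar> <= g w" and g: "integrable lborel g"
 shows "flow_deriv v (\<lambda>z. LBINT w. A w z) (\<lambda>z. LBINT w. A' w z)"
 unfolding flow_deriv_def
proof (intro allI)
 fix z :: "'n heis" and r :: real
 let ?h = "\<lambda>w s. indicator {0..1} s * A' w (z \<star> ((s * r) *\<^sub>R v))"
 have pi: "integrable (lborel \<Otimes>\<^sub>M lborel) (\<lambda>(w, s). ?h w s)"
 proof (rule integrable_pair_bound[where g=g and k="indicator {0..1}"])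
  have "(\<lambda>x. A' (fst x) (z \<star> ((snd x * r) *\<^sub>R v))) \<in> borel_measurable (lborel \<Otimes>\<^sub>M lborel)"
   using measurable_compose[OF _ m, of "\<lambda>x. (fst x, z \<star> ((snd x * r) *\<^sub>R v))" "lborel \<Otimes>\<^sub>M lborel"] by simp
  then show "(\<lambda>(w, s). ?h w s) \<in> borel_measurable (lborel \<Otimes>\<^sub>M lborel)"
   unfolding split_beta' by measurable
  show "\<bar>?h w s\<bar> <= g w * indicator {0..1} s" for w s
   using b by (auto split: split_indicator)
  show "integrable lborel (indicator {0..1::real} :: real => real)" by (intro integrable_real_indicator) auto
 qed (fact g)
 have "(LBINT w. A w (z \<star> (r *\<^sub>R v))) - (LBINT w. A w z) = (LBINT w. A w (z \<star> (r *\<^sub>R v)) - A w z)"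
  by (rule Bochner_Integration.integral_diff[symmetric]) (rule i)+
 also have "\<dots> = (LBINT w. r * (LBINT s. ?h w s))"
  using fl unfolding flow_deriv_def set_lebesgue_integral_def by simp
 also have "\<dots> = r * (LBINT w. (LBINT s. ?h w s))" by simp
 also have "(LBINT w. (LBINT s. ?h w s)) = (LBINT s. (LBINT w. ?h w s))"
  by (rule lborel_pair.Fubini_integral[OF pi, symmetric])
 also have "\<dots> = (LBINT s:{0..1}. LBINT w. A' w (z \<star> ((s * r) *\<^sub>R v)))"
  by (simp add: set_lebesgue_integral_def)
 finally show "(LBINT w. A w (z \<star> (r *\<^sub>R v))) - (LBINT w. A w z)
  = r * (LBINT s:{0..1}. LBINT w. A' w (z \<star> ((s * r) *\<^sub>R v)))" .
qed

lemma wavg_integrable: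
 assumes "integrable lborel \<omega>" "integrable lborel K" "borel_fun f" "!!z. \<bar>f z\<bar> <= B"
 shows "integrable lborel (\<lambda>e. \<omega> e * avg e K f z)"
proof (rule bintegrable_bound)
 show "integrable lborel (\<lambda>e. B * (LBINT w. \<bar>K w\<bar>) * \<bar>\<omega> e\<bar>)" using assms(1) by simp
 have [measurable]: "borel_fun K" "borel_fun f" "borel_fun \<omega>" using assms by auto
 show "(\<lambda>e. \<omega> e * avg e K f z) \<in> borel_measurable lborel" by simp
 have "\<bar>\<omega> e * avg e K f z\<bar> <= \<bar>\<omega> e\<bar> * (B * (LBINT w. \<bar>K w\<bar>))" for e
  unfolding abs_mult by (intro mult_left_mono avg_bound assms) auto
 then show "AE e in lborel. norm (\<omega> e * avg e K f z) <= norm (B * (LBINT w. \<bar>K w\<bar>) * \<bar>\<omega> e\<bar>)"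
  by (intro AE_I2) (auto intro!: order_trans[OF _ abs_ge_self] simp: mult.commute)
qed

lemma wavg_bound:
 assumes "integrable lborel \<omega>" "integrable lborel K" "borel_fun f" "!!z. \<bar>f z\<bar> <= B"
 shows "\<bar>wavg \<omega> K f z\<bar> <= B * (LBINT w. \<bar>K w\<bar>) * (LBINT e. \<bar>\<omega> e\<bar>)"
proof -
 have "\<bar>wavg \<omega> K f z\<bar> <= (LBINT e. \<bar>\<omega> e * avg e K f z\<bar>)"
  unfolding wavg_def using integral_norm_bound[of lborel "\<lambda>e. \<omega> e * avg e K f z"] by simp
 also have "\<dots> <= (LBINT e. B * (LBINT w. \<bar>K w\<bar>) * \<bar>\<omega> e\<bar>)"
 proof (rule integral_mono)
  show "integrable lborel (\<lambda>e. \<bar>\<omega> e * avg e K f z\<bar>)" by (rule integrable_abs[OF wavg_integrable[OF assms]])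
  show "\<bar>\<omega> e * avg e K f z\<bar> <= B * (LBINT w. \<bar>K w\<bar>) * \<bar>\<omega> e\<bar>" for e
   unfolding abs_mult using mult_left_mono[OF avg_bound[OF assms(2-4)] abs_ge_zero[of "\<omega> e"]] by (simp add: mult.commute)
 qed (use assms(1) in simp)
 finally show ?thesis by simp
qed

text \<open>A step of length r along \<open>v\<close> equals the dilate of a step of length r / e^d,
  which explains the factor; the sign arises because the kernel is translated in place of
  \<open>f\<close>.\<close>

lemma avg_flow_deriv:
 fixes f :: "'n::finite heis => real"
 assumes K: "good_kernel (1/4) K" "good_kernel (1/4) K1" "rderiv v K K1"
  and f: "borel_fun f" "!!z. \<bar>f z\<bar> <= B" and v: "dil e v = e ^ d *\<^sub>R v" and e: "0 < e"
 shows "flow_deriv v (avg e K f) (\<lambda>z. - ((1 / e) ^ d) * avg e K1 f z)"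
 unfolding flow_deriv_def
proof (intro allI)
 fix z :: "'n heis" and r :: real
 define c where "c = r * (1 / e) ^ d"
 have dv: "dil e ((s * c) *\<^sub>R v) = (s * r) *\<^sub>R v" for s
 proof -
  have "dil e (a *\<^sub>R v) = a *\<^sub>R dil e v" for a by (simp add: dil_def heis_eq_iff)
  then show ?thesis using e by (simp add: v c_def power_one_over)
 qed
 have "good_kernel (1/4) (\<lambda>w. c * K1 w)" by (rule good_kernel_cmult[OF K(2)])
 note inc = avg_increment[OF K(1) this rderiv_scale[OF K(3)] f, of e z]
 have "avg e K f (z \<star> (r *\<^sub>R v)) - avg e K f z = - (LBINT s:{0..1}. avg e (\<lambda>w. c * K1 w) f (z \<star> ((s * r) *\<^sub>R v)))"
  using inc(1) dv[of 1] by (simp add: dv)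
 also have "\<dots> = - (c * (LBINT s:{0..1}. avg e K1 f (z \<star> ((s * r) *\<^sub>R v))))"
  by (simp add: avg_def mult.assoc)
 finally have "avg e K f (z \<star> (r *\<^sub>R v)) - avg e K f z = r * (- ((1 / e) ^ d) * (LBINT s:{0..1}. avg e K1 f (z \<star> ((s * r) *\<^sub>R v))))"
  unfolding c_def by simp
 then show "avg e K f (z \<star> (r *\<^sub>R v)) - avg e K f z =
  r * (LBINT s:{0..1}. - ((1 / e) ^ d) * avg e K1 f (z \<star> ((s * r) *\<^sub>R v)))"
  by (simp only: set_integral_mult_right)
qed

lemma flow_deriv_cmult: "flow_deriv v u U ==> flow_deriv v (\<lambda>z. c * u z) (\<lambda>z. c * U z)"
 unfolding flow_deriv_def by (simp add: right_diff_distrib[symmetric])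

text \<open>\<open>wavg \<omega> K f\<close> is differentiable along \<open>v\<close>, homogeneous of degree \<open>d\<close>. The scaling produces
 the singular factor \<open>(1 / e) ^ d\<close>, which is compensated by the Hoelder continuity of \<open>f\<close> since
 \<open>K1\<close> has mean zero.\<close>

lemma wavg_flow_deriv:
 fixes f :: "'n::finite heis => real"
 assumes K: "good_kernel (1/4) K" "good_kernel (1/4) K1" "rderiv v K K1"
  and f: "borel_fun f" "!!z. \<bar>f z\<bar> <= B"
  and h: "!!z w. \<bar>f (z \<star> w) - f z\<bar> <= L * hnorm w powr \<alpha>" and \<alpha>: "0 <= \<alpha>" "\<alpha> <= 1" and L: "0 <= L"
  and v: "!!e. dil e v = e ^ d *\<^sub>R v"
  and \<omega>: "integrable lborel \<omega>" "!!e. e <= 0 ==> \<omega> e = 0" "integrable lborel (\<lambda>e. \<omega> e * (1 / e) ^ d * e powr \<alpha>)"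
 shows "flow_deriv v (wavg \<omega> K f) (wavg (\<lambda>e. - \<omega> e * (1 / e) ^ d) K1 f)"
  and "\<exists>C. \<forall>z. \<bar>wavg (\<lambda>e. - \<omega> e * (1 / e) ^ d) K1 f z\<bar> <= C"
  and "!!z. integrable lborel (\<lambda>e. - \<omega> e * (1 / e) ^ d * avg e K1 f z)"
  and "cont_UNIV f ==> cont_UNIV (wavg (\<lambda>e. - \<omega> e * (1 / e) ^ d) K1 f)"
proof -
 note zero = rderiv_integral_zero[OF K]
 note hb = avg_holder_bound[OF K(2) zero f h \<alpha> L]
 note i = good_kernel_integrable(2)[OF K(1)] good_kernel_integrable(2)[OF K(2)]
 have [measurable]: "borel_fun K" "borel_fun K1" "borel_fun f" "borel_fun \<omega>"
  using i f \<omega>(1) by auto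
 let ?g = "\<lambda>e. L * kmass K1 * \<bar>\<omega> e * (1 / e) ^ d * e powr \<alpha>\<bar>"
 have g: "integrable lborel ?g" using \<omega>(3) by simp
 have bnd: "\<bar>- \<omega> e * (1 / e) ^ d * avg e K1 f z\<bar> <= ?g e" for e z
 proof (cases "0 < e")
  case True
  have "\<bar>- \<omega> e * (1 / e) ^ d * avg e K1 f z\<bar> <= \<bar>\<omega> e * (1 / e) ^ d\<bar> * (L * e powr \<alpha> * kmass K1)"
   unfolding abs_mult[of "- \<omega> e * (1 / e) ^ d"] using hb[OF True, of z] by (intro mult_mono) auto
  then show ?thesis using True by (simp add: abs_mult mult_ac)
 qed (use \<omega>(2) in simp)
 show i3: "integrable lborel (\<lambda>e. - \<omega> e * (1 / e) ^ d * avg e K1 f z)" for z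
 proof (rule bintegrable_bound[OF g])
  show "AE e in lborel. norm (- \<omega> e * (1 / e) ^ d * avg e K1 f z) <= norm (?g e)"
   unfolding real_norm_def by (intro AE_I2 order_trans[OF bnd abs_ge_self])
 qed measurable
 show "flow_deriv v (wavg \<omega> K f) (wavg (\<lambda>e. - \<omega> e * (1 / e) ^ d) K1 f)"
  unfolding wavg_def[abs_def]
 proof (rule flow_deriv_integral[where g="?g"])
  show "integrable lborel (\<lambda>e. \<omega> e * avg e K f z)" for z by (rule wavg_integrable[OF \<omega>(1) i(1) f])
  show "borel_fun (\<lambda>p. - \<omega> (fst p) * (1 / fst p) ^ d * avg (fst p) K1 f (snd p))" by measurable
  show "flow_deriv v (\<lambda>z. \<omega> e * avg e K f z) (\<lambda>z. - \<omega> e * (1 / e) ^ d * avg e K1 f z)" for e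
  proof (cases "0 < e")
   case False
   then show ?thesis using \<omega>(2)[of e] by (simp add: flow_deriv_def set_lebesgue_integral_def)
  next
   case True
   show ?thesis
    using flow_deriv_cmult[OF avg_flow_deriv[OF K f v True], of "\<omega> e"] by (simp add: mult.assoc)
  qed
 qed (fact bnd g)+
 have "\<bar>wavg (\<lambda>e. - \<omega> e * (1 / e) ^ d) K1 f z\<bar> <= (LBINT e. ?g e)" for z
 proof -
  have "\<bar>wavg (\<lambda>e. - \<omega> e * (1 / e) ^ d) K1 f z\<bar> <= (LBINT e. \<bar>- \<omega> e * (1 / e) ^ d * avg e K1 f z\<bar>)"
   unfolding wavg_def using integral_norm_bound[of lborel "\<lambda>e. - \<omega> e * (1 / e) ^ d * avg e K1 f z"] by simp
  also have "\<dots> <= (LBINT e. ?g e)" by (rule integral_mono[OF integrable_abs[OF i3] g bnd])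
  finally show ?thesis .
 qed
 then show "\<exists>C. \<forall>z. \<bar>wavg (\<lambda>e. - \<omega> e * (1 / e) ^ d) K1 f z\<bar> <= C" by blast
 show "cont_UNIV (wavg (\<lambda>e. - \<omega> e * (1 / e) ^ d) K1 f)" if "cont_UNIV f"
  unfolding wavg_def[abs_def]
 proof (rule continuous_integral_dominated[OF _ _ _ g])
  show "cont_UNIV (\<lambda>z. - \<omega> e * (1 / e) ^ d * avg e K1 f z)" for e
   by (intro continuous_intros continuous_on_avg'[OF i(2) that f(2)])
 qed (use bnd in auto)
qed

lemma continuous_on_wavg:
 assumes "integrable lborel \<omega>" "integrable lborel K" "cont_UNIV f" "!!z. \<bar>f z\<bar> <= B"
 shows "cont_UNIV (wavg \<omega> K f)"
 unfolding wavg_def[abs_def]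
proof (rule continuous_integral_dominated[where g="\<lambda>e. \<bar>\<omega> e\<bar> * (B * (LBINT w. \<bar>K w\<bar>))"])
 have [measurable]: "borel_fun K" "borel_fun f" "borel_fun \<omega>"
  using assms by (auto intro: borel_continuous)
 show "cont_UNIV (\<lambda>z. \<omega> e * avg e K f z)" for e
  by (intro continuous_intros continuous_on_avg'[OF assms(2-4)])
 show "(\<lambda>e. \<omega> e * avg e K f z) \<in> borel_measurable lborel" for z by simp
 show "\<bar>\<omega> e * avg e K f z\<bar> <= \<bar>\<omega> e\<bar> * (B * (LBINT w. \<bar>K w\<bar>))" for z e
  unfolding abs_mult by (intro mult_left_mono avg_bound assms) auto
qed (use assms in simp)

text \<open>A central translation commutes with the dilated displacement, so the derivative falls on
  \<open>f\<close> instead of the kernel and no singular power of the scale appears.\<close>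

lemma wavg_central_flow_deriv:
 fixes f :: "'n::finite heis => real"
 assumes v: "!!z. z \<star> v = v \<star> z" "!!r z. z \<star> (r *\<^sub>R v) = (r *\<^sub>R v) \<star> z" and fl: "flow_deriv v f F"
  and f: "borel_fun f" "!!z. \<bar>f z\<bar> <= B" and F: "borel_fun F" "!!z. \<bar>F z\<bar> <= B'"
  and K: "integrable lborel K" and \<omega>: "integrable lborel \<omega>"
 shows "flow_deriv v (wavg \<omega> K f) (wavg \<omega> K F)"
proof -
 have [measurable]: "borel_fun f" "borel_fun F" "borel_fun K" "borel_fun \<omega>"
  using f F K \<omega> by auto
 have "flow_deriv v (avg e K f) (avg e K F)" for e
  unfolding avg_def[abs_def]
 proof (rule flow_deriv_integral[where g="\<lambda>w. \<bar>K w\<bar> * B'"])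
  show "flow_deriv v (\<lambda>z. K w * f (z \<star> dil e w)) (\<lambda>z. K w * F (z \<star> dil e w))" for w
   unfolding flow_deriv_def
  proof (intro allI)
   fix z :: "'n heis" and r :: real
   have c: "z \<star> (s *\<^sub>R v) \<star> dil e w = z \<star> dil e w \<star> (s *\<^sub>R v)" for s
    by (simp add: hmul_assoc v(2)[symmetric])
   show "K w * f (z \<star> (r *\<^sub>R v) \<star> dil e w) - K w * f (z \<star> dil e w) =
     r * (LBINT s:{0..1}. K w * F (z \<star> ((s * r) *\<^sub>R v) \<star> dil e w))"
    using fl unfolding c flow_deriv_def by (simp add: right_diff_distrib[symmetric])
  qed
  show "integrable lborel (\<lambda>w. K w * f (z \<star> dil e w))" for z by (rule avg_integrable[OF K f])
  show "\<bar>K w * F (z \<star> dil e w)\<bar> <= \<bar>K w\<bar> * B'" for w z using F(2) by (simp add: abs_mult mult_left_mono)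
  show "integrable lborel (\<lambda>w. \<bar>K w\<bar> * B')" using K by simp
 qed measurable
 then have fe: "flow_deriv v (\<lambda>z. \<omega> e * avg e K f z) (\<lambda>z. \<omega> e * avg e K F z)" for e
  by (rule flow_deriv_cmult)
 show ?thesis
  unfolding wavg_def[abs_def]
 proof (rule flow_deriv_integral[where g="\<lambda>e. \<bar>\<omega> e\<bar> * (B' * (LBINT w. \<bar>K w\<bar>))", OF fe])
  show "integrable lborel (\<lambda>e. \<omega> e * avg e K f z)" for z by (rule wavg_integrable[OF \<omega> K f])
  show "\<bar>\<omega> e * avg e K F z\<bar> <= \<bar>\<omega> e\<bar> * (B' * (LBINT w. \<bar>K w\<bar>))" for e z
   unfolding abs_mult by (intro mult_left_mono avg_bound K F) auto
 qed (use \<omega> in \<open>simp_all\<close>)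
qed

lemma flow_deriv_increment_bound:
 assumes fl: "flow_deriv v u U" and U: "!!z. \<bar>U z\<bar> <= C"
 shows "\<bar>u (z \<star> (r *\<^sub>R v)) - u z\<bar> <= \<bar>r\<bar> * C"
proof -
 have C: "0 <= C" using order_trans[OF abs_ge_zero U[of 0]] .
 have "\<bar>LBINT s:{0..1}. U (z \<star> ((s * r) *\<^sub>R v))\<bar> <= C"
 proof (cases "integrable lborel (\<lambda>s. indicator {0..1} s *\<^sub>R U (z \<star> ((s * r) *\<^sub>R v)))")
  \<comment> \<open>A non-integrable integrand has integral 0 by convention, and the bound is then
    trivial.\<close>
  case False
  then show ?thesis using C unfolding set_lebesgue_integral_def by (simp add: not_integrable_integral_eq)
 next
  case True
  have "\<bar>LBINT s:{0..1}. U (z \<star> ((s * r) *\<^sub>R v))\<bar> <= (LBINT s. \<bar>indicator {0..1} s *\<^sub>R U (z \<star> ((s * r) *\<^sub>R v))\<bar>)"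
   unfolding set_lebesgue_integral_def using integral_norm_bound[of lborel "\<lambda>s. indicator {0..1} s *\<^sub>R U (z \<star> ((s * r) *\<^sub>R v))"] by simp
  also have "\<dots> <= (LBINT s. indicator {0..1::real} s * C)"
  proof (rule integral_mono)
   show "integrable lborel (\<lambda>s. \<bar>indicator {0..1} s *\<^sub>R U (z \<star> ((s * r) *\<^sub>R v))\<bar>)" using True by (rule integrable_abs)
   show "integrable lborel (\<lambda>s. indicator {0..1::real} s * C)" by (intro integrable_mult_left integrable_real_indicator) auto
  qed (use U in \<open>auto split: split_indicator\<close>)
  also have "\<dots> = C" by simp
  finally show ?thesis .
 qed
 then show ?thesis using fl unfolding flow_deriv_def by (simp add: abs_mult mult_left_mono)
qed

text \<open>Dividing the integrated identity by the increment leaves the mean of \<open>U\<close>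
  over a shrinking segment, which tends to its value by continuity.\<close>

lemma flow_deriv_DERIV:
 assumes fl: "flow_deriv v u U" and U: "cont_UNIV U" "!!z. \<bar>U z\<bar> <= C"
 shows "((\<lambda>r. u (z \<star> (r *\<^sub>R v))) has_real_derivative U (z \<star> (r *\<^sub>R v))) (at r)"
proof -
 let ?y = "z \<star> (r *\<^sub>R v)"
 have "cont_UNIV (\<lambda>h. LBINT s. indicator {0..1} s * U (?y \<star> ((s * h) *\<^sub>R v)))"
 proof (rule continuous_integral_dominated[where g="\<lambda>s. indicator {0..1} s * C"])
  have [measurable]: "borel_fun U" using U(1) by (rule borel_continuous)
  show "cont_UNIV (\<lambda>h. indicator {0..1} s * U (?y \<star> ((s * h) *\<^sub>R v)))" for s
   by (intro continuous_intros continuous_on_compose2[OF U(1)]) auto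
  show "(\<lambda>s. indicator {0..1} s * U (?y \<star> ((s * h) *\<^sub>R v))) \<in> borel_measurable lborel" for h by simp
  show "\<bar>indicator {0..1} s * U (?y \<star> ((s * h) *\<^sub>R v))\<bar> <= indicator {0..1} s * C" for h s :: real
   using U(2) by (auto split: split_indicator)
  show "integrable lborel (\<lambda>s. indicator {0..1::real} s * C)" by (intro integrable_mult_left integrable_real_indicator) auto
 qed
 then have "isCont (\<lambda>h. LBINT s:{0..1}. U (?y \<star> ((s * h) *\<^sub>R v))) 0"
  by (simp add: set_lebesgue_integral_def continuous_on_eq_continuous_at)
 moreover have "(LBINT s:{0..1::real}. U ?y) = U ?y" by (simp add: set_lebesgue_integral_def)
 ultimately have "((\<lambda>h. LBINT s:{0..1}. U (?y \<star> ((s * h) *\<^sub>R v))) \<longlongrightarrow> U ?y) (at 0)"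
  by (simp add: isCont_def)
 then have "((\<lambda>h. (u (?y \<star> (h *\<^sub>R v)) - u ?y) / h) \<longlongrightarrow> U ?y) (at 0)"
 proof (rule Lim_transform_eventually)
  show "\<forall>\<^sub>F h in at 0. (LBINT s:{0..1}. U (?y \<star> ((s * h) *\<^sub>R v))) = (u (?y \<star> (h *\<^sub>R v)) - u ?y) / h"
   unfolding eventually_at_filter using fl unfolding flow_deriv_def by (intro always_eventually) simp
 qed
 then show ?thesis by (simp add: DERIV_def hmul_assoc scale_hmul)
qed

section \<open>The heat semigroup and the resolvent\<close>

definition eX :: "'n => 'n::finite heis" where "eX i = (axis i 1, 0, 0)"
definition eY :: "'n => 'n::finite heis" where "eY i = (0, axis i 1, 0)"
definition eT :: "'n::finite heis" where "eT = (0, 0, 1)"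

text \<open>The sub-Laplacian of \<open>hker 0 0\<close>, formed with right invariant fields because
  derivatives of an average act on its kernel in this way.\<close>

definition hlap :: "'n::finite heis => real" where
 "hlap w = (\<Sum>i\<in>UNIV. hker2 (eX i) (eX i) w + hker2 (eY i) (eY i) w)"

lemma dil_eX: "dil e (eX i) = e ^ 1 *\<^sub>R eX i" and dil_eY: "dil e (eY i) = e ^ 1 *\<^sub>R eY i"
 and dil_eT: "dil e eT = e ^ 2 *\<^sub>R eT"
 by (simp_all add: dil_def eX_def eY_def eT_def)

text \<open>For each index the mixed terms with \<open>hker 1 1\<close> from the two fields cancel,
  leaving (x_i^2 + y_i^2) times the pure second derivatives. Summation then gives the left side of
  \<open>heat_ker_pde\<close>.\<close>

lemma hlap_eq:
 "hlap (w :: 'n::finite heis) = - 4 * ((real CARD('n) + 1) * hker 0 0 w + hsq w * hker 1 0 w + snd (snd w) * hker 0 1 w)"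
proof -
 let ?x = "\<lambda>i. fst w $ i" and ?y = "\<lambda>i. fst (snd w) $ i"
 have dots: "hdot (eX i) w = ?x i" "hdot (eY i) w = ?y i" "hsymp (eX i) w = - ?y i" "hsymp (eY i) w = ?x i"
  "hdot (eX i) (eX i :: 'n heis) = 1" "hdot (eY i) (eY i :: 'n heis) = 1"
  "hsymp (eX i) (eX i :: 'n heis) = 0" "hsymp (eY i) (eY i :: 'n heis) = 0"
  "snd (snd (eX i :: 'n heis)) = 0" "snd (snd (eY i :: 'n heis)) = 0" for i
  by (simp_all add: hdot_def hsymp_def eX_def eY_def inner_axis' inner_axis)
 have "hker2 (eX i) (eX i) w + hker2 (eY i) (eY i) w = 4 * hker 1 0 w + 4 * ((?x i)\<^sup>2 + (?y i)\<^sup>2) * (hker 2 0 w + hker 0 2 w)" for i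
  unfolding hker2_def hker1_def dots by (simp add: numeral_2_eq_2 algebra_simps power2_eq_square)
 then have "hlap w = (\<Sum>i\<in>UNIV. 4 * hker 1 0 w + 4 * ((?x i)\<^sup>2 + (?y i)\<^sup>2) * (hker 2 0 w + hker 0 2 w))"
  by (simp only: hlap_def)
 also have "\<dots> = 4 * real CARD('n) * hker 1 0 w + 4 * (\<Sum>i\<in>UNIV. (?x i)\<^sup>2 + (?y i)\<^sup>2) * (hker 2 0 w + hker 0 2 w)"
  unfolding sum.distrib[of "\<lambda>_. 4 * hker 1 0 w"] sum_distrib_left sum_distrib_right by simp
 also have "(\<Sum>i\<in>UNIV. (?x i)\<^sup>2 + (?y i)\<^sup>2) = hsq w"
  by (simp add: hsq_def inner_vec_def sum.distrib power2_eq_square)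
 finally show ?thesis
  using heat_ker_pde[OF _ hsq_nonneg, of "CARD('n)" w "snd (snd w)"] by (simp add: hker_def Suc_leI algebra_simps)
qed

lemma good_kernel_sum:
 assumes "finite I" "!!i. i \<in> I ==> good_kernel c (K i)" shows "good_kernel c (\<lambda>w. \<Sum>i\<in>I. K i w)"
 using assms
proof (induction rule: finite_induct)
 case empty
 show ?case unfolding sum.empty good_kernel_def by (intro conjI exI[of _ 0]) auto
qed (simp add: good_kernel_add)

lemma good_kernel_hlap: "good_kernel (1/4) hlap"
 unfolding hlap_def[abs_def] by (intro good_kernel_sum good_kernel_add good_kernel_hker2) auto

lemma good_kernel_hker': "good_kernel (1/4) (hker j m)" and good_kernel_hker1': "good_kernel (1/4) (hker1 v j m)"
 by (rule good_kernel_mono[OF good_kernel_hker], simp, rule good_kernel_mono[OF good_kernel_hker1], simp)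

lemma lborel_dil_density:
 assumes e: "0 < e"
 shows "density (distr lborel lborel (dil e)) (\<lambda>_. ennreal (e ^ (2 * CARD('n) + 2))) = (lborel :: 'n::finite heis measure)"
proof (rule measure_eqI)
 fix A :: "'n heis set" assume "A \<in> sets (density (distr lborel lborel (dil e)) (\<lambda>_. ennreal (e ^ (2 * CARD('n) + 2))))"
 then have [measurable]: "A \<in> sets borel" by simp
 have "(\<integral>\<^sup>+x. indicator A x \<partial>distr lborel lborel (dil e)) = (NNI w. indicator A (dil e w))"
  by (rule nn_integral_distr) simp_all
 then have "emeasure (density (distr lborel lborel (dil e)) (\<lambda>_. ennreal (e ^ (2 * CARD('n) + 2)))) A
  = ennreal (e ^ (2 * CARD('n) + 2)) * (NNI w. indicator A (dil e w))"
  by (subst emeasure_density) (simp_all add: nn_integral_cmult)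
 then show "emeasure (density (distr lborel lborel (dil e)) (\<lambda>_. ennreal (e ^ (2 * CARD('n) + 2)))) A = emeasure lborel A"
  using nn_integral_dil[OF _ e, of "indicator A"] by simp
qed simp

lemma
 fixes F :: "'n::finite heis => real"
 assumes [measurable]: "borel_fun F" and e: "0 < e"
 shows integral_dil: "(LBINT w. F w) = e ^ (2 * CARD('n) + 2) * (LBINT w. F (dil e w))"
  and integrable_dil: "integrable lborel F \<longleftrightarrow> integrable lborel (\<lambda>w. F (dil e w))"
proof -
 show "(LBINT w. F w) = e ^ (2 * CARD('n) + 2) * (LBINT w. F (dil e w))"
  using e by (subst lborel_dil_density[OF e, symmetric], subst integral_density) (simp_all add: integral_distr)
 have "integrable lborel F \<longleftrightarrow> integrable lborel (\<lambda>w. e ^ (2 * CARD('n) + 2) * F (dil e w))"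
  using e by (subst lborel_dil_density[OF e, symmetric], subst integrable_density) (simp_all add: integrable_distr_eq)
 then show "integrable lborel F \<longleftrightarrow> integrable lborel (\<lambda>w. F (dil e w))" using e by simp
qed

text \<open>Moves the scale from \<open>f\<close>, which need not be differentiable, to the smooth
  kernel, so that averages can be differentiated in the scale.\<close>

lemma avg_conv:
 fixes f :: "'n::finite heis => real"
 assumes [measurable]: "borel_fun K" "borel_fun f" and e: "0 < e"
 shows "avg e K f z = (LBINT w. (1 / e) ^ (2 * CARD('n) + 2) * K (dil (1 / e) w) * f (z \<star> w))"
proof -
 have "(LBINT w. (1 / e) ^ (2 * CARD('n) + 2) * K (dil (1 / e) w) * f (z \<star> w)) =
  e ^ (2 * CARD('n) + 2) * (LBINT w. (1 / e) ^ (2 * CARD('n) + 2) * K w * f (z \<star> dil e w))"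
  using e by (subst integral_dil[OF _ e]) (simp_all add: dil_dil)
 also have "\<dots> = (e * (1 / e)) ^ (2 * CARD('n) + 2) * avg e K f z"
  by (simp only: avg_def mult.assoc integral_mult_right_zero power_mult_distrib)
 finally show ?thesis using e by simp
qed

text \<open>The derivative in the scale of the normalised dilate is the dilation generator up to the
  factor -2 / e, and \<open>hlap_eq\<close> identifies it with the sub-Laplacian.\<close>

lemma hker_scaled_deriv:
 fixes w :: "'n::finite heis"
 assumes e: "0 < e"
 shows "((\<lambda>e. (1 / e) ^ (2 * CARD('n) + 2) * hker 0 0 (dil (1 / e) w)) has_real_derivative
  (1 / e) ^ (2 * CARD('n) + 2) * (hlap (dil (1 / e) w) / (2 * e))) (at e)"
proof -
 let ?n = "CARD('n)"
 have hd: "hsq (dil a w) = a\<^sup>2 * hsq w" "snd (snd (dil a w)) = a\<^sup>2 * snd (snd w)" for a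
  by (simp_all add: hsq_def dil_def power2_eq_square algebra_simps)
 let ?p = "\<lambda>e. ((1 / e)\<^sup>2 * hsq w, (1 / e)\<^sup>2 * snd (snd w))"
 have d0: "((\<lambda>e. (1 / e)\<^sup>2) has_real_derivative - 2 / e ^ 3) (at e)"
  using e by (auto intro!: derivative_eq_intros simp: power2_eq_square power3_eq_cube field_simps)
 have dp: "(?p has_derivative (\<lambda>r. (- 2 / e ^ 3 * hsq w * r, - 2 / e ^ 3 * snd (snd w) * r))) (at e)"
  by (intro has_derivative_Pair; rule has_derivative_eq_rhs[OF DERIV_cmult_right[OF d0, unfolded has_field_derivative_def]]) (simp_all add: fun_eq_iff)
 have "- 1 / 2 < (1 / e)\<^sup>2 * hsq w" by (rule less_le_trans[of _ 0]) (auto simp: hsq_nonneg)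
 then have "((\<lambda>p. heat_ker ?n 0 0 (fst p) (snd p)) has_derivative
  (\<lambda>h. fst h * heat_ker ?n (Suc 0) 0 ((1 / e)\<^sup>2 * hsq w) ((1 / e)\<^sup>2 * snd (snd w)) + snd h * heat_ker ?n 0 (Suc 0) ((1 / e)\<^sup>2 * hsq w) ((1 / e)\<^sup>2 * snd (snd w)))) (at (?p e))"
  by (intro heat_ker_has_derivative) (simp_all add: Suc_leI)
 from has_derivative_compose[OF dp this]
 have "((\<lambda>e. hker 0 0 (dil (1 / e) w)) has_derivative (\<lambda>r. r * (- 2 / e ^ 3 * (hsq w * hker 1 0 (dil (1 / e) w) + snd (snd w) * hker 0 1 (dil (1 / e) w))))) (at e)"
  by (simp add: hker_def hd algebra_simps)
 then have d1: "((\<lambda>e. hker 0 0 (dil (1 / e) w)) has_real_derivative (- 2 / e ^ 3 * (hsq w * hker 1 0 (dil (1 / e) w) + snd (snd w) * hker 0 1 (dil (1 / e) w)))) (at e)"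
  by (rule has_derivative_imp_has_field_derivative) simp
 have d2: "((\<lambda>e. (1 / e) ^ (2 * ?n + 2)) has_real_derivative - real (2 * ?n + 2) * (1 / e) ^ (2 * ?n + 2) * (1 / e)) (at e)"
 proof -
  define g where "g = (\<lambda>e::real. 1 / e)"
  have Dg: "(g has_real_derivative - (g e * g e)) (at e)"
   unfolding g_def using e by (auto intro!: derivative_eq_intros simp: field_simps)
  have "((\<lambda>e. g e ^ q) has_real_derivative - real q * g e ^ q * g e) (at e)" for q
  proof (induction q)
   case (Suc q)
   from DERIV_mult[OF Dg Suc] show ?case by (simp add: algebra_simps)
  qed simp
  then show ?thesis unfolding g_def .
 qed
 from DERIV_mult[OF d2 d1] show ?thesis
 proof (rule DERIV_cong)
  show "- real (2 * ?n + 2) * (1 / e) ^ (2 * ?n + 2) * (1 / e) * hker 0 0 (dil (1 / e) w) +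
   (- 2 / e ^ 3 * (hsq w * hker 1 0 (dil (1 / e) w) + snd (snd w) * hker 0 1 (dil (1 / e) w))) * (1 / e) ^ (2 * ?n + 2)
   = (1 / e) ^ (2 * ?n + 2) * (hlap (dil (1 / e) w) / (2 * e))"
  proof -
   define a P k0 k1 k2 where "a = 1 / e" and "P = (1 / e) ^ (2 * ?n + 2)" and "k0 = hker 0 0 (dil (1 / e) w)"
    and "k1 = hker 1 0 (dil (1 / e) w)" and "k2 = hker 0 1 (dil (1 / e) w)"
   have e3: "- 2 / e ^ 3 = - 2 * (a\<^sup>2 * a)" and e1: "X / (2 * e) = X * a / 2" for X
    by (simp_all add: a_def power2_eq_square power3_eq_cube)
   show ?thesis unfolding hlap_eq hd e3 e1 k0_def[symmetric] k1_def[symmetric] k2_def[symmetric] P_def[symmetric] a_def[symmetric]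
    by (simp add: algebra_simps)
  qed
 qed
qed

text \<open>The heat equation at time \<open>e\<^sup>2 / 4\<close>, which explains the factor \<open>2 * e\<close>.\<close>

lemma avg_heat_deriv:
 fixes f :: "'n::finite heis => real"
 assumes f[measurable]: "borel_fun f" and fb: "!!z. \<bar>f z\<bar> <= B" and e: "0 < e"
 shows "((\<lambda>e. avg e (hker 0 0) f z) has_real_derivative avg e hlap f z / (2 * e)) (at e)"
proof -
 let ?Q = "2 * CARD('n) + 2"
 have [measurable]: "borel_fun (hker 0 0 :: 'n heis => real)" "borel_fun (hlap :: 'n heis => real)"
  by (rule good_kernel_measurable[OF good_kernel_hker], rule good_kernel_measurable[OF good_kernel_hlap])
 obtain C where C: "!!w::'n heis. \<bar>hlap w\<bar> <= C * (exp (- (1/4) * hsq w) / (1 + (snd (snd w))\<^sup>2))"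
  using good_kernel_hlap unfolding good_kernel_def by blast
 have C0: "0 <= C" using order_trans[OF abs_ge_zero C[of 0]] by (simp add: hsq_def)
 define E where "E = (\<lambda>w::'n heis. exp (- (1/4) * hsq w) / (1 + (snd (snd w))\<^sup>2))"
 have Em[measurable]: "borel_fun E" unfolding E_def by measurable
 have "good_kernel (1/4) E" unfolding good_kernel_def E_def
 proof (intro conjI exI[of _ 1] allI)
  show "cont_UNIV (\<lambda>w::'n heis. exp (- (1/4) * hsq w) / (1 + (snd (snd w))\<^sup>2))"
   by (intro continuous_intros) (simp add: add_nonneg_eq_0_iff)
 qed (simp add: add_nonneg_nonneg)
 then have Ei: "integrable lborel E" by (rule good_kernel_integrable(2))
 let ?S = "{e / 2 <..< 2 * e}"
 \<comment> \<open>The majorant takes the worst case over the scales in \<open>?S\<close>: the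
   prefactor at e / 2, and the envelope \<open>E\<close> at 2 * e because \<open>E\<close> increases
   when its argument is contracted; also 1 / (2 * x) <= 1 / e.\<close>
 let ?g = "\<lambda>w. (2 / e) ^ ?Q * (C * E (dil (1 / (2 * e)) w) / e) * B"
 have B0: "0 <= B" using fb[of 0] by simp
 have "((\<lambda>x. LBINT w. (1 / x) ^ ?Q * hker 0 0 (dil (1 / x) w) * f (z \<star> w)) has_derivative
  (\<lambda>r. LBINT w. r * ((1 / e) ^ ?Q * (hlap (dil (1 / e) w) / (2 * e)) * f (z \<star> w)))) (at e)"
 proof (rule has_derivative_integral_dominated(1)[where S="?S" and g="?g" and F'="\<lambda>x w r. r * ((1 / x) ^ ?Q * (hlap (dil (1 / x) w) / (2 * x)) * f (z \<star> w))"])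
  show "((\<lambda>x. (1 / x) ^ ?Q * hker 0 0 (dil (1 / x) w) * f (z \<star> w)) has_derivative
   (\<lambda>r. r * ((1 / x) ^ ?Q * (hlap (dil (1 / x) w) / (2 * x)) * f (z \<star> w)))) (at x)" if x: "x \<in> ?S" for x w
  proof -
   have "0 < x" using x e by auto
   note D = DERIV_cmult_right[OF hker_scaled_deriv[OF this, of w], of "f (z \<star> w)"]
   show ?thesis
    by (rule has_derivative_eq_rhs[OF D[unfolded has_field_derivative_def]]) (rule ext, rule mult.commute)
  qed
  show "integrable lborel (\<lambda>w. (1 / x) ^ ?Q * hker 0 0 (dil (1 / x) w) * f (z \<star> w))" if x: "x \<in> ?S" for x
  proof -
   have x0: "0 < x" using x e by auto
   have "integrable lborel (\<lambda>w. (1 / x) ^ ?Q * (hker 0 0 (dil (1 / x) w) * f (z \<star> w)))"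
    using avg_integrable[OF good_kernel_integrable(2)[OF good_kernel_hker'] f fb, of 0 0 z x] x0
    by (intro integrable_mult_right, subst integrable_dil[OF _ x0]) (simp_all add: dil_dil)
   then show ?thesis by (simp add: mult.assoc)
  qed
  show "integrable lborel ?g" using integrable_dil[OF Em, of "1 / (2 * e)"] Ei e by simp
  show "\<bar>r * ((1 / x) ^ ?Q * (hlap (dil (1 / x) w) / (2 * x)) * f (z \<star> w))\<bar> <= ?g w * norm r" if x: "x \<in> ?S" for x r w
  proof -
   have x0: "0 < x" "1 / x <= 2 / e" "1 / (2 * e) <= 1 / x" "1 / (2 * x) <= 1 / e" using x e by (auto simp: field_simps)
   have sq: "(1 / (2 * e))\<^sup>2 <= (1 / x)\<^sup>2" using x0 e by (intro power_mono) auto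
   have "E (dil (1 / x) w) <= E (dil (1 / (2 * e)) w)"
    unfolding E_def
   proof (rule frac_le)
    have "(1 / (2 * e))\<^sup>2 * hsq w <= (1 / x)\<^sup>2 * hsq w" using sq hsq_nonneg[of w] by (rule mult_right_mono)
    then show "exp (- (1/4) * hsq (dil (1 / x) w)) <= exp (- (1/4) * hsq (dil (1 / (2 * e)) w))"
     by (simp add: hsq_def dil_def power2_eq_square algebra_simps)
    have "((1 / (2 * e))\<^sup>2)\<^sup>2 * (snd (snd w))\<^sup>2 <= ((1 / x)\<^sup>2)\<^sup>2 * (snd (snd w))\<^sup>2"
     by (rule mult_right_mono[OF power_mono[OF sq]]) simp_all
    then show "1 + (snd (snd (dil (1 / (2 * e)) w)))\<^sup>2 <= 1 + (snd (snd (dil (1 / x) w)))\<^sup>2"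
     by (simp add: dil_def power_mult_distrib)
   qed (auto simp: add_pos_nonneg)
   from mult_left_mono[OF this C0] have "\<bar>hlap (dil (1 / x) w)\<bar> <= C * E (dil (1 / (2 * e)) w)"
    by (rule order_trans[rotated]) (unfold E_def, rule C)
   then have M: "\<bar>hlap (dil (1 / x) w)\<bar> * (1 / (2 * x)) <= C * E (dil (1 / (2 * e)) w) * (1 / e)"
    using x0 by (intro mult_mono) auto
   have P: "(1 / x) ^ ?Q <= (2 / e) ^ ?Q" by (rule power_mono) (use x0 in simp_all)
   have N: "0 <= (1 / x) ^ ?Q" "0 <= (2 / e) ^ ?Q" using x0(1) e by simp_all
   have "(1 / x) ^ ?Q * (\<bar>hlap (dil (1 / x) w)\<bar> * (1 / (2 * x))) * \<bar>f (z \<star> w)\<bar> <= (2 / e) ^ ?Q * (C * E (dil (1 / (2 * e)) w) * (1 / e)) * B"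
   proof -
    have N3: "0 <= \<bar>hlap (dil (1 / x) w)\<bar> * (1 / (2 * x))" using x0(1) by simp
    have "0 <= (2 / e) ^ ?Q * (C * E (dil (1 / (2 * e)) w) * (1 / e))"
     by (intro mult_nonneg_nonneg[OF N(2)] order_trans[OF N3 M])
    from mult_mono[OF mult_mono[OF P M N(2) N3] fb this abs_ge_zero] show ?thesis .
   qed
   then have "\<bar>r\<bar> * ((1 / x) ^ ?Q * (\<bar>hlap (dil (1 / x) w)\<bar> * (1 / (2 * x))) * \<bar>f (z \<star> w)\<bar>) <= \<bar>r\<bar> * ((2 / e) ^ ?Q * (C * E (dil (1 / (2 * e)) w) * (1 / e)) * B)"
    by (intro mult_left_mono) auto
   then show ?thesis using x0(1) by (simp add: abs_mult mult_ac)
  qed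
 qed (use e in \<open>simp_all\<close>)
 then have "((\<lambda>x. LBINT w. (1 / x) ^ ?Q * hker 0 0 (dil (1 / x) w) * f (z \<star> w)) has_derivative
  (\<lambda>r. r * (avg e hlap f z / (2 * e)))) (at e)"
  using e by (simp add: avg_conv[of hlap f e z] field_simps)
 then have "((\<lambda>x. LBINT w. (1 / x) ^ ?Q * hker 0 0 (dil (1 / x) w) * f (z \<star> w)) has_real_derivative avg e hlap f z / (2 * e)) (at e)"
  by (rule has_derivative_imp_has_field_derivative) simp
 then show ?thesis
  by (rule has_field_derivative_transform_within_open[where S="{0<..}"]) (use e in \<open>auto simp: avg_conv\<close>)
qed

section \<open>Maximum principle and positivity of the heat kernel\<close>

lemma AE_zero_continuous:
 fixes f :: "'a::euclidean_space => real"
 assumes c: "cont_UNIV f" and ae: "AE x in lborel. f x = 0" shows "f x = 0"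
proof (rule ccontr)
 assume "f x ~= 0"
 have o: "open {x. f x ~= 0}" using c by (intro open_Collect_neq continuous_on_const)
 from ae have "{x. f x ~= 0} \<in> null_sets lborel"
  using o by (subst AE_iff_null_sets) auto
 then have "negligible {x. f x ~= 0}" by (simp add: negligible_iff_null_sets null_sets_completionI)
 then show False using open_not_negligible[OF o] \<open>f x ~= 0\<close> by blast
qed

lemma nonneg_integral_zero_continuous:
 fixes f :: "'a::euclidean_space => real"
 assumes c: "cont_UNIV f" and nn: "!!x. 0 <= f x" and i: "integrable lborel f" and z: "(LBINT x. f x) <= 0"
 shows "f x = 0"
proof (rule AE_zero_continuous[OF c])
 have "(LBINT x. f x) = 0" using z nn by (intro antisym integral_nonneg_AE) auto
 then show "AE x in lborel. f x = 0" using i nn by (subst (asm) integral_nonneg_eq_0_iff_AE) auto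
qed

lemma integrable_tail:
 fixes K :: "'a::euclidean_space => real"
 assumes K: "integrable lborel K" and \<eta>: "0 < \<eta>"
 obtains W where "0 < W" "(LBINT w. indicator {w. W < norm w} w * \<bar>K w\<bar>) < \<eta>"
proof -
 have [measurable]: "borel_fun K" using K by simp
 have "(\<lambda>n. LBINT w. indicator {w. real n < norm w} w * \<bar>K w\<bar>) \<longlonglongrightarrow> (\<integral>w. 0 \<partial>(lborel :: 'a measure))"
 proof (rule integral_dominated_convergence[where w="\<lambda>w. \<bar>K w\<bar>"])
  show "AE w in lborel. (\<lambda>n. indicator {w. real n < norm w} w * \<bar>K w\<bar>) \<longlonglongrightarrow> 0"
  proof (rule AE_I2)
   fix w :: 'a
   obtain N where N: "norm w <= real N" using real_arch_simple by blast
   have "\<forall>\<^sub>F n in sequentially. indicator {w. real n < norm w} w * \<bar>K w\<bar> = 0"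
    using eventually_ge_at_top[of N] by eventually_elim (use N in \<open>auto simp: indicator_def\<close>)
   then show "(\<lambda>n. indicator {w. real n < norm w} w * \<bar>K w\<bar>) \<longlonglongrightarrow> 0" by (rule tendsto_eventually)
  qed
 qed (use K in \<open>auto split: split_indicator\<close>)
 then have "\<forall>\<^sub>F n in sequentially. (LBINT w. indicator {w. real n < norm w} w * \<bar>K w\<bar>) < \<eta>"
  using \<eta> by (intro order_tendstoD) auto
 then obtain n where "\<forall>m\<ge>n. (LBINT w. indicator {w. real m < norm w} w * \<bar>K w\<bar>) < \<eta>"
  by (auto simp: eventually_sequentially)
 then show ?thesis using that[of "real (Suc n)"] by (metis le_SucI of_nat_0_less_iff order_refl zero_less_Suc)
qed

text \<open>Since \<open>z = (z \<star> w) \<star> (- w)\<close>, translates by a bounded set leave every compact set as \<open>z\<close> tends to infinity.\<close>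

lemma escape_compact:
 fixes K0 :: "'n::finite heis set"
 assumes K0: "compact K0"
 obtains R where "!!z e w. e \<in> {0..S} ==> norm w <= W ==> R < norm z ==> z \<star> dil e w \<notin> K0"
proof -
 let ?h = "\<lambda>(k, e, w). k \<star> (- dil e w)"
 have "compact (?h ` (K0 \<times> {0..S} \<times> cball 0 W))"
  unfolding split_beta' by (intro compact_continuous_image continuous_intros compact_Times K0) auto
 then obtain R where R: "!!y. y \<in> ?h ` (K0 \<times> {0..S} \<times> cball 0 W) ==> norm y <= R"
  using compact_imp_bounded bounded_iff by metis
 show ?thesis
 proof (rule that[of R], rule notI)
  fix z :: "'n heis" and e :: real and w
  assume a: "e \<in> {0..S}" "norm w <= W" "R < norm z" "z \<star> dil e w \<in> K0"
  have "?h (z \<star> dil e w, e, w) \<in> ?h ` (K0 \<times> {0..S} \<times> cball 0 W)"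
   using a by (intro imageI) simp
  from R[OF this] show False using a by simp
 qed
qed

text \<open>Displacements from a large ball miss \<open>K0\<close> once z is far out, and the
  remaining displacements carry little kernel mass. Uniformity in e holds because the scales range
  over a compact interval.\<close>

lemma avg_vanish:
 fixes f :: "'n::finite heis => real"
 assumes K: "integrable lborel K" and f: "borel_fun f" "!!z. \<bar>f z\<bar> <= B"
  and K0: "compact K0" "!!z. z \<notin> K0 ==> f z = 0" and \<eta>: "0 < \<eta>"
 obtains R where "!!z e. e \<in> {0..S} ==> R < norm z ==> \<bar>avg e K f z\<bar> <= \<eta>"
proof -
 have B: "0 <= B" using f(2)[of 0] by simp
 obtain W where W: "(LBINT w. indicator {w. W < norm w} w * \<bar>K w\<bar>) < \<eta> / (B + 1)"
  using integrable_tail[OF K, of "\<eta> / (B + 1)"] \<eta> B by auto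
 obtain R where R: "!!z e w. e \<in> {0..S} ==> norm w <= W ==> R < norm z ==> z \<star> dil e w \<notin> K0"
  using escape_compact[OF K0(1)] by metis
 have [measurable]: "borel_fun K" using K by simp
 have ti: "integrable lborel (\<lambda>w. indicator {w. W < norm w} w * \<bar>K w\<bar>)"
  by (rule bintegrable_bound[OF integrable_abs[OF K]]) (auto split: split_indicator)
 show ?thesis
 proof (rule that[of R])
  fix z :: "'n heis" and e assume a: "e \<in> {0..S}" "R < norm z"
  have "\<bar>avg e K f z\<bar> <= (LBINT w. \<bar>K w * f (z \<star> dil e w)\<bar>)"
   unfolding avg_def using integral_norm_bound[of lborel "\<lambda>w. K w * f (z \<star> dil e w)"] by simp
  also have "\<dots> <= (LBINT w. B * (indicator {w. W < norm w} w * \<bar>K w\<bar>))"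
  proof (rule integral_mono[OF integrable_abs[OF avg_integrable[OF K f]] integrable_mult_right[OF ti]])
   fix w
   show "\<bar>K w * f (z \<star> dil e w)\<bar> <= B * (indicator {w. W < norm w} w * \<bar>K w\<bar>)"
   proof (cases "norm w <= W")
    case True
    then show ?thesis using K0(2)[OF R[OF a(1) True a(2)]] by simp
   next
    case False
    then show ?thesis using f(2)[of "z \<star> dil e w"] by (simp add: abs_mult mult.commute[of B] mult_left_mono)
   qed
  qed
  also have "\<dots> <= B * (\<eta> / (B + 1))" by (rule mult_left_mono[OF less_imp_le[OF W] B, THEN order_trans[rotated]]) simp
  also have "\<dots> <= \<eta>" using B \<eta> by (simp add: field_simps)
  finally show "\<bar>avg e K f z\<bar> <= \<eta>" .
 qed
qed

text \<open>If \<open>D2\<close> were negative, \<open>D\<close> would be negative just to the right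
  of 0 and the mean value theorem would make g drop below its minimum.\<close>

lemma second_deriv_nonneg_at_min:
 fixes g D :: "real => real"
 assumes g: "!!r. (g has_real_derivative D r) (at r)" and D: "(D has_real_derivative D2) (at 0)" and m: "!!r. g 0 <= g r"
 shows "0 <= D2"
proof (rule ccontr)
 assume "\<not> 0 <= D2"
 have "D 0 = 0" by (rule DERIV_local_min[OF g[of 0] zero_less_one]) (use m in auto)
 then obtain d where d: "0 < d" "!!h. 0 < h ==> h < d ==> D h < 0"
  using DERIV_neg_dec_right[OF D] \<open>\<not> 0 <= D2\<close> by auto
 obtain x where x: "0 < x" "x < d / 2" "g (d / 2) - g 0 = (d / 2 - 0) * D x"
  using MVT2[of 0 "d / 2" g D] g d(1) by auto
 have "D x < 0" by (rule d(2)) (use x d(1) in linarith)+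
 then have "(d / 2 - 0) * D x < 0" using d(1) by (simp add: mult_pos_neg)
 then show False using x(3) m[of "d / 2"] by linarith
qed

text \<open>The parabolic maximum principle. The total mass of \<open>hker 0 0\<close> is not known yet, only its sign
 relative to \<open>f\<close> enters; the mass turns out to be positive because \<open>hker 0 0 0 > 0\<close>.\<close>

lemma heat_avg_nonneg:
 fixes f :: "'n::finite heis => real"
 assumes f: "cont_UNIV f" and K0: "compact K0" "!!z. z \<notin> K0 ==> f z = 0"
  and pos: "!!z. 0 <= (\<integral>w. hker 0 0 w \<partial>(lborel :: 'n heis measure)) * f z" and e1: "0 <= e1"
 shows "0 <= avg e1 (hker 0 0) f z1"
proof (rule ccontr)
 let ?h = "hker 0 0 :: 'n heis => real"
 assume neg: "\<not> 0 <= avg e1 ?h f z1"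
 have fm[measurable]: "borel_fun f" using f by (rule borel_continuous)
 obtain B where B: "!!z. \<bar>f z\<bar> <= B"
 proof -
  have "bounded (f ` K0)" using K0(1) f by (intro compact_imp_bounded compact_continuous_image continuous_on_subset[OF f]) auto
  then obtain B where "!!z. z \<in> K0 ==> \<bar>f z\<bar> <= B" unfolding bounded_iff by auto
  then have "\<bar>f z\<bar> <= max B 0" for z using K0(2)[of z] by (cases "z \<in> K0") (simp_all add: le_max_iff_disj)
  then show ?thesis by (rule that)
 qed
 note hi = good_kernel_integrable(2)[OF good_kernel_hker', of 0 0]
 define m where "m = avg e1 ?h f z1"
 have m: "m < 0" using neg by (simp add: m_def)
 have at0: "avg 0 ?h f z = (LBINT w. ?h w) * f z" for z by (simp add: avg_def)
 have e1': "0 < e1" using e1 m pos[of z1] at0[of z1] unfolding m_def by (cases "e1 = 0") auto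
 \<comment> \<open>The slope is chosen with \<delta> * e1 = - m / 2: the added linear term makes the
   time derivative strict but leaves the value m / 2 < 0 at \<open>(e1, z1)\<close>.\<close>
 define \<delta> where "\<delta> = - m / (2 * e1)"
 have \<delta>: "0 < \<delta>" using m e1' by (simp add: \<delta>_def divide_neg_pos)
 define \<Phi> where "\<Phi> = (\<lambda>p. avg (fst p) ?h f (snd p) + \<delta> * fst p)"
 \<comment> \<open>Far out the perturbed function is at least m / 4, which exceeds m / 2; hence the
   minimum over the compact set is a global one.\<close>
 obtain R where R: "!!z e. e \<in> {0..e1} ==> R < norm z ==> \<bar>avg e ?h f z\<bar> <= - m / 4"
  using avg_vanish[OF hi fm B K0, of "- m / 4"] m by (metis divide_pos_pos neg_0_less_iff_less zero_less_numeral)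
 let ?C = "{0..e1} \<times> cball 0 (max R (norm z1))"
 have cont: "continuous_on ?C \<Phi>"
  unfolding \<Phi>_def by (intro continuous_intros continuous_on_subset[OF continuous_on_avg[OF hi f B]]) auto
 have "(e1, z1) \<in> ?C" using e1 by simp
 then obtain p where p: "p \<in> ?C" "!!y. y \<in> ?C ==> \<Phi> p <= \<Phi> y"
  using continuous_attains_inf[OF _ _ cont] by (metis compact_Times compact_Icc compact_cball empty_iff)
 obtain e0 z0 where p0: "p = (e0, z0)" by (cases p)
 have le: "\<Phi> p <= m / 2" using p(2)[OF \<open>(e1, z1) \<in> ?C\<close>] e1' by (simp add: \<Phi>_def m_def[symmetric] \<delta>_def)
 have glob: "\<Phi> p <= \<Phi> (e, z)" if e: "e \<in> {0..e1}" for e z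
 proof (cases "norm z <= max R (norm z1)")
  case True then show ?thesis using p(2) e by simp
 next
  case False
  then have "- m / 4 \<ge> \<bar>avg e ?h f z\<bar>" using R[OF e] by simp
  moreover have "0 <= \<delta> * e" using \<delta> e by simp
  ultimately show ?thesis using le m by (simp add: \<Phi>_def)
 qed
 have e0: "0 < e0" "e0 <= e1"
 proof -
  show "e0 <= e1" using p(1) p0 by simp
  have "0 <= e0" using p(1) p0 by simp
  moreover have "e0 ~= 0"
  proof
   assume "e0 = 0"
   then have "\<Phi> p = (LBINT w. ?h w) * f z0" by (simp add: \<Phi>_def p0 at0)
   then show False using le m pos[of z0] by simp
  qed
  ultimately show "0 < e0" by simp
 qed
 have time: "((\<lambda>e. \<Phi> (e, z0)) has_real_derivative avg e0 hlap f z0 / (2 * e0) + \<delta>) (at e0)"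
  unfolding \<Phi>_def by (auto intro!: derivative_eq_intros avg_heat_deriv[OF fm B e0(1)])
 \<comment> \<open>The minimum may lie at the final time, so it is compared only with earlier times;
   a positive derivative would give a smaller value just before \<open>e0\<close>.\<close>
 have "avg e0 hlap f z0 / (2 * e0) + \<delta> <= 0"
 proof (rule ccontr)
  assume "\<not> ?thesis"
  then obtain d where d: "0 < d" "!!h. 0 < h ==> h < d ==> \<Phi> (e0 - h, z0) < \<Phi> (e0, z0)"
   using DERIV_pos_inc_left[OF time] by auto
  define h where "h = min (d / 2) e0"
  have "0 < h" "h < d" "e0 - h \<in> {0..e1}" using d(1) e0 by (auto simp: h_def)
  then show False using d(2)[of h] glob[of "e0 - h" z0] by (simp add: p0)
 qed
 then have lneg: "avg e0 hlap f z0 < 0" using \<delta> e0(1) by (simp add: divide_less_0_iff add_nonpos_neg not_le[symmetric]) (smt (verit) divide_nonneg_pos)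
 \<comment> \<open>Each of the two differentiations brings a factor - 1 / e0; their product is
   positive, so the second derivative test transfers to \<open>hker2\<close>.\<close>
 have dir: "0 <= avg e0 (hker2 v v) f z0" if v: "!!e. dil e v = e ^ 1 *\<^sub>R v" for v
 proof -
  note k = good_kernel_hker' good_kernel_hker1'
  have K1i: "integrable lborel (hker1 v 0 0)" by (rule good_kernel_integrable(2)[OF good_kernel_hker1'])
  have K2i: "integrable lborel (hker2 v v)" by (rule good_kernel_integrable(2)[OF good_kernel_hker2])
  have c1: "cont_UNIV (\<lambda>z. - ((1 / e0) ^ 1) * avg e0 (hker1 v 0 0) f z)"
   and c2: "cont_UNIV (\<lambda>z. - ((1 / e0) ^ 1) * avg e0 (hker2 v v) f z)"
   by (intro continuous_intros continuous_on_avg'[OF K1i f B], intro continuous_intros continuous_on_avg'[OF K2i f B])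
  have b1: "\<bar>- ((1 / e0) ^ 1) * avg e0 (hker1 v 0 0) f z\<bar> <= (1 / e0) * (B * (LBINT w. \<bar>hker1 v 0 0 w\<bar>))" for z
   using avg_bound[OF K1i fm B, of e0 z] e0(1) by (simp add: abs_mult divide_right_mono)
  have b2: "\<bar>- ((1 / e0) ^ 1) * avg e0 (hker2 v v) f z\<bar> <= (1 / e0) * (B * (LBINT w. \<bar>hker2 v v w\<bar>))" for z
   using avg_bound[OF K2i fm B, of e0 z] e0(1) by (simp add: abs_mult divide_right_mono)
  have d1: "((\<lambda>r. avg e0 ?h f (z0 \<star> (r *\<^sub>R v))) has_real_derivative - ((1 / e0) ^ 1) * avg e0 (hker1 v 0 0) f (z0 \<star> (r *\<^sub>R v))) (at r)" for r
   by (rule flow_deriv_DERIV[OF avg_flow_deriv[OF good_kernel_hker' good_kernel_hker1' rderiv_hker fm B v e0(1)] c1 b1])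
  have d2: "((\<lambda>r. avg e0 (hker1 v 0 0) f (z0 \<star> (r *\<^sub>R v))) has_real_derivative - ((1 / e0) ^ 1) * avg e0 (hker2 v v) f (z0 \<star> (0 *\<^sub>R v))) (at 0)"
   by (rule flow_deriv_DERIV[OF avg_flow_deriv[OF good_kernel_hker1' good_kernel_hker2 rderiv_hker1 fm B v e0(1)] c2 b2])
  have "0 <= - ((1 / e0) ^ 1) * (- ((1 / e0) ^ 1) * avg e0 (hker2 v v) f (z0 \<star> (0 *\<^sub>R v)))"
  proof (rule second_deriv_nonneg_at_min[OF d1])
   show "((\<lambda>r. - ((1 / e0) ^ 1) * avg e0 (hker1 v 0 0) f (z0 \<star> r *\<^sub>R v)) has_real_derivative - ((1 / e0) ^ 1) * (- ((1 / e0) ^ 1) * avg e0 (hker2 v v) f (z0 \<star> 0 *\<^sub>R v))) (at 0)"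
    by (rule DERIV_cmult[OF d2])
   show "avg e0 ?h f (z0 \<star> 0 *\<^sub>R v) <= avg e0 ?h f (z0 \<star> r *\<^sub>R v)" for r
    using glob[of e0 "z0 \<star> r *\<^sub>R v"] e0 by (simp add: \<Phi>_def p0)
  qed
  then have "0 <= (1 / e0 * (1 / e0)) * avg e0 (hker2 v v) f z0" by simp
  moreover have "0 < 1 / e0 * (1 / e0)" using e0(1) by simp
  ultimately show ?thesis by (simp only: zero_le_mult_iff) linarith
 qed
 have "avg e0 hlap f z0 = (\<Sum>i\<in>UNIV. avg e0 (hker2 (eX i) (eX i)) f z0 + avg e0 (hker2 (eY i) (eY i)) f z0)"
  unfolding avg_def hlap_def sum_distrib_right distrib_right
  by (subst bintegral_sum)
   (auto intro!: bintegrable_add avg_integrable[OF good_kernel_integrable(2)[OF good_kernel_hker2] fm B]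
    simp: bintegral_add[OF avg_integrable[OF good_kernel_integrable(2)[OF good_kernel_hker2] fm B]
     avg_integrable[OF good_kernel_integrable(2)[OF good_kernel_hker2] fm B]])
 also have "0 <= \<dots>" by (intro sum_nonneg add_nonneg_nonneg dir dil_eX dil_eY)
 finally show False using lneg by simp
qed

text \<open>If s times the kernel were negative somewhere while s times its mass is nonnegative, a
  bump of sign s concentrated there would contradict \<open>heat_avg_nonneg\<close>. With s = -1 a
  nonpositive mass would contradict positivity at the origin, so the mass is positive and s = 1
  applies.\<close>

lemma hker_nonneg_and_mass:
 shows "0 <= hker 0 0 (w0 :: 'n::finite heis)" and "0 < (\<integral>w. hker 0 0 w \<partial>(lborel :: 'n heis measure))"
proof -
 let ?h = "hker 0 0 :: 'n heis => real"
 let ?c = "(LBINT w. ?h w)"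
 have ch: "cont_UNIV ?h" using good_kernel_hker[of 0 0] unfolding good_kernel_def by blast
 have sgn: "0 <= s * ?h w0" if s: "0 <= s * ?c" "s = 1 \<or> s = - 1" for s w0
 proof (rule ccontr)
  assume neg: "\<not> 0 <= s * ?h w0"
  have csh: "cont_UNIV (\<lambda>w. s * ?h w)" by (intro continuous_intros ch)
  have "open {w. s * ?h w < 0}" by (intro open_Collect_less csh continuous_on_const)
  then obtain d where d: "0 < d" "ball w0 d \<subseteq> {w. s * ?h w < 0}"
   using neg by (metis (mono_tags, lifting) open_contains_ball mem_Collect_eq not_le)
  \<comment> \<open>A tent supported where s times the kernel is negative; the average at the
    identity with e = 1 is then an integral of one sign.\<close>
  define f where "f = (\<lambda>w. max 0 (d - dist w w0))"
  have cf: "cont_UNIV f" unfolding f_def by (intro continuous_intros)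
  have z: "w \<notin> cball w0 d ==> f w = 0" for w by (simp add: f_def dist_commute)
  have fb: "\<bar>f w\<bar> <= d" for w using d(1) zero_le_dist[of w w0] unfolding f_def by linarith
  have fm: "borel_fun f" using cf by (rule borel_continuous)
  have i: "integrable lborel (\<lambda>w. ?h w * f w)"
   using avg_integrable[OF good_kernel_integrable(2)[OF good_kernel_hker'] fm fb, of 0 0 0 1] by simp
  have "0 <= avg 1 ?h (\<lambda>w. s * f w) 0"
  proof (rule heat_avg_nonneg[OF _ compact_cball[of w0 d]])
   show "cont_UNIV (\<lambda>w. s * f w)" by (intro continuous_intros cf)
   show "0 <= ?c * (s * f z)" for z
   proof -
    have "0 <= (s * ?c) * f z" using s(1) by (simp add: f_def)
    then show ?thesis by (simp add: mult_ac)
   qed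
  qed (use z in simp_all)
  also have "avg 1 ?h (\<lambda>w. s * f w) 0 = (LBINT w. s * (?h w * f w))"
   by (simp add: avg_def mult_ac)
  finally have "(LBINT w. - (s * ?h w) * f w) <= 0" by (simp add: mult_ac)
  then have "- (s * ?h w0) * f w0 = 0"
  proof (rule nonneg_integral_zero_continuous[rotated 3])
   show "cont_UNIV (\<lambda>w. - (s * ?h w) * f w)" by (intro continuous_intros cf ch)
   show "0 <= - (s * ?h w) * f w" for w
   proof (cases "dist w w0 < d")
    case True
    then have "s * ?h w < 0" using d(2) by (auto simp: dist_commute)
    then show ?thesis by (simp add: f_def mult_nonpos_nonneg)
   qed (simp add: f_def)
   show "integrable lborel (\<lambda>w. - (s * ?h w) * f w)"
    using integrable_mult_right[OF i, of "- s"] by (simp add: mult_ac)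
  qed
  then show False using neg d(1) by (auto simp: f_def)
 qed
 have h0: "0 < ?h 0" using heat_ker_origin_pos[of "CARD('n)"] by (simp add: hker_def hsq_def Suc_leI)
 show c: "0 < ?c"
 proof (rule ccontr)
  assume "\<not> 0 < ?c"
  then show False using sgn[of "- 1" 0] h0 by simp
 qed
 show "0 <= hker 0 0 w0" using sgn[of 1 w0] c by simp
qed

section \<open>The normalised heat kernel and the resolvent\<close>

text \<open>Dividing by the mass gives a probability density without evaluating the mass, of which
  only positivity is known.\<close>

definition hk :: "'n::finite heis => real" where
 "hk w = hker 0 0 w / (\<integral>w. hker 0 0 w \<partial>(lborel :: 'n heis measure))"

text \<open>The density exp (-s) ds transported by s = e^2 / 4; the Jacobian is e / 2.\<close>

definition green_weight :: "real => real" where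
 "green_weight e = (if 0 < e then e / 2 * exp (- e\<^sup>2 / 4) else 0)"

text \<open>The kernel \<open>hker 0 0\<close> is the heat kernel at time \<open>1/4\<close>, so \<open>avg e hk\<close> is the heat semigroup at time
 \<open>s = e\<^sup>2/4\<close>, and \<open>green\<close> is the resolvent \<open>(1 - \<Delta>)\<^sup>-\<^sup>1\<close> as the Laplace transform of the semigroup in \<open>s\<close>.\<close>

definition green :: "('n::finite heis => real) => 'n heis => real" where
 "green f = wavg green_weight hk f"

lemma hk_eq_cmult: "hk = (\<lambda>w::'n::finite heis. (1 / (\<integral>w. hker 0 0 w \<partial>(lborel :: 'n heis measure))) * hker 0 0 w)"
 by (simp add: fun_eq_iff hk_def)

lemma good_kernel_hk: "good_kernel (1/4) hk"
 unfolding hk_eq_cmult by (rule good_kernel_cmult[OF good_kernel_hker'])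

lemma hk_nonneg: "0 <= hk (w :: 'n::finite heis)" and hk_origin_pos: "0 < hk (0 :: 'n::finite heis)"
 and integral_hk: "(\<integral>w. hk w \<partial>(lborel :: 'n heis measure)) = 1"
proof -
 show "0 <= hk w" using hker_nonneg_and_mass(1)[of w] hker_nonneg_and_mass(2)[where 'n='n] by (simp add: hk_def)
 have "0 < hker 0 0 (0 :: 'n heis)" using heat_ker_origin_pos[of "CARD('n)"] by (simp add: hker_def hsq_def Suc_leI)
 then show "0 < hk (0 :: 'n heis)" using hker_nonneg_and_mass(2)[where 'n='n] by (simp add: hk_def)
 show "(\<integral>w. hk w \<partial>(lborel :: 'n heis measure)) = 1" using hker_nonneg_and_mass(2)[where 'n='n] by (simp add: hk_def)
qed

lemma hk_integrable: "integrable lborel hk" and hk_measurable [measurable]: "borel_fun hk"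
 by (rule good_kernel_integrable(2)[OF good_kernel_hk], rule good_kernel_measurable[OF good_kernel_hk])

lemma hk_minus: "hk (- w) = hk w"
proof -
 have "heat_ker k 0 0 \<rho> (- t) = heat_ker k 0 0 \<rho> t" for k \<rho> t by (simp add: heat_ker_def)
 then show ?thesis by (simp add: hk_def hker_def hsq_def)
qed

lemma good_kernel_bounded:
 assumes "good_kernel (1/4) K" obtains S where "0 < S" "!!w. \<bar>K w\<bar> <= S"
proof -
 obtain C where C: "!!w. \<bar>K w\<bar> <= C * (exp (- (1/4) * hsq w) / (1 + (snd (snd w))\<^sup>2))"
  using assms unfolding good_kernel_def by blast
 have C0: "0 <= C" using order_trans[OF abs_ge_zero C[of 0]] by (simp add: hsq_def)
 have "\<bar>K w\<bar> <= C + 1" for w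
 proof -
  have "exp (- (1/4) * hsq w) / (1 + (snd (snd w))\<^sup>2) <= 1 / 1"
   using hsq_nonneg[of w] by (intro frac_le) auto
  then have "C * (exp (- (1/4) * hsq w) / (1 + (snd (snd w))\<^sup>2)) <= C * 1" by (intro mult_left_mono C0) simp
  then show ?thesis using C[of w] by simp
 qed
 then show ?thesis using that[of "C + 1"] C0 by simp
qed

text \<open>Since e^2 / 4 >= e - 1, the Gamma integrand times exp 1 is a majorant.\<close>

lemma integrable_power_gauss:
 assumes "- 1 < s" shows "integrable lborel (\<lambda>e. indicator {0<..} e * (e powr s * exp (- e\<^sup>2 / 4)) :: real)"
proof (rule bintegrable_bound)
 have "((\<lambda>t. t powr (s + 1 - 1) / exp t) has_integral Gamma (s + 1)) {0..}" by (rule Gamma_integral_real) (use assms in simp)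
 then have "((\<lambda>t. if t \<in> {0..} then t powr s / exp t else 0) has_integral Gamma (s + 1)) UNIV"
  by (simp only: has_integral_restrict_UNIV) simp
 also have "(\<lambda>t. if t \<in> {0..} then t powr s / exp t else 0) = (\<lambda>t. indicator {0..} t * (t powr s / exp t))"
  by (auto simp: fun_eq_iff indicator_def)
 finally have "(NNI t. ennreal (indicator {0..} t * (t powr s / exp t))) = ennreal (Gamma (s + 1))"
  by (rule nn_integral_has_integral_lborel[rotated 2]) auto
 then have "integrable lborel (\<lambda>t::real. indicator {0..} t * (t powr s / exp t))"
  by (intro integrableI_nonneg) auto
 then show "integrable lborel (\<lambda>t::real. exp 1 * (indicator {0..} t * (t powr s / exp t)))" by (rule integrable_mult_right)
 show "AE e in lborel. norm (indicator {0<..} e * (e powr s * exp (- e\<^sup>2 / 4)) :: real) <= norm (exp 1 * (indicator {0..} e * (e powr s / exp e)))"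
 proof (rule AE_I2)
  fix e :: real
  have "0 <= (e / 2 - 1)\<^sup>2" by simp
  then have "- e\<^sup>2 / 4 <= 1 - e" by (simp add: power2_eq_square algebra_simps)
  then have "exp (- e\<^sup>2 / 4) <= exp 1 / exp e" unfolding exp_diff[symmetric] by simp
  then have "e powr s * exp (- e\<^sup>2 / 4) <= e powr s * (exp 1 / exp e)" by (intro mult_left_mono) auto
  then show "norm (indicator {0<..} e * (e powr s * exp (- e\<^sup>2 / 4)) :: real) <= norm (exp 1 * (indicator {0..} e * (e powr s / exp e)))"
   by (simp add: indicator_def mult_ac)
 qed
qed simp

lemma green_weight_nonneg: "0 <= green_weight e"
 by (simp add: green_weight_def)

lemma green_weight_measurable [measurable]: "borel_fun green_weight"
 unfolding green_weight_def[abs_def] by measurable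

text \<open>Near 0 the weight behaves like e / 2, so singularities weaker than e^(-2) are
  admissible. This margin decides both where subcriticality is needed and how many derivatives the
  resolvent gains.\<close>

lemma green_weight_powr_integrable:
 assumes "- 2 < s" shows "integrable lborel (\<lambda>e. green_weight e * e powr s)"
proof -
 have "integrable lborel (\<lambda>e. 1 / 2 * (indicator {0<..} e * (e powr (s + 1) * exp (- e\<^sup>2 / 4))) :: real)"
  by (intro integrable_mult_right integrable_power_gauss) (use assms in simp)
 also have "(\<lambda>e. 1 / 2 * (indicator {0<..} e * (e powr (s + 1) * exp (- e\<^sup>2 / 4))) :: real) = (\<lambda>e. green_weight e * e powr s)"
  by (auto simp: fun_eq_iff green_weight_def powr_add indicator_def)
 finally show ?thesis .
qed

lemma green_weight_integrable: "integrable lborel green_weight"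
 using green_weight_powr_integrable[of 0] by (rule bintegrable_bound) (auto simp: green_weight_def)

lemma integral_green_weight: "(LBINT e. green_weight e) = 1"
proof -
 have "(NNI e. ennreal (e / 2 * exp (- e\<^sup>2 / 4)) * indicator {0..} e) = ennreal (0 - (- exp (- 0\<^sup>2 / 4)))"
 proof (rule nn_integral_FTC_atLeast)
  show "((\<lambda>e::real. - exp (- e\<^sup>2 / 4)) \<longlongrightarrow> 0) at_top" by real_asymp
 qed (auto intro!: derivative_eq_intros)
 also have "(NNI e. ennreal (e / 2 * exp (- e\<^sup>2 / 4)) * indicator {0..} e) = (NNI e. ennreal (green_weight e))"
  by (intro nn_integral_cong) (auto simp: green_weight_def split: split_indicator)
 finally show ?thesis by (subst integral_eq_nn_integral) (simp_all add: green_weight_nonneg)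
qed

lemma avg_hk_bounds:
 fixes f :: "'n::finite heis => real"
 assumes f: "borel_fun f" "!!z. 0 <= f z" "!!z. f z <= B"
 shows "0 <= avg e hk f z" "avg e hk f z <= B"
proof -
 have b: "\<bar>f z\<bar> <= B" for z using f(2,3)[of z] by simp
 have "\<bar>avg e hk f z\<bar> <= B * (\<integral>w. \<bar>hk w\<bar> \<partial>(lborel :: 'n heis measure))" by (rule avg_bound[OF hk_integrable f(1) b])
 then show "avg e hk f z <= B" by (simp add: hk_nonneg integral_hk)
 show "0 <= avg e hk f z" unfolding avg_def by (intro integral_nonneg_AE AE_I2 mult_nonneg_nonneg hk_nonneg f)
qed

lemma green_bounds:
 fixes f :: "'n::finite heis => real"
 assumes f: "borel_fun f" "!!z. 0 <= f z" "!!z. f z <= B"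
 shows "0 <= green f z" "green f z <= B"
proof -
 have b: "\<bar>f z\<bar> <= B" for z using f(2,3)[of z] by simp
 show "0 <= green f z" unfolding green_def wavg_def
  by (intro integral_nonneg_AE AE_I2 mult_nonneg_nonneg green_weight_nonneg avg_hk_bounds(1)[OF f])
 have "\<bar>green f z\<bar> <= B * (\<integral>w. \<bar>hk w\<bar> \<partial>(lborel :: 'n heis measure)) * (LBINT e. \<bar>green_weight e\<bar>)"
  unfolding green_def by (rule wavg_bound[OF green_weight_integrable hk_integrable f(1) b])
 then show "green f z <= B" by (simp add: hk_nonneg integral_hk green_weight_nonneg integral_green_weight)
qed

lemma green_measurable [measurable (raw)]: "borel_fun f ==> green f \<in> borel_measurable borel"
 unfolding green_def by (intro wavg_measurable hk_measurable green_weight_measurable)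

lemma ennreal_avg_hk:
 fixes f :: "'n::finite heis => real"
 assumes f[measurable]: "borel_fun f" and "!!z. 0 <= f z" "!!z. f z <= B"
 shows "ennreal (avg e hk f z) = (NNI w. ennreal (hk w) * ennreal (f (z \<star> dil e w)))"
proof -
 have b: "\<bar>f z\<bar> <= B" for z using assms(2,3)[of z] by simp
 show ?thesis unfolding avg_def using assms(2)
  by (subst nn_integral_eq_integral[symmetric, OF avg_integrable[OF hk_integrable f b]]) (auto simp: hk_nonneg ennreal_mult)
qed

lemma ennreal_green:
 fixes f :: "'n::finite heis => real"
 assumes f[measurable]: "borel_fun f" and "!!z. 0 <= f z" "!!z. f z <= B"
 shows "ennreal (green f z) = (NNI e. ennreal (green_weight e) * ennreal (avg e hk f z))"
proof -
 have b: "\<bar>f z\<bar> <= B" for z using assms(2,3)[of z] by simp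
 show ?thesis unfolding green_def wavg_def
  by (subst nn_integral_eq_integral[symmetric, OF wavg_integrable[OF green_weight_integrable hk_integrable f b]])
   (auto simp: green_weight_nonneg ennreal_mult avg_hk_bounds[OF assms] intro!: mult_nonneg_nonneg)
qed

text \<open>Self-adjointness of the heat flow: right translation by \<open>dil e (- w)\<close>
  preserves the measure, and \<open>hk\<close> is even.\<close>

lemma nn_integral_mult_avg_hk:
 fixes f g :: "'n::finite heis => real"
 assumes f[measurable]: "borel_fun f" and f0: "!!z. 0 <= f z" "!!z. f z <= B"
  and g[measurable]: "borel_fun g" and g0: "!!z. 0 <= g z" "!!z. g z <= B'"
 shows "(NNI z. ennreal (g z) * ennreal (avg e hk f z)) = (NNI z. ennreal (f z) * ennreal (avg e hk g z))"
proof -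
 have "(NNI z. ennreal (g z) * ennreal (avg e hk f z))
  = (NNI z. NNI w. ennreal (g z) * (ennreal (hk w) * ennreal (f (z \<star> dil e w))))"
  unfolding ennreal_avg_hk[OF f f0] by (simp add: nn_integral_cmult)
 also have "\<dots> = (NNI w. NNI z. ennreal (g z) * (ennreal (hk w) * ennreal (f (z \<star> dil e w))))"
  by (rule lborel_pair.Fubini') measurable
 also have "\<dots> = (NNI w. NNI z. ennreal (g (z \<star> dil e (- w))) * (ennreal (hk w) * ennreal (f z)))"
 proof (rule nn_integral_cong)
  fix w :: "'n heis"
  have "(NNI z. ennreal (g (z \<star> dil e (- w))) * (ennreal (hk w) * ennreal (f z)))
   = (NNI z. ennreal (g (z \<star> dil e w \<star> dil e (- w))) * (ennreal (hk w) * ennreal (f (z \<star> dil e w))))"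
   by (rule nn_integral_hmul_right[symmetric]) measurable
  then show "(NNI z. ennreal (g z) * (ennreal (hk w) * ennreal (f (z \<star> dil e w))))
   = (NNI z. ennreal (g (z \<star> dil e (- w))) * (ennreal (hk w) * ennreal (f z)))" by simp
 qed
 also have "\<dots> = (NNI w. NNI z. ennreal (g (z \<star> dil e w)) * (ennreal (hk w) * ennreal (f z)))"
  using nn_integral_uminus[of "\<lambda>w. (NNI z. ennreal (g (z \<star> dil e w)) * (ennreal (hk w) * ennreal (f z)))"]
  by (simp add: hk_minus)
 also have "\<dots> = (NNI z. NNI w. ennreal (g (z \<star> dil e w)) * (ennreal (hk w) * ennreal (f z)))"
  by (rule lborel_pair.Fubini') measurable
 also have "\<dots> = (NNI z. ennreal (f z) * ennreal (avg e hk g z))"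
  unfolding ennreal_avg_hk[OF g g0] by (subst nn_integral_cmult[symmetric]) (simp_all add: mult_ac)
 finally show ?thesis .
qed

lemma nn_integral_mult_green:
 fixes f g :: "'n::finite heis => real"
 assumes f[measurable]: "borel_fun f" and f0: "!!z. 0 <= f z" "!!z. f z <= B"
  and g[measurable]: "borel_fun g" and g0: "!!z. 0 <= g z"
 shows "(NNI z. ennreal (g z) * ennreal (green f z)) =
  (NNI e. ennreal (green_weight e) * (NNI z. ennreal (g z) * ennreal (avg e hk f z)))"
proof -
 have "(NNI z. ennreal (g z) * ennreal (green f z)) =
  (NNI z. NNI e. ennreal (green_weight e) * (ennreal (g z) * ennreal (avg e hk f z)))"
  unfolding ennreal_green[OF f f0] by (subst nn_integral_cmult[symmetric]) (simp_all add: mult_ac)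
 also have "\<dots> = (NNI e. NNI z. ennreal (green_weight e) * (ennreal (g z) * ennreal (avg e hk f z)))"
  by (rule lborel_pair.Fubini') measurable
 also have "\<dots> = (NNI e. ennreal (green_weight e) * (NNI z. ennreal (g z) * ennreal (avg e hk f z)))"
  by (intro nn_integral_cong nn_integral_cmult) measurable
 finally show ?thesis .
qed

lemma green_symmetric:
 fixes f g :: "'n::finite heis => real"
 assumes f: "borel_fun f" and f0: "!!z. 0 <= f z" "!!z. f z <= B"
  and g: "borel_fun g" and g0: "!!z. 0 <= g z" "!!z. g z <= B'"
 shows "(NNI z. ennreal (g z) * ennreal (green f z)) = (NNI z. ennreal (f z) * ennreal (green g z))"
 unfolding nn_integral_mult_green[OF f f0 g g0(1)] nn_integral_mult_green[OF g g0 f f0(1)]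
 by (simp add: nn_integral_mult_avg_hk[OF f f0 g g0])

lemma nn_integral_avg_hk:
 fixes f :: "'n::finite heis => real"
 assumes f: "borel_fun f" and f0: "!!z. 0 <= f z" "!!z. f z <= B"
 shows "(NNI z. ennreal (avg e hk f z)) = (NNI z. ennreal (f z))"
 using nn_integral_mult_avg_hk[OF f f0, of "\<lambda>_. 1" 1 e] by (simp add: avg_def integral_hk)

section \<open>Convexity and smoothing bounds for heat averages\<close>

text \<open>The tangent to the convex power at a, obtained from Young's inequality with exponents m
  and m / (m - 1).\<close>

lemma powr_tangent:
 fixes x a m :: real
 assumes "1 < m" "0 <= x" "0 <= a" shows "a powr m + m * a powr (m - 1) * (x - a) <= x powr m"
proof (cases "a = 0")
 case False
 then have a: "0 < a" using assms by simp
 define c where "c = m / (m - 1)"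
 have "x * a powr (m - 1) <= x powr m / m + (a powr (m - 1)) powr c / c"
  by (rule Youngs_inequality) (use assms in \<open>auto simp: c_def field_simps\<close>)
 also have "(a powr (m - 1)) powr c = a powr m" using assms by (simp add: powr_powr c_def)
 also have "a powr m / c = a powr m * (1 - 1 / m)" using assms by (simp add: c_def field_simps)
 finally have "m * (x * a powr (m - 1)) <= m * (x powr m / m + a powr m * (1 - 1 / m))" using assms by (intro mult_left_mono) auto
 also have "\<dots> = x powr m + a powr m * (m - 1)" using assms by (simp add: field_simps)
 also have "a powr m = a powr (m - 1) * a" using a powr_add[of a "m - 1" 1] by simp
 finally show ?thesis using \<open>a powr m = a powr (m - 1) * a\<close> by (simp add: algebra_simps)
qed (use assms in simp)

text \<open>Jensen's inequality for the probability density \<open>hk\<close>: the tangent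
  inequality at the value a of the average is integrated, and its linear part cancels.\<close>

lemma avg_hk_jensen:
 fixes f :: "'n::finite heis => real"
 assumes f[measurable]: "borel_fun f" and f0: "!!z. 0 <= f z" "!!z. f z <= B" and m: "1 < m"
 shows "(avg e hk f z) powr m <= avg e hk (\<lambda>z. f z powr m) z"
proof -
 define a where "a = avg e hk f z"
 have a: "0 <= a" unfolding a_def by (rule avg_hk_bounds[OF f f0])
 have b: "\<bar>f z\<bar> <= B" for z using f0[of z] by simp
 have bm: "\<bar>f z powr m\<bar> <= B powr m" for z using f0[of z] m by (auto intro: powr_mono2)
 have fm: "borel_fun (\<lambda>z. f z powr m)" by measurable
 note i1 = avg_integrable[OF hk_integrable f b, of z e]
 note im = avg_integrable[OF hk_integrable fm bm, of z e]
 have i2: "integrable lborel (\<lambda>w. (a powr m - m * a powr (m - 1) * a) * hk w + m * a powr (m - 1) * (hk w * f (z \<star> dil e w)))"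
  by (intro bintegrable_add integrable_mult_right hk_integrable i1)
 have "(LBINT w. (a powr m - m * a powr (m - 1) * a) * hk w + m * a powr (m - 1) * (hk w * f (z \<star> dil e w)))
  <= (LBINT w. hk w * f (z \<star> dil e w) powr m)"
 proof (rule integral_mono[OF i2 im])
  fix w
  have "hk w * (a powr m + m * a powr (m - 1) * (f (z \<star> dil e w) - a)) <= hk w * f (z \<star> dil e w) powr m"
   by (intro mult_left_mono powr_tangent m f0 a hk_nonneg)
  then show "(a powr m - m * a powr (m - 1) * a) * hk w + m * a powr (m - 1) * (hk w * f (z \<star> dil e w)) <= hk w * f (z \<star> dil e w) powr m"
   by (simp add: algebra_simps)
 qed
 also have "(LBINT w. (a powr m - m * a powr (m - 1) * a) * hk w + m * a powr (m - 1) * (hk w * f (z \<star> dil e w))) =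
  (a powr m - m * a powr (m - 1) * a) * 1 + m * a powr (m - 1) * a"
  by (simp only: bintegral_add[OF integrable_mult_right[OF hk_integrable] integrable_mult_right[OF i1]]
   integral_mult_right_zero integral_hk avg_def[symmetric] a_def[symmetric])
 finally show ?thesis by (simp add: a_def avg_def)
qed

text \<open>Ultracontractivity: the kernel is bounded by \<open>S\<close>, and undoing the dilation
  contributes the inverse Jacobian.\<close>

lemma avg_hk_sup_bound:
 fixes f :: "'n::finite heis => real"
 assumes f[measurable]: "borel_fun f" and f0: "!!z. 0 <= f z" "!!z. f z <= B"
  and S: "!!w :: 'n heis. hk w <= S" and I: "(NNI z. ennreal (f z)) <= ennreal c" and c: "0 <= c" and e: "0 < e"
 shows "avg e hk f z <= S * c * (1 / e) ^ (2 * CARD('n) + 2)"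
proof -
 let ?Q = "2 * CARD('n) + 2"
 have S0: "0 <= S" using S[of 0] hk_nonneg[of "0 :: 'n heis"] by linarith
 have "ennreal (avg e hk f z) <= (NNI w. ennreal S * ennreal (f (z \<star> dil e w)))"
  unfolding ennreal_avg_hk[OF f f0] by (intro nn_integral_mono mult_right_mono ennreal_leI S) simp
 also have "\<dots> = ennreal S * (NNI w. ennreal (f (z \<star> dil e w)))" by (rule nn_integral_cmult) measurable
 finally have "ennreal (e ^ ?Q) * ennreal (avg e hk f z) <= ennreal (e ^ ?Q) * (ennreal S * (NNI w. ennreal (f (z \<star> dil e w))))"
  by (rule mult_left_mono) simp
 also have "\<dots> = ennreal S * (ennreal (e ^ ?Q) * (NNI w. ennreal (f (z \<star> dil e w))))" by (simp add: mult_ac)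
 also have "ennreal (e ^ ?Q) * (NNI w. ennreal (f (z \<star> dil e w))) = (NNI w. ennreal (f (z \<star> w)))"
  by (rule nn_integral_dil[OF _ e, of "\<lambda>w. ennreal (f (z \<star> w))"]) measurable
 also have "\<dots> = (NNI w. ennreal (f w))" by (rule nn_integral_hmul_left) measurable
 also have "ennreal S * \<dots> <= ennreal S * ennreal c" by (intro mult_left_mono I) simp
 finally have "ennreal (e ^ ?Q * avg e hk f z) <= ennreal (S * c)"
  using e S0 c by (simp add: ennreal_mult avg_hk_bounds[OF f f0])
 then have "e ^ ?Q * avg e hk f z <= S * c" using S0 c by (simp add: ennreal_le_iff)
 then have "(1 / e) ^ ?Q * (e ^ ?Q * avg e hk f z) <= (1 / e) ^ ?Q * (S * c)" using e by (intro mult_left_mono) auto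
 also have "(1 / e) ^ ?Q * (e ^ ?Q * avg e hk f z) = (1 / e * e) ^ ?Q * avg e hk f z"
  by (simp only: power_mult_distrib mult.assoc)
 also have "1 / e * e = 1" using e by simp
 finally show ?thesis by (simp only: power_one mult_1 mult.commute[of "(1 / e) ^ ?Q"])
qed

section \<open>The dual variational problem\<close>

text \<open>The exponents \<open>q = p + 1\<close> and \<open>r\<close> are conjugate. The functional \<open>f \<mapsto> \<parallel>green f\<parallel>\<^sub>q\<close> is maximised
 over nonnegative bounded \<open>f\<close> with \<open>\<parallel>f\<parallel>\<^sub>r <= 1\<close>.\<close>

locale subcritical =
 fixes p :: real and ty :: "'n::finite itself" and q r S :: real
 assumes p1: "1 < p" and p2: "p * real CARD('n) < real CARD('n) + 2"
  and q_def: "q = p + 1" and r_def: "r = (p + 1) / p"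
  and S0: "0 < S" and S: "!!w :: 'n heis. hk w <= S"
begin

text \<open>Boundedness is qualitative here: it makes \<open>green\<close> a genuine integral, but
  no bound is uniform over the class.\<close>

definition adm :: "('n heis => real) => bool" where
 "adm f \<longleftrightarrow> f \<in> borel_measurable borel \<and> (\<forall>z. 0 <= f z) \<and> (\<exists>B. \<forall>z. f z <= B) \<and>
  (NNI z. ennreal (f z powr r)) <= 1"

definition Q :: nat where "Q = 2 * CARD('n) + 2"

lemma exps: "1 < r" "r < 2" "2 < q" "1 / r + 1 / q = 1" "p * r = q" "(q - r) / r = p - 1" "(1 - 2 / q) * q = p - 1" "0 < 1 - 2 / q" "r - 1 = 1 / p"
proof -
 show pr: "p * r = q" using p1 by (simp add: q_def r_def)
 have "1 < r" using p1 by (simp add: r_def field_simps)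
 then show "1 < r" "(q - r) / r = p - 1" using pr by (simp_all add: diff_divide_distrib flip: pr)
qed (use p1 in \<open>auto simp: q_def r_def field_simps\<close>)

lemma powr_q: "0 <= x ==> x powr q = x powr p * x"
 by (cases "x = 0") (simp_all add: q_def powr_add)

lemma adm_bound:
 assumes "adm f" obtains B where "0 < B" "!!z. 0 <= f z" "!!z. f z <= B" "borel_fun f"
proof -
 obtain B where "!!z. 0 <= f z" "!!z. f z <= B" "borel_fun f" using assms unfolding adm_def by blast
 then show ?thesis using that[of "max B 1"] by (simp add: le_max_iff_disj)
qed

lemma admD: "adm f ==> f \<in> borel_measurable borel" "adm f ==> 0 <= f z" "adm f ==> (NNI z. ennreal (f z powr r)) <= 1"
 by (auto simp: adm_def)

text \<open>Interpolation: Jensen with exponent m, then the bound f^m <= \<Lambda>^(m - r) f^r and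
  ultracontractivity. With m = r the bound \<Lambda> drops out; a larger m makes the singularity in
  the scale milder.\<close>

lemma avg_adm_sup:
 assumes f: "adm f" and fL: "!!z. f z <= \<Lambda>" and L: "0 < \<Lambda>" and m: "r <= m" and e: "0 < e"
 shows "avg e hk f z <= (\<Lambda> powr (m - r) * (S * (1 / e) ^ Q)) powr (1 / m)"
proof -
 note fm[measurable] = admD(1)[OF f] and f0 = admD(2)[OF f]
 have m1: "1 < m" using m exps(1) by simp
 have fmm: "borel_fun (\<lambda>z. f z powr m)" by measurable
 have b: "0 <= f z powr m" "f z powr m <= \<Lambda> powr m" for z using f0[of z] fL[of z] m1 by (auto intro: powr_mono2)
 have le: "f z powr m <= \<Lambda> powr (m - r) * f z powr r" for z
 proof (cases "f z = 0")
  case False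
  then have "f z powr m = f z powr (m - r) * f z powr r" by (simp add: powr_add[symmetric])
  also have "\<dots> <= \<Lambda> powr (m - r) * f z powr r" using f0[of z] fL[of z] m by (intro mult_right_mono powr_mono2) auto
  finally show ?thesis .
 qed simp
 have "(NNI z. ennreal (f z powr m)) <= (NNI z. ennreal (\<Lambda> powr (m - r)) * ennreal (f z powr r))"
  by (intro nn_integral_mono) (simp add: ennreal_mult[symmetric] ennreal_leI le)
 also have "\<dots> = ennreal (\<Lambda> powr (m - r)) * (NNI z. ennreal (f z powr r))" by (rule nn_integral_cmult) measurable
 also have "\<dots> <= ennreal (\<Lambda> powr (m - r)) * 1" by (intro mult_left_mono admD(3)[OF f]) simp
 finally have I: "(NNI z. ennreal (f z powr m)) <= ennreal (\<Lambda> powr (m - r))" by simp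
 have "(avg e hk f z) powr m <= avg e hk (\<lambda>z. f z powr m) z" by (rule avg_hk_jensen[OF fm f0 fL m1])
 also have "\<dots> <= S * \<Lambda> powr (m - r) * (1 / e) ^ (2 * CARD('n) + 2)"
  by (rule avg_hk_sup_bound[OF fmm b S I _ e]) simp
 finally have "((avg e hk f z) powr m) powr (1 / m) <= (\<Lambda> powr (m - r) * (S * (1 / e) ^ Q)) powr (1 / m)"
  using m1 by (intro powr_mono2) (auto simp: Q_def mult_ac)
 then show ?thesis using m1 avg_hk_bounds(1)[OF fm f0 fL, of e z] by (simp add: powr_powr)
qed

text \<open>Bounds the heat average at scale e from L^r to L^q. The exponent is 1 / r - 1 / q, which
  equals 1 - 2 / q for conjugate exponents.\<close>

definition kap :: "real => real" where
 "kap e = (S * (1 / e) ^ Q) powr (1 - 2 / q)"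

text \<open>The power q is split as (q - r) + r: the first factor is bounded uniformly by
  \<open>avg_adm_sup\<close>, the second by Jensen and conservation of the integral.\<close>

lemma avg_adm_Lq:
 assumes f: "adm f" and e: "0 < e"
 shows "(NNI z. ennreal (avg e hk f z powr q)) <= ennreal (kap e powr q)"
proof -
 obtain B where B: "0 < B" "!!z. 0 <= f z" "!!z. f z <= B" "borel_fun f" by (rule adm_bound[OF f]) (rule that)
 note [measurable] = B(4)
 let ?s = "S * (1 / e) ^ Q"
 have s: "0 < ?s" using S0 e by simp
 have fr: "borel_fun (\<lambda>z. f z powr r)" by measurable
 have br: "0 <= f z powr r" "f z powr r <= B powr r" for z using B(2,3)[of z] exps(1) by (auto intro: powr_mono2)
 have le: "avg e hk f z powr q <= ?s powr (p - 1) * avg e hk (\<lambda>z. f z powr r) z" for z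
 proof (cases "avg e hk f z = 0")
  case True
  then show ?thesis using avg_hk_bounds(1)[OF fr br, of e z] by simp
 next
  case False
  have a: "0 <= avg e hk f z" by (rule avg_hk_bounds(1)[OF B(4,2,3)])
  have "avg e hk f z <= ?s powr (1 / r)"
   using avg_adm_sup[OF f B(3,1) order_refl e, of z] B(1) by simp
  then have "avg e hk f z powr (q - r) <= (?s powr (1 / r)) powr (q - r)" using a exps by (intro powr_mono2) auto
  also have "\<dots> = ?s powr (p - 1)" using exps(6) by (simp add: powr_powr)
  finally have 1: "avg e hk f z powr (q - r) <= ?s powr (p - 1)" .
  have "avg e hk f z powr q = avg e hk f z powr (q - r) * avg e hk f z powr r" using False by (simp add: powr_add[symmetric])
  also have "\<dots> <= ?s powr (p - 1) * avg e hk (\<lambda>z. f z powr r) z"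
   using 1 avg_hk_jensen[OF B(4,2,3) exps(1), of e z] by (intro mult_mono) auto
  finally show ?thesis .
 qed
 have "(NNI z. ennreal (avg e hk f z powr q)) <= (NNI z. ennreal (?s powr (p - 1)) * ennreal (avg e hk (\<lambda>z. f z powr r) z))"
  by (intro nn_integral_mono) (simp add: ennreal_mult[symmetric] ennreal_leI le avg_hk_bounds(1)[OF fr br])
 also have "\<dots> = ennreal (?s powr (p - 1)) * (NNI z. ennreal (f z powr r))"
  by (subst nn_integral_cmult) (simp_all add: nn_integral_avg_hk[OF fr br])
 also have "\<dots> <= ennreal (?s powr (p - 1)) * 1" by (intro mult_left_mono admD(3)[OF f]) simp
 also have "?s powr (p - 1) = kap e powr q" by (simp only: kap_def powr_powr exps(7))
 finally show ?thesis by simp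
qed

text \<open>Hoelder's inequality in normalised form: Young's inequality for \<open>g z\<close> and
  \<open>h z / t\<close> is integrated, and the coefficients add up to 1 / r + 1 / q = 1.\<close>

lemma holder_adm:
 assumes g: "adm g" and h[measurable]: "borel_fun h" and h0: "!!z. 0 <= h z"
  and I: "(NNI z. ennreal (h z powr q)) <= ennreal (t powr q)" and t: "0 < t"
 shows "(NNI z. ennreal (g z) * ennreal (h z)) <= ennreal t"
proof -
 note [measurable] = admD(1)[OF g]
 have Y: "g z * h z <= t * (g z powr r / r) + (t / (q * t powr q)) * h z powr q" for z
 proof -
  have "g z * (h z / t) <= g z powr r / r + (h z / t) powr q / q"
   by (rule Youngs_inequality) (use exps admD(2)[OF g] h0 t in auto)
  then have "t * (g z * (h z / t)) <= t * (g z powr r / r + (h z / t) powr q / q)" using t by (intro mult_left_mono) auto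
  also have "(h z / t) powr q = h z powr q / t powr q" using h0[of z] t by (simp add: powr_divide)
  finally show ?thesis using t by (simp add: field_simps)
 qed
 have "(NNI z. ennreal (g z) * ennreal (h z)) <=
  (NNI z. ennreal (t / r) * ennreal (g z powr r) + ennreal (t / (q * t powr q)) * ennreal (h z powr q))"
 proof (intro nn_integral_mono)
  fix z
  have "ennreal (g z) * ennreal (h z) = ennreal (g z * h z)" using admD(2)[OF g] h0 by (simp add: ennreal_mult)
  also have "\<dots> <= ennreal (t / r * g z powr r + (t / (q * t powr q)) * h z powr q)" using Y[of z] by (intro ennreal_leI) simp
  also have "\<dots> = ennreal (t / r) * ennreal (g z powr r) + ennreal (t / (q * t powr q)) * ennreal (h z powr q)"
   using t exps by (simp add: ennreal_mult'[symmetric] ennreal_plus[symmetric] del: ennreal_plus)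
  finally show "ennreal (g z) * ennreal (h z) <= ennreal (t / r) * ennreal (g z powr r) + ennreal (t / (q * t powr q)) * ennreal (h z powr q)" .
 qed
 also have "\<dots> = ennreal (t / r) * (NNI z. ennreal (g z powr r)) + ennreal (t / (q * t powr q)) * (NNI z. ennreal (h z powr q))"
  by (simp add: nn_integral_add nn_integral_cmult)
 also have "\<dots> <= ennreal (t / r) * 1 + ennreal (t / (q * t powr q)) * ennreal (t powr q)"
  by (intro add_mono mult_left_mono admD(3)[OF g] I) auto
 also have "\<dots> = ennreal (t / r + t / (q * t powr q) * t powr q)"
  using t exps by (simp add: ennreal_mult'[symmetric] ennreal_plus[symmetric] del: ennreal_plus)
 also have "t / r + t / (q * t powr q) * t powr q = t * (1 / r + 1 / q)" using t by (simp add: field_simps)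
 finally show ?thesis using exps(4) by simp
qed

definition dual_const :: real where
 "dual_const = (LBINT e. green_weight e * kap e)"

lemma powr_inverse_power: "0 < e ==> ((1 / e) ^ Q) powr s = e powr (- real Q * s)"
 by (simp add: powr_realpow[symmetric] powr_powr powr_divide powr_minus_divide)

text \<open>The singularity of \<open>kap\<close> at 0 has order Q (1 - 2 / q), and this is below 2
  exactly when p n < n + 2. Here subcriticality makes the dual supremum finite.\<close>

lemma kap_integrable: "integrable lborel (\<lambda>e. green_weight e * kap e)"
proof -
 have "real Q * (1 - 2 / q) < 2"
 proof -
  have "real Q * (q - 2) < 2 * q" using p2 by (simp add: Q_def q_def algebra_simps)
  then show ?thesis using exps(3) by (simp add: field_simps)
 qed
 then have "integrable lborel (\<lambda>e. S powr (1 - 2 / q) * (green_weight e * e powr (- real Q * (1 - 2 / q))))"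
  by (intro integrable_mult_right green_weight_powr_integrable) linarith
 also have "(\<lambda>e. S powr (1 - 2 / q) * (green_weight e * e powr (- real Q * (1 - 2 / q)))) = (\<lambda>e. green_weight e * kap e)"
 proof
  fix e
  show "S powr (1 - 2 / q) * (green_weight e * e powr (- real Q * (1 - 2 / q))) = green_weight e * kap e"
  proof (cases "0 < e")
   case True
   have "kap e = S powr (1 - 2 / q) * ((1 / e) ^ Q) powr (1 - 2 / q)"
    unfolding kap_def by (rule powr_mult)
   then show ?thesis using powr_inverse_power[OF True, of "1 - 2 / q"] by simp
  qed (simp add: green_weight_def)
 qed
 finally show ?thesis .
qed

lemma kap_pos: "0 < e ==> 0 < kap e"
 using S0 by (simp add: kap_def)

text \<open>An inequality of Hardy-Littlewood-Sobolev type: the L^r to L^q bound is applied at each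
  scale and integrated against the weight.\<close>

lemma dual_bound:
 assumes f: "adm f" and g: "adm g"
 shows "(NNI z. ennreal (g z) * ennreal (green f z)) <= ennreal dual_const"
proof -
 obtain B where B: "0 < B" "!!z. 0 <= f z" "!!z. f z <= B" "borel_fun f" by (rule adm_bound[OF f]) (rule that)
 note [measurable] = B(4)
 have "(NNI z. ennreal (g z) * ennreal (green f z)) =
  (NNI e. ennreal (green_weight e) * (NNI z. ennreal (g z) * ennreal (avg e hk f z)))"
  by (rule nn_integral_mult_green[OF B(4,2,3) admD(1)[OF g] admD(2)[OF g]])
 also have "\<dots> <= (NNI e. ennreal (green_weight e * kap e))"
 proof (intro nn_integral_mono)
  fix e :: real
  show "ennreal (green_weight e) * (NNI z. ennreal (g z) * ennreal (avg e hk f z)) <= ennreal (green_weight e * kap e)"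
  proof (cases "0 < e")
   case True
   have "(NNI z. ennreal (g z) * ennreal (avg e hk f z)) <= ennreal (kap e)"
    by (rule holder_adm[OF g _ avg_hk_bounds(1)[OF B(4,2,3)] avg_adm_Lq[OF f True] kap_pos[OF True]]) simp
   then show ?thesis using kap_pos[OF True] by (simp add: ennreal_mult green_weight_nonneg mult_left_mono)
  qed (simp add: green_weight_def)
 qed
 also have "\<dots> = ennreal dual_const" unfolding dual_const_def
  by (rule nn_integral_eq_integral[OF kap_integrable]) (simp add: green_weight_nonneg kap_def)
 finally show ?thesis .
qed

text \<open>The resolvent averages against a probability measure, so Jensen applies in the scale and
  in the point. The integral of \<open>green\<close> of f^r is then bounded by symmetry, testing
  with the constant 1.\<close>

lemma green_adm_integral:
 assumes f: "adm f" shows "(NNI z. ennreal (green f z powr r)) <= 1"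
proof -
 obtain B where B: "0 < B" "!!z. 0 <= f z" "!!z. f z <= B" "borel_fun f" by (rule adm_bound[OF f]) (rule that)
 note fm[measurable] = B(4)
 have b: "\<bar>f z\<bar> <= B" for z using B(2,3)[of z] by simp
 have fr[measurable]: "borel_fun (\<lambda>z. f z powr r)" by measurable
 have br: "0 <= f z powr r" "f z powr r <= B powr r" for z using B(2,3)[of z] exps(1) by (auto intro: powr_mono2)
 have brr: "\<bar>f z powr r\<bar> <= B powr r" for z using br[of z] by simp
 have J: "green f z powr r <= green (\<lambda>z. f z powr r) z" for z
 proof -
  define a where "a = green f z"
  have a: "0 <= a" unfolding a_def by (rule green_bounds[OF B(4,2,3)])
  note i1 = wavg_integrable[OF green_weight_integrable hk_integrable fm b, of z]
  note ir = wavg_integrable[OF green_weight_integrable hk_integrable fr brr, of z]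
  have i2: "integrable lborel (\<lambda>e. (a powr r - r * a powr (r - 1) * a) * green_weight e + r * a powr (r - 1) * (green_weight e * avg e hk f z))"
   by (intro bintegrable_add integrable_mult_right green_weight_integrable i1)
  have "(LBINT e. (a powr r - r * a powr (r - 1) * a) * green_weight e + r * a powr (r - 1) * (green_weight e * avg e hk f z))
   <= (LBINT e. green_weight e * avg e hk (\<lambda>z. f z powr r) z)"
  proof (rule integral_mono[OF i2 ir])
   fix e
   have "a powr r + r * a powr (r - 1) * (avg e hk f z - a) <= avg e hk f z powr r"
    by (intro powr_tangent exps avg_hk_bounds(1)[OF B(4,2,3)] a)
   also have "\<dots> <= avg e hk (\<lambda>z. f z powr r) z" by (rule avg_hk_jensen[OF B(4,2,3) exps(1)])
   finally have "green_weight e * (a powr r + r * a powr (r - 1) * (avg e hk f z - a)) <= green_weight e * avg e hk (\<lambda>z. f z powr r) z"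
    by (intro mult_left_mono green_weight_nonneg)
   then show "(a powr r - r * a powr (r - 1) * a) * green_weight e + r * a powr (r - 1) * (green_weight e * avg e hk f z) <= green_weight e * avg e hk (\<lambda>z. f z powr r) z"
    by (simp add: algebra_simps)
  qed
  also have "(LBINT e. (a powr r - r * a powr (r - 1) * a) * green_weight e + r * a powr (r - 1) * (green_weight e * avg e hk f z)) =
   (a powr r - r * a powr (r - 1) * a) * 1 + r * a powr (r - 1) * a"
   by (simp only: bintegral_add[OF integrable_mult_right[OF green_weight_integrable] integrable_mult_right[OF i1]]
    integral_mult_right_zero integral_green_weight wavg_def[symmetric] green_def[symmetric] a_def[symmetric])
  finally show ?thesis by (simp add: a_def green_def wavg_def)
 qed
 have "(NNI z. ennreal (green f z powr r)) <= (NNI z. ennreal 1 * ennreal (green (\<lambda>z. f z powr r) z))"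
  using J by (intro nn_integral_mono) (simp add: ennreal_leI)
 also have "\<dots> = (NNI z. ennreal (f z powr r) * ennreal (green (\<lambda>_. 1) z))"
  by (rule green_symmetric[OF fr br]) auto
 also have "\<dots> <= (NNI z. ennreal (f z powr r) * 1)"
  using green_bounds(2)[of "\<lambda>_. 1" 1] by (intro nn_integral_mono mult_left_mono) (auto simp: ennreal_le_1)
 also have "\<dots> <= 1" using admD(3)[OF f] by simp
 finally show ?thesis .
qed

text \<open>The L^q norm of \<open>green f\<close>. For admissible functions the integral is finite,
  so \<open>enn2real\<close> does not lose information.\<close>

definition nrm :: "('n heis => real) => real" where
 "nrm f = enn2real (NNI z. ennreal (green f z powr q)) powr (1 / q)"

lemma powr_q_le_r:
 assumes "0 <= x" "x <= \<Lambda>" shows "x powr q <= \<Lambda> powr (q - r) * x powr r"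
proof (cases "x = 0")
 case False
 then have "x powr q = x powr (q - r) * x powr r" by (simp add: powr_add[symmetric])
 also have "\<dots> <= \<Lambda> powr (q - r) * x powr r" using assms exps by (intro mult_right_mono powr_mono2) auto
 finally show ?thesis .
qed simp

lemma green_Lq_le:
 assumes f: "adm f" and L: "!!z. green f z <= \<Lambda>"
 shows "(NNI z. ennreal (green f z powr q)) <= ennreal (\<Lambda> powr (q - r))"
proof -
 obtain B where B: "0 < B" "!!z. 0 <= f z" "!!z. f z <= B" "borel_fun f" by (rule adm_bound[OF f]) (rule that)
 note [measurable] = B(4)
 have "(NNI z. ennreal (green f z powr q)) <= (NNI z. ennreal (\<Lambda> powr (q - r)) * ennreal (green f z powr r))"
  by (intro nn_integral_mono) (simp add: ennreal_mult[symmetric] ennreal_leI powr_q_le_r[OF green_bounds(1)[OF B(4,2,3)] L])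
 also have "\<dots> = ennreal (\<Lambda> powr (q - r)) * (NNI z. ennreal (green f z powr r))" by (rule nn_integral_cmult) measurable
 also have "\<dots> <= ennreal (\<Lambda> powr (q - r)) * 1" by (intro mult_left_mono green_adm_integral[OF f]) simp
 finally show ?thesis by simp
qed

lemma nrm_powr:
 assumes f: "adm f" shows "(NNI z. ennreal (green f z powr q)) = ennreal (nrm f powr q)" and "0 <= nrm f"
proof -
 obtain B where B: "0 < B" "!!z. 0 <= f z" "!!z. f z <= B" "borel_fun f" by (rule adm_bound[OF f]) (rule that)
 have "(NNI z. ennreal (green f z powr q)) < \<infinity>"
  using green_Lq_le[OF f green_bounds(2)[OF B(4,2,3)]] by (rule le_less_trans) simp
 then show "(NNI z. ennreal (green f z powr q)) = ennreal (nrm f powr q)" using exps(3) by (simp add: nrm_def powr_powr)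
qed (simp add: nrm_def)

text \<open>The extremal function in Hoelder's inequality for \<open>green f\<close>; since \<open>green\<close> is symmetric,
 replacing \<open>f\<close> by it does not decrease \<open>nrm\<close>.\<close>

definition improve :: "('n heis => real) => 'n heis => real" where
 "improve f z = (green f z / nrm f) powr p"

lemma adm_improve:
 assumes f: "adm f" and n: "0 < nrm f" shows "adm (improve f)"
proof -
 obtain B where B: "0 < B" "!!z. 0 <= f z" "!!z. f z <= B" "borel_fun f" by (rule adm_bound[OF f]) (rule that)
 note [measurable] = B(4)
 note g = green_bounds[OF B(4,2,3)]
 have "improve f z <= (B / nrm f) powr p" for z
  unfolding improve_def using g[of z] n p1 by (intro powr_mono2 divide_right_mono divide_nonneg_pos) auto
 moreover have "(NNI z. ennreal (improve f z powr r)) = (NNI z. ennreal (1 / nrm f powr q) * ennreal (green f z powr q))"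
  using g(1) n by (intro nn_integral_cong) (simp add: improve_def powr_powr exps(5) powr_divide ennreal_mult'[symmetric])
 moreover have "\<dots> = ennreal (1 / nrm f powr q) * ennreal (nrm f powr q)"
  by (subst nn_integral_cmult) (simp_all add: nrm_powr(1)[OF f])
 moreover have "\<dots> = 1" using n by (simp add: ennreal_mult'[symmetric])
 moreover have "borel_fun (improve f)" "!!z. 0 <= improve f z" unfolding improve_def[abs_def] by simp_all
 ultimately show ?thesis unfolding adm_def by (metis order_refl)
qed

lemma improve_pairing:
 assumes f: "adm f" and n: "0 < nrm f"
 shows "(NNI z. ennreal (improve f z) * ennreal (green f z)) = ennreal (nrm f)"
proof -
 obtain B where B: "0 < B" "!!z. 0 <= f z" "!!z. f z <= B" "borel_fun f" by (rule adm_bound[OF f]) (rule that)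
 note [measurable] = B(4)
 note g = green_bounds(1)[OF B(4,2,3)]
 have "ennreal (improve f z) * ennreal (green f z) = ennreal (1 / nrm f powr p) * ennreal (green f z powr q)" for z
 proof -
  have "improve f z * green f z = 1 / nrm f powr p * green f z powr q"
   using g[of z] n by (simp add: improve_def powr_divide powr_q)
  then show ?thesis using g[of z] by (simp add: ennreal_mult'[symmetric] improve_def)
 qed
 then have "(NNI z. ennreal (improve f z) * ennreal (green f z)) = ennreal (1 / nrm f powr p) * ennreal (nrm f powr q)"
  by (simp add: nn_integral_cmult nrm_powr(1)[OF f])
 also have "\<dots> = ennreal (nrm f)" using n by (simp add: ennreal_mult'[symmetric] powr_q)
 finally show ?thesis .
qed

lemma pairing_le_nrm:
 assumes f: "adm f" and g: "adm g"
 shows "(NNI z. ennreal (g z) * ennreal (green f z)) <= ennreal (nrm f)"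
proof (rule ennreal_le_epsilon)
 \<comment> \<open>Hoelder's inequality above requires a strictly positive bound, while
   \<open>nrm f\<close> may vanish; hence the margin d.\<close>
 fix d :: real assume d: "0 < d"
 obtain B where B: "0 < B" "!!z. 0 <= f z" "!!z. f z <= B" "borel_fun f" by (rule adm_bound[OF f]) (rule that)
 have n: "0 <= nrm f" by (rule nrm_powr[OF f])
 have "(NNI z. ennreal (g z) * ennreal (green f z)) <= ennreal (nrm f + d)"
 proof (rule holder_adm[OF g green_measurable[OF B(4)] green_bounds(1)[OF B(4,2,3)]])
  show "(NNI z. ennreal (green f z powr q)) <= ennreal ((nrm f + d) powr q)"
   unfolding nrm_powr(1)[OF f] using n d exps by (intro ennreal_leI powr_mono2) auto
 qed (use n d in simp)
 then show "(NNI z. ennreal (g z) * ennreal (green f z)) <= ennreal (nrm f) + ennreal d" using n d by (simp add: ennreal_plus)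
qed

lemma nrm_improve:
 assumes f: "adm f" and n: "0 < nrm f" shows "nrm f <= nrm (improve f)"
proof -
 note i = adm_improve[OF assms]
 obtain B where B: "0 < B" "!!z. 0 <= f z" "!!z. f z <= B" "borel_fun f" by (rule adm_bound[OF f]) (rule that)
 obtain B' where B': "0 < B'" "!!z. 0 <= improve f z" "!!z. improve f z <= B'" "borel_fun (improve f)" by (rule adm_bound[OF i]) (rule that)
 have "ennreal (nrm f) = (NNI z. ennreal (f z) * ennreal (green (improve f) z))"
  unfolding improve_pairing[OF assms, symmetric] by (rule green_symmetric[OF B(4,2,3) B'(4,2,3)])
 also have "\<dots> <= ennreal (nrm (improve f))" by (rule pairing_le_nrm[OF i f])
 finally show ?thesis using nrm_powr(2)[OF i] by (simp add: ennreal_le_iff)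
qed

text \<open>The norm is attained by pairing with \<open>improve f\<close>, so the bilinear bound
  applies.\<close>

lemma nrm_le_dual: assumes f: "adm f" shows "nrm f <= max dual_const 0"
proof (cases "nrm f = 0")
 case False
 then have n: "0 < nrm f" using nrm_powr(2)[OF f] by simp
 have "ennreal (nrm f) <= ennreal dual_const"
  unfolding improve_pairing[OF f n, symmetric] by (rule dual_bound[OF f adm_improve[OF f n]])
 then show ?thesis using n by (auto simp: ennreal_le_iff2)
qed simp

end

section \<open>First derivatives of the resolvent, Lipschitz bounds and positivity\<close>

lemma rderiv_cmult: "rderiv v K K1 ==> rderiv v (\<lambda>w. c * K w) (\<lambda>w. c * K1 w)"
 unfolding rderiv_def by (intro allI DERIV_cmult) (drule spec, assumption)

definition hk1 :: "'n::finite heis => 'n heis => real" where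
 "hk1 v = (\<lambda>w. (1 / (\<integral>w. hker 0 0 w \<partial>(lborel :: 'n heis measure))) * hker1 v 0 0 w)"

definition hk2 :: "'n::finite heis => 'n heis => 'n heis => real" where
 "hk2 v v' = (\<lambda>w. (1 / (\<integral>w. hker 0 0 w \<partial>(lborel :: 'n heis measure))) * hker2 v v' w)"

lemma rderiv_hk: "rderiv v hk (hk1 v)" and rderiv_hk1: "rderiv v' (hk1 v) (hk2 v v')"
 unfolding hk_eq_cmult hk1_def hk2_def by (rule rderiv_cmult[OF rderiv_hker], rule rderiv_cmult[OF rderiv_hker1])

lemma good_kernel_hk1: "good_kernel (1/4) (hk1 v)" and good_kernel_hk2: "good_kernel (1/4) (hk2 v v')"
 unfolding hk1_def hk2_def by (rule good_kernel_cmult[OF good_kernel_hker1'], rule good_kernel_cmult[OF good_kernel_hker2])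

text \<open>The weight after differentiation along a vector of homogeneous degree \<open>d\<close>,
  with sign and power as in \<open>avg_flow_deriv\<close>.\<close>

definition green_weight' :: "nat => real => real" where
 "green_weight' d e = - green_weight e * (1 / e) ^ d"

lemma green_weight_div_eq: "green_weight e * (1 / e) ^ d * e powr \<alpha> = green_weight e * e powr (\<alpha> - real d)"
proof (cases "0 < e")
 case True
 then have "(1 / e) ^ d * e powr \<alpha> = e powr (\<alpha> - real d)"
  by (simp add: powr_diff powr_realpow power_one_over field_simps)
 then show ?thesis by (simp only: mult.assoc)
qed (simp add: green_weight_def)

lemma green_weight_div_integrable:
 "real d < \<alpha> + 2 ==> integrable lborel (\<lambda>e. green_weight e * (1 / e) ^ d * e powr \<alpha>)"
 unfolding green_weight_div_eq by (rule green_weight_powr_integrable) simp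

lemma green_weight'_integrable: "d < 2 ==> integrable lborel (green_weight' d)"
proof -
 assume "d < 2"
 then have "integrable lborel (\<lambda>e. - (green_weight e * (1 / e) ^ d * e powr 0))"
  by (intro integrable_minus green_weight_div_integrable) auto
 then show ?thesis
  by (rule bintegrable_bound) (auto simp: green_weight'_def[abs_def] green_weight_def)
qed

lemma hnorm_eq_0: "hnorm w = 0 \<longleftrightarrow> w = 0"
 using norm_ge_zero[of "fst w"] norm_ge_zero[of "fst (snd w)"] real_sqrt_ge_zero[of "\<bar>snd (snd w)\<bar>"]
 by (auto simp: hnorm_def heis_eq_iff add_nonneg_eq_0_iff)

text \<open>Boundedness is treated as Hoelder continuity of exponent 0, so that first derivatives
  fit the general differentiation lemma. At w = 0 both sides vanish, since 0 powr 0 = 0.\<close>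

lemma bounded_holder_zero:
 fixes f :: "'n::finite heis => real"
 assumes "!!z. \<bar>f z\<bar> <= B" shows "\<bar>f (z \<star> w) - f z\<bar> <= 2 * B * hnorm w powr 0"
proof (cases "w = 0")
 case False
 then show ?thesis using assms[of z] assms[of "z \<star> w"] by (simp add: hnorm_eq_0)
qed simp

lemma dil_horizontal: "snd (snd v) = 0 ==> dil e v = e ^ 1 *\<^sub>R v"
 by (simp add: dil_def heis_eq_iff)

text \<open>A derivative of degree one costs one power of e, and the weight e / 2 compensates it
  without any regularity of \<open>f\<close>.\<close>

lemma green_flow_horizontal:
 fixes f :: "'n::finite heis => real"
 assumes f: "borel_fun f" "!!z. \<bar>f z\<bar> <= B" and v: "snd (snd v) = 0"
 shows "flow_deriv v (green f) (wavg (green_weight' 1) (hk1 v) f)"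
proof -
 have B: "0 <= 2 * B" using f(2)[of 0] by simp
 show ?thesis
  unfolding green_def green_weight'_def
 proof (rule wavg_flow_deriv(1)[OF good_kernel_hk good_kernel_hk1 rderiv_hk f bounded_holder_zero[OF f(2)] order_refl _ B dil_horizontal[OF v] green_weight_integrable])
  show "integrable lborel (\<lambda>e. green_weight e * (1 / e) ^ 1 * e powr 0)"
   by (rule green_weight_div_integrable) simp
 qed (auto simp: green_weight_def)
qed

text \<open>One constant controlling the L^1 norms of all horizontal derivatives of
  \<open>hk\<close>, since these depend linearly on the direction.\<close>

definition hk1_mass :: "'n::finite itself => real" where
 "hk1_mass _ = (\<Sum>i\<in>UNIV. (\<integral>w. \<bar>hk1 (eX i) w\<bar> \<partial>(lborel :: 'n heis measure)) + (\<integral>w. \<bar>hk1 (eY i) w\<bar> \<partial>(lborel :: 'n heis measure)))"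

lemma hk1_horizontal:
 assumes "snd (snd v) = 0"
 shows "hk1 v w = (\<Sum>i\<in>UNIV. fst v $ i * hk1 (eX i) w + fst (snd v) $ i * hk1 (eY i) w)"
proof -
 have axes: "hdot (eX i) w = fst w $ i" "hdot (eY i) w = fst (snd w) $ i"
  "hsymp (eX i) w = - fst (snd w) $ i" "hsymp (eY i) w = fst w $ i" for i
  by (simp_all add: hdot_def hsymp_def eX_def eY_def inner_axis' inner_axis)
 have 1: "hdot v w = (\<Sum>i\<in>UNIV. fst v $ i * hdot (eX i) w + fst (snd v) $ i * hdot (eY i) w)"
  unfolding axes by (simp add: hdot_def inner_vec_def sum.distrib)
 have 2: "hsymp v w = (\<Sum>i\<in>UNIV. fst v $ i * hsymp (eX i) w + fst (snd v) $ i * hsymp (eY i) w)"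
  unfolding axes by (simp add: hsymp_def inner_vec_def sum.distrib sum_negf sum_subtractf)
 have z: "snd (snd (eX i :: 'a heis)) = 0" "snd (snd (eY i :: 'a heis)) = 0" for i by (simp_all add: eX_def eY_def)
 define c where "c = 1 / (\<integral>w. hker 0 0 w \<partial>(lborel :: 'a heis measure))"
 show ?thesis unfolding hk1_def c_def[symmetric] hker1_def assms 1 2 z
  by (simp add: sum_distrib_left sum_distrib_right algebra_simps flip: sum.distrib)
qed

lemma hk1_mass_bound:
 fixes v :: "'n::finite heis"
 assumes v: "snd (snd v) = 0"
 shows "(LBINT w. \<bar>hk1 v w\<bar>) <= (norm (fst v) + norm (fst (snd v))) * hk1_mass TYPE('n)"
proof -
 let ?N = "norm (fst v) + norm (fst (snd v))"
 have i: "integrable lborel (\<lambda>w. \<bar>hk1 v w\<bar>)" for v :: "'n heis" by (rule good_kernel_integrable(1)[OF good_kernel_hk1])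
 have "(LBINT w. \<bar>hk1 v w\<bar>) <= (\<integral>w. ?N * (\<Sum>i\<in>UNIV. \<bar>hk1 (eX i) w\<bar> + \<bar>hk1 (eY i) w\<bar>) \<partial>(lborel :: 'n heis measure))"
 proof (rule integral_mono)
  show "integrable lborel (\<lambda>w. \<bar>hk1 v w\<bar>)" by (rule i)
  show "integrable lborel (\<lambda>w::'n heis. ?N * (\<Sum>i\<in>UNIV. \<bar>hk1 (eX i) w\<bar> + \<bar>hk1 (eY i) w\<bar>))"
   by (intro integrable_mult_right Bochner_Integration.integrable_sum bintegrable_add i)
  fix w
  have "\<bar>hk1 v w\<bar> <= (\<Sum>i\<in>UNIV. \<bar>fst v $ i * hk1 (eX i) w + fst (snd v) $ i * hk1 (eY i) w\<bar>)"
   unfolding hk1_horizontal[OF v, of w] by (rule sum_abs)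
  also have "\<dots> <= (\<Sum>i\<in>UNIV. ?N * (\<bar>hk1 (eX i) w\<bar> + \<bar>hk1 (eY i) w\<bar>))"
  proof (rule sum_mono)
   fix i
   have c: "\<bar>fst v $ i\<bar> <= ?N" "\<bar>fst (snd v) $ i\<bar> <= ?N"
    using component_le_norm_cart[of "fst v" i] component_le_norm_cart[of "fst (snd v)" i] norm_ge_zero[of "fst v"] norm_ge_zero[of "fst (snd v)"]
    by linarith+
   have "\<bar>fst v $ i * hk1 (eX i) w + fst (snd v) $ i * hk1 (eY i) w\<bar> <= \<bar>fst v $ i\<bar> * \<bar>hk1 (eX i) w\<bar> + \<bar>fst (snd v) $ i\<bar> * \<bar>hk1 (eY i) w\<bar>"
    by (rule order_trans[OF abs_triangle_ineq]) (simp add: abs_mult)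
   also have "\<dots> <= ?N * \<bar>hk1 (eX i) w\<bar> + ?N * \<bar>hk1 (eY i) w\<bar>" using c by (intro add_mono mult_right_mono) auto
   finally show "\<bar>fst v $ i * hk1 (eX i) w + fst (snd v) $ i * hk1 (eY i) w\<bar> <= ?N * (\<bar>hk1 (eX i) w\<bar> + \<bar>hk1 (eY i) w\<bar>)"
    by (simp add: algebra_simps)
  qed
  finally show "\<bar>hk1 v w\<bar> <= ?N * (\<Sum>i\<in>UNIV. \<bar>hk1 (eX i) w\<bar> + \<bar>hk1 (eY i) w\<bar>)" by (simp add: sum_distrib_left)
 qed
 also have "\<dots> = ?N * hk1_mass TYPE('n)"
  unfolding hk1_mass_def integral_mult_right_zero
  by (subst bintegral_sum) (simp_all add: i bintegrable_add bintegral_add)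
 finally show ?thesis .
qed

text \<open>Vertical increments are commutators of horizontal ones.\<close>

lemma horizontal_lipschitz_imp:
 fixes u :: "'n::finite heis => real"
 assumes h: "!!z v. snd (snd v) = 0 ==> \<bar>u (z \<star> v) - u z\<bar> <= L * (norm (fst v) + norm (fst (snd v)))"
 shows "\<bar>u (z \<star> w) - u z\<bar> <= 2 * L * hnorm w"
proof -
 have vert: "\<bar>u (z \<star> (0, 0, t)) - u z\<bar> <= 2 * L * sqrt \<bar>t\<bar>" for z t
 proof (cases "t = 0")
  case True
  then have "(0, 0, t) = (0 :: 'n heis)" by (simp add: heis_eq_iff)
  then show ?thesis using True by simp
 next
  case False
  \<comment> \<open>Steps of length a and b along conjugate axes have a commutator with central
    coordinate - 4 a b; requiring this to be t with |a| = |b| gives |a| = sqrt |t| / 2.\<close>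
  define a where "a = sqrt \<bar>t\<bar> / 2"
  define b where "b = - t / (4 * a)"
  have a: "0 < a" "4 * a * a = \<bar>t\<bar>" using False by (auto simp: a_def)
  have b: "\<bar>b\<bar> = a" using a by (simp add: b_def field_simps abs_mult)
  \<comment> \<open>Any index will do; one exists because the index type is nonempty.\<close>
  obtain i :: 'n where True by blast
  define x :: "'n heis" where "x = (a *\<^sub>R axis i 1, 0, 0)"
  define y :: "'n heis" where "y = (0, b *\<^sub>R axis i 1, 0)"
  have ab: "a * b = - t / 4" using a by (simp add: b_def)
  have com: "z \<star> (0, 0, t) = z \<star> x \<star> y \<star> (- x) \<star> (- y)"
   using ab by (simp add: hmul_assoc) (simp add: heis_eq_iff hmul_def x_def y_def inner_axis_axis algebra_simps)
  have n: "norm (fst x) + norm (fst (snd x)) = a" "norm (fst y) + norm (fst (snd y)) = a"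
   "norm (fst (- x)) + norm (fst (snd (- x))) = a" "norm (fst (- y)) + norm (fst (snd (- y))) = a"
   using a b by (simp_all add: x_def y_def norm_axis_1)
  have s: "snd (snd x) = 0" "snd (snd y) = 0" "snd (snd (- x)) = 0" "snd (snd (- y)) = 0" by (simp_all add: x_def y_def)
  have "\<bar>u (z \<star> (0, 0, t)) - u z\<bar> <= 4 * (L * a)"
   unfolding com using h[OF s(1), of z] h[OF s(2), of "z \<star> x"] h[OF s(3), of "z \<star> x \<star> y"] h[OF s(4), of "z \<star> x \<star> y \<star> (- x)"]
   unfolding n by linarith
  then show ?thesis by (simp add: a_def)
 qed
 \<comment> \<open>The hypothesis for a unit step along one axis forces the constant to be
   nonnegative.\<close>
 have L: "0 <= L" using h[of "(axis undefined 1, 0, 0)" 0] by (simp add: norm_axis_1)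
 define v :: "'n heis" where "v = (fst w, fst (snd w), 0)"
 have w: "w = v \<star> (0, 0, snd (snd w))" by (simp add: heis_eq_iff hmul_def v_def)
 have "\<bar>u (z \<star> w) - u z\<bar> <= \<bar>u (z \<star> v \<star> (0, 0, snd (snd w))) - u (z \<star> v)\<bar> + \<bar>u (z \<star> v) - u z\<bar>"
  by (subst w, simp add: hmul_assoc)
 also have "\<dots> <= 2 * L * sqrt \<bar>snd (snd w)\<bar> + L * (norm (fst w) + norm (fst (snd w)))"
  using vert[of "z \<star> v" "snd (snd w)"] h[of v z] by (simp add: v_def)
 also have "\<dots> <= 2 * L * hnorm w" using L by (simp add: hnorm_def algebra_simps)
 finally show ?thesis .
qed

definition green_lip :: "'n::finite itself => real" where
 "green_lip t = 2 * (hk1_mass t * (LBINT e. \<bar>green_weight' 1 e\<bar>))"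

text \<open>The constant depends on \<open>f\<close> only through its supremum. This makes
  resolvents of uniformly bounded functions equicontinuous.\<close>

lemma green_lipschitz:
 fixes f :: "'n::finite heis => real"
 assumes f: "borel_fun f" "!!z. \<bar>f z\<bar> <= B"
 shows "\<bar>green f (z \<star> w) - green f z\<bar> <= B * green_lip TYPE('n) * hnorm w"
proof -
 let ?I = "(LBINT e. \<bar>green_weight' 1 e\<bar>)"
 have B: "0 <= B" using f(2)[of 0] by simp
 have I: "0 <= ?I" by (intro integral_nonneg_AE) auto
 have "\<bar>green f (z \<star> v) - green f z\<bar> <= (B * hk1_mass TYPE('n) * ?I) * (norm (fst v) + norm (fst (snd v)))"
  if v: "snd (snd v) = 0" for z v
 proof -
  have "\<bar>wavg (green_weight' 1) (hk1 v) f y\<bar> <= B * (LBINT w. \<bar>hk1 v w\<bar>) * ?I" for y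
   by (rule wavg_bound[OF green_weight'_integrable good_kernel_integrable(2)[OF good_kernel_hk1] f]) simp
  from flow_deriv_increment_bound[OF green_flow_horizontal[OF f v] this, of z 1]
  have "\<bar>green f (z \<star> v) - green f z\<bar> <= B * (LBINT w. \<bar>hk1 v w\<bar>) * ?I" by simp
  also have "\<dots> <= B * ((norm (fst v) + norm (fst (snd v))) * hk1_mass TYPE('n)) * ?I"
   by (intro mult_right_mono[OF _ I] mult_left_mono[OF _ B] hk1_mass_bound v)
  finally show ?thesis by (simp add: mult_ac)
 qed
 from horizontal_lipschitz_imp[OF this, of z w] show ?thesis by (simp add: green_lip_def mult_ac)
qed

lemma lipschitz_continuous:
 fixes u :: "'n::finite heis => real"
 assumes h: "!!z w. \<bar>u (z \<star> w) - u z\<bar> <= L * hnorm w powr \<alpha>" and \<alpha>: "0 < \<alpha>"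
 shows "cont_UNIV u"
proof (rule continuous_at_imp_continuous_on, rule ballI)
 fix z :: "'n heis"
 have c: "((\<lambda>y. L * hnorm (- z \<star> y) powr \<alpha>) \<longlongrightarrow> L * hnorm (- z \<star> z) powr \<alpha>) (at z)"
 proof -
  have "isCont (\<lambda>y. hnorm (- z \<star> y)) z"
   using continuous_on_compose2[OF continuous_on_hnorm[of UNIV] continuous_on_hmul[OF continuous_on_const continuous_on_id, of UNIV "- z"]]
   by (simp add: continuous_on_eq_continuous_at)
  then show ?thesis using \<alpha> unfolding isCont_def by (intro tendsto_mult tendsto_const tendsto_powr') (auto intro!: always_eventually simp: hnorm_nonneg)
 qed
 then have c: "((\<lambda>y. L * hnorm (- z \<star> y) powr \<alpha>) \<longlongrightarrow> 0) (at z)" by simp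
 have "((\<lambda>y. u y - u z) \<longlongrightarrow> 0) (at z)"
 proof (rule Lim_null_comparison[OF always_eventually c], rule allI)
  show "norm (u y - u z) <= L * hnorm (- z \<star> y) powr \<alpha>" for y
   using h[of z "- z \<star> y"] by simp
 qed
 then show "isCont u z" unfolding isCont_def by (simp add: LIM_zero_iff)
qed

lemma green_continuous:
 fixes f :: "'n::finite heis => real"
 assumes f: "borel_fun f" "!!z. \<bar>f z\<bar> <= B"
 shows "cont_UNIV (green f)"
 by (rule lipschitz_continuous[where \<alpha>=1 and L="B * green_lip TYPE('n)"]) (simp_all add: hnorm_nonneg green_lipschitz[OF f])

text \<open>If \<open>green f z = 0\<close> then \<open>hk (dil (1 / e) w) = 0\<close> for all \<open>e > 0\<close>, where \<open>z \<star> w\<close> is a point at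
 which \<open>f\<close> is positive; letting \<open>e\<close> tend to infinity contradicts \<open>hk 0 > 0\<close>.\<close>

lemma green_pos:
 fixes f :: "'n::finite heis => real"
 assumes f: "cont_UNIV f" "!!z. 0 <= f z" "!!z. f z <= B" and z0: "0 < f z0"
 shows "0 < green f z"
proof (rule ccontr)
 assume neg: "\<not> 0 < green f z"
 have fm[measurable]: "borel_fun f" using f(1) by (rule borel_continuous)
 have b: "\<bar>f z\<bar> <= B" for z using f(2,3)[of z] by simp
 have zero: "green_weight e * avg e hk f z = 0" for e
 proof (rule nonneg_integral_zero_continuous[of "\<lambda>e. green_weight e * avg e hk f z"])
  \<comment> \<open>Written with a maximum, the weight is visibly continuous at 0.\<close>
  have "green_weight = (\<lambda>e. max 0 (e / 2) * exp (- e\<^sup>2 / 4))" by (auto simp: fun_eq_iff green_weight_def max_def)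
  then have "cont_UNIV green_weight" by (rule ssubst) (intro continuous_intros; simp)
  then show "cont_UNIV (\<lambda>e. green_weight e * avg e hk f z)"
   by (intro continuous_intros continuous_on_avg'[OF hk_integrable f(1) b]) auto
  show "0 <= green_weight e * avg e hk f z" for e by (intro mult_nonneg_nonneg green_weight_nonneg avg_hk_bounds(1)[OF fm f(2,3)])
  show "integrable lborel (\<lambda>e. green_weight e * avg e hk f z)" by (rule wavg_integrable[OF green_weight_integrable hk_integrable fm b])
  show "(LBINT e. green_weight e * avg e hk f z) <= 0" using neg by (simp add: green_def wavg_def)
 qed
 have az: "avg e hk f z = 0" if "0 < e" for e using zero[of e] that by (simp add: green_weight_def)
 have ch: "cont_UNIV (hk :: 'n heis => real)" using good_kernel_hk unfolding good_kernel_def by blast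
 define w where "w = - z \<star> z0"
 have hz: "hk (dil (1 / e) w) = 0" if e: "0 < e" for e
 proof -
  have "hk y * f (z \<star> dil e y) = 0" for y
  proof (rule nonneg_integral_zero_continuous[of "\<lambda>y. hk y * f (z \<star> dil e y)"])
   show "cont_UNIV (\<lambda>y. hk y * f (z \<star> dil e y))"
    by (rule continuous_on_mult[OF ch continuous_on_compose2[OF f(1) continuous_on_hmul[OF continuous_on_const continuous_on_dil[OF continuous_on_const continuous_on_id]]]]) simp
   show "0 <= hk y * f (z \<star> dil e y)" for y by (intro mult_nonneg_nonneg hk_nonneg f(2))
   show "integrable lborel (\<lambda>y. hk y * f (z \<star> dil e y))" by (rule avg_integrable[OF hk_integrable fm b])
   show "(LBINT y. hk y * f (z \<star> dil e y)) <= 0" using az[OF e] by (simp add: avg_def)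
  qed
  from this[of "dil (1 / e) w"] show ?thesis using e z0 by (simp add: dil_dil w_def)
 qed
 have "isCont (\<lambda>s. hk (dil s w)) 0"
  using continuous_on_compose2[OF ch continuous_on_dil[OF continuous_on_id continuous_on_const, of UNIV w]]
  by (simp add: continuous_on_eq_continuous_at)
 then have "((\<lambda>s. hk (dil s w)) \<longlongrightarrow> hk (dil 0 w)) (at_right 0)" unfolding isCont_def by (rule tendsto_within_subset) simp
 moreover have "\<forall>\<^sub>F s in at_right 0. hk (dil s w) = 0"
 proof (rule eventually_at_rightI[of 0 1])
  fix s :: real assume "s \<in> {0<..<1}"
  then show "hk (dil s w) = 0" using hz[of "1 / s"] by simp
 qed simp
 ultimately have "hk (dil 0 w) = 0"
  using tendsto_unique[OF trivial_limit_at_right_real _ tendsto_eventually] by blast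
 then show False using hk_origin_pos[where 'n='n] by simp
qed

section \<open>Passing to the limit under the resolvent and equality in Young's inequality\<close>

lemma AE_dil:
 fixes P :: "'n::finite heis => bool"
 assumes "AE y in lborel. P y" and e: "0 < e"
 shows "AE w in lborel. P (z \<star> dil e w)"
proof -
 obtain N where N: "N \<in> null_sets lborel" "{y. \<not> P y} \<subseteq> N"
  using assms(1) unfolding eventually_ae_filter by (auto simp: space_lborel)
 have [measurable]: "N \<in> sets borel" using N(1) by auto
 have "ennreal (e ^ (2 * CARD('n) + 2)) * (NNI w. indicator N (z \<star> dil e w)) = (NNI w. indicator N (z \<star> w))"
  by (rule nn_integral_dil[OF _ e]) measurable
 also have "\<dots> = (NNI w. indicator N w)" by (rule nn_integral_hmul_left) measurable
 also have "\<dots> = 0" using N(1) by (simp add: null_sets_def)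
 finally have "(NNI w. indicator N (z \<star> dil e w)) = 0" using e by simp
 then have "AE w in lborel. indicator N (z \<star> dil e w) = (0 :: ennreal)" by (subst (asm) nn_integral_0_iff_AE) measurable
 then show ?thesis by eventually_elim (use N(2) in \<open>auto simp: indicator_def split: if_splits\<close>)
qed

lemma green_tendsto:
 fixes f :: "nat => 'n::finite heis => real"
 assumes [measurable]: "!!k. borel_fun (f k)" and b: "!!k z. \<bar>f k z\<bar> <= B"
  and g[measurable]: "borel_fun g" and lim: "AE y in lborel. (\<lambda>k. f k y) \<longlonglongrightarrow> g y"
 shows "(\<lambda>k. green (f k) z) \<longlonglongrightarrow> green g z"
 unfolding green_def wavg_def
proof (rule integral_dominated_convergence[where w="\<lambda>e. green_weight e * B"])
 have B: "0 <= B" using b[of 0 0] by simp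
 show "integrable lborel (\<lambda>e. green_weight e * B)" using green_weight_integrable by simp
 show "AE e in lborel. (\<lambda>k. green_weight e * avg e hk (f k) z) \<longlonglongrightarrow> green_weight e * avg e hk g z"
 proof (rule AE_I2)
  fix e :: real
  show "(\<lambda>k. green_weight e * avg e hk (f k) z) \<longlonglongrightarrow> green_weight e * avg e hk g z"
  proof (cases "0 < e")
   case True
   have "(\<lambda>k. avg e hk (f k) z) \<longlonglongrightarrow> avg e hk g z"
    unfolding avg_def
   proof (rule integral_dominated_convergence[where w="\<lambda>w. hk w * B"])
    show "integrable lborel (\<lambda>w::'n heis. hk w * B)" by (intro integrable_mult_left hk_integrable)
    show "AE w in lborel. (\<lambda>k. hk w * f k (z \<star> dil e w)) \<longlonglongrightarrow> hk w * g (z \<star> dil e w)"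
     using AE_dil[OF lim True, of z] by eventually_elim (intro tendsto_intros)
    show "AE w in lborel. norm (hk w * f k (z \<star> dil e w)) <= hk w * B" for k
     using b by (intro AE_I2) (simp add: abs_mult hk_nonneg mult_left_mono)
   qed measurable
   then show ?thesis by (intro tendsto_intros)
  qed (simp add: green_weight_def)
 qed
 show "AE e in lborel. norm (green_weight e * avg e hk (f k) z) <= green_weight e * B" for k
 proof (rule AE_I2)
  fix e :: real
  have "\<bar>avg e hk (f k) z\<bar> <= B"
   using avg_bound[OF hk_integrable assms(1)[of k] b[of k], where e=e and z=z] by (simp add: hk_nonneg integral_hk)
  then show "norm (green_weight e * avg e hk (f k) z) <= green_weight e * B"
   by (simp add: abs_mult green_weight_nonneg mult_left_mono)
 qed
qed measurable

lemma green_translate: "green (\<lambda>z. f (y \<star> z)) z = green f (y \<star> z)"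
 by (simp add: green_def wavg_def avg_def hmul_assoc)

text \<open>A diagonal subsequence converges on a countable dense set, and equicontinuity makes it
  Cauchy everywhere. The general codomain allows several sequences to be treated at once as a
  tuple.\<close>

lemma equicontinuous_convergent_subsequence:
 fixes u :: "nat => 'n::finite heis => 'b::{real_normed_vector, heine_borel}"
 assumes b: "!!k z. norm (u k z) <= B" and h: "!!k z w. norm (u k (z \<star> w) - u k z) <= L * hnorm w"
 obtains s U where "strict_mono (s :: nat => nat)" "!!z. (\<lambda>k. u (s k) z) \<longlonglongrightarrow> U z"
proof -
 obtain D :: "'n heis set" where D: "countable D" "!!X. open X ==> X ~= {} ==> \<exists>d\<in>D. d \<in> X"
  by (rule countable_dense_setE) (rule that)
 obtain s :: "nat => nat" where s: "strict_mono s" "!!x. x \<in> D ==> \<exists>l. (\<lambda>n. u (s n) x) \<longlonglongrightarrow> l"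
  using function_convergent_subsequence[OF D(1), of u B] b by metis
 have L: "0 <= L"
 proof (rule ccontr)
  assume "\<not> 0 <= L"
  moreover have "norm (u 0 (0 \<star> eT) - u 0 0) <= L * hnorm (eT :: 'n heis)" by (rule h)
  moreover have "0 < hnorm (eT :: 'n heis)" by (simp add: hnorm_def eT_def)
  ultimately have "norm (u 0 (0 \<star> eT) - u 0 0) < 0" using mult_neg_pos[of L "hnorm (eT :: 'n heis)"] by linarith
  then show False by simp
 qed
 have "convergent (\<lambda>n. u (s n) z)" for z
 proof (rule Cauchy_convergent, rule CauchyI')
  fix \<epsilon> :: real assume \<epsilon>: "0 < \<epsilon>"
  let ?X = "{d. L * hnorm (- z \<star> d) < \<epsilon> / 3}"
  have "cont_UNIV (\<lambda>d. L * hnorm (- z \<star> d))"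
   by (intro continuous_on_mult continuous_on_const continuous_on_compose2[OF continuous_on_hnorm[of UNIV]] continuous_on_hmul continuous_on_id) simp
  then have "open ?X" by (intro open_Collect_less) auto
  moreover have "z \<in> ?X" using \<epsilon> by simp
  ultimately obtain d where d: "d \<in> D" "L * hnorm (- z \<star> d) < \<epsilon> / 3" using D(2)[of ?X] by blast
  have "Cauchy (\<lambda>n. u (s n) d)" using s(2)[OF d(1)] LIMSEQ_imp_Cauchy by blast
  then obtain N where N: "!!m n. N <= m ==> N <= n ==> norm (u (s m) d - u (s n) d) < \<epsilon> / 3"
   using \<epsilon> unfolding Cauchy_iff by (meson divide_pos_pos zero_less_numeral)
  have near: "norm (u (s m) d - u (s m) z) < \<epsilon> / 3" for m using h[of "s m" z "- z \<star> d"] d(2) by simp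
  show "\<exists>N. \<forall>m\<ge>N. \<forall>n>m. dist (u (s m) z) (u (s n) z) < \<epsilon>"
  proof (intro exI[of _ N] allI impI)
   fix m n assume mn: "N <= m" "m < n"
   have "dist (u (s m) z) (u (s n) z) <= dist (u (s m) z) (u (s m) d) + dist (u (s m) d) (u (s n) d) + dist (u (s n) d) (u (s n) z)"
    using dist_triangle[of "u (s m) z" "u (s n) z" "u (s n) d"] dist_triangle[of "u (s m) z" "u (s n) d" "u (s m) d"] by linarith
   also have "\<dots> < \<epsilon>" using near[of m] near[of n] N[of m n] mn by (simp add: dist_norm norm_minus_commute)
   finally show "dist (u (s m) z) (u (s n) z) < \<epsilon>" .
  qed
 qed
 then have "\<exists>U. \<forall>z. (\<lambda>n. u (s n) z) \<longlonglongrightarrow> U z" unfolding convergent_def by metis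
 then show ?thesis using that s(1) by blast
qed

text \<open>With y fixed, the deficit is nonnegative and vanishes at x, so x is a local minimum and
  the derivative there is zero.\<close>

lemma Youngs_equality_case:
 fixes x y :: real
 assumes e: "1 < r" "1 < q" "1 / r + 1 / q = 1" "0 <= x" "0 <= y" and eq: "x powr r / r + y powr q / q - x * y = 0"
 shows "y = x powr (r - 1)"
proof (cases "x = 0")
 case True
 then show ?thesis using e eq by simp
next
 case False
 then have x: "0 < x" using e by simp
 let ?D = "\<lambda>x. x powr r / r + y powr q / q - x * y"
 have "(?D has_real_derivative (r * x powr (r - 1) / r - y)) (at x)"
  using x e by (auto intro!: derivative_eq_intros)
 moreover have "\<forall>t. \<bar>x - t\<bar> < x --> ?D x <= ?D t"
 proof (intro allI impI)
  fix t assume "\<bar>x - t\<bar> < x"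
  then show "?D x <= ?D t" using Youngs_inequality[OF e(1-3), of t y] e(5) eq by (simp add: abs_if split: if_splits)
 qed
 ultimately have "r * x powr (r - 1) / r - y = 0" using DERIV_local_min x by blast
 then show ?thesis using e by simp
qed

section \<open>Maximising sequences of the dual problem\<close>

context subcritical begin

definition M :: real where "M = (SUP f\<in>{f. adm f}. nrm f)"

lemma bump_adm: obtains f where "adm f" "cont_UNIV f" "0 < f 0"
proof -
 let ?V = "measure lborel (cball (0::'n heis) 1)"
 \<comment> \<open>The factor satisfies c <= 1 and c * V <= 1 for the volume V of the unit ball: the
   first gives f^r <= f <= c, the second bounds the integral by 1.\<close>
 define c where "c = 1 / (1 + ?V)"
 have c: "0 < c" "c <= 1" "c * ?V <= 1" using measure_nonneg[of lborel "cball (0::'n heis) 1"] by (simp_all add: c_def add_pos_nonneg)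
 define f :: "'n heis => real" where "f z = c * max 0 (1 - norm z)" for z
 have cf: "cont_UNIV f" unfolding f_def by (intro continuous_intros)
 have b: "0 <= f z" "f z <= c" for z
  using c mult_left_mono[of "max 0 (1 - norm z)" 1 c] by (auto simp: f_def)
 have le: "f z powr r <= c * indicator (cball 0 1) z" for z
 proof (cases "norm z <= 1")
  case True
  have "f z powr r <= f z powr 1" using b[of z] c exps(1) by (intro powr_mono') auto
  then show ?thesis using b[of z] True by simp
 qed (simp add: f_def max_def)
 have "(NNI z. ennreal (f z powr r)) <= (\<integral>\<^sup>+z. ennreal c * indicator (cball 0 1) z \<partial>(lborel :: 'n heis measure))"
 proof (intro nn_integral_mono)
  show "ennreal (f z powr r) <= ennreal c * indicator (cball 0 1) z" for z
   using le[of z] c by (cases "z \<in> cball 0 1") (auto simp: indicator_def ennreal_leI simp del: mem_cball)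
 qed
 also have "\<dots> = ennreal c * emeasure lborel (cball (0 :: 'n heis) 1)" by (simp add: nn_integral_cmult_indicator)
 also have "emeasure lborel (cball (0 :: 'n heis) 1) = ennreal ?V"
  using emeasure_lborel_cball_finite[of "0 :: 'n heis" 1] by (intro emeasure_eq_ennreal_measure) simp
 also have "ennreal c * ennreal ?V = ennreal (c * ?V)" using c by (simp add: ennreal_mult)
 also have "\<dots> <= 1" using c by (simp add: ennreal_le_1)
 finally have "adm f" unfolding adm_def using b cf borel_continuous by blast
 moreover have "0 < f 0" using c by (simp add: f_def)
 ultimately show ?thesis using that cf by blast
qed

lemma nrm_le_M: "adm f ==> nrm f <= M"
 unfolding M_def by (rule cSUP_upper) (auto intro: bdd_aboveI2 nrm_le_dual)

lemma M_pos: "0 < M"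
proof -
 obtain f where f: "adm f" "cont_UNIV f" "0 < f 0" by (rule bump_adm)
 obtain B where B: "0 < B" "!!z. 0 <= f z" "!!z. f z <= B" "borel_fun f" by (rule adm_bound[OF f(1)]) (rule that)
 have b: "\<bar>f z\<bar> <= B" for z using B(2,3)[of z] by simp
 have pos: "0 < green f z" for z by (rule green_pos[OF f(2) B(2,3) f(3)])
 have "nrm f ~= 0"
 proof
  assume "nrm f = 0"
  then have "(NNI z. ennreal (green f z powr q)) = 0" using nrm_powr(1)[OF f(1)] by simp
  then have "AE z in lborel. ennreal (green f z powr q) = 0" by (subst (asm) nn_integral_0_iff_AE) (use B(4) in measurable)
  then have "AE z in lborel. green f z = 0" by eventually_elim (simp add: pos less_imp_neq[symmetric])
  then have "green f 0 = 0" by (rule AE_zero_continuous[OF green_continuous[OF B(4) b]])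
  then show False using pos[of 0] by simp
 qed
 then show ?thesis using nrm_powr(2)[OF f(1)] nrm_le_M[OF f(1)] by linarith
qed

definition sup_const :: "real => real" where
 "sup_const m = (LBINT e. green_weight e * (S * (1 / e) ^ Q) powr (1 / m))"

text \<open>Near 0 the integrand behaves like e^(1 - Q / m), so m has to exceed Q / 2 = n +
  1.\<close>

lemma sup_const_integrable:
 assumes m: "real CARD('n) + 1 < m"
 shows "integrable lborel (\<lambda>e. green_weight e * (S * (1 / e) ^ Q) powr (1 / m))"
proof -
 have "real Q * (1 / m) < 2" using m by (simp add: Q_def field_simps)
 then have "integrable lborel (\<lambda>e. S powr (1 / m) * (green_weight e * e powr (- real Q * (1 / m))))"
  by (intro integrable_mult_right green_weight_powr_integrable) linarith
 also have "(\<lambda>e. S powr (1 / m) * (green_weight e * e powr (- real Q * (1 / m)))) = (\<lambda>e. green_weight e * (S * (1 / e) ^ Q) powr (1 / m))"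
 proof
  fix e
  show "S powr (1 / m) * (green_weight e * e powr (- real Q * (1 / m))) = green_weight e * (S * (1 / e) ^ Q) powr (1 / m)"
  proof (cases "0 < e")
   case True
   have "(S * (1 / e) ^ Q) powr (1 / m) = S powr (1 / m) * ((1 / e) ^ Q) powr (1 / m)"
    by (rule powr_mult)
   then show ?thesis using powr_inverse_power[OF True, of "1 / m"] by simp
  qed (simp add: green_weight_def)
 qed
 finally show ?thesis .
qed

text \<open>The supremum of the resolvent grows only like a power below 1 of the supremum of
  \<open>f\<close>, because the L^r norm is normalised.\<close>

lemma green_adm_sup:
 assumes f: "adm f" and fL: "!!z. f z <= \<Lambda>" and L: "0 < \<Lambda>" and m: "real CARD('n) + 1 < m"
 shows "green f z <= sup_const m * \<Lambda> powr ((m - r) / m)"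
proof -
 have "(1::real) <= real CARD('n)" by simp
 then have rm: "r <= m" "0 < m" using m exps(2) by linarith+
 obtain B where B: "0 < B" "!!z. 0 <= f z" "!!z. f z <= B" "borel_fun f" by (rule adm_bound[OF f]) (rule that)
 have b: "\<bar>f z\<bar> <= B" for z using B(2,3)[of z] by simp
 have "green f z <= (LBINT e. \<Lambda> powr ((m - r) / m) * (green_weight e * (S * (1 / e) ^ Q) powr (1 / m)))"
  unfolding green_def wavg_def
 proof (rule integral_mono)
  show "integrable lborel (\<lambda>e. green_weight e * avg e hk f z)" by (rule wavg_integrable[OF green_weight_integrable hk_integrable B(4) b])
  show "integrable lborel (\<lambda>e. \<Lambda> powr ((m - r) / m) * (green_weight e * (S * (1 / e) ^ Q) powr (1 / m)))"
   by (intro integrable_mult_right sup_const_integrable m)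
  fix e :: real
  show "green_weight e * avg e hk f z <= \<Lambda> powr ((m - r) / m) * (green_weight e * (S * (1 / e) ^ Q) powr (1 / m))"
  proof (cases "0 < e")
   case True
   have "avg e hk f z <= (\<Lambda> powr (m - r) * (S * (1 / e) ^ Q)) powr (1 / m)" by (rule avg_adm_sup[OF f fL L rm(1) True])
   also have "\<dots> = \<Lambda> powr ((m - r) / m) * (S * (1 / e) ^ Q) powr (1 / m)"
    by (simp only: powr_mult powr_powr) simp
   finally have "green_weight e * avg e hk f z <= green_weight e * (\<Lambda> powr ((m - r) / m) * (S * (1 / e) ^ Q) powr (1 / m))"
    by (intro mult_left_mono green_weight_nonneg)
   then show ?thesis by (simp add: mult_ac)
  qed (simp add: green_weight_def)
 qed
 also have "\<dots> = sup_const m * \<Lambda> powr ((m - r) / m)" by (simp add: sup_const_def)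
 finally show ?thesis .
qed

lemma improve_le:
 assumes f: "adm f" and n: "M / 2 <= nrm f" and G: "!!z. green f z <= G"
 shows "improve f z <= (2 * G / M) powr p"
proof -
 obtain B where B: "0 < B" "!!z. 0 <= f z" "!!z. f z <= B" "borel_fun f" by (rule adm_bound[OF f]) (rule that)
 note g = green_bounds(1)[OF B(4,2,3)]
 have "green f z / nrm f <= G / (M / 2)" using g[of z] G[of z] n M_pos by (intro frac_le) auto
 then show ?thesis unfolding improve_def using g[of z] n M_pos p1 by (intro powr_mono2) (auto simp: mult_ac)
qed

text \<open>One step of \<open>improve\<close> raises the supremum bound to the power \<theta> = p
  (m - r) / m, which is below 1 when m < (p + 1) / (p - 1). Integrability demands m > n + 1, and the
  window for m is nonempty exactly in the subcritical range.\<close>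

lemma improve_contraction:
 obtains A \<theta> where "1 <= A" "\<theta> < 1"
  "!!f \<Lambda> z. adm f ==> M / 2 <= nrm f ==> 0 < \<Lambda> ==> \<forall>z. f z <= \<Lambda> ==> improve f z <= A * \<Lambda> powr \<theta>"
proof -
 have "(real CARD('n) + 1) < (p + 1) / (p - 1)" using p1 p2 by (simp add: field_simps)
 then obtain m where m: "real CARD('n) + 1 < m" "m < (p + 1) / (p - 1)" using dense by blast
 have m0: "0 < m" using m by linarith
 define \<theta> where "\<theta> = (m - r) / m * p"
 have "m * (p - 1) < p + 1" using m(2) p1 by (simp add: field_simps)
 then have "(m - r) * p < m" using exps(5) by (simp add: q_def algebra_simps)
 then have th: "\<theta> < 1" using m0 by (simp add: \<theta>_def field_simps)
 define A where "A = max 1 ((2 * sup_const m / M) powr p)"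
 have sc: "0 <= sup_const m" unfolding sup_const_def by (intro integral_nonneg_AE) (simp add: green_weight_nonneg)
 have "improve f z <= A * \<Lambda> powr \<theta>"
  if f: "adm f" "M / 2 <= nrm f" "0 < \<Lambda>" "\<forall>z. f z <= \<Lambda>" for f \<Lambda> z
 proof -
  have "improve f z <= (2 * (sup_const m * \<Lambda> powr ((m - r) / m)) / M) powr p"
   by (rule improve_le[OF f(1,2) green_adm_sup[OF f(1) spec[OF f(4)] f(3) m(1)]])
  also have "2 * (sup_const m * \<Lambda> powr ((m - r) / m)) / M = (2 * sup_const m / M) * \<Lambda> powr ((m - r) / m)" by simp
  also have "\<dots> powr p = (2 * sup_const m / M) powr p * \<Lambda> powr \<theta>" unfolding powr_mult powr_powr \<theta>_def ..
  also have "\<dots> <= A * \<Lambda> powr \<theta>" by (intro mult_right_mono) (auto simp: A_def)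
  finally show ?thesis .
 qed
 with th show ?thesis by (intro that[of A \<theta>]) (auto simp: A_def)
qed

text \<open>Each application of \<open>improve\<close> halves the bound of a function as long as it exceeds \<open>L\<close>.\<close>

lemma bounded_maximisers:
 obtains L where "0 < L" "!!f. adm f ==> M / 2 <= nrm f ==> \<exists>g. adm g \<and> nrm f <= nrm g \<and> (\<forall>z. g z <= L)"
proof -
 obtain A \<theta> where A: "1 <= A" "\<theta> < 1"
  "!!f \<Lambda> z. adm f ==> M / 2 <= nrm f ==> 0 < \<Lambda> ==> \<forall>z. f z <= \<Lambda> ==> improve f z <= A * \<Lambda> powr \<theta>"
  by (rule improve_contraction) (rule that)
 \<comment> \<open>The threshold solves \<open>A * L powr \<theta> = L / 2\<close>; since \<theta> <
   1, every bound above it is at least halved.\<close>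
 define L where "L = (2 * A) powr (1 / (1 - \<theta>))"
 have L: "0 < L" using A(1) by (simp add: L_def)
 have half: "A * \<Lambda> powr \<theta> <= \<Lambda> / 2" if "L <= \<Lambda>" for \<Lambda>
 proof -
  have \<Lambda>: "0 < \<Lambda>" using L that by simp
  have "2 * A = L powr (1 - \<theta>)" using A by (simp add: L_def powr_powr)
  also have "\<dots> <= \<Lambda> powr (1 - \<theta>)" using A(2) L that by (intro powr_mono2) auto
  finally have "2 * A * \<Lambda> powr \<theta> <= \<Lambda> powr (1 - \<theta>) * \<Lambda> powr \<theta>" by (intro mult_right_mono) auto
  also have "\<dots> = \<Lambda>" using \<Lambda> by (simp add: powr_add[symmetric])
  finally show ?thesis by simp
 qed
 have step: "\<exists>g. adm g \<and> nrm f <= nrm g \<and> (\<forall>z. g z <= L)"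
  if "adm f" "M / 2 <= nrm f" "!!z. f z <= L * 2 ^ k" for f k
  using that
 proof (induction k arbitrary: f)
  case 0
  then show ?case by auto
 next
  case (Suc k)
  have n: "0 < nrm f" using Suc.prems(2) M_pos by linarith
  have 1: "nrm f <= nrm (improve f)" by (rule nrm_improve[OF Suc.prems(1) n])
  have "improve f z <= L * 2 ^ k" for z
  proof -
   have "L * 1 <= L * 2 ^ Suc k" using L by (intro mult_left_mono one_le_power) auto
   then have "A * (L * 2 ^ Suc k) powr \<theta> <= L * 2 ^ Suc k / 2" by (intro half) simp
   moreover have "improve f z <= A * (L * 2 ^ Suc k) powr \<theta>" using L Suc.prems by (intro A(3)) auto
   ultimately show ?thesis by simp
  qed
  from Suc.IH[OF adm_improve[OF Suc.prems(1) n] _ this] 1 Suc.prems(2) show ?case by (meson order_trans)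
 qed
 have "\<exists>g. adm g \<and> nrm f <= nrm g \<and> (\<forall>z. g z <= L)" if f: "adm f" "M / 2 <= nrm f" for f
 proof -
  obtain B where B: "0 < B" "!!z. 0 <= f z" "!!z. f z <= B" "borel_fun f" by (rule adm_bound[OF f(1)]) (rule that)
  obtain k where "B / L < 2 ^ k" using real_arch_pow[of 2 "B / L"] by auto
  then have "B <= L * 2 ^ k" using L by (simp add: field_simps)
  then show ?thesis using step[OF f] B(3) by (meson order_trans)
 qed
 then show ?thesis using that L by blast
qed

lemma adm_translate:
 assumes f: "adm f" shows "adm (\<lambda>z. f (y \<star> z))" and "nrm (\<lambda>z. f (y \<star> z)) = nrm f"
proof -
 note [measurable] = admD(1)[OF f]
 have "(NNI z. ennreal (f (y \<star> z) powr r)) = (NNI z. ennreal (f z powr r))"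
  by (rule nn_integral_hmul_left) measurable
 moreover have "borel_fun (\<lambda>z. f (y \<star> z))" by measurable
 ultimately show "adm (\<lambda>z. f (y \<star> z))" using f unfolding adm_def by simp blast
 have "(NNI z. ennreal (green f (y \<star> z) powr q)) = (NNI z. ennreal (green f z powr q))"
  by (rule nn_integral_hmul_left) measurable
 then show "nrm (\<lambda>z. f (y \<star> z)) = nrm f" by (simp add: nrm_def green_translate)
qed

text \<open>The resolvent is bounded in L^r, so a large L^q norm forces a large value somewhere. A
  left translation, which changes neither constraint nor functional, moves that value to the
  origin.\<close>

lemma centred_maximising_sequence:
 obtains L \<delta> a where "0 < \<delta>" "!!k. adm (a k)" "!!k z. a k z <= L" "!!k. M / 2 <= nrm (a k)"
  "(\<lambda>k. nrm (a k)) \<longlonglongrightarrow> M" "!!k. \<delta> <= green (a k) 0"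
proof -
 obtain L where L: "0 < L" "!!f. adm f ==> M / 2 <= nrm f ==> \<exists>g. adm g \<and> nrm f <= nrm g \<and> (\<forall>z. g z <= L)"
  by (rule bounded_maximisers) (rule that)
 \<comment> \<open>If the resolvent stayed below \<delta> everywhere, \<open>green_Lq_le\<close>
   would bound \<open>nrm g powr q\<close> by \<delta>^(q - r), which is only half of (M /
   2)^q.\<close>
 define \<delta> where "\<delta> = ((M / 2) powr q / 2) powr (1 / (q - r))"
 have \<delta>: "0 < \<delta>" using M_pos by (simp add: \<delta>_def)
 have dq: "\<delta> powr (q - r) < (M / 2) powr q" using M_pos exps(2,3) by (simp add: \<delta>_def powr_powr)
 have ex: "\<exists>a. adm a \<and> (\<forall>z. a z <= L) \<and> M / 2 <= nrm a \<and> M - M / 2 * (1 / (real k + 1)) <= nrm a \<and> \<delta> <= green a 0" for k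
 proof -
  let ?t = "M - M / 2 * (1 / (real k + 1))"
  have t: "M / 2 <= ?t" "?t < M" using M_pos by (auto simp: field_simps)
  have "\<exists>f\<in>{f. adm f}. ?t < nrm f"
  proof (rule ccontr)
   assume "\<not> ?thesis"
   then have "M <= ?t" unfolding M_def by (intro cSUP_least) (use bump_adm in \<open>auto simp: not_less\<close>)
   then show False using t by simp
  qed
  then obtain f where f: "adm f" "?t < nrm f" by blast
  then obtain g where g: "adm g" "nrm f <= nrm g" "!!z. g z <= L" using L(2)[OF f(1)] t by force
  have "\<exists>y. \<delta> <= green g y"
  proof (rule ccontr)
   assume "\<not> ?thesis"
   then have "green g y <= \<delta>" for y by (meson linear)
   from green_Lq_le[OF g(1) this] have "nrm g powr q <= \<delta> powr (q - r)" unfolding nrm_powr(1)[OF g(1)] by (simp add: ennreal_le_iff)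
   moreover have "(M / 2) powr q <= nrm g powr q" using f g t M_pos exps by (intro powr_mono2) auto
   ultimately show False using dq by simp
  qed
  then obtain y where y: "\<delta> <= green g y" by blast
  show ?thesis
   by (rule exI[of _ "\<lambda>z. g (y \<star> z)"]) (use adm_translate[OF g(1), of y] g f t y green_translate[of g y 0] in auto)
 qed
 then obtain a where a: "!!k. adm (a k)" "!!k z. a k z <= L" "!!k. M / 2 <= nrm (a k)"
  "!!k. M - M / 2 * (1 / (real k + 1)) <= nrm (a k)" "!!k. \<delta> <= green (a k) 0"
  using choice[of "\<lambda>k a. adm a \<and> (\<forall>z. a z <= L) \<and> M / 2 <= nrm a \<and> M - M / 2 * (1 / (real k + 1)) <= nrm a \<and> \<delta> <= green a 0"] by metis
 have "(\<lambda>k. nrm (a k)) \<longlonglongrightarrow> M"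
 proof (rule tendsto_sandwich)
  show "(\<lambda>k. M - M / 2 * (1 / (real k + 1))) \<longlonglongrightarrow> M" by real_asymp
  show "(\<lambda>k. M) \<longlonglongrightarrow> M" by simp
 qed (use a nrm_le_M in auto)
 then show ?thesis using that[of \<delta> a L] \<delta> a(1,2,3,5) by blast
qed

text \<open>Along a maximising sequence equality holds in Young's inequality in the limit, by Fatou's lemma
 applied to the deficit.\<close>

lemma Youngs_deficit_limit_zero:
 fixes b w :: "nat => 'n heis => real"
 assumes b: "!!k. adm (b k)" and c: "!!k. adm (c k)" "!!k. 0 < N k" "!!k. nrm (c k) <= N k"
  and I: "!!k. (NNI z. ennreal (b k z) * ennreal (green (c k) z)) = ennreal (P k)" "!!k. 0 <= P k" "(\<lambda>k. P k / N k) \<longlonglongrightarrow> 1"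
  and lim: "!!z. (\<lambda>k. b k z) \<longlonglongrightarrow> b' z" "!!z. (\<lambda>k. green (c k) z / N k) \<longlonglongrightarrow> w' z"
  and cont: "cont_UNIV b'" "cont_UNIV w'"
 shows "w' z = b' z powr (r - 1)"
proof -
 define D where "D k z = b k z powr r / r + (green (c k) z / N k) powr q / q - b k z * (green (c k) z / N k)" for k z
 define D' where "D' z = b' z powr r / r + w' z powr q / q - b' z * w' z" for z
 have e: "1 < r" "1 < q" "1 / r + 1 / q = 1" "0 < r" "0 < q" using exps by linarith+
 have g0: "0 <= green (c k) z" for k z using admD[OF c(1)] adm_bound[OF c(1)] green_bounds(1) by metis
 have [measurable]: "borel_fun (b k)" "borel_fun (c k)" for k using admD(1) b c(1) by auto
 have w0: "0 <= green (c k) z / N k" for k z using g0 c(2)[of k] by (intro divide_nonneg_pos) auto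
 have b0: "0 <= b k z" for k z by (rule admD(2)[OF b])
 have lim0: "0 <= b' z" "0 <= w' z" for z
  by (rule LIMSEQ_le_const[OF lim(1)] LIMSEQ_le_const[OF lim(2)], use b0 w0 in blast)+
 have D0: "0 <= D k z" for k z unfolding D_def using Youngs_inequality[OF e(1-3) b0 w0] by simp
 have [measurable]: "borel_fun (D k)" for k unfolding D_def[abs_def] by measurable
 have limD: "(\<lambda>k. D k z) \<longlonglongrightarrow> D' z" for z
  unfolding D_def D'_def using e lim0 b0 w0
  by (intro tendsto_diff tendsto_add tendsto_divide tendsto_mult tendsto_powr' lim tendsto_const) (auto intro: always_eventually)
 \<comment> \<open>Instead of subtracting extended reals, the integral of the product is added on
   both sides: the product contributes \<open>P k / N k\<close>, and the Young terms integrate to at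
   most 1 / r + 1 / q = 1.\<close>
 have int: "(NNI z. ennreal (D k z)) <= ennreal (1 - P k / N k)" for k
 proof -
  have "(NNI z. ennreal (D k z)) + ennreal (P k / N k) =
   (NNI z. ennreal (D k z)) + ennreal (1 / N k) * (NNI z. ennreal (b k z) * ennreal (green (c k) z))"
   using c(2)[of k] I(2)[of k] by (simp add: I(1) ennreal_mult'[symmetric] less_imp_le)
  also have "\<dots> = (NNI z. ennreal (D k z) + ennreal (1 / N k) * (ennreal (b k z) * ennreal (green (c k) z)))"
   by (subst nn_integral_add) (simp_all add: nn_integral_cmult)
  also have "\<dots> = (NNI z. ennreal (1 / r) * ennreal (b k z powr r) + ennreal (1 / (q * N k powr q)) * ennreal (green (c k) z powr q))"
  proof (intro nn_integral_cong)
   fix z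
   have "ennreal (D k z) + ennreal (1 / N k) * (ennreal (b k z) * ennreal (green (c k) z)) = ennreal (D k z + 1 / N k * (b k z * green (c k) z))"
    using c(2)[of k] b0 g0 D0 by (simp add: ennreal_mult'[symmetric] ennreal_plus[symmetric] less_imp_le del: ennreal_plus)
   also have "D k z + 1 / N k * (b k z * green (c k) z) = 1 / r * b k z powr r + 1 / (q * N k powr q) * green (c k) z powr q"
    using c(2)[of k] g0[of k z] by (simp add: D_def powr_divide)
   also have "ennreal \<dots> = ennreal (1 / r) * ennreal (b k z powr r) + ennreal (1 / (q * N k powr q)) * ennreal (green (c k) z powr q)"
    using e by (simp add: ennreal_mult'[symmetric] ennreal_plus[symmetric] del: ennreal_plus)
   finally show "ennreal (D k z) + ennreal (1 / N k) * (ennreal (b k z) * ennreal (green (c k) z)) =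
    ennreal (1 / r) * ennreal (b k z powr r) + ennreal (1 / (q * N k powr q)) * ennreal (green (c k) z powr q)" .
  qed
  also have "\<dots> = ennreal (1 / r) * (NNI z. ennreal (b k z powr r)) + ennreal (1 / (q * N k powr q)) * ennreal (nrm (c k) powr q)"
   by (simp add: nn_integral_add nn_integral_cmult nrm_powr(1)[OF c(1)])
  also have "\<dots> <= ennreal (1 / r) * 1 + ennreal (1 / (q * N k powr q)) * ennreal (N k powr q)"
   using nrm_powr(2)[OF c(1)] c(3) e by (intro add_mono mult_left_mono admD(3)[OF b] ennreal_leI powr_mono2) auto
  also have "\<dots> = ennreal (1 / r + 1 / (q * N k powr q) * N k powr q)"
   using e by (simp add: ennreal_mult'[symmetric] ennreal_plus[symmetric] del: ennreal_plus)
  also have "1 / r + 1 / (q * N k powr q) * N k powr q = 1" using e c(2)[of k] by simp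
  finally have le: "(NNI z. ennreal (D k z)) + ennreal (P k / N k) <= ennreal 1" .
  have "(NNI z. ennreal (D k z)) ~= top"
   using le by (metis ennreal_add_eq_top ennreal_less_top neq_top_trans infinity_ennreal_def top.not_eq_extremum)
  then obtain d where d: "(NNI z. ennreal (D k z)) = ennreal d" "0 <= d"
   by (metis ennreal_cases)
  have "0 <= P k / N k" using I(2)[of k] c(2)[of k] by simp
  then have "d + P k / N k <= 1" using le d by (simp add: ennreal_plus[symmetric] ennreal_le_1 del: ennreal_plus)
  then show ?thesis unfolding d by (intro ennreal_leI) simp
 qed
 have "(NNI z. ennreal (D' z)) = (NNI z. liminf (\<lambda>k. ennreal (D k z)))"
  by (intro nn_integral_cong, rule lim_imp_Liminf[symmetric]) (auto intro!: tendsto_ennrealI limD)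
 also have "\<dots> <= liminf (\<lambda>k. NNI z. ennreal (D k z))" by (rule nn_integral_liminf) measurable
 also have "\<dots> <= liminf (\<lambda>k. ennreal (1 - P k / N k))" by (intro Liminf_mono always_eventually allI int)
 also have "\<dots> = 0"
 proof (rule lim_imp_Liminf)
  have "(\<lambda>k. 1 - P k / N k) \<longlonglongrightarrow> 1 - 1" by (intro tendsto_intros I)
  then show "(\<lambda>k. ennreal (1 - P k / N k)) \<longlonglongrightarrow> 0" using tendsto_ennrealI by fastforce
 qed simp
 finally have z: "(NNI z. ennreal (D' z)) = 0" by simp
 have D'0: "0 <= D' z" for z unfolding D'_def using Youngs_inequality[OF e(1-3) lim0] by simp
 have cD: "cont_UNIV D'" unfolding D'_def using lim0 e
  by (intro continuous_on_diff continuous_on_add continuous_on_divide continuous_on_mult continuous_on_powr' cont continuous_on_const) auto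
 have [measurable]: "borel_fun D'" using cD by (rule borel_continuous)
 have "AE z in lborel. ennreal (D' z) = 0" using z by (subst (asm) nn_integral_0_iff_AE) measurable
 then have "AE z in lborel. D' z = 0" by eventually_elim (use D'0 in \<open>auto simp: antisym\<close>)
 then have "D' z = 0" by (rule AE_zero_continuous[OF cD])
 then show ?thesis using Youngs_equality_case[OF e(1-3) lim0] by (simp add: D'_def)
qed

end

lemma lim_ge: "f \<longlonglongrightarrow> x ==> (!!k. c <= f k) ==> c <= x" and lim_le: "f \<longlonglongrightarrow> x ==> (!!k. f k <= c) ==> x <= c"
 for x :: real
 by (erule LIMSEQ_le_const, blast, erule LIMSEQ_le_const2, blast)

context subcritical begin

text \<open>For three successive iterates a, b, c with resolvent limits u, v, w, the definition of
  \<open>improve\<close> gives v from u and w from v. Symmetry turns the pairing of b with the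
  resolvent of c into \<open>nrm\<close> of b, which tends to M, so equality in Young's inequality
  closes the loop with w = u.\<close>

lemma maximising_pair:
 obtains u v :: "'n heis => real" and B K
 where "!!z. u z = green (\<lambda>z. (v z / M) powr p) z" "!!z. v z = green (\<lambda>z. (u z / M) powr p) z"
  "!!z. 0 <= u z" "!!z. u z <= B" "!!z. 0 <= v z" "!!z. v z <= B"
  "!!z w. \<bar>u (z \<star> w) - u z\<bar> <= K * hnorm w" "!!z w. \<bar>v (z \<star> w) - v z\<bar> <= K * hnorm w"
  "(NNI z. ennreal (u z powr r)) <= 1" "(NNI z. ennreal (v z powr r)) <= 1" "0 < u 0"
proof -
 obtain L \<delta> a where d: "0 < \<delta>" and a: "!!k. adm (a k)" "!!k z. a k z <= L" "!!k. M / 2 <= nrm (a k)"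
  "(\<lambda>k. nrm (a k)) \<longlonglongrightarrow> M" "!!k. \<delta> <= green (a k) 0"
  by (rule centred_maximising_sequence) (rule that)
 define b where "b k = improve (a k)" for k
 define c where "c k = improve (b k)" for k
 have na: "0 < nrm (a k)" for k using a(3)[of k] M_pos by linarith
 have b: "adm (b k)" for k unfolding b_def by (rule adm_improve[OF a(1) na])
 have nab: "nrm (a k) <= nrm (b k)" for k unfolding b_def by (rule nrm_improve[OF a(1) na])
 have nb: "0 < nrm (b k)" "M / 2 <= nrm (b k)" for k using na[of k] nab[of k] a(3)[of k] by linarith+
 have c: "adm (c k)" for k unfolding c_def by (rule adm_improve[OF b nb(1)])
 have nbM: "(\<lambda>k. nrm (b k)) \<longlonglongrightarrow> M"
  by (rule tendsto_sandwich[OF _ _ a(4) tendsto_const]) (auto simp: nab nrm_le_M b)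
 have gb: "!!z. green (a k) z <= L" for k using green_bounds(2)[OF admD(1)[OF a(1)] admD(2)[OF a(1)] a(2)] .
 have bL: "b k z <= (2 * L / M) powr p" for k z unfolding b_def by (rule improve_le[OF a(1,3) gb])
 have gc: "!!z. green (b k) z <= (2 * L / M) powr p" for k using green_bounds(2)[OF admD(1)[OF b] admD(2)[OF b] bL] .
 have cL: "c k z <= (2 * (2 * L / M) powr p / M) powr p" for k z unfolding c_def by (rule improve_le[OF b nb(2) gc])
 define B where "B = max L (max ((2 * L / M) powr p) ((2 * (2 * L / M) powr p / M) powr p))"
 have B: "\<bar>a k z\<bar> <= B" "\<bar>b k z\<bar> <= B" "\<bar>c k z\<bar> <= B" for k z
 proof -
  have "a k z <= B" "b k z <= B" "c k z <= B"
   unfolding B_def using a(2)[of k z] bL[of k z] cL[of k z] by (simp_all only: le_max_iff_disj simp_thms)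
  then show "\<bar>a k z\<bar> <= B" "\<bar>b k z\<bar> <= B" "\<bar>c k z\<bar> <= B"
   using admD(2)[OF a(1), of k z] admD(2)[OF b, of k z] admD(2)[OF c, of k z] by linarith+
 qed
 have B0: "0 <= B" using B(1)[of 0 0] by linarith
 let ?K = "B * green_lip TYPE('n)"
 have g0: "0 <= green (a k) z" "0 <= green (b k) z" "0 <= green (c k) z" for k z
  by (rule green_bounds(1)[OF admD(1)[OF a(1)] admD(2)[OF a(1)] abs_le_D1[OF B(1)]]
   green_bounds(1)[OF admD(1)[OF b] admD(2)[OF b] abs_le_D1[OF B(2)]]
   green_bounds(1)[OF admD(1)[OF c] admD(2)[OF c] abs_le_D1[OF B(3)]])+
 have gB: "green (a k) z <= B" "green (b k) z <= B" "green (c k) z <= B" for k z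
  by (rule green_bounds(2)[OF admD(1)[OF a(1)] admD(2)[OF a(1)] abs_le_D1[OF B(1)]]
   green_bounds(2)[OF admD(1)[OF b] admD(2)[OF b] abs_le_D1[OF B(2)]]
   green_bounds(2)[OF admD(1)[OF c] admD(2)[OF c] abs_le_D1[OF B(3)]])+
 note lips = green_lipschitz[OF admD(1)[OF a(1)] B(1)] green_lipschitz[OF admD(1)[OF b] B(2)] green_lipschitz[OF admD(1)[OF c] B(3)]
 \<comment> \<open>The triple is handled as one sequence so that a single subsequence serves all
   three resolvents.\<close>
 define G where "G k z = (green (a k) z, green (b k) z, green (c k) z)" for k z
 have norm3: "norm (x, y, z) <= \<bar>x\<bar> + \<bar>y\<bar> + \<bar>z\<bar>" for x y z :: real
  using norm_Pair_le[of x "(y, z)"] norm_Pair_le[of y z] by simp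
 have "norm (G k z) <= 3 * B" for k z
  using norm3[of "green (a k) z" "green (b k) z" "green (c k) z"] g0[where k=k and z=z] gB[where k=k and z=z] by (simp add: G_def)
 moreover have "norm (G k (z \<star> w) - G k z) <= (3 * ?K) * hnorm w" for k z w
  using norm3[of "green (a k) (z \<star> w) - green (a k) z" "green (b k) (z \<star> w) - green (b k) z" "green (c k) (z \<star> w) - green (c k) z"]
   lips[of k z w] by (simp add: G_def)
 ultimately obtain s U where s: "strict_mono (s :: nat => nat)" "!!z. (\<lambda>k. G (s k) z) \<longlonglongrightarrow> U z"
  by (rule equicontinuous_convergent_subsequence) (rule that)
 define u v w where "u z = fst (U z)" and "v z = fst (snd (U z))" and "w z = snd (snd (U z))" for z
 have lu: "(\<lambda>k. green (a (s k)) z) \<longlonglongrightarrow> u z" and lv: "(\<lambda>k. green (b (s k)) z) \<longlonglongrightarrow> v z" and lw: "(\<lambda>k. green (c (s k)) z) \<longlonglongrightarrow> w z" for z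
  using tendsto_fst[OF s(2)[of z]] tendsto_fst[OF tendsto_snd[OF s(2)[of z]]] tendsto_snd[OF tendsto_snd[OF s(2)[of z]]]
  by (simp_all add: G_def u_def v_def w_def)
 have u0: "0 <= u z" and uB: "u z <= B" and v0: "0 <= v z" and vB: "v z <= B" and w0: "0 <= w z" for z
  by (rule lim_ge[OF lu g0(1)] lim_le[OF lu gB(1)] lim_ge[OF lv g0(2)] lim_le[OF lv gB(2)] lim_ge[OF lw g0(3)])+
 have lip: "\<bar>u (z \<star> y) - u z\<bar> <= ?K * hnorm y" "\<bar>v (z \<star> y) - v z\<bar> <= ?K * hnorm y" "\<bar>w (z \<star> y) - w z\<bar> <= ?K * hnorm y" for z y
  by (rule lim_le[OF tendsto_rabs[OF tendsto_diff[OF lu lu]] lips(1)] lim_le[OF tendsto_rabs[OF tendsto_diff[OF lv lv]] lips(2)]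
   lim_le[OF tendsto_rabs[OF tendsto_diff[OF lw lw]] lips(3)])+
 have lipc: "cont_UNIV f" if "!!z y. \<bar>f (z \<star> y) - f z\<bar> <= ?K * hnorm y" for f :: "'n heis => real"
  by (rule lipschitz_continuous[where \<alpha>=1 and L="?K"]) (simp_all add: hnorm_nonneg that)
 have cont: "cont_UNIV u" "cont_UNIV v" "cont_UNIV w" by (rule lipc, rule lip)+
 have subs: "(\<lambda>k. nrm (a (s k))) \<longlonglongrightarrow> M" "(\<lambda>k. nrm (b (s k))) \<longlonglongrightarrow> M"
  using LIMSEQ_subseq_LIMSEQ[OF a(4) s(1)] LIMSEQ_subseq_LIMSEQ[OF nbM s(1)] by (simp_all add: o_def)
 have q0: "0 <= green (a k) z / nrm (a k)" "0 <= green (b k) z / nrm (b k)" for k z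
  by (simp_all add: g0 na nb(1) less_imp_le)
 have M: "M ~= 0" "0 < p" using M_pos p1 by auto
 have lb: "(\<lambda>k. b (s k) z) \<longlonglongrightarrow> (u z / M) powr p" for z
  unfolding b_def improve_def
  by (intro tendsto_powr' tendsto_divide lu subs tendsto_const M) (simp add: M q0)
 have lc: "(\<lambda>k. c (s k) z) \<longlonglongrightarrow> (v z / M) powr p" for z
  unfolding c_def improve_def
  by (intro tendsto_powr' tendsto_divide lv subs tendsto_const M) (simp add: M q0)
 have um: "borel_fun (\<lambda>z. (u z / M) powr p)" "borel_fun (\<lambda>z. (v z / M) powr p)"
 proof -
  note [measurable] = cont[THEN borel_continuous]
  show "borel_fun (\<lambda>z. (u z / M) powr p)" "borel_fun (\<lambda>z. (v z / M) powr p)" by measurable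
 qed
 have veq: "v z = green (\<lambda>z. (u z / M) powr p) z" for z
  by (rule LIMSEQ_unique[OF lv green_tendsto[OF admD(1)[OF b] B(2) um(1) AE_I2[OF lb]]])
 have weq: "w z = green (\<lambda>z. (v z / M) powr p) z" for z
  by (rule LIMSEQ_unique[OF lw green_tendsto[OF admD(1)[OF c] B(3) um(2) AE_I2[OF lc]]])
 \<comment> \<open>The pairings tend to M while \<open>nrm\<close> of c stays at most M, so the
   deficit vanishes in the limit. As p (r - 1) = 1, the right side is just u z / M.\<close>
 have "w z / M = ((u z / M) powr p) powr (r - 1)" for z
 proof (rule Youngs_deficit_limit_zero[where b="\<lambda>k. b (s k)" and c="\<lambda>k. c (s k)" and N="\<lambda>_. M" and P="\<lambda>k. nrm (b (s k))"])
  show "(NNI z. ennreal (b (s k) z) * ennreal (green (c (s k)) z)) = ennreal (nrm (b (s k)))" for k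
   unfolding improve_pairing[OF b nb(1), symmetric] c_def[symmetric]
   by (rule green_symmetric[OF admD(1)[OF c] admD(2)[OF c] abs_le_D1[OF B(3)] admD(1)[OF b] admD(2)[OF b] abs_le_D1[OF B(2)]])
  show "(\<lambda>k. nrm (b (s k)) / M) \<longlonglongrightarrow> 1" using tendsto_divide[OF subs(2) tendsto_const[of M]] M_pos by simp
  show "cont_UNIV (\<lambda>z. (u z / M) powr p)"
   using M_pos u0 p1 by (intro continuous_on_powr' continuous_on_divide cont continuous_on_const) auto
  show "cont_UNIV (\<lambda>z. w z / M)" using M_pos by (intro continuous_on_divide cont continuous_on_const) auto
  show "(\<lambda>k. green (c (s k)) z / M) \<longlonglongrightarrow> w z / M" for z using M_pos by (intro tendsto_divide lw tendsto_const) simp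
  show "0 <= nrm (b (s k))" for k using nb(1)[of "s k"] by simp
 qed (rule M_pos nrm_le_M c b lb)+
 then have wu: "w z = u z" for z using M_pos u0[of z] p1 exps(9) by (simp add: powr_powr)
 have fatou: "(NNI z. ennreal (g z powr r)) <= 1"
  if f: "!!k. adm (f k)" and g: "!!z. (\<lambda>k. green (f k) z) \<longlonglongrightarrow> g z" "!!z. 0 <= g z" "!!k z. 0 <= green (f k) z" for f g
 proof -
  have [measurable]: "borel_fun (f k)" for k by (rule admD(1)[OF f])
  have "(NNI z. ennreal (g z powr r)) = (NNI z. liminf (\<lambda>k. ennreal (green (f k) z powr r)))"
   using g exps(1) by (intro nn_integral_cong, intro lim_imp_Liminf[symmetric] tendsto_ennrealI tendsto_powr') auto
  also have "\<dots> <= liminf (\<lambda>k. NNI z. ennreal (green (f k) z powr r))" by (rule nn_integral_liminf) measurable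
  also have "\<dots> <= liminf (\<lambda>k::nat. 1 :: ennreal)" by (intro Liminf_mono always_eventually allI green_adm_integral f)
  also have "\<dots> = 1" by (intro Liminf_const) simp
  finally show ?thesis .
 qed
 show ?thesis
 proof (rule that[of u v B "?K"])
  show "u z = green (\<lambda>z. (v z / M) powr p) z" for z using weq[of z] unfolding wu .
  show "(NNI z. ennreal (u z powr r)) <= 1" by (rule fatou[OF a(1) lu u0 g0(1)])
  show "(NNI z. ennreal (v z powr r)) <= 1" by (rule fatou[OF b lv v0 g0(2)])
  have "\<delta> <= u 0" by (rule LIMSEQ_le_const[OF lu]) (use a(5) in blast)
  then show "0 < u 0" using d by simp
  show "v z = green (\<lambda>z. (u z / M) powr p) z" for z by (rule veq)
  show "0 <= u z" "u z <= B" "0 <= v z" "v z <= B" for z by (rule u0 uB v0 vB)+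
  show "\<bar>u (z \<star> w) - u z\<bar> <= ?K * hnorm w" "\<bar>v (z \<star> w) - v z\<bar> <= ?K * hnorm w" for z w by (rule lip)+
 qed
qed

end

section \<open>Regularity of the resolvent and the maximum principle\<close>

text \<open>The derivative of \<open>green f\<close> along a horizontal \<open>v\<close>, with the
  derivative carried by the kernel.\<close>

definition green1 :: "'n::finite heis => ('n heis => real) => 'n heis => real" where
 "green1 v f = wavg (green_weight' 1) (hk1 v) f"

text \<open>Second horizontal derivatives. The weight is \<open>green_weight e / e^2\<close>, about
  1 / (2 e) near 0 and not integrable; the integral converges through cancellation in the mean zero
  kernel for Hoelder continuous \<open>f\<close>.\<close>

definition green2 :: "'n::finite heis => 'n heis => ('n heis => real) => 'n heis => real" where
 "green2 v v' f = wavg (\<lambda>e. - green_weight' 1 e * (1 / e) ^ 1) (hk2 v v') f"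

lemma green1_bounded:
 assumes "borel_fun f" "!!z. \<bar>f z\<bar> <= B"
 obtains C where "!!z. \<bar>green1 v f z\<bar> <= C"
 unfolding green1_def using wavg_bound[OF green_weight'_integrable good_kernel_integrable(2)[OF good_kernel_hk1] assms] that
 by (metis Suc_1 lessI)

lemma green1_continuous:
 assumes "cont_UNIV f" "!!z. \<bar>f z\<bar> <= B" shows "cont_UNIV (green1 v f)"
 unfolding green1_def by (rule continuous_on_wavg[OF green_weight'_integrable good_kernel_integrable(2)[OF good_kernel_hk1] assms]) simp

text \<open>The cancellation contributes e^\<alpha>, turning the borderline weight 1 / e into the
  integrable e^(\<alpha> - 1).\<close>

lemma
 fixes f :: "'n::finite heis => real"
 assumes f: "borel_fun f" "!!z. \<bar>f z\<bar> <= B"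
  and h: "!!z w. \<bar>f (z \<star> w) - f z\<bar> <= L * hnorm w powr \<alpha>" and \<alpha>: "0 < \<alpha>" "\<alpha> <= 1" and L: "0 <= L"
  and v': "snd (snd v') = 0"
 shows green1_flow: "flow_deriv v' (green1 v f) (green2 v v' f)"
  and green2_bounded: "\<exists>C. \<forall>z. \<bar>green2 v v' f z\<bar> <= C"
  and green2_integrable: "!!z. integrable lborel (\<lambda>e. - green_weight' 1 e * (1 / e) ^ 1 * avg e (hk2 v v') f z)"
  and green2_continuous: "cont_UNIV f ==> cont_UNIV (green2 v v' f)"
proof -
 have i: "integrable lborel (\<lambda>e. green_weight' 1 e * (1 / e) ^ 1 * e powr \<alpha>)"
 proof -
  have "integrable lborel (\<lambda>e. - (green_weight e * (1 / e) ^ 2 * e powr \<alpha>))"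
   using \<alpha> by (intro integrable_minus green_weight_div_integrable) simp
  then show ?thesis by (simp add: green_weight'_def power2_eq_square mult_ac)
 qed
 have \<omega>0: "green_weight' 1 e = 0" if "e <= 0" for e using that by (simp add: green_weight'_def green_weight_def)
 note w = wavg_flow_deriv[OF good_kernel_hk1 good_kernel_hk2 rderiv_hk1 f h less_imp_le[OF \<alpha>(1)] \<alpha>(2) L dil_horizontal[OF v'] green_weight'_integrable \<omega>0 i]
 show "flow_deriv v' (green1 v f) (green2 v v' f)" unfolding green1_def green2_def by (rule w(1)) simp_all
 show "\<exists>C. \<forall>z. \<bar>green2 v v' f z\<bar> <= C" unfolding green2_def by (rule w(2)) simp_all
 show "!!z. integrable lborel (\<lambda>e. - green_weight' 1 e * (1 / e) ^ 1 * avg e (hk2 v v') f z)" by (rule w(3)) simp_all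
 show "cont_UNIV f ==> cont_UNIV (green2 v v' f)" unfolding green2_def by (rule w(4)) simp_all
qed

lemma avg_hk_deriv:
 fixes f :: "'n::finite heis => real"
 assumes f: "borel_fun f" "!!z. \<bar>f z\<bar> <= B" and e: "0 < e"
 shows "((\<lambda>e. avg e hk f z) has_real_derivative
  (\<Sum>i\<in>UNIV. avg e (hk2 (eX i) (eX i)) f z + avg e (hk2 (eY i) (eY i)) f z) / (2 * e)) (at e)"
proof -
 define c where "c = 1 / (\<integral>w. hker 0 0 w \<partial>(lborel :: 'n heis measure))"
 have 1: "(\<lambda>e. avg e hk f z) = (\<lambda>e. c * avg e (hker 0 0) f z)"
  unfolding hk_eq_cmult c_def[symmetric] by (simp add: avg_def mult.assoc fun_eq_iff)
 have i: "integrable lborel (\<lambda>w. hk2 v v' w * f (z \<star> dil e w))" for v v'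
  by (rule avg_integrable[OF good_kernel_integrable(2)[OF good_kernel_hk2] f])
 have "(\<Sum>i\<in>UNIV. avg e (hk2 (eX i) (eX i)) f z + avg e (hk2 (eY i) (eY i)) f z) =
  (LBINT w. (\<Sum>i\<in>UNIV. hk2 (eX i) (eX i) w * f (z \<star> dil e w) + hk2 (eY i) (eY i) w * f (z \<star> dil e w)))"
  unfolding avg_def
  by (subst bintegral_sum) (simp_all add: i bintegrable_add bintegral_add)
 also have "\<dots> = c * avg e hlap f z"
  unfolding avg_def hlap_def hk2_def c_def[symmetric] integral_mult_right_zero[symmetric]
  by (intro Bochner_Integration.integral_cong refl) (simp add: sum_distrib_left sum_distrib_right algebra_simps)
 finally show ?thesis unfolding 1 using DERIV_cmult[OF avg_heat_deriv[OF f e, of z], of c] by simp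
qed

text \<open>Integrating the heat equation for \<open>avg e hk f z\<close>, with time \<open>e\<^sup>2 / 4\<close>, against \<open>exp (- e\<^sup>2 / 4)\<close>.\<close>

lemma green_pde:
 fixes f :: "'n::finite heis => real"
 assumes f: "cont_UNIV f" "!!z. \<bar>f z\<bar> <= B"
  and h: "!!z w. \<bar>f (z \<star> w) - f z\<bar> <= L * hnorm w powr \<alpha>" and \<alpha>: "0 < \<alpha>" "\<alpha> <= 1" and L: "0 <= L"
 shows "(\<Sum>i\<in>UNIV. green2 (eX i) (eX i) f z + green2 (eY i) (eY i) f z) = green f z - f z"
proof -
 have fm: "borel_fun f" using f(1) by (rule borel_continuous)
 have ho: "snd (snd (eX i :: 'n heis)) = 0" "snd (snd (eY i :: 'n heis)) = 0" for i by (simp_all add: eX_def eY_def)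
 define H where "H e = (\<Sum>i\<in>UNIV. avg e (hk2 (eX i) (eX i)) f z + avg e (hk2 (eY i) (eY i)) f z)" for e
 \<comment> \<open>This is the boundary term of the integration by parts. It tends to 0 at the scale
   0 because \<open>hk\<close> has mass 1, so the flow starts at \<open>f\<close>, and at infinity
   by the exponential factor.\<close>
 define F where "F e = exp (- e\<^sup>2 / 4) * (avg e hk f z - f z)" for e
 define F' where "F' e = exp (- e\<^sup>2 / 4) * (H e / (2 * e)) - e / 2 * exp (- e\<^sup>2 / 4) * (avg e hk f z - f z)" for e
 let ?w = "\<lambda>e. - green_weight' 1 e * (1 / e) ^ 1"
 note gi = green2_integrable[OF fm f(2) h \<alpha> L ho(1)] green2_integrable[OF fm f(2) h \<alpha> L ho(2)]
 have i1: "integrable lborel (\<lambda>e. ?w e * H e)"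
  unfolding H_def sum_distrib_left distrib_left
  by (intro Bochner_Integration.integrable_sum bintegrable_add gi)
 have s: "(\<Sum>i\<in>UNIV. green2 (eX i) (eX i) f z + green2 (eY i) (eY i) f z) = (LBINT e. ?w e * H e)"
  unfolding H_def sum_distrib_left distrib_left green2_def wavg_def
  by (subst bintegral_sum) (simp_all only: gi bintegrable_add bintegral_add)
 have i2: "integrable lborel (\<lambda>e. green_weight e * avg e hk f z)" by (rule wavg_integrable[OF green_weight_integrable hk_integrable fm f(2)])
 have i3: "integrable lborel (\<lambda>e. green_weight e * f z)" using green_weight_integrable by simp
 have eq: "?w e * H e - (green_weight e * avg e hk f z - green_weight e * f z) = indicator {0<..} e * F' e" for e
  by (cases "0 < e") (simp_all add: green_weight'_def green_weight_def F'_def field_simps)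
 have "(LBINT e=0..\<infinity>. F' e) = 0 - 0"
 proof (rule interval_integral_FTC_integrable)
  fix e :: real assume "0 < ereal e"
  then have e: "0 < e" by simp
  have "(F has_real_derivative F' e) (at e)"
   unfolding F_def F'_def H_def using e
   by (auto intro!: derivative_eq_intros avg_hk_deriv[OF fm f(2) e] simp: field_simps)
  then show "(F has_vector_derivative F' e) (at e)" by (rule has_real_derivative_iff_has_vector_derivative[THEN iffD1])
  have ca: "isCont (\<lambda>e. avg e K f z) e" if "integrable lborel K" for K
   using continuous_on_avg'[OF that f continuous_on_id continuous_on_const, of UNIV z] by (simp add: continuous_on_eq_continuous_at)
  have "isCont H e" unfolding H_def
   by (intro continuous_intros ca good_kernel_integrable(2)[OF good_kernel_hk2])
  then show "isCont F' e" unfolding F'_def using e by (intro continuous_intros ca hk_integrable) auto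
 next
  have "integrable lborel (\<lambda>e. indicator {0<..} e * F' e)" unfolding eq[symmetric]
   by (intro bintegrable_diff i1 i2 i3)
  then show "set_integrable lborel (einterval 0 \<infinity>) F'" by (simp add: set_integrable_def einterval_def greaterThan_def)
  have "isCont (\<lambda>e. avg e hk f z) 0"
   using continuous_on_avg'[OF hk_integrable f continuous_on_id continuous_on_const, of UNIV z] by (simp add: continuous_on_eq_continuous_at)
  moreover have "avg 0 hk f z = f z" by (simp add: avg_def dil_def integral_hk zero_prod_def[symmetric])
  ultimately have "(F \<longlongrightarrow> exp (- 0\<^sup>2 / 4) * (f z - f z)) (at 0)"
   unfolding F_def isCont_def by (intro tendsto_intros) auto
  then have "(F \<longlongrightarrow> 0) (at 0)" by simp
  then have "(F \<longlongrightarrow> 0) (at_right 0)" by (rule tendsto_within_subset) simp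
  then show "((F \<circ> real_of_ereal) \<longlongrightarrow> 0) (at_right 0)"
   unfolding zero_ereal_def ereal_tendsto_simps1 .
  have "((\<lambda>e. exp (- e\<^sup>2 / 4) * (2 * B)) \<longlongrightarrow> 0) at_top" by real_asymp
  moreover have "\<forall>\<^sub>F e in at_top. norm (F e) <= exp (- e\<^sup>2 / 4) * (2 * B)"
  proof (intro always_eventually allI)
   fix e
   have "\<bar>avg e hk f z\<bar> <= B" using avg_bound[OF hk_integrable fm f(2), of e z] by (simp add: hk_nonneg integral_hk)
   then have "\<bar>avg e hk f z - f z\<bar> <= 2 * B" using f(2)[of z] by linarith
   then show "norm (F e) <= exp (- e\<^sup>2 / 4) * (2 * B)" by (simp add: F_def abs_mult)
  qed
  ultimately have "(F \<longlongrightarrow> 0) at_top" by (rule Lim_null_comparison[rotated])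
  then show "((F \<circ> real_of_ereal) \<longlongrightarrow> 0) (at_left \<infinity>)" unfolding ereal_tendsto_simps1 .
 qed simp
 also have "(LBINT e=0..\<infinity>. F' e) = (LBINT e. indicator {0<..} e * F' e)"
  by (simp add: interval_lebesgue_integral_def set_lebesgue_integral_def einterval_def greaterThan_def)
 also have "\<dots> = (LBINT e. ?w e * H e) - ((LBINT e. green_weight e * avg e hk f z) - (LBINT e. green_weight e * f z))"
  unfolding eq[symmetric]
  by (simp only: Bochner_Integration.integral_diff i1 i2 i3 bintegrable_diff)
 finally show ?thesis unfolding s green_def wavg_def by (simp add: integral_green_weight)
qed

section \<open>Decay at infinity and comparison\<close>

lemma powr_lipschitz:
 fixes x y p :: real
 assumes p: "1 < p" and x: "0 <= x" "x <= C" and y: "0 <= y" "y <= C"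
 shows "\<bar>x powr p - y powr p\<bar> <= p * C powr (p - 1) * \<bar>x - y\<bar>"
proof -
 have "y powr p - x powr p <= p * C powr (p - 1) * \<bar>x - y\<bar>" if x: "0 <= x" "x <= C" and y: "0 <= y" "y <= C" for x y
 proof (cases "x <= y")
  case True
  have "y powr p - x powr p <= p * y powr (p - 1) * (y - x)" using powr_tangent[OF p x(1) y(1)] by (simp add: algebra_simps)
  also have "\<dots> <= p * C powr (p - 1) * (y - x)" using p y True by (intro mult_right_mono mult_left_mono powr_mono2) auto
  finally show ?thesis using True by simp
 next
  case False
  then have "y powr p <= x powr p" using p y by (intro powr_mono2) auto
  moreover have "0 <= p * C powr (p - 1) * \<bar>x - y\<bar>" using p by simp
  ultimately show ?thesis by linarith
 qed
 from this[OF x y] this[OF y x] show ?thesis by (simp add: abs_le_iff abs_minus_commute)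
qed

lemma hnorm_small_open: "0 < d ==> open {w :: 'n::finite heis. hnorm w < d}"
 by (intro open_Collect_less continuous_on_hnorm continuous_on_const)

text \<open>A value of at least \<epsilon> far out keeps u above \<epsilon> / 2 on a left translate
  of a fixed neighbourhood, by the Lipschitz bound. Translates have equal measure, so this
  contributes a fixed amount to an arbitrarily small tail of the integral.\<close>

lemma lipschitz_Lr_decay:
 fixes u :: "'n::finite heis => real"
 assumes u0: "!!z. 0 <= u z" and lip: "!!z w. \<bar>u (z \<star> w) - u z\<bar> <= K * hnorm w" and r: "0 < r"
  and I: "(NNI z. ennreal (u z powr r)) < \<infinity>" and \<epsilon>: "0 < \<epsilon>"
 obtains R where "!!z. R < norm z ==> u z < \<epsilon>"
proof -
 have cu: "cont_UNIV u"
  by (rule lipschitz_continuous[where \<alpha>=1 and L=K]) (simp_all add: hnorm_nonneg lip)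
 have [measurable]: "borel_fun u" using cu by (rule borel_continuous)
 define d where "d = \<epsilon> / (2 * (\<bar>K\<bar> + 1))"
 have d: "0 < d" using \<epsilon> by (simp add: d_def)
 define N :: "'n heis set" where "N = {w. hnorm w < d} \<inter> ball 0 1"
 have N: "open N" "0 \<in> N" unfolding N_def using d hnorm_small_open[OF d] by (auto intro: open_Int)
 have Nm[measurable]: "N \<in> sets borel" using N(1) by simp
 have Nfin: "emeasure lborel N < \<infinity>"
  by (rule le_less_trans[OF emeasure_mono emeasure_lborel_ball_finite[of 0 1]]) (auto simp: N_def)
 have N0: "0 < measure lborel N"
 proof -
  have "emeasure lborel N ~= 0"
  proof
   assume "emeasure lborel N = 0"
   then have "AE x in lborel. x \<notin> N" by (intro AE_not_in) (simp add: null_sets_def)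
   then have "negligible N" by (simp add: negligible_iff_emeasure0 \<open>emeasure lborel N = 0\<close>)
   then show False using open_not_negligible[OF N(1)] N(2) by blast
  qed
  then show ?thesis using Nfin by (simp add: measure_def enn2real_positive_iff zero_less_iff_neq_zero)
 qed
 define \<eta> where "\<eta> = (\<epsilon> / 2) powr r * measure lborel N"
 have \<eta>: "0 < \<eta>" using \<epsilon> N0 by (simp add: \<eta>_def)
 have int: "integrable lborel (\<lambda>z. u z powr r)"
  by (rule integrableI_bounded) (use I in \<open>simp_all\<close>)
 obtain W where W: "0 < W" "(LBINT w. indicator {w. W < norm w} w * \<bar>u w powr r\<bar>) < \<eta>"
  by (rule integrable_tail[OF int \<eta>])
 obtain R where R: "!!z e w. e \<in> {0..1} ==> norm w <= 1 ==> R < norm z ==> z \<star> dil e w \<notin> cball (0 :: 'n heis) W"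
  by (rule escape_compact[OF compact_cball]) (rule that)
 have "u z < \<epsilon>" if z: "R < norm z" for z
 proof (rule ccontr)
  assume "\<not> u z < \<epsilon>"
  then have uz: "\<epsilon> <= u z" by simp
  have big: "\<epsilon> / 2 <= u (z \<star> w)" "W < norm (z \<star> w)" if w: "w \<in> N" for w
  proof -
   have "hnorm w < d" "norm w < 1" using w by (simp_all add: N_def)
   have "\<bar>u (z \<star> w) - u z\<bar> <= \<bar>K\<bar> * hnorm w"
    using lip[of z w] hnorm_nonneg[of w] by (meson abs_ge_self mult_right_mono order_trans)
   also have "\<dots> <= (\<bar>K\<bar> + 1) * d" using \<open>hnorm w < d\<close> hnorm_nonneg[of w] by (intro mult_mono) auto
   also have "\<dots> = \<epsilon> / 2" by (simp add: d_def field_simps)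
   finally show "\<epsilon> / 2 <= u (z \<star> w)" using uz by linarith
   show "W < norm (z \<star> w)" using R[of 1 w z] \<open>norm w < 1\<close> z by (simp add: dil_def not_le)
  qed
  have "ennreal \<eta> = (NNI w. ennreal ((\<epsilon> / 2) powr r) * indicator N w)"
   using Nfin by (simp add: \<eta>_def nn_integral_cmult_indicator ennreal_mult emeasure_eq_ennreal_measure)
  also have "\<dots> <= (NNI w. ennreal (indicator {w. W < norm w} (z \<star> w) * \<bar>u (z \<star> w) powr r\<bar>))"
  proof (rule nn_integral_mono)
   fix w
   show "ennreal ((\<epsilon> / 2) powr r) * indicator N w <= ennreal (indicator {w. W < norm w} (z \<star> w) * \<bar>u (z \<star> w) powr r\<bar>)"
   proof (cases "w \<in> N")
    case True
    then show ?thesis using big[OF True] \<epsilon> r by (simp add: ennreal_leI powr_mono2)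
   qed simp
  qed
  also have "\<dots> = (NNI w. ennreal (indicator {w. W < norm w} w * \<bar>u w powr r\<bar>))"
   by (rule nn_integral_hmul_left) measurable
  also have "\<dots> = ennreal (LBINT w. indicator {w. W < norm w} w * \<bar>u w powr r\<bar>)"
   by (rule nn_integral_eq_integral) (use integrable_mult_indicator[of "{w. W < norm w}" lborel "\<lambda>z. u z powr r"] int in simp_all)
  also have "\<dots> < ennreal \<eta>" using W(2) \<eta> by (simp add: ennreal_lessI)
  finally show False by simp
 qed
 then show ?thesis using that by blast
qed

lemma flow_second_deriv_nonpos_at_max:
 fixes w W Wv :: "'n::finite heis => real"
 assumes w: "flow_deriv v w W" "cont_UNIV W" "!!z. \<bar>W z\<bar> <= C"
  and W: "flow_deriv v W Wv" "cont_UNIV Wv" "!!z. \<bar>Wv z\<bar> <= D" and m: "!!z. w z <= w z0"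
 shows "Wv z0 <= 0"
proof -
 have "0 <= - Wv z0"
 proof (rule second_deriv_nonneg_at_min)
  show "((\<lambda>r. - w (z0 \<star> (r *\<^sub>R v))) has_real_derivative - W (z0 \<star> (r *\<^sub>R v))) (at r)" for r
   by (intro DERIV_minus flow_deriv_DERIV[OF w])
  show "((\<lambda>r. - W (z0 \<star> (r *\<^sub>R v))) has_real_derivative - Wv z0) (at 0)"
   using DERIV_minus[OF flow_deriv_DERIV[OF W, of z0 0]] by simp
  show "- w (z0 \<star> (0 *\<^sub>R v)) <= - w (z0 \<star> (r *\<^sub>R v))" for r using m by simp
 qed
 then show ?thesis by simp
qed

lemma flow_deriv_diff:
 assumes u: "flow_deriv v u U" "cont_UNIV U" and w: "flow_deriv v w W" "cont_UNIV W"
 shows "flow_deriv v (\<lambda>z. u z - w z) (\<lambda>z. U z - W z)"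
proof -
 have i: "set_integrable lborel {0..1::real} (\<lambda>s. F (z \<star> ((s * r) *\<^sub>R v)))" if "cont_UNIV F" for F :: "'a heis => real" and z r
  by (intro borel_integrable_atLeastAtMost' continuous_on_compose2[OF that] continuous_on_hmul continuous_on_scaleR
   continuous_on_mult continuous_on_id continuous_on_const) simp
 show ?thesis unfolding flow_deriv_def
 proof (intro allI)
  fix z r
  show "u (z \<star> (r *\<^sub>R v)) - w (z \<star> (r *\<^sub>R v)) - (u z - w z) = r * (LBINT s:{0..1}. U (z \<star> ((s * r) *\<^sub>R v)) - W (z \<star> ((s * r) *\<^sub>R v)))"
   using u(1) w(1) unfolding flow_deriv_def by (simp add: set_integral_diff(2)[OF i[OF u(2)] i[OF w(2)]] right_diff_distrib algebra_simps)
 qed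
qed

text \<open>The elliptic maximum principle. Decay yields a maximum point if the difference is
  positive somewhere; there the second derivatives give \<open>green a - green b <= a - b\<close>,
  and the last hypothesis makes the right side nonpositive.\<close>

lemma green_comparison:
 fixes a b :: "'n::finite heis => real"
 assumes a: "!!z. \<bar>a z\<bar> <= B" "!!z w. \<bar>a (z \<star> w) - a z\<bar> <= L * hnorm w" and b: "!!z. \<bar>b z\<bar> <= B" "!!z w. \<bar>b (z \<star> w) - b z\<bar> <= L * hnorm w"
  and decay: "!!\<epsilon>. 0 < \<epsilon> ==> \<exists>R. \<forall>z. R < norm z --> green a z - green b z < \<epsilon>"
  and le: "!!z. green b z < green a z ==> a z <= b z"
 shows "green a z <= green b z"
proof (rule ccontr)
 assume "\<not> green a z <= green b z"
 define w where "w z = green a z - green b z" for z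
 have pos: "0 < w z" using \<open>\<not> _\<close> by (simp add: w_def)
 have a': "\<bar>a (z \<star> w) - a z\<bar> <= L * hnorm w powr 1" and b': "\<bar>b (z \<star> w) - b z\<bar> <= L * hnorm w powr 1" for z w
  using a(2) b(2) hnorm_nonneg[of w] by simp_all
 have ca: "cont_UNIV a" "cont_UNIV b" by (rule lipschitz_continuous[OF a'], simp, rule lipschitz_continuous[OF b'], simp)
 note am = ca[THEN borel_continuous]
 have L: "0 <= L"
 proof -
  have "0 < hnorm (eT :: 'n heis)" by (simp add: hnorm_def eT_def)
  moreover have "0 <= L * hnorm (eT :: 'n heis)" using a(2)[of 0 eT] by linarith
  ultimately show ?thesis by (simp add: zero_le_mult_iff)
 qed
 have cw: "cont_UNIV w" unfolding w_def by (intro continuous_on_diff green_continuous[OF am(1) a(1)] green_continuous[OF am(2) b(1)])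
 obtain R where R: "!!y. R < norm y ==> w y < w z" using decay[OF pos] unfolding w_def by blast
 have "cball (0 :: 'n heis) (max R (norm z)) ~= {}" using norm_ge_zero[of z] by (simp add: le_max_iff_disj)
 then obtain z0 where z0: "z0 \<in> cball 0 (max R (norm z))" "!!y. y \<in> cball 0 (max R (norm z)) ==> w y <= w z0"
  using continuous_attains_sup[OF compact_cball _ continuous_on_subset[OF cw]] by (metis subset_UNIV)
 have m: "w y <= w z0" for y
 proof (cases "norm y <= max R (norm z)")
  case False
  then have "w y < w z" by (intro R) simp
  then show ?thesis using z0(2)[of z] by (simp add: le_max_iff_disj)
 qed (use z0(2) in simp)
 have second: "green2 v v a z0 - green2 v v b z0 <= 0" if v: "snd (snd v) = 0" for v
 proof -
  obtain C where C: "!!z. \<bar>green1 v a z\<bar> <= C" by (rule green1_bounded[OF am(1) a(1)]) (rule that)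
  obtain C' where C': "!!z. \<bar>green1 v b z\<bar> <= C'" by (rule green1_bounded[OF am(2) b(1)]) (rule that)
  obtain D where D: "!!z. \<bar>green2 v v a z\<bar> <= D" using green2_bounded[OF am(1) a(1) a' _ _ L v, of v] by auto
  obtain D' where D': "!!z. \<bar>green2 v v b z\<bar> <= D'" using green2_bounded[OF am(2) b(1) b' _ _ L v, of v] by auto
  note c1 = green1_continuous[OF ca(1) a(1), of v] green1_continuous[OF ca(2) b(1), of v]
  have c2: "cont_UNIV (green2 v v a)" "cont_UNIV (green2 v v b)"
   by (rule green2_continuous[OF am(1) a(1) a' _ _ L v ca(1)] green2_continuous[OF am(2) b(1) b' _ _ L v ca(2)]; simp)+
  have g: "flow_deriv v (green f) (green1 v f)" if "borel_fun f" "!!z. \<bar>f z\<bar> <= B" for f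
   unfolding green1_def by (rule green_flow_horizontal[OF that v])
  have g1: "flow_deriv v (green1 v a) (green2 v v a)" "flow_deriv v (green1 v b) (green2 v v b)"
   by (rule green1_flow[OF am(1) a(1) a' _ _ L v] green1_flow[OF am(2) b(1) b' _ _ L v]; simp)+
  show ?thesis
  proof (rule flow_second_deriv_nonpos_at_max[where w=w and W="\<lambda>z. green1 v a z - green1 v b z" and Wv="\<lambda>z. green2 v v a z - green2 v v b z"])
   show "flow_deriv v w (\<lambda>z. green1 v a z - green1 v b z)"
    unfolding w_def by (rule flow_deriv_diff[OF g[OF am(1) a(1)] c1(1) g[OF am(2) b(1)] c1(2)])
   show "flow_deriv v (\<lambda>z. green1 v a z - green1 v b z) (\<lambda>z. green2 v v a z - green2 v v b z)"
    by (rule flow_deriv_diff[OF g1(1) c2(1) g1(2) c2(2)])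
   show "\<bar>green1 v a z - green1 v b z\<bar> <= C + C'" for z using C[of z] C'[of z] by linarith
   show "\<bar>green2 v v a z - green2 v v b z\<bar> <= D + D'" for z using D[of z] D'[of z] by linarith
  qed (use m c1 c2 in \<open>simp_all add: continuous_on_diff\<close>)
 qed
 have ho: "snd (snd (eX i :: 'n heis)) = 0" "snd (snd (eY i :: 'n heis)) = 0" for i by (simp_all add: eX_def eY_def)
 have "(green a z0 - a z0) - (green b z0 - b z0) <= 0"
  unfolding green_pde[OF ca(1) a(1) a' zero_less_one order_refl L, symmetric] green_pde[OF ca(2) b(1) b' zero_less_one order_refl L, symmetric] sum_subtractf[symmetric]
 proof (rule sum_nonpos)
  fix i
  show "green2 (eX i) (eX i) a z0 + green2 (eY i) (eY i) a z0 - (green2 (eX i) (eX i) b z0 + green2 (eY i) (eY i) b z0) <= 0"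
   using second[OF ho(1)[of i]] second[OF ho(2)[of i]] by linarith
 qed
 moreover have "0 < w z0" using pos m[of z] by linarith
 ultimately show False using le[of z0] by (simp add: w_def)
qed

lemma green_cmult: "green (\<lambda>z. c * f z) z = c * green f z"
proof -
 have "avg e hk (\<lambda>z. c * f z) z = c * avg e hk f z" for e
  unfolding avg_def integral_mult_right_zero[symmetric] by (simp add: mult.left_commute)
 then show ?thesis unfolding green_def wavg_def integral_mult_right_zero[symmetric] by (simp add: mult.left_commute)
qed

section \<open>A positive fixed point of the resolvent equation\<close>

context subcritical begin

text \<open>The pair satisfies the system symmetrically, so comparison in both directions identifies
  its members; a scalar multiple then removes the constant M.\<close>

lemma green_fixed_point:
 obtains u :: "'n heis => real" and B K
 where "!!z. u z = green (\<lambda>z. u z powr p) z" "!!z. 0 < u z" "!!z. u z <= B"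
  "!!z w. \<bar>u (z \<star> w) - u z\<bar> <= K * hnorm w" "(NNI z. ennreal (u z powr r)) < \<infinity>"
  "!!\<epsilon>. 0 < \<epsilon> ==> \<exists>R. \<forall>z. R < norm z --> u z < \<epsilon>"
proof -
 obtain u v :: "'n heis => real" and B K
  where u: "!!z. u z = green (\<lambda>z. (v z / M) powr p) z" and v: "!!z. v z = green (\<lambda>z. (u z / M) powr p) z"
   and b: "!!z. 0 <= u z" "!!z. u z <= B" "!!z. 0 <= v z" "!!z. v z <= B"
   and lip: "!!z w. \<bar>u (z \<star> w) - u z\<bar> <= K * hnorm w" "!!z w. \<bar>v (z \<star> w) - v z\<bar> <= K * hnorm w"
   and I: "(NNI z. ennreal (u z powr r)) <= 1" "(NNI z. ennreal (v z powr r)) <= 1" and u0: "0 < u 0"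
  by (rule maximising_pair) (rule that)
 note M = M_pos
 have r0: "0 < r" using exps(1) by simp
 have decay: "\<exists>R. \<forall>z. R < norm z --> w z < \<epsilon>"
  if "!!z. 0 <= w z" "!!z y. \<bar>w (z \<star> y) - w z\<bar> <= K * hnorm y" "(NNI z. ennreal (w z powr r)) < \<infinity>" "0 < \<epsilon>"
  for w :: "'n heis => real" and \<epsilon> K
  by (rule lipschitz_Lr_decay[OF that(1,2) r0 that(3,4)]) blast
 define N where "N w z = (w z / M) powr p" for w :: "'n heis => real" and z
 have bd: "\<bar>N w z\<bar> <= (B / M) powr p" if "!!z. 0 <= w z" "!!z. w z <= B" for w z
  unfolding N_def using that[of z] M p1 by (auto intro!: powr_mono2 divide_right_mono)
 have li: "\<bar>N w (z \<star> y) - N w z\<bar> <= (p * (B / M) powr (p - 1) * (K / M)) * hnorm y"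
  if w: "!!z. 0 <= w z" "!!z. w z <= B" "!!z y. \<bar>w (z \<star> y) - w z\<bar> <= K * hnorm y" for w z y
 proof -
  have "\<bar>N w (z \<star> y) - N w z\<bar> <= p * (B / M) powr (p - 1) * \<bar>w (z \<star> y) / M - w z / M\<bar>"
   unfolding N_def using w(1,2)[of z] w(1,2)[of "z \<star> y"] M by (intro powr_lipschitz p1 divide_right_mono) auto
  also have "\<bar>w (z \<star> y) / M - w z / M\<bar> = \<bar>w (z \<star> y) - w z\<bar> / M" using M by (simp add: diff_divide_distrib[symmetric] abs_divide)
  also have "p * (B / M) powr (p - 1) * (\<bar>w (z \<star> y) - w z\<bar> / M) <= p * (B / M) powr (p - 1) * (K * hnorm y / M)"
   using w(3)[of z y] p1 M by (intro mult_left_mono divide_right_mono) auto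
  finally show ?thesis by (simp add: mult_ac)
 qed
 \<comment> \<open>Where w exceeds w', the source \<open>N w'\<close> of w is at most the source
   \<open>N w\<close> of w', as the power is monotone; this is the sign condition of the comparison
   principle.\<close>
 have compare: "w z <= w' z" if w: "!!z. w z = green (N w') z" "!!z. w' z = green (N w) z" "!!z. 0 <= w z" "!!z. w z <= B"
   "!!z. 0 <= w' z" "!!z. w' z <= B" "!!z y. \<bar>w (z \<star> y) - w z\<bar> <= K * hnorm y" "!!z y. \<bar>w' (z \<star> y) - w' z\<bar> <= K * hnorm y"
   "(NNI z. ennreal (w z powr r)) <= 1" for w w' z
 proof -
  have g: "green (N w') = w" "green (N w) = w'" using w(1,2) by (simp_all add: fun_eq_iff del: split_paired_All)
  have "green (N w') z <= green (N w) z"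
  proof (rule green_comparison[OF bd[OF w(5,6)] li[OF w(5,6,8)] bd[OF w(3,4)] li[OF w(3,4,7)]])
   fix \<epsilon> :: real assume \<epsilon>: "0 < \<epsilon>"
   have "(NNI z. ennreal (w z powr r)) < \<infinity>" using w(9) by (rule le_less_trans) simp
   then obtain R where R: "!!z. R < norm z ==> w z < \<epsilon>" using decay[OF w(3,7) _ \<epsilon>] by blast
   have "w y - w' y < \<epsilon>" if "R < norm y" for y using R[OF that] w(5)[of y] by linarith
   then show "\<exists>R. \<forall>z. R < norm z --> green (N w') z - green (N w) z < \<epsilon>" unfolding g by blast
  next
   fix z assume "green (N w) z < green (N w') z"
   then have "w' z < w z" unfolding g .
   then show "N w' z <= N w z" unfolding N_def using w(5)[of z] M p1 by (intro powr_mono2 divide_right_mono) auto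
  qed
  then show ?thesis unfolding g .
 qed
 have uN: "u z = green (N v) z" "v z = green (N u) z" for z unfolding N_def[abs_def] by (rule u v)+
 have uv: "v = u"
 proof
  fix z
  show "v z = u z" by (rule antisym) (rule compare[OF uN(2,1) b(3,4,1,2) lip(2,1) I(2)] compare[OF uN(1,2) b(1,2,3,4) lip(1,2) I(1)])+
 qed
 \<comment> \<open>The multiple c u solves the equation without M if c^p = c M^(-p), that is c =
   M^(- p / (p - 1)).\<close>
 define c where "c = (1 / M) powr (p / (p - 1))"
 have c: "0 < c" using M by (simp add: c_def)
 have cp: "c powr p = c * (1 / M) powr p"
 proof -
  have "p / (p - 1) * p = p / (p - 1) + p" using p1 by (simp add: field_simps)
  then show ?thesis using M by (simp add: c_def powr_powr powr_add)
 qed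
 define U where "U z = c * u z" for z
 have Up: "U z powr p = c * N u z" for z
  using c b(1)[of z] M by (simp add: U_def N_def powr_mult cp powr_divide)
 have U0: "0 <= U z" "U z <= c * B" for z using c b(1,2)[of z] by (simp_all add: U_def)
 have U: "U z = green (\<lambda>z. U z powr p) z" for z
  unfolding Up green_cmult uN(1)[unfolded uv, symmetric] unfolding U_def ..
 have Ulip: "\<bar>U (z \<star> w) - U z\<bar> <= (c * K) * hnorm w" for z w
  using mult_left_mono[OF lip(1)[of z w] less_imp_le[OF c]] c by (simp add: U_def right_diff_distrib[symmetric] abs_mult)
 have cU: "cont_UNIV U"
  by (rule lipschitz_continuous[where \<alpha>=1 and L="c * K"]) (simp_all add: hnorm_nonneg Ulip)
 have [measurable]: "borel_fun u"
  by (rule borel_continuous, rule lipschitz_continuous[where \<alpha>=1 and L=K]) (simp_all add: hnorm_nonneg lip)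
 have UI: "(NNI z. ennreal (U z powr r)) < \<infinity>"
 proof -
  have "(NNI z. ennreal (U z powr r)) = (NNI z. ennreal (c powr r) * ennreal (u z powr r))"
   using c b(1) by (intro nn_integral_cong) (simp add: U_def powr_mult ennreal_mult)
  also have "\<dots> = ennreal (c powr r) * (NNI z. ennreal (u z powr r))" by (rule nn_integral_cmult) measurable
  also have "\<dots> <= ennreal (c powr r) * 1" by (intro mult_left_mono I) simp
  also have "\<dots> < \<infinity>" by simp
  finally show ?thesis .
 qed
 have Upos: "0 < U z" for z
 proof -
  have "0 < green (\<lambda>z. U z powr p) z"
  proof (rule green_pos)
   show "cont_UNIV (\<lambda>z. U z powr p)" using U0(1) p1 by (intro continuous_on_powr' cU continuous_on_const) auto
   show "U z powr p <= (c * B) powr p" for z using U0[of z] p1 by (intro powr_mono2) auto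
   show "0 < U 0 powr p" using c u0 by (simp add: U_def)
  qed simp
  then show ?thesis using U[of z] by simp
 qed
 show ?thesis
  by (rule that[of U "c * B" "c * K"]) (rule U Upos U0(2) Ulip UI decay[OF U0(1) Ulip UI], assumption?)+
qed

end

theorem semilinear_green_solution:
 fixes p :: real
 assumes p1: "1 < p" and p2: "p * real CARD('n::finite) < real CARD('n) + 2"
 obtains u :: "'n::finite heis => real" and B K r
 where "!!z. u z = green (\<lambda>z. u z powr p) z" "!!z. 0 < u z" "!!z. u z <= B"
  "!!z w. \<bar>u (z \<star> w) - u z\<bar> <= K * hnorm w" "1 < r" "r < 2" "(NNI z. ennreal (u z powr r)) < \<infinity>"
  "!!\<epsilon>. 0 < \<epsilon> ==> \<exists>R. \<forall>z. R < norm z --> u z < \<epsilon>"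
proof -
 obtain S where S: "0 < S" "!!w :: 'n heis. \<bar>hk w\<bar> <= S" by (rule good_kernel_bounded[OF good_kernel_hk]) (rule that)
 interpret subcritical p "TYPE('n)" "p + 1" "(p + 1) / p" S
  by unfold_locales (rule p1 p2 refl S(1) abs_le_D1[OF S(2)])+
 show ?thesis by (rule green_fixed_point) (rule that[OF _ _ _ _ exps(1,2)])
qed

section \<open>From derivatives along flows to Frechet derivatives\<close>

text \<open>An increment along a flow is a linear coordinate times an averaged derivative;
  continuity of that average at 0 suffices for differentiability of the product, because the linear
  factor vanishes there.\<close>

lemma linear_times_continuous_derivative:
 fixes l A :: "'a::real_normed_vector => real"
 assumes l: "bounded_linear l" and A: "isCont A 0"
 shows "((\<lambda>h. l h * A h) has_derivative (\<lambda>h. l h * A 0)) (at 0)"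
proof -
 interpret l: bounded_linear l by fact
 obtain K where K: "!!h. norm (l h) <= norm h * K" using l.bounded by blast
 have "((\<lambda>h. norm (A h - A 0) * K) \<longlongrightarrow> norm (A 0 - A 0) * K) (at 0)"
  using A unfolding isCont_def by (intro tendsto_intros)
 then have lim: "((\<lambda>h. norm (A h - A 0) * K) \<longlongrightarrow> 0) (at 0)" by simp
 show ?thesis
 proof (unfold has_derivative_at, intro conjI)
  show "bounded_linear (\<lambda>h. l h * A 0)" by (rule bounded_linear_compose[OF bounded_linear_mult_left l])
  show "((\<lambda>h. norm (l (0 + h) * A (0 + h) - l 0 * A 0 - l h * A 0) / norm h) \<longlongrightarrow> 0) (at 0)"
  proof (rule Lim_null_comparison[OF always_eventually lim], rule allI)
   fix h
   have "norm (l (0 + h) * A (0 + h) - l 0 * A 0 - l h * A 0) = norm (l h) * norm (A h - A 0)"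
    by (simp add: l.zero right_diff_distrib[symmetric] abs_mult)
   also have "\<dots> <= (norm h * K) * norm (A h - A 0)" by (intro mult_right_mono K) simp
   finally show "norm (norm (l (0 + h) * A (0 + h) - l 0 * A 0 - l h * A 0) / norm h) <= norm (A h - A 0) * K"
    by (cases "h = 0") (simp_all add: field_simps)
  qed
 qed
qed

lemma continuous_flow_integral:
 fixes G :: "'n::finite heis => real" and \<gamma> :: "'a::metric_space => real => 'n heis"
 assumes G: "cont_UNIV G" "!!z. \<bar>G z\<bar> <= C" and \<gamma>: "!!s. cont_UNIV (\<lambda>h. \<gamma> h s)" "!!h. cont_UNIV (\<gamma> h)"
 shows "cont_UNIV (\<lambda>h. LBINT s:{0..1}. G (\<gamma> h s))"
 unfolding set_lebesgue_integral_def
proof (rule continuous_integral_dominated)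
 show "cont_UNIV (\<lambda>h. indicator {0..1} s *\<^sub>R G (\<gamma> h s))" for s :: real
  by (intro continuous_on_scaleR continuous_on_const continuous_on_compose2[OF G(1) \<gamma>(1)]) simp
 have [measurable]: "borel_fun (\<lambda>s. G (\<gamma> h s))" for h
  by (intro borel_continuous continuous_on_compose2[OF G(1) \<gamma>(2)]) simp
 show "(\<lambda>s. indicator {0..1} s *\<^sub>R G (\<gamma> h s)) \<in> borel_measurable lborel" for h by measurable
 show "\<bar>indicator {0..1} s *\<^sub>R G (\<gamma> h s)\<bar> <= indicator {0..1} s * C" for h and s :: real
  using G(2)[of "\<gamma> h s"] by (simp add: indicator_def)
 show "integrable lborel (\<lambda>s::real. indicator {0..1} s * C)" by (intro integrable_mult_left integrable_real_indicator) auto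
qed

text \<open>Bounded continuous derivatives of \<open>u\<close> along the left invariant fields; by linearity of
 the horizontal part these flows reach every neighbouring point in two steps, which gives
 Frechet differentiability.\<close>

definition flow_C1 :: "('n::finite heis => real) => ('n => 'n heis => real) => ('n => 'n heis => real) => ('n heis => real) => bool" where
 "flow_C1 u UX UY UT \<longleftrightarrow>
  (\<forall>v. snd (snd v) = 0 --> flow_deriv v u (\<lambda>z. \<Sum>i\<in>UNIV. fst v $ i * UX i z + fst (snd v) $ i * UY i z)) \<and>
  flow_deriv eT u UT \<and>
  (\<forall>i. cont_UNIV (UX i) \<and> (\<exists>C. \<forall>z. \<bar>UX i z\<bar> <= C)) \<and>
  (\<forall>i. cont_UNIV (UY i) \<and> (\<exists>C. \<forall>z. \<bar>UY i z\<bar> <= C)) \<and>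
  cont_UNIV UT \<and> (\<exists>C. \<forall>z. \<bar>UT z\<bar> <= C)"

lemma flow_C1_has_derivative:
 fixes u :: "'n::finite heis => real"
 assumes "flow_C1 u UX UY UT"
 shows "(u has_derivative (\<lambda>h. (\<Sum>i\<in>UNIV. fst h $ i * UX i z + fst (snd h) $ i * UY i z) + (snd (snd h) - 2 * hsymp z h) * UT z)) (at z)"
proof -
 have fl: "!!v. snd (snd v) = 0 ==> flow_deriv v u (\<lambda>z. \<Sum>i\<in>UNIV. fst v $ i * UX i z + fst (snd v) $ i * UY i z)"
  and flT: "flow_deriv eT u UT" and c: "!!i. cont_UNIV (UX i)" "!!i. cont_UNIV (UY i)" "cont_UNIV UT"
  and b: "!!i. \<exists>C. \<forall>z. \<bar>UX i z\<bar> <= C" "!!i. \<exists>C. \<forall>z. \<bar>UY i z\<bar> <= C" "\<exists>C. \<forall>z. \<bar>UT z\<bar> <= C"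
  using assms unfolding flow_C1_def by blast+
 define v :: "'n heis => 'n heis" where "v h = (fst h, fst (snd h), 0)" for h
 \<comment> \<open>After the horizontal step \<open>v h\<close> the central coordinate has moved by
   \<open>2 * hsymp z h\<close>; \<tau> corrects this, so that z + h is reached by one horizontal
   and one central step.\<close>
 define \<tau> :: "'n heis => real" where "\<tau> h = snd (snd h) - 2 * hsymp z h" for h
 define A where "A G h = (LBINT s:{0..1}. G (z \<star> (s *\<^sub>R v h)))" for G :: "'n heis => real" and h
 define C where "C h = (LBINT s:{0..1}. UT (z \<star> v h \<star> ((s * \<tau> h) *\<^sub>R eT)))" for h
 have cv: "continuous_on S v" for S unfolding v_def by (intro continuous_intros)
 have c\<tau>: "continuous_on S \<tau>" for S unfolding \<tau>_def hsymp_def by (intro continuous_intros)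
 have cA: "isCont (A G) 0" if G: "cont_UNIV G" "\<exists>C. \<forall>z. \<bar>G z\<bar> <= C" for G
 proof -
  obtain B where B: "!!z. \<bar>G z\<bar> <= B" using G(2) by blast
  have "cont_UNIV (A G)" unfolding A_def
   by (rule continuous_flow_integral[OF G(1) B]) (intro continuous_on_hmul continuous_on_scaleR continuous_on_const continuous_on_id cv)+
  then show ?thesis by (simp add: continuous_on_eq_continuous_at)
 qed
 have cC: "isCont C 0"
 proof -
  obtain B where B: "!!z. \<bar>UT z\<bar> <= B" using b(3) by blast
  have "cont_UNIV C" unfolding C_def
   by (rule continuous_flow_integral[OF c(3) B])
    (intro continuous_on_hmul continuous_on_scaleR continuous_on_mult continuous_on_const continuous_on_id cv c\<tau>)+
  then show ?thesis by (simp add: continuous_on_eq_continuous_at)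
 qed
 have A0: "A G 0 = G z" for G by (simp add: A_def v_def zero_prod_def[symmetric] set_lebesgue_integral_def)
 have C0: "C 0 = UT z" by (simp add: C_def v_def \<tau>_def hsymp_def zero_prod_def[symmetric] set_lebesgue_integral_def)
 have int: "set_integrable lborel {0..1::real} (\<lambda>s. G (z \<star> (s *\<^sub>R v h)))" if "cont_UNIV G" for G :: "'n heis => real" and h
  by (intro borel_integrable_atLeastAtMost' continuous_on_compose2[OF that] continuous_on_hmul continuous_on_scaleR
   continuous_on_id continuous_on_const) simp
 have eq: "u (z + h) = u z + ((\<Sum>i\<in>UNIV. fst h $ i * A (UX i) h + fst (snd h) $ i * A (UY i) h) + \<tau> h * C h)" for h
 proof -
  have "z + h = z \<star> v h \<star> (\<tau> h *\<^sub>R eT)"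
   by (simp add: heis_eq_iff hmul_def v_def \<tau>_def hsymp_def eT_def)
  then have "u (z + h) - u (z \<star> v h) = \<tau> h * C h"
   using flT unfolding flow_deriv_def C_def by simp
  moreover have "u (z \<star> v h) - u z = (\<Sum>i\<in>UNIV. fst h $ i * A (UX i) h + fst (snd h) $ i * A (UY i) h)"
  proof -
   have "snd (snd (v h)) = 0" by (simp add: v_def)
   from fl[OF this, unfolded flow_deriv_def, rule_format, of z 1]
   have "u (z \<star> v h) - u z = (LBINT s:{0..1}. \<Sum>i\<in>UNIV. fst h $ i * UX i (z \<star> (s *\<^sub>R v h)) + fst (snd h) $ i * UY i (z \<star> (s *\<^sub>R v h)))"
    by (simp add: v_def)
   also have "\<dots> = (\<Sum>i\<in>UNIV. fst h $ i * A (UX i) h + fst (snd h) $ i * A (UY i) h)"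
   proof -
    have i: "integrable lborel (\<lambda>s. a * (indicator {0..1::real} s * UX i (z \<star> (s *\<^sub>R v h))))"
     "integrable lborel (\<lambda>s. a * (indicator {0..1::real} s * UY i (z \<star> (s *\<^sub>R v h))))" for i a
     using int[OF c(1)[of i], of h] int[OF c(2)[of i], of h] by (simp_all add: set_integrable_def)
    have "(LBINT s:{0..1}. \<Sum>i\<in>UNIV. fst h $ i * UX i (z \<star> (s *\<^sub>R v h)) + fst (snd h) $ i * UY i (z \<star> (s *\<^sub>R v h))) =
     (LBINT s. \<Sum>i\<in>UNIV. fst h $ i * (indicator {0..1} s * UX i (z \<star> (s *\<^sub>R v h))) + fst (snd h) $ i * (indicator {0..1} s * UY i (z \<star> (s *\<^sub>R v h))))"
     unfolding set_lebesgue_integral_def by (simp add: sum_distrib_left algebra_simps)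
    also have "\<dots> = (\<Sum>i\<in>UNIV. fst h $ i * A (UX i) h + fst (snd h) $ i * A (UY i) h)"
     unfolding A_def set_lebesgue_integral_def real_scaleR_def integral_mult_right_zero[symmetric]
     by (subst bintegral_sum) (simp_all only: i bintegrable_add bintegral_add)
    finally show ?thesis .
   qed
   finally show ?thesis .
  qed
  ultimately show ?thesis by linarith
 qed
 have bl: "bounded_linear (\<lambda>h::'n heis. fst h $ i)" "bounded_linear (\<lambda>h::'n heis. fst (snd h) $ i)" for i
  by (intro bounded_linear_compose[OF bounded_linear_vec_nth] bounded_linear_compose[OF bounded_linear_fst] bounded_linear_fst bounded_linear_snd)+
 have bt: "bounded_linear \<tau>"
  unfolding \<tau>_def hsymp_def
  by (intro bounded_linear_sub bounded_linear_compose[OF bounded_linear_snd] bounded_linear_snd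
   bounded_linear_const_mult bounded_linear_compose[OF bounded_linear_inner_right] bounded_linear_fst bounded_linear_compose[OF bounded_linear_fst])
 have "((\<lambda>h. u (z + h)) has_derivative (\<lambda>h. 0 + ((\<Sum>i\<in>UNIV. fst h $ i * A (UX i) 0 + fst (snd h) $ i * A (UY i) 0) + \<tau> h * C 0))) (at 0)"
  unfolding eq
  by (intro has_derivative_add has_derivative_const has_derivative_sum linear_times_continuous_derivative bl bt cC cA c b)
 then have "((\<lambda>h. u (z + h)) has_derivative (\<lambda>h. (\<Sum>i\<in>UNIV. fst h $ i * UX i z + fst (snd h) $ i * UY i z) + \<tau> h * UT z)) (at (z - z))"
  by (simp add: A0 C0)
 moreover have "((\<lambda>y. y - z) has_derivative (\<lambda>h. h)) (at z)"
  by (auto intro!: derivative_eq_intros)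
 ultimately have "((\<lambda>y. u (z + (y - z))) has_derivative (\<lambda>h. (\<Sum>i\<in>UNIV. fst h $ i * UX i z + fst (snd h) $ i * UY i z) + \<tau> h * UT z)) (at z)"
  by (rule has_derivative_compose[rotated])
 then show ?thesis by (simp add: \<tau>_def)
qed

text \<open>The term \<open>- 2 * hsymp z h\<close> of the Frechet derivative cancels the coordinate
  coefficient of the t-derivative in \<open>X_field\<close> and \<open>Y_field\<close>.\<close>

lemma flow_C1_fields:
 fixes u :: "'n::finite heis => real"
 assumes u: "flow_C1 u UX UY UT"
 shows "X_field i u = UX i" "Y_field i u = UY i" "d_dt u = UT"
proof -
 note fd = frechet_derivative_at[OF flow_C1_has_derivative[OF u], symmetric]
 have ax: "axis i (1::real) $ j * c = (if j = i then c else 0)" for i j :: 'n and c by (simp add: axis_def)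
 have T: "d_dt u z = UT z" for z by (simp add: d_dt_def fd hsymp_def)
 then show "d_dt u = UT" ..
 show "X_field i u = UX i"
  by (rule ext) (auto simp: X_field_def T d_dx_def fd hsymp_def ax inner_axis algebra_simps)
 show "Y_field i u = UY i"
  by (rule ext) (auto simp: Y_field_def T d_dy_def fd hsymp_def ax inner_axis algebra_simps)
qed

section \<open>Closure properties of \<open>C_k\<close>\<close>

lemma C_k_Suc: "C_k (Suc k) f ==> C_k k f"
proof (induction k arbitrary: f)
 case 0
 then show ?case by (auto intro: differentiable_imp_continuous_on)
next
 case (Suc k)
 then show ?case by (metis C_k.simps(2))
qed

lemma C_k_const: "C_k k (\<lambda>_. c)"
 by (induction k arbitrary: c) (simp_all add: frechet_derivative_const)

lemma C_k_bounded_linear: "bounded_linear l ==> C_k k l"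
proof (cases k)
 case (Suc j)
 assume l: "bounded_linear l"
 then have "frechet_derivative l (at z) = l" for z
  using frechet_derivative_at[OF bounded_linear_imp_has_derivative[OF l]] by metis
 then show ?thesis using l Suc by (simp add: C_k_const bounded_linear_imp_differentiable_on)
qed (simp add: linear_continuous_on)

lemma C_k_add: "C_k k f ==> C_k k g ==> C_k k (\<lambda>z. f z + g z)"
proof (induction k arbitrary: f g)
 case (Suc k)
 then have d: "f differentiable at z" "g differentiable at z" for z by (simp_all add: differentiable_on_def)
 have "frechet_derivative (\<lambda>z. f z + g z) (at z) b = frechet_derivative f (at z) b + frechet_derivative g (at z) b" for z b
  using frechet_derivative_at[OF has_derivative_add[OF d[THEN frechet_derivative_works[THEN iffD1]]]] by metis
 then show ?case using Suc by simp
qed (simp add: continuous_on_add)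

lemma C_k_mult: "C_k k f ==> C_k k g ==> C_k k (\<lambda>z. f z * g z)"
proof (induction k arbitrary: f g)
 case (Suc k)
 then have d: "f differentiable at z" "g differentiable at z" for z by (simp_all add: differentiable_on_def)
 have e: "frechet_derivative (\<lambda>z. f z * g z) (at z) b = f z * frechet_derivative g (at z) b + frechet_derivative f (at z) b * g z" for z b
  using frechet_derivative_at[OF has_derivative_mult[OF d[THEN frechet_derivative_works[THEN iffD1]]]] by metis
 show ?case using Suc.prems unfolding C_k.simps(2) e
  by (auto intro!: C_k_add Suc.IH C_k_Suc[of k f] C_k_Suc[of k g] differentiable_on_mult)
qed (simp add: continuous_on_mult)

lemma C_k_sum: "(!!i. i \<in> I ==> C_k k (f i)) ==> C_k k (\<lambda>z. \<Sum>i\<in>I. f i z)"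
 by (induction I rule: infinite_finite_induct) (simp_all add: C_k_const C_k_add)

lemma C_k_cmult: "C_k k f ==> C_k k (\<lambda>z. c * f z)"
 by (rule C_k_mult[OF C_k_const])

lemma C_k_diff: "C_k k f ==> C_k k g ==> C_k k (\<lambda>z. f z - g z)"
 using C_k_add[OF _ C_k_cmult[of k g "-1"], of f] by simp

lemma flow_C1_C_k:
 fixes u :: "'n::finite heis => real"
 assumes u: "flow_C1 u UX UY UT" and k: "!!i. C_k k (UX i)" "!!i. C_k k (UY i)" "C_k k UT"
 shows "C_k (Suc k) u"
proof -
 note d = flow_C1_has_derivative[OF u]
 note fd = frechet_derivative_at[OF d, symmetric]
 have hs: "bounded_linear (\<lambda>z::'n heis. hsymp z b)" for b
  unfolding hsymp_def
  by (intro bounded_linear_sub bounded_linear_compose[OF bounded_linear_inner_left] bounded_linear_snd bounded_linear_fst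
   bounded_linear_compose[OF bounded_linear_fst])
 have "u differentiable_on UNIV" using d by (auto simp: differentiable_on_def differentiable_def)
 moreover have "C_k k (\<lambda>z. frechet_derivative u (at z) b)" for b
  unfolding fd by (intro C_k_add C_k_sum C_k_cmult C_k_mult C_k_diff C_k_const C_k_bounded_linear hs k)
 ultimately show ?thesis by simp
qed

section \<open>Regularity of solutions\<close>

lemma flow_deriv_unique:
 assumes "flow_deriv v u U" "cont_UNIV U" "!!z. \<bar>U z\<bar> <= C"
  and "flow_deriv v u U'" "cont_UNIV U'" "!!z. \<bar>U' z\<bar> <= C'"
 shows "U = U'"
proof
 fix z
 show "U z = U' z" using DERIV_unique[OF flow_deriv_DERIV[OF assms(1-3), of z 0] flow_deriv_DERIV[OF assms(4-6), of z 0]] by simp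
qed

lemma flow_deriv_chain:
 assumes u: "flow_deriv v u U" "cont_UNIV U" "!!z. \<bar>U z\<bar> <= C"
  and \<phi>: "!!z. (\<phi> has_real_derivative \<phi>' (u z)) (at (u z))" "cont_UNIV (\<lambda>z. \<phi>' (u z))"
 shows "flow_deriv v (\<lambda>z. \<phi> (u z)) (\<lambda>z. \<phi>' (u z) * U z)"
 unfolding flow_deriv_def
proof (intro allI)
 fix z :: "'a heis" and r :: real
 let ?g = "\<lambda>s. \<phi> (u (z \<star> ((s * r) *\<^sub>R v)))"
 let ?g' = "\<lambda>s. \<phi>' (u (z \<star> ((s * r) *\<^sub>R v))) * U (z \<star> ((s * r) *\<^sub>R v)) * r"
 have c: "cont_UNIV (\<lambda>s. z \<star> ((s * r) *\<^sub>R v))"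
  by (intro continuous_on_hmul continuous_on_scaleR continuous_on_mult continuous_on_id continuous_on_const)
 have cc: "continuous_on {0..1} ?g'"
  by (rule continuous_on_subset[of UNIV], intro continuous_on_mult continuous_on_const continuous_on_compose2[OF \<phi>(2) c] continuous_on_compose2[OF u(2) c]) auto
 have d: "(?g has_vector_derivative ?g' s) (at s within {0..1})" for s
 proof -
  have "((\<lambda>s. u (z \<star> ((s * r) *\<^sub>R v))) has_real_derivative U (z \<star> ((s * r) *\<^sub>R v)) * r) (at s)"
   by (rule DERIV_chain2[where f="\<lambda>r. u (z \<star> (r *\<^sub>R v))" and g="\<lambda>s. s * r", OF flow_deriv_DERIV[OF u]])
    (auto intro!: derivative_eq_intros)
  from DERIV_chain2[OF \<phi>(1) this] have "(?g has_real_derivative ?g' s) (at s)" by (simp add: mult.assoc)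
  then show ?thesis using has_real_derivative_iff_has_vector_derivative has_vector_derivative_at_within by blast
 qed
 have "(LBINT s:{0..1}. ?g' s) = ?g 1 - ?g 0"
  unfolding set_lebesgue_integral_def by (rule integral_FTC_atLeastAtMost[OF zero_le_one d cc])
 then show "\<phi> (u (z \<star> (r *\<^sub>R v))) - \<phi> (u z) = r * (LBINT s:{0..1}. \<phi>' (u (z \<star> ((s * r) *\<^sub>R v))) * U (z \<star> ((s * r) *\<^sub>R v)))"
  by (simp add: set_integral_mult_left mult.commute)
qed

text \<open>For exponents up to 1 the power is subadditive, since numbers in [0, 1] only increase
  under it. This covers \<open>u powr (p - 1)\<close> when p <= 2.\<close>

lemma powr_holder:
 fixes x y s :: real
 assumes "0 <= x" "0 <= y" "0 < s" "s <= 1" shows "\<bar>x powr s - y powr s\<bar> <= \<bar>x - y\<bar> powr s"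
proof -
 have "x powr s <= y powr s + (x - y) powr s" if "0 <= y" "y <= x" for x y
 proof (cases "x = 0")
  case False
  then have x: "0 < x" using that by simp
  have "y / x <= (y / x) powr s" "(x - y) / x <= ((x - y) / x) powr s"
   using that x assms powr_mono'[of s 1 "y / x"] powr_mono'[of s 1 "(x - y) / x"] by simp_all
  then have "1 <= (y / x) powr s + ((x - y) / x) powr s" using x by (simp add: diff_divide_distrib)
  then have "x powr s * 1 <= x powr s * ((y / x) powr s + ((x - y) / x) powr s)" by (intro mult_left_mono) auto
  also have "\<dots> = y powr s + (x - y) powr s" using x that by (simp add: powr_divide field_simps)
  finally show ?thesis by simp
 qed (use that in simp)
 moreover have "y powr s <= x powr s" if "0 <= y" "y <= x" for x y using that assms by (intro powr_mono2) auto
 ultimately show ?thesis using assms(1,2) by (cases "y <= x") (smt (verit) abs_minus_commute)+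
qed

text \<open>Small increments use the Lipschitz bound, large ones boundedness; the constants are
  added.\<close>

lemma lipschitz_imp_holder:
 fixes u :: "'n::finite heis => real"
 assumes "!!z. \<bar>u z\<bar> <= B" "!!z w. \<bar>u (z \<star> w) - u z\<bar> <= L * hnorm w" "0 <= L" "0 < \<beta>" "\<beta> <= 1"
 shows "\<bar>u (z \<star> w) - u z\<bar> <= (L + 2 * B) * hnorm w powr \<beta>"
proof -
 have B: "0 <= B" using assms(1)[of 0] by linarith
 show ?thesis
 proof (cases "hnorm w <= 1")
  case True
  have "\<bar>u (z \<star> w) - u z\<bar> <= L * hnorm w powr 1" using assms(2)[of z w] hnorm_nonneg[of w] by simp
  also have "\<dots> <= (L + 2 * B) * hnorm w powr \<beta>"
   using True assms B hnorm_nonneg[of w] by (intro mult_mono powr_mono') auto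
  finally show ?thesis .
 next
  case False
  have "\<bar>u (z \<star> w) - u z\<bar> <= (L + 2 * B) * 1" unfolding mult_1_right using assms(1)[of z] assms(1)[of "z \<star> w"] assms(3) by linarith
  also have "\<dots> <= (L + 2 * B) * hnorm w powr \<beta>" using False assms B by (intro mult_left_mono ge_one_powr_ge_zero) auto
  finally show ?thesis .
 qed
qed

text \<open>The central derivative with all of it on the kernel. Degree two gives a weight of order
  1 / e near 0, as for second horizontal derivatives. It proves that the derivative exists before
  \<open>f\<close> is known to have one.\<close>

definition greenT :: "('n::finite heis => real) => 'n heis => real" where
 "greenT f = wavg (\<lambda>e. - green_weight e * (1 / e) ^ 2) (hk1 eT) f"

lemma
 fixes f :: "'n::finite heis => real"
 assumes f: "cont_UNIV f" "!!z. \<bar>f z\<bar> <= B"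
  and h: "!!z w. \<bar>f (z \<star> w) - f z\<bar> <= L * hnorm w powr \<alpha>" and \<alpha>: "0 < \<alpha>" "\<alpha> <= 1" and L: "0 <= L"
 shows greenT_flow: "flow_deriv eT (green f) (greenT f)"
  and greenT_bounded: "\<exists>C. \<forall>z. \<bar>greenT f z\<bar> <= C"
  and greenT_continuous: "cont_UNIV (greenT f)"
proof -
 have i: "integrable lborel (\<lambda>e. green_weight e * (1 / e) ^ 2 * e powr \<alpha>)"
  using \<alpha> by (intro green_weight_div_integrable) simp
 have \<omega>0: "green_weight e = 0" if "e <= 0" for e using that by (simp add: green_weight_def)
 note w = wavg_flow_deriv[OF good_kernel_hk good_kernel_hk1 rderiv_hk borel_continuous[OF f(1)] f(2) h less_imp_le[OF \<alpha>(1)] \<alpha>(2) L dil_eT green_weight_integrable \<omega>0 i]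
 show "flow_deriv eT (green f) (greenT f)" unfolding green_def greenT_def by (rule w(1)) simp_all
 show "\<exists>C. \<forall>z. \<bar>greenT f z\<bar> <= C" unfolding greenT_def by (rule w(2)) simp_all
 show "cont_UNIV (greenT f)" unfolding greenT_def by (rule w(4)) (simp_all add: f)
qed

text \<open>Derivative kernels are linear in a horizontal direction; this transfers the linearity to
  \<open>green1\<close> and \<open>green2\<close>, as required by \<open>flow_C1\<close>.\<close>

lemma wavg_linear_kernel:
 fixes f :: "'n::finite heis => real"
 assumes K: "!!w. K w = (\<Sum>i\<in>UNIV. a i * K1 i w + b i * K2 i w)"
  and i: "!!i. integrable lborel (K1 i)" "!!i. integrable lborel (K2 i)" and f: "borel_fun f" "!!z. \<bar>f z\<bar> <= B"
  and w: "!!i. integrable lborel (\<lambda>e. \<omega> e * avg e (K1 i) f z)" "!!i. integrable lborel (\<lambda>e. \<omega> e * avg e (K2 i) f z)"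
 shows "wavg \<omega> K f z = (\<Sum>i\<in>UNIV. a i * wavg \<omega> (K1 i) f z + b i * wavg \<omega> (K2 i) f z)"
proof -
 have m: "integrable lborel (\<lambda>w. c * (K1 i w * f (z \<star> dil e w)))" "integrable lborel (\<lambda>w. c * (K2 i w * f (z \<star> dil e w)))" for c i e
  by (intro integrable_mult_right avg_integrable[OF i(1) f] avg_integrable[OF i(2) f])+
 have "avg e K f z = (\<Sum>i\<in>UNIV. a i * avg e (K1 i) f z + b i * avg e (K2 i) f z)" for e
 proof -
  have "avg e K f z = (LBINT w. (\<Sum>i\<in>UNIV. a i * (K1 i w * f (z \<star> dil e w)) + b i * (K2 i w * f (z \<star> dil e w))))"
   unfolding avg_def K sum_distrib_right by (simp add: algebra_simps)
  also have "\<dots> = (\<Sum>i\<in>UNIV. a i * avg e (K1 i) f z + b i * avg e (K2 i) f z)"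
   unfolding avg_def integral_mult_right_zero[symmetric]
   by (subst bintegral_sum) (simp_all only: m bintegrable_add bintegral_add)
  finally show ?thesis .
 qed
 then have "wavg \<omega> K f z = (LBINT e. (\<Sum>i\<in>UNIV. a i * (\<omega> e * avg e (K1 i) f z) + b i * (\<omega> e * avg e (K2 i) f z)))"
  unfolding wavg_def by (simp add: sum_distrib_left algebra_simps)
 also have "\<dots> = (\<Sum>i\<in>UNIV. a i * wavg \<omega> (K1 i) f z + b i * wavg \<omega> (K2 i) f z)"
  unfolding wavg_def integral_mult_right_zero[symmetric]
  by (subst bintegral_sum)
   (simp_all only: integrable_mult_right[OF w(1)] integrable_mult_right[OF w(2)] bintegrable_add bintegral_add)
 finally show ?thesis .
qed

lemma eT_central: "z \<star> eT = eT \<star> z" "z \<star> (r *\<^sub>R eT) = (r *\<^sub>R eT) \<star> z"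
 by (simp_all add: heis_eq_iff hmul_def eT_def)

lemma snd_snd_eX [simp]: "snd (snd (eX i)) = 0" and snd_snd_eY [simp]: "snd (snd (eY i)) = 0"
 by (simp_all add: eX_def eY_def)

lemma hk2_horizontal:
 assumes "snd (snd v') = 0"
 shows "hk2 v v' w = (\<Sum>i\<in>UNIV. fst v' $ i * hk2 v (eX i) w + fst (snd v') $ i * hk2 v (eY i) w)"
proof -
 have axes: "hdot v (eX i) = fst v $ i" "hdot v (eY i) = fst (snd v) $ i"
  "hsymp v (eX i) = fst (snd v) $ i" "hsymp v (eY i) = - fst v $ i" for i and v :: "'a heis"
  by (simp_all add: hdot_def hsymp_def eX_def eY_def inner_axis' inner_axis)
 have axes': "hdot (eX i) w = fst w $ i" "hdot (eY i) w = fst (snd w) $ i"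
  "hsymp (eX i) w = - fst (snd w) $ i" "hsymp (eY i) w = fst w $ i" for i and w :: "'a heis"
  by (simp_all add: hdot_def hsymp_def eX_def eY_def inner_axis' inner_axis)
 have 1: "hdot v v' = (\<Sum>i\<in>UNIV. fst v' $ i * hdot v (eX i) + fst (snd v') $ i * hdot v (eY i))"
  "hsymp v v' = (\<Sum>i\<in>UNIV. fst v' $ i * hsymp v (eX i) + fst (snd v') $ i * hsymp v (eY i))"
  unfolding axes by (simp_all add: hdot_def hsymp_def inner_vec_def sum.distrib sum_subtractf sum_negf algebra_simps)
 have 2: "hdot v' w = (\<Sum>i\<in>UNIV. fst v' $ i * hdot (eX i) w + fst (snd v') $ i * hdot (eY i) w)"
  "hsymp v' w = (\<Sum>i\<in>UNIV. fst v' $ i * hsymp (eX i) w + fst (snd v') $ i * hsymp (eY i) w)"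
  unfolding axes' by (simp_all add: hdot_def hsymp_def inner_vec_def sum.distrib sum_subtractf sum_negf algebra_simps)
 have 3: "hker1 v' j m w = (\<Sum>i\<in>UNIV. fst v' $ i * hker1 (eX i) j m w + fst (snd v') $ i * hker1 (eY i) j m w)" for j m
  unfolding hker1_def assms snd_snd_eX snd_snd_eY 2
  by (simp add: sum_distrib_left sum_distrib_right algebra_simps flip: sum.distrib)
 define c where "c = 1 / (\<integral>w. hker 0 0 w \<partial>(lborel :: 'a heis measure))"
 show ?thesis unfolding hk2_def c_def[symmetric] hker2_def 1 3
  by (simp add: sum_distrib_left sum_distrib_right algebra_simps flip: sum.distrib)
qed

lemma green_flow_C1:
 fixes f :: "'n::finite heis => real"
 assumes f: "cont_UNIV f" "!!z. \<bar>f z\<bar> <= B" and T: "flow_deriv eT (green f) U" "cont_UNIV U" "\<exists>C. \<forall>z. \<bar>U z\<bar> <= C"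
 shows "flow_C1 (green f) (\<lambda>i. green1 (eX i) f) (\<lambda>i. green1 (eY i) f) U"
proof -
 note fm = borel_continuous[OF f(1)]
 have b: "\<exists>C. \<forall>z. \<bar>green1 v f z\<bar> <= C" for v by (rule green1_bounded[OF fm f(2)]) blast
 have i: "integrable lborel (hk1 v)" for v :: "'n heis" by (rule good_kernel_integrable(2)[OF good_kernel_hk1])
 have "flow_deriv v (green f) (\<lambda>z. \<Sum>i\<in>UNIV. fst v $ i * green1 (eX i) f z + fst (snd v) $ i * green1 (eY i) f z)" if v: "snd (snd v) = 0" for v
 proof -
  have "green1 v f z = (\<Sum>i\<in>UNIV. fst v $ i * green1 (eX i) f z + fst (snd v) $ i * green1 (eY i) f z)" for z
   unfolding green1_def by (rule wavg_linear_kernel[OF hk1_horizontal[OF v] i i fm f(2)]) (rule wavg_integrable[OF green_weight'_integrable i fm f(2)], simp)+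
  from this[symmetric] show ?thesis using green_flow_horizontal[OF fm f(2) v] unfolding green1_def by (simp only:)
 qed
 then show ?thesis unfolding flow_C1_def using T b green1_continuous[OF f] by blast
qed

lemma green1_flow_C1:
 fixes f :: "'n::finite heis => real"
 assumes f: "cont_UNIV f" "!!z. \<bar>f z\<bar> <= B"
  and h: "!!z w. \<bar>f (z \<star> w) - f z\<bar> <= L * hnorm w powr \<alpha>" and \<alpha>: "0 < \<alpha>" "\<alpha> <= 1" and L: "0 <= L"
  and F: "flow_deriv eT f F" "cont_UNIV F" "!!z. \<bar>F z\<bar> <= B'"
 shows "flow_C1 (green1 v f) (\<lambda>i. green2 v (eX i) f) (\<lambda>i. green2 v (eY i) f) (green1 v F)"
proof -
 note fm = borel_continuous[OF f(1)] note Fm = borel_continuous[OF F(2)]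
 note a = fm f(2) h \<alpha> L
 have i: "integrable lborel (hk2 v v')" for v v' :: "'n heis" by (rule good_kernel_integrable(2)[OF good_kernel_hk2])
 have "flow_deriv v' (green1 v f) (\<lambda>z. \<Sum>i\<in>UNIV. fst v' $ i * green2 v (eX i) f z + fst (snd v') $ i * green2 v (eY i) f z)" if v': "snd (snd v') = 0" for v'
 proof -
  have "green2 v v' f z = (\<Sum>i\<in>UNIV. fst v' $ i * green2 v (eX i) f z + fst (snd v') $ i * green2 v (eY i) f z)" for z
   unfolding green2_def by (rule wavg_linear_kernel[OF hk2_horizontal[OF v'] i i fm f(2)]) (rule green2_integrable[OF a], simp)+
  from this[symmetric] show ?thesis using green1_flow[OF a v', of v] by (simp only:)
 qed
 moreover have "flow_deriv eT (green1 v f) (green1 v F)" unfolding green1_def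
  by (rule wavg_central_flow_deriv[OF eT_central F(1) fm f(2) Fm F(3) good_kernel_integrable(2)[OF good_kernel_hk1] green_weight'_integrable]) simp
 moreover have "\<exists>C. \<forall>z. \<bar>green1 v F z\<bar> <= C" by (rule green1_bounded[OF Fm F(3)]) blast
 moreover have "cont_UNIV (green2 v (eX i) f)" "cont_UNIV (green2 v (eY i) f)" for i
  by (rule green2_continuous[OF a _ f(1)], simp)+
 moreover have "\<exists>C. \<forall>z. \<bar>green2 v (eX i) f z\<bar> <= C" "\<exists>C. \<forall>z. \<bar>green2 v (eY i) f z\<bar> <= C" for i
  by (rule green2_bounded[OF a], simp)+
 ultimately show ?thesis unfolding flow_C1_def using green1_continuous[OF F(2,3)] by blast
qed

lemma flow_C1_continuous:
 assumes "flow_C1 u UX UY UT"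
 shows "cont_UNIV (UX i)" "cont_UNIV (UY i)" "cont_UNIV UT"
 using assms unfolding flow_C1_def by blast+

text \<open>A bootstrap. The source f = u^p is Lipschitz, so u has a central derivative
  \<open>greenT f\<close>; by the chain rule f has the central derivative F. Then the central
  derivative of u also equals \<open>green F\<close> and is Lipschitz, which makes F Hoelder
  continuous. All first derivatives of u are thereby resolvents or \<open>green1\<close> potentials
  that are themselves \<open>flow_C1\<close>.\<close>

lemma semilinear_green_regularity:
 fixes u :: "'n::finite heis => real"
 assumes p: "1 < p" and u: "!!z. u z = green (\<lambda>z. u z powr p) z" and pos: "!!z. 0 < u z" and B: "!!z. u z <= B"
  and lip: "!!z w. \<bar>u (z \<star> w) - u z\<bar> <= K * hnorm w"
 shows "C_k 2 u" and "sub_laplacian u z = u z - u z powr p"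
  and "\<exists>T. flow_C1 u (\<lambda>i. green1 (eX i) (\<lambda>z. u z powr p)) (\<lambda>i. green1 (eY i) (\<lambda>z. u z powr p)) T"
proof -
 define f where "f z = u z powr p" for z
 have gf: "green f = u" unfolding f_def[abs_def] by (rule ext) (rule u[symmetric])
 have B0: "0 < B" using pos[of 0] B[of 0] by linarith
 have K0: "0 <= K"
 proof -
  have "0 < hnorm (eT :: 'n heis)" by (simp add: hnorm_def eT_def)
  moreover have "0 <= K * hnorm (eT :: 'n heis)" using lip[of 0 eT] by linarith
  ultimately show ?thesis by (simp add: zero_le_mult_iff)
 qed
 have cu: "cont_UNIV u"
  by (rule lipschitz_continuous[where \<alpha>=1 and L=K]) (simp_all add: hnorm_nonneg lip)
 have cpow: "cont_UNIV (\<lambda>z. u z powr s)" for s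
  using pos by (intro continuous_on_powr cu continuous_on_const) (simp add: less_imp_neq[symmetric])
 have cf: "cont_UNIV f" unfolding f_def[abs_def] by (rule cpow)
 have fb: "\<bar>f z\<bar> <= B powr p" for z using pos[of z] B[of z] p by (auto simp: f_def intro!: powr_mono2)
 define L where "L = p * B powr (p - 1) * K"
 have L0: "0 <= L" using p K0 by (simp add: L_def)
 have fl: "\<bar>f (z \<star> w) - f z\<bar> <= L * hnorm w powr 1" for z w
 proof -
  have "\<bar>f (z \<star> w) - f z\<bar> <= p * B powr (p - 1) * \<bar>u (z \<star> w) - u z\<bar>"
   unfolding f_def using pos[of z] pos[of "z \<star> w"] B by (intro powr_lipschitz p) (auto intro: less_imp_le)
  also have "\<dots> <= p * B powr (p - 1) * (K * hnorm w)" using p by (intro mult_left_mono lip) auto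
  finally show ?thesis using hnorm_nonneg[of w] by (simp add: L_def mult_ac)
 qed
 note T0 = greenT_flow[OF cf fb fl zero_less_one order_refl L0, unfolded gf] greenT_continuous[OF cf fb fl zero_less_one order_refl L0]
 obtain C where C: "!!z. \<bar>greenT f z\<bar> <= C" using greenT_bounded[OF cf fb fl zero_less_one order_refl L0] by blast
 define F where "F z = p * u z powr (p - 1) * greenT f z" for z
 have flF: "flow_deriv eT f F"
 proof -
  have "flow_deriv eT (\<lambda>z. u z powr p) (\<lambda>z. p * u z powr (p - 1) * greenT f z)"
   by (rule flow_deriv_chain[OF T0 C, where \<phi>="\<lambda>x. x powr p" and \<phi>'="\<lambda>x. p * x powr (p - 1)"])
    (rule has_real_derivative_powr[OF pos] continuous_on_mult[OF continuous_on_const cpow])+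
  then show ?thesis by (simp only: f_def[abs_def] F_def[abs_def])
 qed
 have cF: "cont_UNIV F" unfolding F_def by (intro continuous_on_mult continuous_on_const cpow T0)
 have upow: "\<bar>u z powr (p - 1)\<bar> <= B powr (p - 1)" for z using pos[of z] B[of z] p by (auto intro!: powr_mono2)
 have Fb: "\<bar>F z\<bar> <= p * B powr (p - 1) * C" for z
  unfolding F_def abs_mult using p upow[of z] C[of z] by (intro mult_mono) auto
 note fm = borel_continuous[OF cf] note Fm = borel_continuous[OF cF]
 have flG: "flow_deriv eT u (green F)"
  unfolding gf[symmetric] unfolding green_def
  by (rule wavg_central_flow_deriv[OF eT_central flF fm fb Fm Fb hk_integrable green_weight_integrable])
 have gFb: "\<bar>green F z\<bar> <= p * B powr (p - 1) * C * (\<integral>w. \<bar>hk w\<bar> \<partial>(lborel :: 'n heis measure)) * (LBINT e. \<bar>green_weight e\<bar>)" for z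
  unfolding green_def by (rule wavg_bound[OF green_weight_integrable hk_integrable Fm Fb])
 note cG = green_continuous[OF Fm Fb]
 \<comment> \<open>The derivative computed on the kernel agrees with the one computed on the source;
   only the second expression is known to be Lipschitz.\<close>
 have eq: "greenT f = green F" by (rule flow_deriv_unique[OF T0 C flG cG gFb])
 \<comment> \<open>F contains the factor u^(p - 1), which inherits from the Lipschitz function u
   only the exponent p - 1 when p < 2.\<close>
 define \<beta> where "\<beta> = min 1 (p - 1)"
 have \<beta>: "0 < \<beta>" "\<beta> <= 1" using p by (auto simp: \<beta>_def)
 let ?LG = "p * B powr (p - 1) * C * green_lip TYPE('n)"
 have LG0: "0 <= ?LG"
 proof -
  have "0 < hnorm (eT :: 'n heis)" by (simp add: hnorm_def eT_def)
  moreover have "0 <= ?LG * hnorm (eT :: 'n heis)" using green_lipschitz[OF Fm Fb, of 0 eT] by linarith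
  ultimately show ?thesis by (simp only: zero_le_mult_iff) linarith
 qed
 have C0: "0 <= C" using C[of 0] by linarith
 have Th: "\<bar>greenT f (z \<star> w) - greenT f z\<bar> <= (?LG + 2 * C) * hnorm w powr \<beta>" for z w
  by (rule lipschitz_imp_holder[OF C _ LG0 \<beta>]) (simp only: eq green_lipschitz[OF Fm Fb])
 obtain D where D: "0 <= D" "!!z w. \<bar>u (z \<star> w) powr (p - 1) - u z powr (p - 1)\<bar> <= D * hnorm w powr \<beta>"
 proof (cases "p - 1 <= 1")
  case True
  have "\<bar>u (z \<star> w) powr (p - 1) - u z powr (p - 1)\<bar> <= K powr (p - 1) * hnorm w powr \<beta>" for z w
  proof -
   have "\<bar>u (z \<star> w) powr (p - 1) - u z powr (p - 1)\<bar> <= \<bar>u (z \<star> w) - u z\<bar> powr (p - 1)"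
    using True p by (intro powr_holder less_imp_le[OF pos]) auto
   also have "\<dots> <= (K * hnorm w) powr (p - 1)" using p by (intro powr_mono2 lip) auto
   finally show ?thesis using True by (simp add: powr_mult \<beta>_def)
  qed
  then show ?thesis using that[of "K powr (p - 1)"] by simp
 next
  case False
  define D where "D = (p - 1) * B powr (p - 1 - 1) * K"
  have "\<bar>u (z \<star> w) powr (p - 1) - u z powr (p - 1)\<bar> <= D * hnorm w powr \<beta>" for z w
  proof -
   have "\<bar>u (z \<star> w) powr (p - 1) - u z powr (p - 1)\<bar> <= (p - 1) * B powr (p - 1 - 1) * \<bar>u (z \<star> w) - u z\<bar>"
    using False pos[of z] pos[of "z \<star> w"] B by (intro powr_lipschitz) (auto intro: less_imp_le)
   also have "\<dots> <= (p - 1) * B powr (p - 1 - 1) * (K * hnorm w)" using p by (intro mult_left_mono lip) auto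
   also have "\<dots> = D * hnorm w powr \<beta>" using False hnorm_nonneg[of w] by (simp add: D_def \<beta>_def min_def mult_ac)
   finally show ?thesis .
  qed
  then show ?thesis using that[of D] p K0 by (simp add: D_def)
 qed
 define LF where "LF = p * (D * C + B powr (p - 1) * (?LG + 2 * C))"
 have LF0: "0 <= LF" unfolding LF_def
  by (rule mult_nonneg_nonneg[OF _ add_nonneg_nonneg[OF mult_nonneg_nonneg[OF D(1) C0] mult_nonneg_nonneg[OF powr_ge_zero add_nonneg_nonneg[OF LG0]]]])
   (use p C0 in auto)
 have Fh: "\<bar>F (z \<star> w) - F z\<bar> <= LF * hnorm w powr \<beta>" for z w
 proof -
  let ?a = "u (z \<star> w) powr (p - 1)" and ?b = "u z powr (p - 1)" and ?s = "greenT f (z \<star> w)" and ?t = "greenT f z"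
  have "F (z \<star> w) - F z = p * ((?a - ?b) * ?s + ?b * (?s - ?t))" by (simp add: F_def algebra_simps)
  also have "\<bar>\<dots>\<bar> <= p * (\<bar>?a - ?b\<bar> * \<bar>?s\<bar> + \<bar>?b\<bar> * \<bar>?s - ?t\<bar>)"
  proof -
   have "\<bar>p * X\<bar> = p * \<bar>X\<bar>" for X using p by (simp add: abs_mult)
   then show ?thesis unfolding abs_mult[symmetric] using p by (simp add: abs_triangle_ineq)
  qed
  also have "\<dots> <= p * ((D * hnorm w powr \<beta>) * C + B powr (p - 1) * ((?LG + 2 * C) * hnorm w powr \<beta>))"
   using p D C C0 upow Th by (intro mult_left_mono add_mono mult_mono) auto
  finally show ?thesis by (simp add: LF_def algebra_simps)
 qed
 have c1: "flow_C1 u (\<lambda>i. green1 (eX i) f) (\<lambda>i. green1 (eY i) f) (green F)"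
  using green_flow_C1[OF cf fb, of "green F"] flG cG gFb unfolding gf by blast
 have c2: "flow_C1 (green1 v f) (\<lambda>i. green2 v (eX i) f) (\<lambda>i. green2 v (eY i) f) (green1 v F)" for v
  by (rule green1_flow_C1[OF cf fb fl zero_less_one order_refl L0 flF cF Fb])
 have c3: "flow_C1 (green F) (\<lambda>i. green1 (eX i) F) (\<lambda>i. green1 (eY i) F) (greenT F)"
  by (rule green_flow_C1[OF cF Fb greenT_flow[OF cF Fb Fh \<beta> LF0] greenT_continuous[OF cF Fb Fh \<beta> LF0] greenT_bounded[OF cF Fb Fh \<beta> LF0]])
 have k1: "C_k (Suc 0) w" if w: "flow_C1 w UX UY UT" for w :: "'n heis => real" and UX UY UT
  by (rule flow_C1_C_k[OF w]) (simp_all only: C_k.simps flow_C1_continuous[OF w])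
 show "C_k 2 u" unfolding numeral_2_eq_2
  by (rule flow_C1_C_k[OF c1]) (rule k1[OF c2] k1[OF c3])+
 show "sub_laplacian u z = u z - u z powr p"
  using green_pde[OF cf fb fl zero_less_one order_refl L0, of z]
  unfolding sub_laplacian_def flow_C1_fields[OF c1] flow_C1_fields[OF c2] gf f_def[of z] .
 show "\<exists>T. flow_C1 u (\<lambda>i. green1 (eX i) (\<lambda>z. u z powr p)) (\<lambda>i. green1 (eY i) (\<lambda>z. u z powr p)) T"
  using c1 unfolding f_def[abs_def] by blast
qed

section \<open>Approximation by test functions\<close>

text \<open>The family s^(-m) exp (- 1 / s), cut off at s <= 0. It is closed under differentiation
  up to linear combinations, which makes smoothness of exp (- 1 / s) an induction.\<close>

definition flat_exp :: "nat => real => real" where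
 "flat_exp m s = (if 0 < s then (1 / s) ^ m * exp (- (1 / s)) else 0)"

lemma flat_exp_le: "\<bar>flat_exp m s\<bar> <= fact (Suc m) * \<bar>s\<bar>"
proof (cases "0 < s")
 case True
 define x where "x = 1 / s"
 have x: "0 < x" using True by (simp add: x_def)
 have "x ^ Suc m / fact (Suc m) <= exp x"
 proof -
  have "(\<Sum>n\<in>{Suc m}. inverse (fact n) *\<^sub>R x ^ n) <= (\<Sum>n. inverse (fact n) *\<^sub>R x ^ n)"
   using x by (intro sum_le_suminf summable_exp_generic) auto
  also have "(\<Sum>n. inverse (fact n) *\<^sub>R x ^ n) = exp x" by (simp add: exp_def)
  finally show ?thesis by (simp add: divide_inverse mult.commute del: fact_Suc power_Suc)
 qed
 then have "x ^ m * exp (- x) <= fact (Suc m) / x" using x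
  by (simp add: exp_minus field_simps del: fact_Suc)
 then show ?thesis using True by (simp add: flat_exp_def x_def del: fact_Suc)
next
 case False
 have "0 <= fact (Suc m) * \<bar>s\<bar>" by (intro mult_nonneg_nonneg fact_ge_zero abs_ge_zero)
 then show ?thesis using False by (simp only: flat_exp_def if_False abs_zero)
qed

lemma flat_exp_tendsto_0: "(flat_exp m \<longlongrightarrow> 0) (at 0)"
proof (rule Lim_null_comparison[OF always_eventually])
 show "\<forall>s. norm (flat_exp m s) <= fact (Suc m) * \<bar>s\<bar>" using flat_exp_le by (simp del: fact_Suc)
 have "((\<lambda>s::real. fact (Suc m) * \<bar>s\<bar>) \<longlongrightarrow> fact (Suc m) * \<bar>0\<bar>) (at 0)" by (intro tendsto_intros)
 then show "((\<lambda>s::real. fact (Suc m) * \<bar>s\<bar>) \<longlongrightarrow> 0) (at 0)" by simp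
qed

lemma flat_exp_deriv: "(flat_exp m has_real_derivative flat_exp (m + 2) s - m * flat_exp (m + 1) s) (at s)"
proof -
 consider "0 < s" | "s < 0" | "s = 0" by linarith
 then show ?thesis
 proof cases
  case 1
  have "((\<lambda>s. (1 / s) ^ m * exp (- (1 / s))) has_real_derivative flat_exp (m + 2) s - m * flat_exp (m + 1) s) (at s)"
   using 1 by (auto intro!: derivative_eq_intros simp: flat_exp_def) (cases m; simp add: field_simps power2_eq_square)
  then show ?thesis
   by (rule has_field_derivative_transform_within_open[of _ _ _ "{0<..}"]) (use 1 in \<open>auto simp: flat_exp_def\<close>)
 next
  case 2
  have "((\<lambda>s. 0) has_real_derivative flat_exp (m + 2) s - m * flat_exp (m + 1) s) (at s)"
   using 2 by (simp add: flat_exp_def)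
  then show ?thesis
   by (rule has_field_derivative_transform_within_open[of _ _ _ "{..<0}"]) (use 2 in \<open>auto simp: flat_exp_def\<close>)
 next
  case 3
  \<comment> \<open>At 0 the difference quotient of \<open>flat_exp m\<close> is
    \<open>flat_exp (Suc m)\<close>, whose limit is known to be 0.\<close>
  have "((\<lambda>h. (flat_exp m (0 + h) - flat_exp m 0) / h) \<longlongrightarrow> 0) (at 0)"
   by (rule Lim_transform_eventually[OF flat_exp_tendsto_0[of "Suc m"]]) (auto simp: eventually_at_filter flat_exp_def)
  then show ?thesis using 3 by (simp add: has_field_derivative_def DERIV_def[unfolded has_field_derivative_def] flat_exp_def)
 qed
qed

lemma C_k_flat_exp: "C_k k (flat_exp m)"
proof (induction k arbitrary: m)
 case 0
 show ?case using flat_exp_deriv by (auto intro!: continuous_at_imp_continuous_on DERIV_isCont)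
next
 case (Suc k)
 have d: "(flat_exp m has_derivative (*) (flat_exp (m + 2) s - m * flat_exp (m + 1) s)) (at s)" for s
  using flat_exp_deriv[of m s] by (simp add: has_field_derivative_def)
 have "flat_exp m differentiable_on UNIV" using d unfolding differentiable_on_def differentiable_def by blast
 moreover have "C_k k (\<lambda>s. frechet_derivative (flat_exp m) (at s) 1)"
  unfolding frechet_derivative_at[OF d, symmetric] mult_1_right by (intro C_k_diff C_k_cmult Suc)
 ultimately show ?case by simp
qed

lemma C_k_compose:
 fixes h :: "real => real" and g :: "'a::euclidean_space => real"
 shows "C_k k h ==> C_k k g ==> C_k k (\<lambda>z. h (g z))"
proof (induction k arbitrary: h g)
 case 0
 then show ?case by (auto intro: continuous_on_compose2)
next
 case (Suc k)
 then have d: "h differentiable at x" "g differentiable at z" for x z by (simp_all add: differentiable_on_def)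
 have lin: "frechet_derivative h (at x) y = y * frechet_derivative h (at x) 1" for x y
  using linear_cmul[OF linear_frechet_derivative[OF d(1)], of x y 1] by simp
 have e: "frechet_derivative (\<lambda>z. h (g z)) (at z) b = frechet_derivative g (at z) b * frechet_derivative h (at (g z)) 1" for z b
  using frechet_derivative_at[OF has_derivative_compose[OF d(2)[THEN frechet_derivative_works[THEN iffD1]] d(1)[THEN frechet_derivative_works[THEN iffD1]]]] lin by metis
 have "(\<lambda>z. h (g z)) differentiable_on UNIV"
  using differentiable_compose[OF d] by (simp add: differentiable_on_def)
 moreover have "C_k k (\<lambda>z. frechet_derivative (\<lambda>z. h (g z)) (at z) b)" if "b \<in> Basis" for b
  unfolding e
  using Suc.prems that by (intro C_k_mult Suc.IH[OF _ C_k_Suc[OF Suc.prems(2)]]) auto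
 ultimately show ?case by simp
qed

lemma C_k_inner_self: "C_k k (\<lambda>z::'a::euclidean_space. z \<bullet> z)"
 unfolding euclidean_inner[of z z for z]
 by (intro C_k_sum C_k_mult C_k_bounded_linear bounded_linear_inner_left)

lemma test_functionsI:
 assumes "!!k. C_k k f" "!!z. R < norm z ==> f z = 0" shows "f \<in> test_functions"
proof -
 have "{z. f z ~= 0} \<subseteq> cball 0 R" using assms(2) by (auto simp: not_less[symmetric])
 then have "bounded {z. f z ~= 0}" using bounded_cball bounded_subset by blast
 then show ?thesis using assms(1) by (simp add: test_functions_def compact_closure)
qed

lemma test_functionsD:
 assumes "f \<in> test_functions" shows "C_k k f" and "\<exists>R. \<forall>z. R < norm z --> f z = 0"
proof -
 show "C_k k f" using assms by (simp add: test_functions_def)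
 have "bounded {z. f z ~= 0}" using assms compact_imp_bounded bounded_subset closure_subset unfolding test_functions_def by blast
 then obtain R where "\<forall>z\<in>{z. f z ~= 0}. norm z <= R" unfolding bounded_iff by blast
 then show "\<exists>R. \<forall>z. R < norm z --> f z = 0" by (meson mem_Collect_eq not_less)
qed

lemma bump_exists:
 assumes "0 < \<epsilon>"
 obtains \<psi> :: "'a::euclidean_space => real" where "\<psi> \<in> test_functions" "!!z. 0 <= \<psi> z" "!!z. \<psi> z <= 1" "\<psi> 0 = 1" "!!z. \<epsilon> <= norm z ==> \<psi> z = 0"
proof -
 define \<psi> :: "'a => real" where "\<psi> z = (1 / flat_exp 0 (\<epsilon>\<^sup>2)) * flat_exp 0 (\<epsilon>\<^sup>2 - z \<bullet> z)" for z
 have e: "0 < \<epsilon>\<^sup>2" using assms by simp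
 have p: "0 < flat_exp 0 (\<epsilon>\<^sup>2)" using e by (simp add: flat_exp_def)
 have zero: "\<psi> z = 0" if "\<epsilon> <= norm z" for z
 proof -
  have "\<epsilon>\<^sup>2 <= z \<bullet> z" using that assms by (simp add: dot_square_norm power_mono)
  then show ?thesis by (simp add: \<psi>_def flat_exp_def)
 qed
 have "C_k k \<psi>" for k unfolding \<psi>_def
  by (intro C_k_cmult C_k_compose[OF C_k_flat_exp] C_k_diff C_k_const C_k_inner_self)
 then have "\<psi> \<in> test_functions" by (rule test_functionsI[of _ \<epsilon>]) (simp add: zero)
 moreover have "\<psi> z <= 1" "0 <= \<psi> z" for z
 proof -
  have "flat_exp 0 (\<epsilon>\<^sup>2 - z \<bullet> z) <= flat_exp 0 (\<epsilon>\<^sup>2)"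
  proof (cases "0 < \<epsilon>\<^sup>2 - z \<bullet> z")
   case True
   then have "1 / \<epsilon>\<^sup>2 <= 1 / (\<epsilon>\<^sup>2 - z \<bullet> z)" using e by (intro divide_left_mono mult_pos_pos) auto
   then show ?thesis using True e by (simp add: flat_exp_def)
  qed (use p in \<open>simp add: flat_exp_def\<close>)
  then show "\<psi> z <= 1" using p by (simp add: \<psi>_def)
  show "0 <= \<psi> z" using p by (simp add: \<psi>_def flat_exp_def)
 qed
 moreover have "\<psi> 0 = 1" using p by (simp add: \<psi>_def)
 ultimately show ?thesis using that zero by blast
qed

lemma compact_support_bounded:
 fixes g :: "'a::euclidean_space => real"
 assumes "cont_UNIV g" "!!z. R < norm z ==> g z = 0"
 obtains C where "0 <= C" "!!z. \<bar>g z\<bar> <= C"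
proof -
 have "bounded (g ` cball 0 R)" using assms(1) by (intro compact_imp_bounded compact_continuous_image) (auto intro: continuous_on_subset)
 then obtain C where C: "!!z. z \<in> cball 0 R ==> \<bar>g z\<bar> <= C" unfolding bounded_iff by force
 have "\<bar>g z\<bar> <= max C 0" for z using C[of z] assms(2)[of z] by (cases "norm z <= R") auto
 then show ?thesis using that[of "max C 0"] by simp
qed

lemma compact_support_integrable:
 fixes g :: "'a::euclidean_space => real"
 assumes g: "cont_UNIV g" "!!z. R < norm z ==> g z = 0"
 shows "integrable lborel g"
proof -
 obtain C where C: "0 <= C" "!!z. \<bar>g z\<bar> <= C" using compact_support_bounded[OF g] by blast
 show ?thesis
 proof (rule bintegrable_bound[of _ "\<lambda>z. C * indicator (cball 0 R) z"])
  show "integrable lborel (\<lambda>z::'a. C * indicator (cball 0 R) z)"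
   using emeasure_lborel_cball_finite[of "0::'a" R] by (intro integrable_mult_right integrable_real_indicator) auto
  show "g \<in> borel_measurable lborel" using g(1) by (simp add: borel_continuous)
  show "AE z in lborel. norm (g z) <= norm (C * indicator (cball 0 R) z)"
   using C g(2) by (intro AE_I2) (auto simp: indicator_def not_le[symmetric])
 qed
qed

lemma compact_support_uniform:
 fixes g :: "'a::euclidean_space => real"
 assumes g: "cont_UNIV g" "!!z. R < norm z ==> g z = 0" and \<delta>: "0 < \<delta>"
 obtains \<epsilon> where "0 < \<epsilon>" "!!z y. norm y <= \<epsilon> ==> \<bar>g (z - y) - g z\<bar> <= \<delta>"
proof -
 have "uniformly_continuous_on (cball 0 (R + 1)) g"
  using g(1) by (intro compact_uniformly_continuous compact_cball) (auto intro: continuous_on_subset)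
 then obtain e where e: "0 < e" "!!x y. x \<in> cball 0 (R + 1) ==> y \<in> cball 0 (R + 1) ==> dist x y < e ==> dist (g x) (g y) < \<delta>"
  using \<delta> unfolding uniformly_continuous_on_def by metis
 \<comment> \<open>The cap 1/2 keeps z - y in the ball of radius R + 1 if |z| <= R + 1/2, and
   outside the ball of radius R otherwise, where g vanishes.\<close>
 have "\<bar>g (z - y) - g z\<bar> <= \<delta>" if y: "norm y <= min (e / 2) (1 / 2)" for z y
 proof (cases "norm z <= R + 1 / 2")
  case True
  then have "norm (z - y) <= R + 1" using y norm_triangle_ineq4[of z y] by simp
  then have "dist (g (z - y)) (g z) < \<delta>" using True y e(1) by (intro e(2)) (simp_all add: dist_norm norm_minus_commute)
  then show ?thesis by (simp add: dist_norm)
 next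
  case False
  then have "R < norm (z - y)" using y norm_triangle_ineq2[of z y] by simp
  then show ?thesis using False g(2) \<delta> by simp
 qed
 then show ?thesis using that[of "min (e / 2) (1 / 2)"] e(1) by simp
qed

lemma frechet_derivative_zero_outside:
 fixes f :: "'a::euclidean_space => real"
 assumes "!!z. R < norm z ==> f z = 0" "R < norm z" shows "frechet_derivative f (at z) h = 0"
proof -
 have "((\<lambda>_. 0 :: real) has_derivative (\<lambda>_. 0)) (at z)" by simp
 then have "(f has_derivative (\<lambda>_. 0)) (at z)"
 proof (rule has_derivative_transform_within_open)
  show "open {z::'a. R < norm z}" by (intro open_Collect_less continuous_intros)
 qed (use assms in auto)
 then show ?thesis using frechet_derivative_at by metis
qed

lemma frechet_derivative_sum_Basis:
 fixes f :: "'a::euclidean_space => real"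
 assumes "f differentiable at z"
 shows "frechet_derivative f (at z) h = (\<Sum>b\<in>Basis. (h \<bullet> b) * frechet_derivative f (at z) b)"
proof -
 have "frechet_derivative f (at z) (\<Sum>b\<in>Basis. (h \<bullet> b) *\<^sub>R b) = (\<Sum>b\<in>Basis. (h \<bullet> b) * frechet_derivative f (at z) b)"
  using linear_frechet_derivative[OF assms] by (simp add: linear_sum linear_cmul)
 then show ?thesis by (simp add: euclidean_representation)
qed

lemma frechet_derivative_bound:
 fixes f :: "'a::euclidean_space => real"
 assumes f: "C_k (Suc 0) f" "!!z. R < norm z ==> f z = 0"
 obtains C where "0 <= C" "!!z h. \<bar>frechet_derivative f (at z) h\<bar> <= C * norm h"
proof -
 have d: "f differentiable at z" for z using f(1) by (simp add: differentiable_on_def)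
 have "\<exists>C\<ge>0. \<forall>z. \<bar>frechet_derivative f (at z) b\<bar> <= C" if "b \<in> Basis" for b
 proof -
  have "cont_UNIV (\<lambda>z. frechet_derivative f (at z) b)" using f(1) that by simp
  then show ?thesis
  proof (rule compact_support_bounded)
   show "R < norm z ==> frechet_derivative f (at z) b = 0" for z by (rule frechet_derivative_zero_outside[OF f(2)])
  qed blast
 qed
 then obtain C where C: "!!b z. b \<in> Basis ==> 0 <= C b" "!!b z. b \<in> Basis ==> \<bar>frechet_derivative f (at z) b\<bar> <= C b" by metis
 have "\<bar>frechet_derivative f (at z) h\<bar> <= sum C Basis * norm h" for z h
 proof -
  have "\<bar>frechet_derivative f (at z) h\<bar> <= (\<Sum>b\<in>Basis. \<bar>(h \<bullet> b) * frechet_derivative f (at z) b\<bar>)"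
   unfolding frechet_derivative_sum_Basis[OF d, of z h] by (rule sum_abs)
  also have "\<dots> <= (\<Sum>b\<in>Basis. norm h * C b)"
   unfolding abs_mult using C by (intro sum_mono mult_mono Basis_le_norm) auto
  finally show ?thesis by (simp add: sum_distrib_left mult.commute)
 qed
 then show ?thesis using that[of "sum C Basis"] C(1) by (simp add: sum_nonneg)
qed

section \<open>Euclidean mollification\<close>

text \<open>Ordinary instead of group convolution: only compactly supported functions are mollified,
  and on compact sets the fields have bounded coefficients, so Euclidean C^1 closeness is
  enough.\<close>

definition convolve :: "('a::euclidean_space => real) => ('a => real) => 'a => real" where
 "convolve f g z = (LBINT y. f (z - y) * g y)"

lemma integral_reflect:
 fixes g :: "'a::euclidean_space => real"
 assumes [measurable]: "borel_fun g"
 shows "(LBINT y. g (z - y)) = (LBINT y. g y)"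
proof -
 have "lborel = distr lborel borel (\<lambda>x. z - x)" using lborel_affine[of "-1" z] by (simp add: density_1)
 then have "(LBINT y. g y) = (\<integral>y. g y \<partial>(distr lborel borel (\<lambda>x. z - x)))" by (rule arg_cong)
 also have "\<dots> = (LBINT y. g (z - y))" by (rule integral_distr) measurable
 finally show ?thesis ..
qed

lemma convolve_commute:
 fixes f g :: "'a::euclidean_space => real"
 assumes [measurable]: "borel_fun f" "borel_fun g"
 shows "convolve f g z = convolve g f z"
 using integral_reflect[of "\<lambda>y. g (z - y) * f y" z] by (simp add: convolve_def mult.commute)

lemma convolve_has_derivative:
 fixes f g :: "'a::euclidean_space => real"
 assumes f: "C_k (Suc 0) f" "!!z. R < norm z ==> f z = 0" and g: "cont_UNIV g" "!!z. \<rho> < norm z ==> g z = 0"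
 shows "(convolve f g has_derivative (\<lambda>h. convolve (\<lambda>z. frechet_derivative f (at z) h) g z)) (at z)"
proof -
 have d: "f differentiable at z" for z using f(1) by (simp add: differentiable_on_def)
 have cf: "cont_UNIV f" using f(1) by (simp add: differentiable_imp_continuous_on)
 obtain C where C: "0 <= C" "!!z h. \<bar>frechet_derivative f (at z) h\<bar> <= C * norm h"
  using frechet_derivative_bound[OF f] by blast
 have [measurable]: "borel_fun g" using g(1) by (rule borel_continuous)
 have shift: "cont_UNIV (\<lambda>y. z - y)" for z :: 'a by (intro continuous_intros)
 show ?thesis unfolding convolve_def[abs_def]
 proof (rule has_derivative_integral_dominated(1)[where S=UNIV and g="\<lambda>y. C * \<bar>g y\<bar>" and F="\<lambda>x y. f (x - y) * g y" and F'="\<lambda>x y h. frechet_derivative f (at (x - y)) h * g y"])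
  show "((\<lambda>x. f (x - y) * g y) has_derivative (\<lambda>h. frechet_derivative f (at (x - y)) h * g y)) (at x)" for x y
  proof -
   have "((\<lambda>x. x - y) has_derivative (\<lambda>h. h)) (at x)" by (auto intro!: derivative_eq_intros)
   from has_derivative_compose[OF this d[of "x - y", THEN frechet_derivative_works[THEN iffD1]]]
   show ?thesis by (rule has_derivative_mult_left)
  qed
  show "integrable lborel (\<lambda>y. f (x - y) * g y)" for x
   by (rule compact_support_integrable[of _ \<rho>]) (simp_all add: g continuous_on_mult continuous_on_compose2[OF cf shift])
  show "(\<lambda>y. frechet_derivative f (at (z - y)) h * g y) \<in> borel_measurable lborel" for h
  proof -
   have "cont_UNIV (\<lambda>y. frechet_derivative f (at (z - y)) b)" if "b \<in> Basis" for b
    using f(1) that by (intro continuous_on_compose2[OF _ shift, of UNIV "\<lambda>z. frechet_derivative f (at z) b"]) auto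
   then have "borel_fun (\<lambda>y. \<Sum>b\<in>Basis. (h \<bullet> b) * frechet_derivative f (at (z - y)) b)"
    by (intro borel_measurable_sum borel_measurable_times borel_measurable_const borel_continuous)
   then show ?thesis unfolding frechet_derivative_sum_Basis[OF d, symmetric] by measurable
  qed
  show "\<bar>frechet_derivative f (at (x - y)) h * g y\<bar> <= C * \<bar>g y\<bar> * norm h" for x y h
   using mult_right_mono[OF C(2)[of "x - y" h] abs_ge_zero[of "g y"]] by (simp add: abs_mult mult_ac)
  show "integrable lborel (\<lambda>y. C * \<bar>g y\<bar>)"
   by (intro integrable_mult_right integrable_abs compact_support_integrable[OF g])
 qed auto
qed

lemma test_function_derivative:
 assumes f: "f \<in> test_functions" and b: "b \<in> Basis" shows "(\<lambda>z. frechet_derivative f (at z) b) \<in> test_functions"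
proof -
 obtain R where R: "!!z. R < norm z ==> f z = 0" using test_functionsD(2)[OF f] by blast
 show ?thesis
 proof (rule test_functionsI)
  show "C_k k (\<lambda>z. frechet_derivative f (at z) b)" for k using test_functionsD(1)[OF f, of "Suc k"] b by simp
  show "frechet_derivative f (at z) b = 0" if "R < norm z" for z by (rule frechet_derivative_zero_outside[OF R that])
 qed
qed

text \<open>All derivatives fall on the test function and give test functions again, so the
  induction varies \<open>f\<close> and keeps the merely continuous \<open>g\<close>.\<close>

lemma convolve_test_function:
 fixes f g :: "'a::euclidean_space => real"
 assumes f: "f \<in> test_functions" and g: "cont_UNIV g" "!!z. \<rho> < norm z ==> g z = 0"
 shows "C_k k (convolve f g)"
 using f
proof (induction k arbitrary: f)
 case 0
 obtain R where R: "!!z. R < norm z ==> f z = 0" using test_functionsD(2)[OF 0] by blast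
 from convolve_has_derivative[OF test_functionsD(1)[OF 0] R g]
 show ?case by (auto intro!: continuous_at_imp_continuous_on has_derivative_continuous)
next
 case (Suc k)
 obtain R where R: "!!z. R < norm z ==> f z = 0" using test_functionsD(2)[OF Suc.prems] by blast
 have d: "(convolve f g has_derivative (\<lambda>h. convolve (\<lambda>z. frechet_derivative f (at z) h) g z)) (at z)" for z
  by (rule convolve_has_derivative[where R=R and \<rho>=\<rho>]) (rule test_functionsD(1)[OF Suc.prems] g(1) | erule R g(2))+
 have e: "frechet_derivative (convolve f g) (at z) b = convolve (\<lambda>z. frechet_derivative f (at z) b) g z" for z b
  using frechet_derivative_at[OF d] by metis
 have "convolve f g differentiable_on UNIV" using d unfolding differentiable_on_def differentiable_def by blast
 moreover have "C_k k (\<lambda>z. frechet_derivative (convolve f g) (at z) b)" if "b \<in> Basis" for b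
  unfolding e by (rule Suc.IH[OF test_function_derivative[OF Suc.prems that]])
 ultimately show ?case by simp
qed

lemma convolve_near:
 fixes g \<psi> :: "'a::euclidean_space => real"
 assumes g: "cont_UNIV g" and \<psi>: "cont_UNIV \<psi>" "!!z. 0 <= \<psi> z" "!!z. \<epsilon> <= norm z ==> \<psi> z = 0" "(LBINT y. \<psi> y) = 1"
  and near: "!!z y. norm y <= \<epsilon> ==> \<bar>g (z - y) - g z\<bar> <= \<delta>"
 shows "\<bar>convolve g \<psi> z - g z\<bar> <= \<delta>"
proof -
 have i\<psi>: "integrable lborel \<psi>" by (rule compact_support_integrable[of _ \<epsilon>]) (simp_all add: \<psi>)
 have i: "integrable lborel (\<lambda>y. g (z - y) * \<psi> y)"
  by (rule compact_support_integrable[of _ \<epsilon>]) (simp_all add: \<psi> continuous_on_mult continuous_on_compose2[OF g] continuous_intros)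
 have "convolve g \<psi> z - g z = (LBINT y. g (z - y) * \<psi> y - g z * \<psi> y)"
  using i i\<psi> by (simp add: convolve_def \<psi>(4))
 also have "\<bar>\<dots>\<bar> <= (LBINT y. \<delta> * \<psi> y)"
 proof (rule order_trans[OF integral_abs_bound integral_mono])
  show "integrable lborel (\<lambda>y. \<bar>g (z - y) * \<psi> y - g z * \<psi> y\<bar>)"
   by (intro integrable_abs bintegrable_diff i integrable_mult_right i\<psi>)
  show "integrable lborel (\<lambda>y. \<delta> * \<psi> y)" by (intro integrable_mult_right i\<psi>)
  fix y
  show "\<bar>g (z - y) * \<psi> y - g z * \<psi> y\<bar> <= \<delta> * \<psi> y"
  proof (cases "norm y <= \<epsilon>")
   case True
   then show ?thesis using mult_right_mono[OF near[of y z] \<psi>(2)[of y]] \<psi>(2)[of y]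
    by (simp add: left_diff_distrib[symmetric] abs_mult)
  qed (simp add: \<psi>(3))
 qed
 also have "\<dots> = \<delta>" by (simp add: \<psi>(4))
 finally show ?thesis .
qed

text \<open>Commutativity is essential: with derivatives on the bump the convolution is smooth, with
  the derivative on w it is an average of nearby derivative values and hence close to the derivative
  of w.\<close>

lemma C1_mollification:
 fixes w :: "'a::euclidean_space => real"
 assumes w: "C_k (Suc 0) w" "!!z. R < norm z ==> w z = 0" and \<delta>: "0 < \<delta>"
 obtains \<phi> where "\<phi> \<in> test_functions" "!!z. \<bar>\<phi> z - w z\<bar> <= \<delta>"
  "!!z b. b \<in> Basis ==> \<bar>frechet_derivative \<phi> (at z) b - frechet_derivative w (at z) b\<bar> <= \<delta>" "!!z. R + 1 < norm z ==> \<phi> z = 0"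
proof -
 have cw: "cont_UNIV w" using w(1) by (simp add: differentiable_imp_continuous_on)
 have cd: "cont_UNIV (\<lambda>z. frechet_derivative w (at z) b)" if "b \<in> Basis" for b using w(1) that by simp
 obtain e0 where e0: "0 < e0" "!!z y. norm y <= e0 ==> \<bar>w (z - y) - w z\<bar> <= \<delta>"
  using compact_support_uniform[OF cw w(2) \<delta>] by blast
 have "\<forall>b\<in>Basis. \<exists>e>0. \<forall>z y. norm y <= e --> \<bar>frechet_derivative w (at (z - y)) b - frechet_derivative w (at z) b\<bar> <= \<delta>"
 proof
  fix b :: 'a assume "b \<in> Basis"
  show "\<exists>e>0. \<forall>z y. norm y <= e --> \<bar>frechet_derivative w (at (z - y)) b - frechet_derivative w (at z) b\<bar> <= \<delta>"
  proof (rule compact_support_uniform[OF cd[OF \<open>b \<in> Basis\<close>] _ \<delta>])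
   show "R < norm z ==> frechet_derivative w (at z) b = 0" for z by (rule frechet_derivative_zero_outside[OF w(2)])
  qed blast
 qed
 then obtain e where e: "!!b. b \<in> Basis ==> 0 < e b"
  "!!b z y. b \<in> Basis ==> norm y <= e b ==> \<bar>frechet_derivative w (at (z - y)) b - frechet_derivative w (at z) b\<bar> <= \<delta>"
  by metis
 \<comment> \<open>One radius serves the function and all its finitely many partial derivatives; the
   cap 1 limits the growth of the support.\<close>
 define \<epsilon> where "\<epsilon> = min (min e0 1) (Min (e ` Basis))"
 have \<epsilon>: "0 < \<epsilon>" "\<epsilon> <= e0" "\<epsilon> <= 1" "!!b. b \<in> Basis ==> \<epsilon> <= e b"
  using e0(1) e(1) by (auto simp: \<epsilon>_def min_le_iff_disj)
 obtain \<psi>0 :: "'a => real" where p0: "\<psi>0 \<in> test_functions" "!!z. 0 <= \<psi>0 z" "!!z. \<psi>0 z <= 1" "\<psi>0 0 = 1" "!!z. \<epsilon> <= norm z ==> \<psi>0 z = 0"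
  using bump_exists[OF \<epsilon>(1)] by metis
 have cp0: "cont_UNIV \<psi>0" using test_functionsD(1)[OF p0(1), of 0] by simp
 have ip0: "integrable lborel \<psi>0" by (rule compact_support_integrable[of _ \<epsilon>]) (simp_all add: cp0 p0)
 define I where "I = (LBINT y. \<psi>0 y)"
 have I: "0 < I"
 proof (rule ccontr)
  assume "\<not> 0 < I"
  then have "\<psi>0 0 = 0" by (intro nonneg_integral_zero_continuous[OF cp0 p0(2) ip0]) (simp add: I_def)
  then show False using p0(4) by simp
 qed
 define \<psi> where "\<psi> z = (1 / I) * \<psi>0 z" for z
 have p: "!!z. 0 <= \<psi> z" "!!z. \<epsilon> <= norm z ==> \<psi> z = 0" "(LBINT y. \<psi> y) = 1" "cont_UNIV \<psi>"
  using I p0 cp0 by (auto simp: \<psi>_def I_def[symmetric] intro: continuous_intros)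
 have pt: "\<psi> \<in> test_functions"
 proof (rule test_functionsI[of _ \<epsilon>])
  show "C_k k \<psi>" for k unfolding \<psi>_def[abs_def] by (intro C_k_cmult test_functionsD(1)[OF p0(1)])
 qed (simp add: p(2))
 note m = borel_continuous[OF p(4)] borel_continuous[OF cw]
 have pz: "\<epsilon> < norm z ==> \<psi> z = 0" for z by (simp add: p(2))
 define \<phi> where "\<phi> = convolve \<psi> w"
 have \<phi>': "\<phi> = convolve w \<psi>" unfolding \<phi>_def by (rule ext) (rule convolve_commute[OF m])
 have zero: "\<phi> z = 0" if "R + 1 < norm z" for z
 proof -
  have "w (z - y) * \<psi> y = 0" for y
  proof (cases "\<epsilon> <= norm y")
   case False
   then have "R < norm (z - y)" using that \<epsilon>(3) norm_triangle_ineq2[of z y] by linarith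
   then show ?thesis by (simp add: w(2))
  qed (simp add: p(2))
  then show ?thesis unfolding \<phi>' convolve_def by (simp only: integral_zero)
 qed
 have "C_k k \<phi>" for k unfolding \<phi>_def by (rule convolve_test_function[OF pt cw w(2)])
 then have t: "\<phi> \<in> test_functions" by (rule test_functionsI) (rule zero)
 have 1: "\<bar>\<phi> z - w z\<bar> <= \<delta>" for z unfolding \<phi>'
  by (rule convolve_near[OF cw p(4,1,2,3)]) (use e0(2) \<epsilon>(2) in auto)
 have 2: "\<bar>frechet_derivative \<phi> (at z) b - frechet_derivative w (at z) b\<bar> <= \<delta>" if b: "b \<in> Basis" for z b
 proof -
  have "(convolve w \<psi> has_derivative (\<lambda>h. convolve (\<lambda>z. frechet_derivative w (at z) h) \<psi> z)) (at z)"
   by (rule convolve_has_derivative[where R=R and \<rho>=\<epsilon>]) (rule w(1) p(4) | erule w(2) pz)+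
  then have "frechet_derivative \<phi> (at z) b = convolve (\<lambda>z. frechet_derivative w (at z) b) \<psi> z"
   unfolding \<phi>' using frechet_derivative_at by metis
  moreover have "\<bar>convolve (\<lambda>z. frechet_derivative w (at z) b) \<psi> z - frechet_derivative w (at z) b\<bar> <= \<delta>"
   by (rule convolve_near[OF cd[OF b] p(4,1,2,3)]) (use e(2)[OF b] \<epsilon>(4)[OF b] in auto)
  ultimately show ?thesis by simp
 qed
 show ?thesis by (rule that[OF t 1 2 zero])
qed

section \<open>Approximation in energy and membership in the Folland-Stein space\<close>

definition energy_density :: "('n::finite heis => real) => 'n heis => real" where
 "energy_density f z = (norm (horizontal_gradient f z))\<^sup>2 + (f z)\<^sup>2"

lemma energy_density_eq: "energy_density f z = (\<Sum>i\<in>UNIV. (X_field i f z)\<^sup>2 + (Y_field i f z)\<^sup>2) + (f z)\<^sup>2"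
 unfolding energy_density_def power2_norm_eq_inner horizontal_gradient_def
 by (simp add: inner_vec_def sum.distrib power2_eq_square)

lemma X_field_eq: "X_field i f z = frechet_derivative f (at z) (axis i 1, 0, 0) + 2 * fst (snd z) $ i * frechet_derivative f (at z) (0, 0, 1)"
 and Y_field_eq: "Y_field i f z = frechet_derivative f (at z) (0, axis i 1, 0) - 2 * fst z $ i * frechet_derivative f (at z) (0, 0, 1)"
 by (cases z; simp add: X_field_def Y_field_def d_dx_def d_dy_def d_dt_def)+

lemma heis_Basis: "(axis i 1, 0, 0) \<in> (Basis :: 'n::finite heis set)" "(0, axis i 1, 0) \<in> (Basis :: 'n heis set)" "(0, 0, 1) \<in> (Basis :: 'n heis set)"
 by (auto simp: Basis_prod_def axis_in_Basis_iff image_iff zero_prod_def)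

lemma C1_differentiable: "C_k (Suc 0) f ==> f differentiable at z"
 by (simp add: differentiable_on_def)

lemma C1_continuous: "C_k (Suc 0) f ==> cont_UNIV f"
 by (simp add: differentiable_imp_continuous_on)

lemma
 fixes f :: "'n::finite heis => real"
 assumes f: "C_k (Suc 0) f"
 shows continuous_on_X_field: "cont_UNIV (X_field i f)" and continuous_on_Y_field: "cont_UNIV (Y_field i f)"
  and continuous_on_energy_density: "cont_UNIV (energy_density f)"
proof -
 have d: "cont_UNIV (\<lambda>z. frechet_derivative f (at z) b)" if "b \<in> Basis" for b using f that by simp
 show X: "cont_UNIV (X_field i f)" for i unfolding X_field_eq[abs_def] by (intro continuous_intros d heis_Basis)
 show Y: "cont_UNIV (Y_field i f)" for i unfolding Y_field_eq[abs_def] by (intro continuous_intros d heis_Basis)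
 show "cont_UNIV (energy_density f)" unfolding energy_density_eq[abs_def] by (intro continuous_intros X Y C1_continuous f)
qed

lemma
 fixes f g :: "'n::finite heis => real"
 assumes f: "C_k (Suc 0) f" and g: "C_k (Suc 0) g"
 shows X_field_diff: "X_field i (\<lambda>z. f z - g z) z = X_field i f z - X_field i g z"
  and Y_field_diff: "Y_field i (\<lambda>z. f z - g z) z = Y_field i f z - Y_field i g z"
  and X_field_mult: "X_field i (\<lambda>z. f z * g z) z = f z * X_field i g z + X_field i f z * g z"
  and Y_field_mult: "Y_field i (\<lambda>z. f z * g z) z = f z * Y_field i g z + Y_field i f z * g z"
proof -
 note d = C1_differentiable[OF f, of z, THEN frechet_derivative_works[THEN iffD1]] C1_differentiable[OF g, of z, THEN frechet_derivative_works[THEN iffD1]]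
 note e = frechet_derivative_at[OF has_derivative_diff[OF d], symmetric] frechet_derivative_at[OF has_derivative_mult[OF d], symmetric]
 show "X_field i (\<lambda>z. f z - g z) z = X_field i f z - X_field i g z" "Y_field i (\<lambda>z. f z - g z) z = Y_field i f z - Y_field i g z"
  "X_field i (\<lambda>z. f z * g z) z = f z * X_field i g z + X_field i f z * g z" "Y_field i (\<lambda>z. f z * g z) z = f z * Y_field i g z + Y_field i f z * g z"
  unfolding X_field_eq Y_field_eq e by (simp_all add: algebra_simps)
qed

lemma energy_density_nonneg: "0 <= energy_density f z"
 by (simp add: energy_density_def)

text \<open>The pointwise bound (a + b)^2 <= 2 a^2 + 2 b^2 replaces the triangle inequality of the
  norm and can be integrated directly.\<close>

lemma energy_density_triangle:
 fixes f g h :: "'n::finite heis => real"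
 assumes "C_k (Suc 0) f" "C_k (Suc 0) g" "C_k (Suc 0) h"
 shows "energy_density (\<lambda>z. f z - h z) z <= 2 * energy_density (\<lambda>z. f z - g z) z + 2 * energy_density (\<lambda>z. g z - h z) z"
proof -
 have sq: "(a - c)\<^sup>2 <= 2 * (a - b)\<^sup>2 + 2 * (b - c)\<^sup>2" for a b c :: real
  using zero_le_power2[of "(a - b) - (b - c)"] by (simp add: power2_eq_square algebra_simps)
 have "energy_density (\<lambda>z. f z - h z) z <=
  (\<Sum>i\<in>UNIV. (2 * (X_field i f z - X_field i g z)\<^sup>2 + 2 * (X_field i g z - X_field i h z)\<^sup>2) +
   (2 * (Y_field i f z - Y_field i g z)\<^sup>2 + 2 * (Y_field i g z - Y_field i h z)\<^sup>2)) + (2 * (f z - g z)\<^sup>2 + 2 * (g z - h z)\<^sup>2)"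
  unfolding energy_density_eq X_field_diff[OF assms(1,3)] Y_field_diff[OF assms(1,3)]
  by (intro add_mono sum_mono sq)
 also have "\<dots> = 2 * energy_density (\<lambda>z. f z - g z) z + 2 * energy_density (\<lambda>z. g z - h z) z"
  unfolding energy_density_eq X_field_diff[OF assms(1,2)] Y_field_diff[OF assms(1,2)] X_field_diff[OF assms(2,3)] Y_field_diff[OF assms(2,3)]
  by (simp add: sum.distrib sum_distrib_left algebra_simps)
 finally show ?thesis .
qed

lemma nn_integral_energy_triangle:
 fixes f g h :: "'n::finite heis => real"
 assumes C: "C_k (Suc 0) f" "C_k (Suc 0) g" "C_k (Suc 0) h"
  and I: "(NNI z. ennreal (energy_density (\<lambda>z. f z - g z) z)) <= ennreal a" "(NNI z. ennreal (energy_density (\<lambda>z. g z - h z) z)) <= ennreal b"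
  and ab: "0 <= a" "0 <= b"
 shows "(NNI z. ennreal (energy_density (\<lambda>z. f z - h z) z)) <= ennreal (2 * a + 2 * b)"
proof -
 have [measurable]: "energy_density (\<lambda>z. f z - g z) \<in> borel_measurable borel" "energy_density (\<lambda>z. g z - h z) \<in> borel_measurable borel"
  by (intro borel_continuous continuous_on_energy_density C_k_diff C)+
 have "(NNI z. ennreal (energy_density (\<lambda>z. f z - h z) z)) <=
  (NNI z. 2 * ennreal (energy_density (\<lambda>z. f z - g z) z) + 2 * ennreal (energy_density (\<lambda>z. g z - h z) z))"
 proof (rule nn_integral_mono)
  fix z
  have "2 * ennreal (energy_density (\<lambda>z. f z - g z) z) + 2 * ennreal (energy_density (\<lambda>z. g z - h z) z) =
   ennreal (2 * energy_density (\<lambda>z. f z - g z) z + 2 * energy_density (\<lambda>z. g z - h z) z)"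
   by (simp add: ennreal_plus ennreal_mult energy_density_nonneg)
  then show "ennreal (energy_density (\<lambda>z. f z - h z) z) <= 2 * ennreal (energy_density (\<lambda>z. f z - g z) z) + 2 * ennreal (energy_density (\<lambda>z. g z - h z) z)"
   using energy_density_triangle[OF C, of z] by (simp add: ennreal_leI)
 qed
 also have "\<dots> = 2 * (NNI z. ennreal (energy_density (\<lambda>z. f z - g z) z)) + 2 * (NNI z. ennreal (energy_density (\<lambda>z. g z - h z) z))"
  by (simp add: nn_integral_add nn_integral_cmult)
 also have "\<dots> <= 2 * ennreal a + 2 * ennreal b" by (intro add_mono mult_left_mono I) auto
 also have "\<dots> = ennreal (2 * a + 2 * b)" using ab by (simp add: ennreal_plus ennreal_mult)
 finally show ?thesis .
qed

lemma test_function_C1: "f \<in> test_functions ==> C_k (Suc 0) f"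
 by (rule test_functionsD(1))

text \<open>Approximation in energy by test functions with error 1 / (k + 1) gives both demands at
  once: energy dominates the L^2 distance, and closeness to the common limit \<open>u\<close> makes
  the sequence Cauchy.\<close>

lemma FS_spaceI:
 fixes u :: "'n::finite heis => real"
 assumes u: "C_k (Suc 0) u" and approx: "!!\<eta>. 0 < \<eta> ==> \<exists>\<phi>\<in>test_functions. (NNI z. ennreal (energy_density (\<lambda>z. \<phi> z - u z) z)) <= ennreal \<eta>"
 shows "u \<in> FS_space"
proof -
 have "\<forall>k::nat. \<exists>\<phi>. \<phi> \<in> test_functions \<and> (NNI z. ennreal (energy_density (\<lambda>z. \<phi> z - u z) z)) <= ennreal (1 / (real k + 1))"
 proof
  fix k :: nat
  have "\<exists>\<phi>\<in>test_functions. (NNI z. ennreal (energy_density (\<lambda>z. \<phi> z - u z) z)) <= ennreal (1 / (real k + 1))"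
   by (rule approx) simp
  then show "\<exists>\<phi>. \<phi> \<in> test_functions \<and> (NNI z. ennreal (energy_density (\<lambda>z. \<phi> z - u z) z)) <= ennreal (1 / (real k + 1))" by blast
 qed
 from choice[OF this] obtain \<phi> where \<phi>0: "\<forall>k::nat. \<phi> k \<in> test_functions \<and>
   (NNI z. ennreal (energy_density (\<lambda>z. \<phi> k z - u z) z)) <= ennreal (1 / (real k + 1))"
  by (rule exE)
 have \<phi>: "\<phi> k \<in> test_functions" "(NNI z. ennreal (energy_density (\<lambda>z. \<phi> k z - u z) z)) <= ennreal (1 / (real k + 1))" for k
  using spec[OF \<phi>0, of k] by (rule conjunct1, rule conjunct2)
 note C = test_function_C1[OF \<phi>(1)]
 have um: "u \<in> borel_measurable lborel" using borel_continuous[OF C1_continuous[OF u]] by simp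
 have sym: "energy_density (\<lambda>z. u z - \<phi> k z) z = energy_density (\<lambda>z. \<phi> k z - u z) z" for k z
  unfolding energy_density_eq X_field_diff[OF C u] Y_field_diff[OF C u] X_field_diff[OF u C] Y_field_diff[OF u C]
  by (simp add: power2_commute)
 have L2: "(\<lambda>k. \<integral>\<^sup>+z. ennreal ((\<phi> k z - u z)\<^sup>2) \<partial>lebesgue) \<longlonglongrightarrow> 0"
 proof (rule tendsto_sandwich[OF _ _ tendsto_const])
  show "\<forall>\<^sub>F k in sequentially. (\<integral>\<^sup>+z. ennreal ((\<phi> k z - u z)\<^sup>2) \<partial>lebesgue) <= ennreal (1 / (real k + 1))"
  proof (intro always_eventually allI)
   fix k
   have "(\<integral>\<^sup>+z. ennreal ((\<phi> k z - u z)\<^sup>2) \<partial>lebesgue) <= (NNI z. ennreal (energy_density (\<lambda>z. \<phi> k z - u z) z))"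
    unfolding nn_integral_completion by (intro nn_integral_mono ennreal_leI) (simp add: energy_density_def)
   then show "(\<integral>\<^sup>+z. ennreal ((\<phi> k z - u z)\<^sup>2) \<partial>lebesgue) <= ennreal (1 / (real k + 1))" using \<phi>(2)[of k] by (rule order_trans)
  qed
  have "(\<lambda>k. 1 / (real k + 1)) \<longlonglongrightarrow> 0" by real_asymp
  then show "(\<lambda>k. ennreal (1 / (real k + 1))) \<longlonglongrightarrow> 0" using tendsto_ennrealI by fastforce
 qed simp
 have cauchy: "\<exists>N. \<forall>j\<ge>N. \<forall>k\<ge>N. FS_norm (\<lambda>z. \<phi> j z - \<phi> k z) < e" if e: "0 < e" for e
 proof -
  \<comment> \<open>Two errors of 1 / (N + 1), each doubled, bound the squared distance by 4 / (N +
    1), which is then below e^2.\<close>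
  obtain N :: nat where N: "4 / (e\<^sup>2) < real N" using reals_Archimedean2 by blast
  have "FS_norm (\<lambda>z. \<phi> j z - \<phi> k z) < e" if jk: "N <= j" "N <= k" for j k
  proof -
   let ?a = "1 / (real N + 1)"
   let ?D = "energy_density (\<lambda>z. \<phi> j z - \<phi> k z)"
   have near: "(NNI z. ennreal (energy_density (\<lambda>z. \<phi> k z - u z) z)) <= ennreal ?a" if "N <= k" for k
    by (rule order_trans[OF \<phi>(2)]) (use that in \<open>intro ennreal_leI divide_left_mono; simp\<close>)
   have I: "(NNI z. ennreal (?D z)) <= ennreal (2 * ?a + 2 * ?a)"
    by (rule nn_integral_energy_triangle[OF C u C]) (simp_all add: sym near jk)
   have Dm: "borel_fun ?D"
    by (intro borel_continuous continuous_on_energy_density C_k_diff C)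
   have "FS_norm (\<lambda>z. \<phi> j z - \<phi> k z) = sqrt (LBINT z. ?D z)"
   proof -
    have "FS_norm g = sqrt (\<integral>z. energy_density g z \<partial>lebesgue)" for g :: "'n heis => real"
     unfolding FS_norm_def energy_density_def ..
    then show ?thesis using integral_completion[of ?D lborel] Dm by simp
   qed
   also have "(LBINT z. ?D z) = enn2real (NNI z. ennreal (?D z))"
    using Dm by (intro integral_eq_nn_integral) (simp_all add: energy_density_nonneg)
   also have "sqrt \<dots> <= sqrt (4 * ?a)" using I by (intro real_sqrt_le_mono enn2real_leI) auto
   also have "\<dots> < sqrt (e\<^sup>2)"
   proof (rule real_sqrt_less_mono)
    have "4 < e\<^sup>2 * real N" using N e by (simp add: field_simps)
    moreover have "0 < e\<^sup>2" using e by simp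
    ultimately have "4 < e\<^sup>2 * (real N + 1)" unfolding distrib_left mult_1_right by linarith
    then show "4 * ?a < e\<^sup>2" by (simp add: field_simps)
   qed
   finally show ?thesis using e by simp
  qed
  then show ?thesis by blast
 qed
 show ?thesis unfolding FS_space_def using um \<phi>(1) cauchy L2 by (auto intro: measurable_completion)
qed

text \<open>Both functions vanish outside the ball of radius \<rho>, where the coefficients of the
  fields are at most 2 \<rho>; the energy of the difference is thus bounded by the volume times a
  constant.\<close>

lemma compact_support_energy_approx:
 fixes w :: "'n::finite heis => real"
 assumes w: "C_k (Suc 0) w" "!!z. R < norm z ==> w z = 0" and \<eta>: "0 < \<eta>"
 shows "\<exists>\<phi>\<in>test_functions. (NNI z. ennreal (energy_density (\<lambda>z. \<phi> z - w z) z)) <= ennreal \<eta>"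
proof -
 define \<rho> where "\<rho> = \<bar>R\<bar> + 1"
 \<comment> \<open>Each of the n indices contributes two squares of (1 + 2 \<rho>) \<delta>; the
   final 1 belongs to the undifferentiated term.\<close>
 define K where "K = real CARD('n) * (2 * (1 + 2 * \<rho>)\<^sup>2) + 1"
 define V where "V = measure lborel (cball (0 :: 'n heis) \<rho>)"
 have K: "0 < K" "0 <= V" by (simp_all add: K_def V_def add_nonneg_pos)
 \<comment> \<open>The cap 1 allows \<delta>^2 <= \<delta>; the other bound gives K V \<delta> <=
   \<eta>, and the added 1 keeps its denominator positive.\<close>
 define \<delta> where "\<delta> = min 1 (\<eta> / (K * V + 1))"
 have KV: "0 < K * V + 1" using K by (simp add: add_nonneg_pos)
 have \<delta>: "0 < \<delta>" "\<delta> <= 1" "K * V * \<delta> <= \<eta>"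
 proof -
  show "0 < \<delta>" "\<delta> <= 1" using \<eta> KV by (simp_all add: \<delta>_def)
  have "K * V * \<delta> <= (K * V + 1) * (\<eta> / (K * V + 1))"
   using K \<eta> KV \<open>0 < \<delta>\<close> by (intro mult_mono) (auto simp: \<delta>_def)
  then show "K * V * \<delta> <= \<eta>" using KV by simp
 qed
 obtain \<phi> where \<phi>: "\<phi> \<in> test_functions" "!!z. \<bar>\<phi> z - w z\<bar> <= \<delta>"
  "!!z b. b \<in> Basis ==> \<bar>frechet_derivative \<phi> (at z) b - frechet_derivative w (at z) b\<bar> <= \<delta>" "!!z. R + 1 < norm z ==> \<phi> z = 0"
  using C1_mollification[OF w \<delta>(1)] by blast
 note C = test_function_C1[OF \<phi>(1)]
 have bound: "energy_density (\<lambda>z. \<phi> z - w z) z <= K * \<delta> * indicator (cball 0 \<rho>) z" for z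
 proof (cases "norm z <= \<rho>")
  case False
  then have z: "R + 1 < norm z" "R < norm z" by (auto simp: \<rho>_def)
  have zero: "frechet_derivative \<phi> (at z) h = 0" "frechet_derivative w (at z) h = 0" for h
   by (rule frechet_derivative_zero_outside[OF _ z(1)], erule \<phi>(4)) (rule frechet_derivative_zero_outside[OF _ z(2)], erule w(2))
  have "energy_density (\<lambda>z. \<phi> z - w z) z = 0"
   unfolding energy_density_eq X_field_diff[OF C w(1)] Y_field_diff[OF C w(1)] X_field_eq Y_field_eq zero
   using \<phi>(4)[OF z(1)] w(2)[OF z(2)] by simp
  then show ?thesis using False by simp
 next
  case True
  have c: "\<bar>fst (snd z) $ i\<bar> <= \<rho>" "\<bar>fst z $ i\<bar> <= \<rho>" for i
   using component_le_norm_cart[of "fst z" i] component_le_norm_cart[of "fst (snd z)" i] True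
    norm_fst_le[of "fst z" "snd z"] norm_fst_le[of "fst (snd z)" "snd (snd z)"] norm_snd_le[of "snd z" "fst z"] by auto
  have lin: "\<bar>(a - a') + 2 * s * (b - b')\<bar> <= (1 + 2 * \<rho>) * \<delta>" if "\<bar>a - a'\<bar> <= \<delta>" "\<bar>b - b'\<bar> <= \<delta>" "\<bar>s\<bar> <= \<rho>" for a a' b b' s
  proof -
   have "\<bar>(a - a') + 2 * s * (b - b')\<bar> <= \<bar>a - a'\<bar> + 2 * (\<bar>s\<bar> * \<bar>b - b'\<bar>)"
    by (rule order_trans[OF abs_triangle_ineq]) (simp add: abs_mult)
   also have "\<dots> <= \<delta> + 2 * (\<rho> * \<delta>)" using that by (intro add_mono mult_left_mono mult_mono) auto
   finally show ?thesis by (simp add: algebra_simps)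
  qed
  have X: "\<bar>X_field i \<phi> z - X_field i w z\<bar> <= (1 + 2 * \<rho>) * \<delta>" for i
   using lin[OF \<phi>(3)[OF heis_Basis(1)[of i]] \<phi>(3)[OF heis_Basis(3)] c(1)[of i], of z z]
   unfolding X_field_eq by (simp add: algebra_simps)
  have Y: "\<bar>Y_field i \<phi> z - Y_field i w z\<bar> <= (1 + 2 * \<rho>) * \<delta>" for i
   using lin[OF \<phi>(3)[OF heis_Basis(2)[of i]] \<phi>(3)[OF heis_Basis(3)], of "- fst z $ i" z z] c(2)[of i]
   unfolding Y_field_eq by (simp add: algebra_simps)
  have sq: "a\<^sup>2 <= b\<^sup>2" if "\<bar>a\<bar> <= b" for a b :: real using that by (simp add: abs_le_square_iff[symmetric])
  have "energy_density (\<lambda>z. \<phi> z - w z) z <= (\<Sum>i\<in>(UNIV :: 'n set). ((1 + 2 * \<rho>) * \<delta>)\<^sup>2 + ((1 + 2 * \<rho>) * \<delta>)\<^sup>2) + \<delta>\<^sup>2"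
   unfolding energy_density_eq X_field_diff[OF C w(1)] Y_field_diff[OF C w(1)]
   by (intro add_mono sum_mono sq X Y \<phi>(2))
  also have "\<dots> = K * \<delta>\<^sup>2" unfolding power_mult_distrib by (simp add: K_def algebra_simps)
  also have "\<dots> <= K * \<delta>" using \<delta> K by (intro mult_left_mono) (simp_all add: power2_eq_square mult_left_le)
  finally show ?thesis using True by simp
 qed
 have "(NNI z. ennreal (energy_density (\<lambda>z. \<phi> z - w z) z)) <= (NNI z. ennreal (K * \<delta>) * indicator (cball (0 :: 'n heis) \<rho>) z)"
 proof (rule nn_integral_mono)
  show "ennreal (energy_density (\<lambda>z. \<phi> z - w z) z) <= ennreal (K * \<delta>) * indicator (cball 0 \<rho>) z" for z
   using ennreal_leI[OF bound[of z]] by (cases "z \<in> cball 0 \<rho>") (simp_all del: mem_cball)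
 qed
 also have "\<dots> = ennreal (K * \<delta>) * emeasure lborel (cball (0 :: 'n heis) \<rho>)" by (simp add: nn_integral_cmult_indicator)
 also have "emeasure lborel (cball (0 :: 'n heis) \<rho>) = ennreal V" unfolding V_def
  using emeasure_lborel_cball_finite[of "0 :: 'n heis" \<rho>] by (intro emeasure_eq_ennreal_measure) simp
 also have "ennreal (K * \<delta>) * ennreal V = ennreal (K * V * \<delta>)" using K \<delta> by (simp add: ennreal_mult'[symmetric] mult_ac)
 also have "\<dots> <= ennreal \<eta>" using \<delta>(3) by (rule ennreal_leI)
 finally show ?thesis by (rule bexI[OF _ \<phi>(1)])
qed

lemma bounded_linear_dil: "bounded_linear (dil c :: 'n::finite heis => 'n heis)"
 unfolding dil_def
 by (intro bounded_linear_Pair bounded_linear_scaleR_right bounded_linear_compose[OF bounded_linear_scaleR_right] bounded_linear_fst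
  bounded_linear_compose[OF bounded_linear_fst] bounded_linear_snd bounded_linear_const_mult bounded_linear_compose[OF bounded_linear_snd])

lemma
 fixes f :: "'n::finite heis => real"
 assumes f: "C_k (Suc 0) f"
 shows C1_dil: "C_k (Suc 0) (\<lambda>z. f (dil c z))"
  and X_field_dil: "X_field i (\<lambda>z. f (dil c z)) z = c * X_field i f (dil c z)"
  and Y_field_dil: "Y_field i (\<lambda>z. f (dil c z)) z = c * Y_field i f (dil c z)"
proof -
 note d = has_derivative_compose[OF bounded_linear_imp_has_derivative[OF bounded_linear_dil] C1_differentiable[OF f, THEN frechet_derivative_works[THEN iffD1]]]
 have e: "frechet_derivative (\<lambda>z. f (dil c z)) (at z) h = frechet_derivative f (at (dil c z)) (dil c h)" for z h
  using frechet_derivative_at[OF d] by metis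
 have "(\<lambda>z. f (dil c z)) differentiable_on UNIV" using d unfolding differentiable_on_def differentiable_def by blast
 moreover have "cont_UNIV (\<lambda>z. frechet_derivative (\<lambda>z. f (dil c z)) (at z) b)" for b
 proof -
  have "cont_UNIV (\<lambda>z. frechet_derivative f (at (dil c z)) b')" if "b' \<in> Basis" for b'
  proof -
   have "cont_UNIV (\<lambda>z. frechet_derivative f (at z) b')" using f that by simp
   then show "cont_UNIV (\<lambda>z. frechet_derivative f (at (dil c z)) b')"
    by (rule continuous_on_compose2[where g="\<lambda>z. frechet_derivative f (at z) b'" and f="dil c" and s=UNIV and t=UNIV])
     (rule linear_continuous_on[OF bounded_linear_dil], rule subset_UNIV)
  qed
  then show ?thesis unfolding e frechet_derivative_sum_Basis[OF C1_differentiable[OF f], of _ "dil c b"]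
   by (intro continuous_on_sum continuous_on_mult continuous_on_const)
 qed
 ultimately show "C_k (Suc 0) (\<lambda>z. f (dil c z))" by simp
 have lin: "frechet_derivative f (at z) (a *\<^sub>R h) = a * frechet_derivative f (at z) h" for z a h
  using linear_cmul[OF linear_frechet_derivative[OF C1_differentiable[OF f]], of z a h] by simp
 have v: "dil c (axis i 1, 0, 0) = c *\<^sub>R (axis i 1, 0, 0)" "dil c (0, axis i 1, 0) = c *\<^sub>R (0, axis i 1, 0)" "dil c (0, 0, 1) = (c * c) *\<^sub>R (0, 0, 1 :: real)"
  by (simp_all add: dil_def power2_eq_square)
 show "X_field i (\<lambda>z. f (dil c z)) z = c * X_field i f (dil c z)" "Y_field i (\<lambda>z. f (dil c z)) z = c * Y_field i f (dil c z)"
  unfolding X_field_eq Y_field_eq e v lin by (simp_all add: dil_def algebra_simps)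
qed

lemma norm_dil_ge:
 fixes z :: "'n::finite heis"
 assumes "0 <= c" "c <= 1" shows "c\<^sup>2 * norm z <= norm (dil c z)"
proof (rule power2_le_imp_le)
 have "c ^ 4 <= c ^ 2" using assms by (intro power_decreasing) auto
 then have "c ^ 4 * (fst z \<bullet> fst z + fst (snd z) \<bullet> fst (snd z)) <= c ^ 2 * (fst z \<bullet> fst z + fst (snd z) \<bullet> fst (snd z))"
  by (intro mult_right_mono) auto
 then show "(c\<^sup>2 * norm z)\<^sup>2 <= (norm (dil c z))\<^sup>2"
  unfolding power_mult_distrib power2_norm_eq_inner
  by (simp add: dil_def inner_prod_def algebra_simps power2_eq_square power4_eq_xxxx)
qed simp

text \<open>Cutting off by a dilated bump costs little energy because \<open>X_field\<close> and \<open>Y_field\<close>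
 are homogeneous of degree one with respect to \<open>dil\<close>.\<close>

lemma finite_energy_FS_space:
 fixes u :: "'n::finite heis => real"
 assumes u: "C_k (Suc 0) u" and fin: "(NNI z. ennreal (energy_density u z)) < \<infinity>"
 shows "u \<in> FS_space"
proof (rule FS_spaceI[OF u])
 fix \<eta>0 :: real assume \<eta>0: "0 < \<eta>0"
 obtain \<psi> :: "'n heis => real" where \<psi>: "\<psi> \<in> test_functions" "!!z. 0 <= \<psi> z" "!!z. \<psi> z <= 1" "\<psi> 0 = 1" "!!z. 1 <= norm z ==> \<psi> z = 0"
  using bump_exists[OF zero_less_one] by blast
 note C\<psi> = test_function_C1[OF \<psi>(1)]
 have "\<exists>C. \<forall>z. energy_density \<psi> z <= C"
 proof (rule compact_support_bounded[OF continuous_on_energy_density[OF C\<psi>]])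
  fix z :: "'n heis" assume z: "1 < norm z"
  have "frechet_derivative \<psi> (at z) h = 0" for h by (rule frechet_derivative_zero_outside[OF _ z]) (simp add: \<psi>(5))
  then show "energy_density \<psi> z = 0" using z by (simp add: energy_density_eq X_field_eq Y_field_eq \<psi>(5))
 next
  fix C assume "!!z. \<bar>energy_density \<psi> z\<bar> <= C"
  then show ?thesis using abs_le_D1 by blast
 qed
 then obtain C where C: "!!z. energy_density \<psi> z <= C" by blast
 have C0: "0 <= C" using C[of 0] energy_density_nonneg[of \<psi> 0] by linarith
 define c where "c k = 1 / (real k + 1)" for k :: nat
 define w where "w k z = \<psi> (dil (c k) z) * u z" for k z
 \<comment> \<open>A majorant for the energy of the cutoff error: the first term is the loss from
   multiplying by the cutoff, the second comes from its derivatives, whose squares carry (c k)^2 by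
   homogeneity.\<close>
 define F where "F k z = 2 * (1 - \<psi> (dil (c k) z))\<^sup>2 * energy_density u z + 2 * (c k)\<^sup>2 * C * (u z)\<^sup>2" for k z
 have c: "0 < c k" "c k <= 1" for k by (simp_all add: c_def)
 have cl: "c \<longlonglongrightarrow> 0" unfolding c_def by real_asymp
 note C\<chi> = C1_dil[OF C\<psi>, of "c k" for k]
 have Cw: "C_k (Suc 0) (w k)" for k unfolding w_def[abs_def] by (rule C_k_mult[OF C\<chi> u])
 have le: "energy_density (\<lambda>z. w k z - u z) z <= F k z" for k z
 proof -
  let ?s = "\<psi> (dil (c k) z)"
  have sq: "(s * a + x * b - a)\<^sup>2 <= 2 * (1 - s)\<^sup>2 * a\<^sup>2 + 2 * x\<^sup>2 * b\<^sup>2" for a b s x :: real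
  proof -
   have "(s * a + x * b - a)\<^sup>2 <= 2 * ((1 - s) * a)\<^sup>2 + 2 * (x * b)\<^sup>2"
    using zero_le_power2[of "(1 - s) * a + x * b"] by (simp add: power2_eq_square algebra_simps)
   then show ?thesis by (simp add: power_mult_distrib mult.assoc)
  qed
  have X: "(X_field i (\<lambda>z. w k z - u z) z)\<^sup>2 <= 2 * (1 - ?s)\<^sup>2 * (X_field i u z)\<^sup>2 + 2 * (c k)\<^sup>2 * (u z)\<^sup>2 * (X_field i \<psi> (dil (c k) z))\<^sup>2" for i
   using sq[of ?s "X_field i u z" "c k * X_field i \<psi> (dil (c k) z)" "u z"]
   unfolding X_field_diff[OF Cw u] unfolding w_def[abs_def] X_field_mult[OF C\<chi> u] X_field_dil[OF C\<psi>]
   by (simp add: power_mult_distrib mult_ac)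
  have Y: "(Y_field i (\<lambda>z. w k z - u z) z)\<^sup>2 <= 2 * (1 - ?s)\<^sup>2 * (Y_field i u z)\<^sup>2 + 2 * (c k)\<^sup>2 * (u z)\<^sup>2 * (Y_field i \<psi> (dil (c k) z))\<^sup>2" for i
   using sq[of ?s "Y_field i u z" "c k * Y_field i \<psi> (dil (c k) z)" "u z"]
   unfolding Y_field_diff[OF Cw u] unfolding w_def[abs_def] Y_field_mult[OF C\<chi> u] Y_field_dil[OF C\<psi>]
   by (simp add: power_mult_distrib mult_ac)
  have U: "(w k z - u z)\<^sup>2 <= 2 * (1 - ?s)\<^sup>2 * (u z)\<^sup>2"
   using sq[of ?s "u z" 0 0] by (simp add: w_def)
  have "energy_density (\<lambda>z. w k z - u z) z <=
   (\<Sum>i\<in>UNIV. (2 * (1 - ?s)\<^sup>2 * (X_field i u z)\<^sup>2 + 2 * (c k)\<^sup>2 * (u z)\<^sup>2 * (X_field i \<psi> (dil (c k) z))\<^sup>2) +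
    (2 * (1 - ?s)\<^sup>2 * (Y_field i u z)\<^sup>2 + 2 * (c k)\<^sup>2 * (u z)\<^sup>2 * (Y_field i \<psi> (dil (c k) z))\<^sup>2)) + 2 * (1 - ?s)\<^sup>2 * (u z)\<^sup>2"
   unfolding energy_density_eq by (intro add_mono sum_mono X Y U)
  also have "\<dots> = 2 * (1 - ?s)\<^sup>2 * energy_density u z +
    2 * (c k)\<^sup>2 * (u z)\<^sup>2 * (\<Sum>i\<in>UNIV. (X_field i \<psi> (dil (c k) z))\<^sup>2 + (Y_field i \<psi> (dil (c k) z))\<^sup>2)"
  proof -
   have "(\<Sum>i\<in>(UNIV :: 'n set). (a * x i + b * y i) + (a * x' i + b * y' i)) + a * t = a * ((\<Sum>i\<in>UNIV. x i + x' i) + t) + b * (\<Sum>i\<in>UNIV. y i + y' i)"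
    for a b t :: real and x x' y y' by (simp add: sum.distrib sum_distrib_left algebra_simps)
   then show ?thesis unfolding energy_density_eq .
  qed
  also have "\<dots> <= 2 * (1 - ?s)\<^sup>2 * energy_density u z + 2 * (c k)\<^sup>2 * (u z)\<^sup>2 * C"
  proof (intro add_left_mono mult_left_mono)
   have "(\<Sum>i\<in>UNIV. (X_field i \<psi> (dil (c k) z))\<^sup>2 + (Y_field i \<psi> (dil (c k) z))\<^sup>2) <= energy_density \<psi> (dil (c k) z)"
    by (simp add: energy_density_eq)
   then show "(\<Sum>i\<in>UNIV. (X_field i \<psi> (dil (c k) z))\<^sup>2 + (Y_field i \<psi> (dil (c k) z))\<^sup>2) <= C" using C by (rule order_trans)
  qed simp
  finally show ?thesis by (simp add: F_def mult_ac)
 qed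
 have [measurable]: "borel_fun (energy_density u)" "borel_fun u" "borel_fun \<psi>"
  by (intro borel_continuous continuous_on_energy_density C1_continuous u C\<psi>)+
 have [measurable]: "borel_fun (F k)" for k unfolding F_def[abs_def] by measurable
 have "(\<lambda>k. NNI z. ennreal (F k z)) \<longlonglongrightarrow> (\<integral>\<^sup>+z. 0 \<partial>(lborel :: 'n heis measure))"
 proof (rule nn_integral_dominated_convergence[where w="\<lambda>z. ennreal (2 + 2 * C) * ennreal (energy_density u z)"])
  show "AE z in lborel. ennreal (F k z) <= ennreal (2 + 2 * C) * ennreal (energy_density u z)" for k
  proof (rule AE_I2)
   fix z
   have "(1 - \<psi> (dil (c k) z))\<^sup>2 <= 1" using \<psi>(2,3)[of "dil (c k) z"] by (simp add: abs_square_le_1)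
   moreover have "(c k)\<^sup>2 <= 1" using c[of k] by (simp add: abs_square_le_1)
   moreover have "(u z)\<^sup>2 <= energy_density u z" by (simp add: energy_density_def)
   ultimately have "F k z <= 2 * 1 * energy_density u z + 2 * 1 * C * energy_density u z"
    unfolding F_def using C0 energy_density_nonneg[of u z] by (intro add_mono mult_mono) auto
   then have "F k z <= (2 + 2 * C) * energy_density u z" by (simp add: algebra_simps)
   from ennreal_leI[OF this] show "ennreal (F k z) <= ennreal (2 + 2 * C) * ennreal (energy_density u z)"
    using C0 energy_density_nonneg[of u z] by (simp only: ennreal_mult'')
  qed
  show "(NNI z. ennreal (2 + 2 * C) * ennreal (energy_density u z)) < \<infinity>"
   using fin by (subst nn_integral_cmult) (simp_all add: ennreal_mult_less_top)
  show "AE z in lborel. (\<lambda>k. ennreal (F k z)) \<longlonglongrightarrow> 0"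
  proof (rule AE_I2)
   fix z :: "'n heis"
   have cont: "cont_UNIV (\<lambda>s. \<psi> (dil s z))"
    by (intro continuous_on_compose2[OF C1_continuous[OF C\<psi>]] continuous_on_dil continuous_on_id continuous_on_const) simp
   then have "isCont (\<lambda>s. \<psi> (dil s z)) 0" by (simp add: continuous_on_eq_continuous_at)
   from isCont_tendsto_compose[OF this cl] have "(\<lambda>k. \<psi> (dil (c k) z)) \<longlonglongrightarrow> \<psi> (dil 0 z)" .
   moreover have "dil 0 z = 0" by (simp add: dil_def zero_prod_def)
   ultimately have "(\<lambda>k. \<psi> (dil (c k) z)) \<longlonglongrightarrow> 1" by (simp add: \<psi>(4))
   then have "(\<lambda>k. F k z) \<longlonglongrightarrow> 2 * (1 - 1)\<^sup>2 * energy_density u z + 2 * 0\<^sup>2 * C * (u z)\<^sup>2"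
    unfolding F_def by (intro tendsto_intros cl)
   then have "(\<lambda>k. F k z) \<longlonglongrightarrow> 0" by simp
   then show "(\<lambda>k. ennreal (F k z)) \<longlonglongrightarrow> 0" using tendsto_ennrealI by fastforce
  qed
 qed measurable
 then have "(\<lambda>k. NNI z. ennreal (F k z)) \<longlonglongrightarrow> 0" by simp
 moreover have "0 < ennreal (\<eta>0 / 4)" using \<eta>0 by simp
 ultimately have "\<forall>\<^sub>F k in sequentially. (NNI z. ennreal (F k z)) < ennreal (\<eta>0 / 4)" by (rule order_tendstoD(2))
 then obtain k where k: "(NNI z. ennreal (F k z)) < ennreal (\<eta>0 / 4)"
  unfolding eventually_sequentially by blast
 have I1: "(NNI z. ennreal (energy_density (\<lambda>z. w k z - u z) z)) <= ennreal (\<eta>0 / 4)"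
  by (rule order_trans[OF nn_integral_mono less_imp_le[OF k]]) (rule ennreal_leI[OF le])
 have wz: "w k z = 0" if z: "1 / (c k)\<^sup>2 < norm z" for z
 proof -
  have "1 <= (c k)\<^sup>2 * norm z" using z c(1)[of k] by (simp add: field_simps)
  also have "\<dots> <= norm (dil (c k) z)" by (rule norm_dil_ge) (use c[of k] in auto)
  finally show ?thesis by (simp add: w_def \<psi>(5))
 qed
 have "0 < \<eta>0 / 4" using \<eta>0 by simp
 from compact_support_energy_approx[OF Cw wz this]
 obtain \<phi> where \<phi>: "\<phi> \<in> test_functions" "(NNI z. ennreal (energy_density (\<lambda>z. \<phi> z - w k z) z)) <= ennreal (\<eta>0 / 4)" by blast
 have "(NNI z. ennreal (energy_density (\<lambda>z. \<phi> z - u z) z)) <= ennreal (2 * (\<eta>0 / 4) + 2 * (\<eta>0 / 4))"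
  by (rule nn_integral_energy_triangle[OF test_function_C1[OF \<phi>(1)] Cw u \<phi>(2) I1]) (use \<eta>0 in simp_all)
 then have "(NNI z. ennreal (energy_density (\<lambda>z. \<phi> z - u z) z)) <= ennreal \<eta>0" by simp
 then show "\<exists>\<phi>\<in>test_functions. (NNI z. ennreal (energy_density (\<lambda>z. \<phi> z - u z) z)) <= ennreal \<eta>0"
  by (rule bexI[OF _ \<phi>(1)])
qed

section \<open>Square integrability of the horizontal gradient\<close>

lemma nn_integral_wavg:
 fixes g K :: "'n::finite heis => real"
 assumes K: "integrable lborel K" "!!w. 0 <= K w" and \<omega>: "integrable lborel \<omega>" "!!e. 0 <= \<omega> e"
  and g: "borel_fun g" "!!z. 0 <= g z" "!!z. g z <= B"
 shows "(NNI z. ennreal (wavg \<omega> K g z)) = ennreal (LBINT e. \<omega> e) * (ennreal (LBINT w. K w) * (NNI z. ennreal (g z)))"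
proof -
 have b: "\<bar>g z\<bar> <= B" for z using g(2,3)[of z] by simp
 have [measurable]: "borel_fun g" "borel_fun K" "borel_fun \<omega>" using g K \<omega> by auto
 have a0: "0 <= avg e K g z" for e z unfolding avg_def by (intro integral_nonneg_AE AE_I2 mult_nonneg_nonneg K g)
 have 1: "ennreal (avg e K g z) = (NNI w. ennreal (K w) * ennreal (g (z \<star> dil e w)))" for e z
  unfolding avg_def using g(2) K(2)
  by (subst nn_integral_eq_integral[symmetric, OF avg_integrable[OF K(1) g(1) b]]) (simp_all add: ennreal_mult)
 have 2: "ennreal (wavg \<omega> K g z) = (NNI e. ennreal (\<omega> e) * ennreal (avg e K g z))" for z
  unfolding wavg_def using a0 \<omega>(2)
  by (subst nn_integral_eq_integral[symmetric, OF wavg_integrable[OF \<omega>(1) K(1) g(1) b]]) (simp_all add: ennreal_mult)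
 have 3: "(NNI z. ennreal (avg e K g z)) = ennreal (LBINT w. K w) * (NNI z. ennreal (g z))" for e
 proof -
  have "(NNI z. ennreal (avg e K g z)) = (NNI w. NNI z. ennreal (K w) * ennreal (g (z \<star> dil e w)))"
   unfolding 1 by (rule lborel_pair.Fubini') measurable
  also have "\<dots> = (NNI w. ennreal (K w) * (NNI z. ennreal (g z)))"
  proof (rule nn_integral_cong)
   fix w
   have "(NNI z. ennreal (g (z \<star> dil e w))) = (NNI z. ennreal (g z))" by (rule nn_integral_hmul_right) measurable
   then show "(NNI z. ennreal (K w) * ennreal (g (z \<star> dil e w))) = ennreal (K w) * (NNI z. ennreal (g z))"
    by (simp add: nn_integral_cmult)
  qed
  also have "\<dots> = (NNI w. ennreal (K w)) * (NNI z. ennreal (g z))" by (rule nn_integral_multc) measurable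
  also have "(NNI w. ennreal (K w)) = ennreal (LBINT w. K w)" by (rule nn_integral_eq_integral[OF K(1)]) (simp add: K(2))
  finally show ?thesis .
 qed
 have "(NNI z. ennreal (wavg \<omega> K g z)) = (NNI e. NNI z. ennreal (\<omega> e) * ennreal (avg e K g z))"
  unfolding 2 by (rule lborel_pair.Fubini') measurable
 also have "\<dots> = (NNI e. ennreal (\<omega> e) * (ennreal (LBINT w. K w) * (NNI z. ennreal (g z))))"
  by (intro nn_integral_cong) (simp add: nn_integral_cmult 3)
 also have "\<dots> = (NNI e. ennreal (\<omega> e)) * (ennreal (LBINT w. K w) * (NNI z. ennreal (g z)))" by (rule nn_integral_multc) measurable
 also have "(NNI e. ennreal (\<omega> e)) = ennreal (LBINT e. \<omega> e)" by (rule nn_integral_eq_integral[OF \<omega>(1)]) (simp add: \<omega>(2))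
 finally show ?thesis .
qed

text \<open>The Cauchy-Schwarz inequality for the double average, in discriminant form: 2 a X <= a^2
  m + W holds for every real a by integrating a pointwise inequality, and a = X / m is inserted. The
  summand 1 in m permits this division.\<close>

lemma wavg_square_le:
 fixes f K :: "'n::finite heis => real"
 assumes K: "integrable lborel K" and \<omega>: "integrable lborel \<omega>" and f: "borel_fun f" "!!z. \<bar>f z\<bar> <= B"
 defines "m \<equiv> (LBINT e. \<bar>\<omega> e\<bar>) * (LBINT w. \<bar>K w\<bar>) + 1"
 shows "(wavg \<omega> K f z)\<^sup>2 <= m * wavg (\<lambda>e. \<bar>\<omega> e\<bar>) (\<lambda>w. \<bar>K w\<bar>) (\<lambda>z. (f z)\<^sup>2) z"
proof -
 define W where "W = wavg (\<lambda>e. \<bar>\<omega> e\<bar>) (\<lambda>w. \<bar>K w\<bar>) (\<lambda>z. (f z)\<^sup>2) z"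
 let ?k = "\<integral>w. \<bar>K w\<bar> \<partial>(lborel :: 'n heis measure)"
 have m: "0 < m" unfolding m_def by (intro add_nonneg_pos mult_nonneg_nonneg integral_nonneg_AE) auto
 have f2: "borel_fun (\<lambda>z. (f z)\<^sup>2)" using f(1) by measurable
 have f2b: "\<bar>(f z)\<^sup>2\<bar> <= B\<^sup>2" for z using f(2)[of z] abs_le_square_iff[of "f z" B] by simp
 note aK = integrable_abs[OF K] and a\<omega> = integrable_abs[OF \<omega>]
 note iW = wavg_integrable[OF a\<omega> aK f2 f2b]
 have avg_le: "\<bar>2 * a * avg e K f z\<bar> <= a\<^sup>2 * ?k + avg e (\<lambda>w. \<bar>K w\<bar>) (\<lambda>z. (f z)\<^sup>2) z" for a e
 proof -
  have i1: "integrable lborel (\<lambda>w. K w * f (z \<star> dil e w))" by (rule avg_integrable[OF K f])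
  have i2: "integrable lborel (\<lambda>w. \<bar>K w\<bar> * (f (z \<star> dil e w))\<^sup>2)" by (rule avg_integrable[OF aK f2 f2b])
  have "\<bar>2 * a * avg e K f z\<bar> = \<bar>(LBINT w. 2 * a * (K w * f (z \<star> dil e w)))\<bar>" by (simp add: avg_def)
  also have "\<dots> <= (LBINT w. a\<^sup>2 * \<bar>K w\<bar> + \<bar>K w\<bar> * (f (z \<star> dil e w))\<^sup>2)"
  proof (rule order_trans[OF integral_abs_bound integral_mono])
   show "integrable lborel (\<lambda>w. \<bar>2 * a * (K w * f (z \<star> dil e w))\<bar>)" by (intro integrable_abs integrable_mult_right i1)
   show "integrable lborel (\<lambda>w. a\<^sup>2 * \<bar>K w\<bar> + \<bar>K w\<bar> * (f (z \<star> dil e w))\<^sup>2)" by (intro bintegrable_add integrable_mult_right aK i2)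
   fix w
   have "2 * \<bar>a\<bar> * \<bar>f (z \<star> dil e w)\<bar> <= a\<^sup>2 + (f (z \<star> dil e w))\<^sup>2"
    using zero_le_power2[of "\<bar>a\<bar> - \<bar>f (z \<star> dil e w)\<bar>"] by (simp add: power2_eq_square algebra_simps)
   then have "\<bar>K w\<bar> * (2 * \<bar>a\<bar> * \<bar>f (z \<star> dil e w)\<bar>) <= \<bar>K w\<bar> * (a\<^sup>2 + (f (z \<star> dil e w))\<^sup>2)" by (intro mult_left_mono) auto
   then show "\<bar>2 * a * (K w * f (z \<star> dil e w))\<bar> <= a\<^sup>2 * \<bar>K w\<bar> + \<bar>K w\<bar> * (f (z \<star> dil e w))\<^sup>2"
    by (simp add: abs_mult algebra_simps)
  qed
  also have "\<dots> = a\<^sup>2 * ?k + avg e (\<lambda>w. \<bar>K w\<bar>) (\<lambda>z. (f z)\<^sup>2) z"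
   unfolding avg_def by (simp only: bintegral_add[OF integrable_mult_right[OF aK] i2] integral_mult_right_zero)
  finally show ?thesis .
 qed
 have main: "2 * a * wavg \<omega> K f z <= a\<^sup>2 * m + W" for a
 proof -
  have i1: "integrable lborel (\<lambda>e. 2 * a * (\<omega> e * avg e K f z))" by (intro integrable_mult_right wavg_integrable[OF \<omega> K f])
  have "2 * a * wavg \<omega> K f z = (LBINT e. 2 * a * (\<omega> e * avg e K f z))" by (simp add: wavg_def)
  also have "\<dots> <= (LBINT e. a\<^sup>2 * ?k * \<bar>\<omega> e\<bar> + \<bar>\<omega> e\<bar> * avg e (\<lambda>w. \<bar>K w\<bar>) (\<lambda>z. (f z)\<^sup>2) z)"
  proof (rule integral_mono[OF i1])
   show "integrable lborel (\<lambda>e. a\<^sup>2 * ?k * \<bar>\<omega> e\<bar> + \<bar>\<omega> e\<bar> * avg e (\<lambda>w. \<bar>K w\<bar>) (\<lambda>z. (f z)\<^sup>2) z)"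
    by (intro bintegrable_add integrable_mult_right a\<omega> iW)
   fix e
   have "2 * a * (\<omega> e * avg e K f z) <= \<bar>\<omega> e\<bar> * \<bar>2 * a * avg e K f z\<bar>"
    using abs_ge_self[of "\<omega> e * (2 * a * avg e K f z)"] by (simp add: abs_mult mult_ac)
   also have "\<dots> <= \<bar>\<omega> e\<bar> * (a\<^sup>2 * ?k + avg e (\<lambda>w. \<bar>K w\<bar>) (\<lambda>z. (f z)\<^sup>2) z)" by (intro mult_left_mono avg_le) simp
   finally show "2 * a * (\<omega> e * avg e K f z) <= a\<^sup>2 * ?k * \<bar>\<omega> e\<bar> + \<bar>\<omega> e\<bar> * avg e (\<lambda>w. \<bar>K w\<bar>) (\<lambda>z. (f z)\<^sup>2) z"
    by (simp add: algebra_simps)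
  qed
  also have "\<dots> = a\<^sup>2 * ?k * (LBINT e. \<bar>\<omega> e\<bar>) + W"
   unfolding W_def wavg_def by (simp only: bintegral_add[OF integrable_mult_right[OF a\<omega>] iW] integral_mult_right_zero)
  also have "\<dots> <= a\<^sup>2 * m + W" by (simp add: m_def algebra_simps)
  finally show ?thesis .
 qed
 define X where "X = wavg \<omega> K f z"
 have "2 * (X / m) * X <= (X / m)\<^sup>2 * m + W" unfolding X_def by (rule main)
 then have "X\<^sup>2 / m <= W" using m by (simp add: power2_eq_square power_divide field_simps)
 then show ?thesis using m unfolding X_def[symmetric] W_def[symmetric] by (simp add: field_simps)
qed

text \<open>The weight and the derivative kernel are both integrable, so the pointwise
  Cauchy-Schwarz bound integrates to a finite multiple of the squared L^2 norm of
  \<open>f\<close>.\<close>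

lemma green1_L2:
 fixes f :: "'n::finite heis => real"
 assumes f: "borel_fun f" "!!z. \<bar>f z\<bar> <= B" and I: "(NNI z. ennreal ((f z)\<^sup>2)) < \<infinity>"
 shows "(NNI z. ennreal ((green1 v f z)\<^sup>2)) < \<infinity>"
proof -
 have K: "integrable lborel (hk1 v)" by (rule good_kernel_integrable(2)[OF good_kernel_hk1])
 have \<omega>: "integrable lborel (green_weight' 1)" by (rule green_weight'_integrable) simp
 define m where "m = (LBINT e. \<bar>green_weight' 1 e\<bar>) * (LBINT w. \<bar>hk1 v w\<bar>) + 1"
 have m: "0 <= m" unfolding m_def by (intro add_nonneg_nonneg mult_nonneg_nonneg integral_nonneg_AE) auto
 let ?W = "wavg (\<lambda>e. \<bar>green_weight' 1 e\<bar>) (\<lambda>w. \<bar>hk1 v w\<bar>) (\<lambda>z. (f z)\<^sup>2)"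
 have f2: "borel_fun (\<lambda>z. (f z)\<^sup>2)" using f(1) by measurable
 have f2b: "(f z)\<^sup>2 <= B\<^sup>2" for z using f(2)[of z] abs_le_square_iff[of "f z" B] by simp
 have [measurable]: "borel_fun (hk1 v)" "borel_fun (green_weight' 1)" using K \<omega> by auto
 have [measurable]: "borel_fun ?W" by (rule wavg_measurable) (use f2 in measurable)
 have "(NNI z. ennreal ((green1 v f z)\<^sup>2)) <= (NNI z. ennreal m * ennreal (?W z))"
  unfolding green1_def ennreal_mult'[OF m, symmetric]
  by (intro nn_integral_mono ennreal_leI) (simp only: m_def wavg_square_le[OF K \<omega> f])
 also have "\<dots> = ennreal m * (NNI z. ennreal (?W z))" by (rule nn_integral_cmult) measurable
 also have "\<dots> < \<infinity>"
  using I by (subst nn_integral_wavg[OF integrable_abs[OF K] abs_ge_zero integrable_abs[OF \<omega>] abs_ge_zero f2 zero_le_power2 f2b]) (simp add: ennreal_mult_less_top)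
 finally show ?thesis .
qed

lemma powr_integral_finite:
 fixes u :: "'n::finite heis => real"
 assumes u: "borel_fun u" "!!z. 0 < u z" "!!z. u z <= B" and I: "(NNI z. ennreal (u z powr r)) < \<infinity>" and s: "r <= s"
 shows "(NNI z. ennreal (u z powr s)) < \<infinity>"
proof -
 note [measurable] = u(1)
 have "(NNI z. ennreal (u z powr s)) <= (NNI z. ennreal (B powr (s - r)) * ennreal (u z powr r))"
 proof (rule nn_integral_mono)
  fix z
  have "u z powr s = u z powr (s - r) * u z powr r" using u(2)[of z] by (simp add: powr_add[symmetric])
  also have "\<dots> <= B powr (s - r) * u z powr r" using u(2,3)[of z] s by (intro mult_right_mono powr_mono2) auto
  finally show "ennreal (u z powr s) <= ennreal (B powr (s - r)) * ennreal (u z powr r)" by (simp add: ennreal_mult[symmetric] ennreal_leI)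
 qed
 also have "\<dots> = ennreal (B powr (s - r)) * (NNI z. ennreal (u z powr r))" by (rule nn_integral_cmult) measurable
 also have "\<dots> < \<infinity>" using I by (simp add: ennreal_mult_less_top)
 finally show ?thesis .
qed

section \<open>Decay with respect to the homogeneous distance and the main result\<close>

lemma continuous_on_rho: "cont_UNIV (rho :: 'n::finite heis => real)"
proof -
 have "rho = (\<lambda>z::'n heis. root 4 ((\<Sum>i\<in>UNIV. ((fst z $ i)\<^sup>2 + (fst (snd z) $ i)\<^sup>2)\<^sup>2) + (snd (snd z))\<^sup>2))"
  by (auto simp: rho_def fun_eq_iff)
 then show ?thesis by (rule ssubst) (intro continuous_intros)
qed

text \<open>Continuity makes \<open>rho\<close> bounded on every ball, so points where
  \<open>rho\<close> is large have large norm and decay in the norm applies.\<close>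

lemma tendsto_zero_rho:
 fixes u :: "'n::finite heis => real"
 assumes "!!z. 0 <= u z" and decay: "!!\<epsilon>. 0 < \<epsilon> ==> \<exists>R. \<forall>z. R < norm z --> u z < \<epsilon>"
 shows "(u \<longlongrightarrow> 0) (filtercomap rho at_top)"
proof (rule tendstoI)
 fix \<epsilon> :: real assume "0 < \<epsilon>"
 then obtain R where R: "!!z. R < norm z ==> u z < \<epsilon>" using decay by blast
 have "bounded (rho ` cball (0 :: 'n heis) R)"
  by (intro compact_imp_bounded compact_continuous_image compact_cball continuous_on_subset[OF continuous_on_rho]) simp
 then obtain C where C: "!!z :: 'n heis. norm z <= R ==> \<bar>rho z\<bar> <= C" unfolding bounded_iff by force
 have "dist (u z) 0 < \<epsilon>" if "C < rho z" for z
 proof -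
  have "R < norm z" using C[of z] that by force
  then show ?thesis using R[of z] assms(1)[of z] by simp
 qed
 moreover have "\<forall>\<^sub>F s in at_top. C < (s :: real)" by (rule eventually_gt_at_top)
 ultimately show "\<forall>\<^sub>F z in filtercomap rho at_top. dist (u z) 0 < \<epsilon>" unfolding eventually_filtercomap by blast
qed

theorem theorem1:
  fixes p Q :: real
  assumes "Q = 2 * real CARD('n::finite) + 2"
    and "1 < p" and "p < (Q + 2) / (Q - 2)"
  shows "\<exists>u :: 'n heis \<Rightarrow> real.
           u \<in> FS_space \<and> C_k 2 u \<and>
           (\<forall>z. sub_laplacian u z - u z + u z powr p = 0) \<and>
           (\<forall>z. u z > 0) \<and>
           (u \<longlongrightarrow> 0) (filtercomap rho at_top)"
proof -
 have "0 < real CARD('n)" by simp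
 \<comment> \<open>With Q = 2 n + 2 the critical quotient (Q + 2) / (Q - 2) is (n + 2) / n.\<close>
 then have p2: "p * real CARD('n) < real CARD('n) + 2" using assms(3) unfolding assms(1) by (simp add: field_simps)
 obtain u :: "'n heis => real" and B K r
  where u: "!!z. u z = green (\<lambda>z. u z powr p) z" "!!z. 0 < u z" "!!z. u z <= B"
   "!!z w. \<bar>u (z \<star> w) - u z\<bar> <= K * hnorm w" and r: "1 < r" "r < 2" and I: "(NNI z. ennreal (u z powr r)) < \<infinity>"
   and decay: "!!\<epsilon>. 0 < \<epsilon> ==> \<exists>R. \<forall>z. R < norm z --> u z < \<epsilon>"
  by (rule semilinear_green_solution[OF assms(2) p2]) (rule that)
 note reg = semilinear_green_regularity[OF assms(2) u]
 have C2: "C_k 2 u" by (rule reg(1))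
 have C1: "C_k (Suc 0) u" using C_k_Suc[of "Suc 0" u] C2 by (simp only: numeral_2_eq_2)
 have um[measurable]: "borel_fun u" by (rule borel_continuous[OF C1_continuous[OF C1]])
 define f where "f z = u z powr p" for z
 have fm[measurable]: "borel_fun f" unfolding f_def[abs_def] by measurable
 have fb: "\<bar>f z\<bar> <= B powr p" for z
  unfolding f_def using u(2,3)[of z] assms(2) by (simp add: powr_mono2 less_imp_le)
 \<comment> \<open>Both exponents 2 p and 2 exceed r, so integrability of u^r and boundedness of u
   give the square integrability of f and of u.\<close>
 have "(f z)\<^sup>2 = u z powr (2 * p)" for z unfolding f_def by (simp add: power2_eq_square powr_add[symmetric])
 then have f2: "(NNI z. ennreal ((f z)\<^sup>2)) < \<infinity>"
  using powr_integral_finite[OF um u(2,3) I, of "2 * p"] assms(2) r by simp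
 have "(u z)\<^sup>2 = u z powr 2" for z using u(2)[of z] by (simp add: powr_numeral)
 then have u2: "(NNI z. ennreal ((u z)\<^sup>2)) < \<infinity>" using powr_integral_finite[OF um u(2,3) I, of 2] r by simp
 obtain T where "flow_C1 u (\<lambda>i. green1 (eX i) f) (\<lambda>i. green1 (eY i) f) T" using reg(3) unfolding f_def[abs_def] by blast
 note fields = flow_C1_fields[OF this]
 note g2 = green1_L2[OF fm fb f2]
 have [measurable]: "borel_fun (green1 v f)" for v
  unfolding green1_def using good_kernel_integrable(2)[OF good_kernel_hk1[of v]] green_weight'_integrable[of 1]
  by (intro wavg_measurable fm) auto
 have "(NNI z. ennreal (energy_density u z)) =
  (NNI z. (\<Sum>i\<in>UNIV. ennreal ((green1 (eX i) f z)\<^sup>2) + ennreal ((green1 (eY i) f z)\<^sup>2)) + ennreal ((u z)\<^sup>2))"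
  unfolding energy_density_eq fields by (intro nn_integral_cong) (simp add: ennreal_plus sum_nonneg sum_ennreal[symmetric])
 also have "\<dots> = (\<Sum>i\<in>UNIV. (NNI z. ennreal ((green1 (eX i) f z)\<^sup>2)) + (NNI z. ennreal ((green1 (eY i) f z)\<^sup>2))) +
   (NNI z. ennreal ((u z)\<^sup>2))"
  by (simp add: nn_integral_add nn_integral_sum)
 also have "\<dots> < \<infinity>" using g2 u2 by (simp add: ennreal_add_less_top less_top[symmetric])
 finally have fin: "(NNI z. ennreal (energy_density u z)) < \<infinity>" .
 have "u \<in> FS_space" by (rule finite_energy_FS_space[OF C1 fin])
 moreover have "(u \<longlongrightarrow> 0) (filtercomap rho at_top)" by (rule tendsto_zero_rho[OF less_imp_le[OF u(2)] decay])
 moreover have "sub_laplacian u z - u z + u z powr p = 0" for z unfolding reg(2)[of z] by simp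
 ultimately show ?thesis using C2 u(2) by blast
qed

end
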